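(* Let $n\ge3$, $s\in(0,n/2)$, and let $P_s$ be the conformally covariant operator of order $2s$ on the round sphere $(\mathbb{S}^n,g_{\mathbb{S}^n})$, $$P_s=\frac{\Gamma\left(B+\frac12+s\right)}{\Gamma\left(B+\frac12-s\right)},\qquad B=\sqrt{-\Delta_{g_{\mathbb{S}^n}}+\left(\tfrac{n-1}{2}\right)^2},$$ and $d_{n,s}=\frac{\Gamma(\frac n2+s)}{\Gamma(\frac n2-s)}=P_s(1)$. Let $f:(0,+\infty)\to\mathbb{R}$ be continuous and consider $$P_su-d_{n,s}u=f(u),\qquad u>0\ \text{ on }\mathbb{S}^n.\qquad(\ast)$$ Assume that $h_s(t):=t^{-\frac{n+2s}{n-2s}}\big(f(t)+d_{n,s}t\big)$ is decreasing on $(0,+\infty)$, and, if $s>1$, that in addition $h_s(t)t^{\frac{n+2s}{n-2s}}$ is nondecreasing on $(0,+\infty)$. Then any continuous solution of $(\ast)$ is constant. In particular, if $f(t)=t^p-\lambda t$ with $p>1$, $\lambda>0$, $p\le\frac{n+2s}{n-2s}$ and $\lambda\le d_{n,s}$, with at least one of these two inequalities strict, then the only positive solution of $(\ast)$ is the constant $u\equiv\lambda^{\frac1{p-1}}$.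
   Context: $\Delta_{g_{\mathbb{S}^n}}$ is the Laplace–Beltrami operator of the round metric; $P_s$ is defined by functional calculus. *)

theory Defs
  imports "HOL-Analysis.Analysis"
begin

text \<open>The sphere S^n is the unit sphere sphere 0 1 in a Euclidean space 'a with
  DIM('a) = n + 1.\<close>

text \<open>Integral over the sphere w.r.t. the standard surface measure, written via the
  cone construction: the integral over S^n of g equals (n+1) times the Lebesgue integral
  over the unit ball of x maps to g (x / |x|).\<close>
definition sph_int :: "('a::euclidean_space \<Rightarrow> real) \<Rightarrow> real" where
  "sph_int g = real DIM('a) * integral (ball 0 1) (\<lambda>x. g (x /\<^sub>R norm x))"

definition hom_ext :: "('a::euclidean_space \<Rightarrow> real) \<Rightarrow> 'a \<Rightarrow> real" where
  "hom_ext \<phi> x = \<phi> (x /\<^sub>R norm x)"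

definition C2_on :: "('a::euclidean_space \<Rightarrow> real) \<Rightarrow> 'a set \<Rightarrow> bool" where
  "C2_on F S \<longleftrightarrow> open S \<and>
     (\<exists>DF D2F. \<forall>x\<in>S. (F has_derivative DF x) (at x) \<and>
        (\<forall>v. ((\<lambda>y. DF y v) has_derivative D2F x v) (at x)) \<and>
        (\<forall>v w. continuous_on S (\<lambda>y. D2F y v w)))"

definition eucl_lap :: "('a::euclidean_space \<Rightarrow> real) \<Rightarrow> 'a \<Rightarrow> real" where
  "eucl_lap F x = (\<Sum>b\<in>Basis. deriv (deriv (\<lambda>r. F (x + r *\<^sub>R b))) 0)"

text \<open>Laplace--Beltrami operator of the round sphere: for x on the sphere it is the
  Euclidean Laplacian of the zero-homogeneous extension.\<close>
definition sph_lap :: "('a::euclidean_space \<Rightarrow> real) \<Rightarrow> 'a \<Rightarrow> real" where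
  "sph_lap \<phi> x = eucl_lap (hom_ext \<phi>) x"

definition sph_eigenfn :: "real \<Rightarrow> ('a::euclidean_space \<Rightarrow> real) \<Rightarrow> bool" where
  "sph_eigenfn \<mu> \<phi> \<longleftrightarrow> C2_on (hom_ext \<phi>) (- {0}) \<and>
     (\<forall>x\<in>sphere 0 1. - sph_lap \<phi> x = \<mu> * \<phi> x)"

text \<open>Functional calculus: P_s acts on a -Delta eigenfunction with eigenvalue \<mu> by the
  multiplier Gamma(B+1/2+s)/Gamma(B+1/2-s), B = sqrt(\<mu> + ((n-1)/2)^2).\<close>
definition Ps_mult :: "real \<Rightarrow> real \<Rightarrow> real \<Rightarrow> real" where
  "Ps_mult n s \<mu> = (let B = sqrt (\<mu> + ((n - 1) / 2)\<^sup>2) in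
      Gamma (B + 1/2 + s) / Gamma (B + 1/2 - s))"

definition d_ns :: "real \<Rightarrow> real \<Rightarrow> real" where
  "d_ns n s = Gamma (n / 2 + s) / Gamma (n / 2 - s)"

text \<open>u (continuous on S^n) solves P_s u - d_{n,s} u = f(u) in the distributional sense:
  tested against every eigenfunction \<phi> of -Delta (on which P_s acts by its multiplier,
  P_s being self-adjoint), <u, P_s \<phi>> = <f(u) + d_{n,s} u, \<phi>>.
  Here n = DIM('a) - 1.\<close>
definition weak_sol :: "real \<Rightarrow> (real \<Rightarrow> real) \<Rightarrow> ('a::euclidean_space \<Rightarrow> real) \<Rightarrow> bool" where
  "weak_sol s f u \<longleftrightarrow>
     (\<forall>\<mu> \<phi>. sph_eigenfn \<mu> (\<phi> :: 'a \<Rightarrow> real) \<longrightarrow>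
        Ps_mult (real DIM('a) - 1) s \<mu> * sph_int (\<lambda>x. u x * \<phi> x)
        = sph_int (\<lambda>x. (f (u x) + d_ns (real DIM('a) - 1) s * u x) * \<phi> x))"

definition crit_exp :: "real \<Rightarrow> real \<Rightarrow> real" where
  "crit_exp n s = (n + 2 * s) / (n - 2 * s)"

end

theory Submission
  imports Defs
begin

text \<open>
  Testing the equation against zonal harmonics and comparing multipliers turns it into \<open>u(x)
  = c \<integral> (1 - x \<cdot> y)\<^bsup>s - n/2\<^esup> (f(u(y)) + d u(y)) dy\<close>: the
  eigenvalues of the kernel are quotients of Gamma functions because both satisfy the same
  recursion in the exponent of the kernel, so their ratio is 1-periodic there, and it tends to 1
  along integer shifts. This equation is covariant under the conformal group, so one can run
  moving spheres: pull \<open>u\<close> back by conformal boosts along an axis \<open>e\<close>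
  and compare with the reflection in \<open>e\<close>, starting near the degenerate boost and
  continuing down to the identity. The strict decrease of \<open>h\<^sub>s\<close> gives a
  positive gain away from the equator, while near it the smallness of the strip suffices. For
  \<open>s > 1\<close> the monotonicity hypothesis gives the sign needed in the comparison; for
  \<open>s \<le> 1\<close> it comes from a maximum principle for the Riesz potential: the failure
  of a power kernel to be invariant under a boost is a positive kernel, which for \<open>s \<le>
  1\<close> concentrates at the diagonal as the boost degenerates. At the identity the comparison
  says \<open>u\<close> does not exceed its own reflection, for every axis, so \<open>u\<close> is
  constant.
\<close>

section \<open>Surface measure and Green's formula\<close>

text \<open>Everything is governed by the exponent -n/2: as 1 - x \<bullet> y is half the squared
  distance, its powers above -n/2 are integrable on the n-sphere. The integral equation needs no
  regularity of u beyond continuity, which is all that the weak formulation provides. The obstacle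
  for s \<le> 1 is that f(u) + d u need not be monotone: where the reflected function is already the
  larger one, the density of the difference has no known sign. The maximum principle therefore asks
  for a sign only where the potential is negative. Its defect kernel behaves like the exponent
  \<beta> - 1 with \<beta> = s - n/2, and it concentrates because \<beta> - 1 \<le> -n/2, which is s
  \<le> 1. The gain from the strict decrease of h is uniform because u has compact range in the
  positive axis; it replaces a strong maximum principle, so that mere nonnegativity of the
  difference suffices to continue. The conformal change of variables is obtained without computing
  Jacobian determinants: boosts permute a family of kernels of constant mass, and these kernels
  approximate point masses.\<close>

definition sph_measure :: "'a::euclidean_space measure" where
  "sph_measure = distr (restrict_space lborel (ball 0 1 - {0}))
     (restrict_space borel (sphere 0 1)) (\<lambda>x. x /\<^sub>R norm x)"

lemma measurable_sph_proj:
  "(\<lambda>x::'a::euclidean_space. x /\<^sub>R norm x)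
     \<in> restrict_space lborel (ball 0 1 - {0}) \<rightarrow>\<^sub>M restrict_space borel (sphere 0 1)"
  by (intro measurable_restrict_space3) auto

lemma space_sph_measure [simp]: "space (sph_measure :: 'a::euclidean_space measure) = sphere 0 1"
  by (simp add: sph_measure_def space_restrict_space)

lemma sets_sph_measure [measurable_cong]:
  "sets (sph_measure :: 'a::euclidean_space measure) = sets (restrict_space borel (sphere 0 1))"
  by (simp add: sph_measure_def)

lemma finite_measure_sph: "finite_measure (sph_measure :: 'a::euclidean_space measure)"
  unfolding sph_measure_def
proof (rule finite_measure.finite_measure_distr[OF _ measurable_sph_proj])
  have "emeasure lborel (ball 0 1 - {0::'a}) \<le> emeasure lborel (ball (0::'a) 1)"
    by (intro emeasure_mono) auto
  also have "\<dots> < \<infinity>"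
    by (rule emeasure_bounded_finite) simp
  finally show "finite_measure (restrict_space lborel (ball 0 1 - {0::'a}))"
    by (intro finite_measureI) (auto simp: space_restrict_space emeasure_restrict_space)
qed

interpretation sph: finite_measure "sph_measure :: 'a::euclidean_space measure"
  by (rule finite_measure_sph)

lemma id_measurable_sph [measurable]:
  "(\<lambda>x. x) \<in> borel_measurable (sph_measure :: 'a::euclidean_space measure)"
  by (subst measurable_cong_sets[OF sets_sph_measure refl]) (rule measurable_restrict_space1, simp)

lemma measurable_sph_continuous:
  fixes g :: "'a::euclidean_space \<Rightarrow> 'b::topological_space"
  assumes "continuous_on (sphere 0 1) g"
  shows "g \<in> borel_measurable sph_measure"
  by (subst measurable_cong_sets[OF sets_sph_measure refl])
     (rule borel_measurable_continuous_on_restrict[OF assms])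

lemma bounded_on_sphere:
  fixes g :: "'a::euclidean_space \<Rightarrow> real"
  assumes "continuous_on (sphere 0 1) g"
  obtains C where "C > 0" "\<And>x. x \<in> sphere 0 1 \<Longrightarrow> \<bar>g x\<bar> \<le> C"
proof -
  have "bounded (g ` sphere 0 1)"
    using assms by (intro compact_imp_bounded compact_continuous_image) auto
  then show ?thesis
    using that by (auto simp: bounded_pos)
qed

lemma integrable_sph_bounded:
  fixes g :: "'a::euclidean_space \<Rightarrow> real"
  assumes "g \<in> borel_measurable sph_measure" "\<And>x. x \<in> sphere 0 1 \<Longrightarrow> \<bar>g x\<bar> \<le> C"
  shows "integrable sph_measure g"
  by (rule sph.integrable_const_bound[of _ C]) (use assms in auto)

lemma integrable_sph_continuous:
  fixes g :: "'a::euclidean_space \<Rightarrow> real"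
  assumes "continuous_on (sphere 0 1) g"
  shows "integrable sph_measure g"
  using bounded_on_sphere[OF assms] integrable_sph_bounded[OF measurable_sph_continuous[OF assms]]
  by metis

lemma integral_sph_measure_eq:
  fixes g :: "'a::euclidean_space \<Rightarrow> real"
  assumes "continuous_on (sphere 0 1) g"
  shows "integral\<^sup>L sph_measure g
    = (LINT x|lborel. indicator (ball 0 1 - {0}) x *\<^sub>R g (x /\<^sub>R norm x))"
proof -
  have gm: "g \<in> borel_measurable (restrict_space borel (sphere 0 1))"
    by (rule borel_measurable_continuous_on_restrict[OF assms])
  have "integral\<^sup>L sph_measure g
      = integral\<^sup>L (restrict_space lborel (ball 0 1 - {0})) (\<lambda>x. g (x /\<^sub>R norm x))"
    unfolding sph_measure_def by (rule integral_distr[OF measurable_sph_proj gm])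
  also have "\<dots> = (LINT x|lborel. indicator (ball 0 1 - {0}) x *\<^sub>R g (x /\<^sub>R norm x))"
    by (simp add: integral_restrict_space)
  finally show ?thesis .
qed

text \<open>Bridge from the gauge integral of the definitions to Lebesgue integration.
  \<open>sph_measure\<close> assigns to a set the volume of the cone over it, that is, surface
  measure divided by the dimension, which explains the factor. The origin, where the projection
  degenerates, is negligible.\<close>

lemma sph_int_eq_integral:
  fixes g :: "'a::euclidean_space \<Rightarrow> real"
  assumes "continuous_on (sphere 0 1) g"
  shows "sph_int g = real DIM('a) * integral\<^sup>L sph_measure g"
proof -
  let ?A = "ball 0 1 - {0::'a}" and ?h = "\<lambda>x. g (x /\<^sub>R norm x)"
  have gm: "g \<in> borel_measurable (restrict_space borel (sphere 0 1))"
    by (rule borel_measurable_continuous_on_restrict[OF assms])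
  have A: "?A \<in> sets lborel" by auto
  have hm: "?h \<in> borel_measurable (restrict_space lborel ?A)"
    using measurable_compose[OF measurable_sph_proj gm] by simp
  have "integrable sph_measure g" by (rule integrable_sph_continuous[OF assms])
  then have "integrable (restrict_space lborel ?A) ?h"
    unfolding sph_measure_def using integrable_distr_eq[OF measurable_sph_proj gm] by simp
  then have int: "set_integrable lborel ?A ?h"
    using A by (simp add: set_integrable_def integrable_restrict_space)
  have "integral\<^sup>L sph_measure g = set_lebesgue_integral lborel ?A ?h"
    by (simp add: set_lebesgue_integral_def integral_sph_measure_eq[OF assms])
  also have "\<dots> = integral ?A ?h"
    by (rule set_borel_integral_eq_integral(2)[OF int])
  also have "\<dots> = integral (ball 0 1) ?h"
    by (rule integral_spike_set) (auto intro: negligible_subset[of "{0}"])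
  finally show ?thesis by (simp add: sph_int_def)
qed

text \<open>The open cone over the cap contains x/2, and nonempty open sets have positive Lebesgue
  measure.\<close>

lemma measure_sph_cap_pos:
  fixes x :: "'a::euclidean_space"
  assumes x: "x \<in> sphere 0 1" and c: "c < 1"
  shows "measure sph_measure {y \<in> sphere 0 1. x \<bullet> y > c} > 0"
proof -
  let ?A = "ball 0 1 - {0::'a}" and ?C = "{y \<in> sphere 0 1. x \<bullet> y > c}"
  define U where "U = (ball 0 1 - {0}) \<inter> {z. c * norm z < x \<bullet> z}"
  have U: "open U"
    unfolding U_def by (intro open_Int open_Diff open_Collect_less continuous_intros) auto
  have xx: "x \<bullet> x = 1" using x by (simp add: dot_square_norm)
  have "x /\<^sub>R 2 \<in> U" using x c xx by (auto simp: U_def)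
  then have "\<not> negligible U" using U open_not_negligible by blast
  then have nz: "emeasure lborel U \<noteq> 0"
    using U by (auto simp: negligible_iff_null_sets null_sets_def)
  have C: "?C \<in> sets (restrict_space borel (sphere 0 1))"
  proof -
    have "?C = {y \<in> space (sph_measure::'a measure). x \<bullet> y > c}" by auto
    also have "\<dots> \<in> sets sph_measure" by measurable
    finally show ?thesis by (simp add: sets_sph_measure)
  qed
  have eq: "(\<lambda>x. x /\<^sub>R norm x) -` ?C \<inter> space (restrict_space lborel ?A) = U"
    by (auto simp: U_def space_restrict_space field_simps)
  have "emeasure sph_measure ?C = emeasure (restrict_space lborel ?A) U"
    unfolding sph_measure_def using emeasure_distr[OF measurable_sph_proj C] by (simp only: eq)
  also have "\<dots> = emeasure lborel U"
    by (rule emeasure_restrict_space) (auto simp: U_def)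
  finally have "emeasure sph_measure ?C \<noteq> 0" using nz by simp
  then show ?thesis
    by (metis sph.emeasure_eq_measure ennreal_0 measure_nonneg order_le_less)
qed

section \<open>Integration by parts with radial cutoffs, leading to Green's formula\<close>

lemma has_real_derivative_max0_square:
  "((\<lambda>t::real. (max 0 t)\<^sup>2) has_real_derivative 2 * max 0 t) (at t)"
proof -
  consider "t < 0" | "t > 0" | "t = 0" by linarith
  then show ?thesis
  proof cases
    case 1
    have "((\<lambda>t::real. 0) has_real_derivative 0) (at t)" by simp
    then have "((\<lambda>t::real. (max 0 t)\<^sup>2) has_real_derivative 0) (at t)"
      by (rule has_field_derivative_transform_within[where d="-t"]) (use 1 in \<open>auto simp: dist_real_def\<close>)
    then show ?thesis using 1 by simp
  next
    case 2
    have "((\<lambda>t::real. t\<^sup>2) has_real_derivative 2 * t) (at t)"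
      by (auto intro!: derivative_eq_intros)
    then have "((\<lambda>t::real. (max 0 t)\<^sup>2) has_real_derivative 2 * t) (at t)"
      by (rule has_field_derivative_transform_within[where d="t"]) (use 2 in \<open>auto simp: dist_real_def\<close>)
    then show ?thesis using 2 by simp
  next
    case 3
    have "((\<lambda>h::real. max 0 h) \<longlongrightarrow> max 0 0) (at 0)"
      by (intro tendsto_intros)
    then have "((\<lambda>h::real. max 0 h) \<longlongrightarrow> 0) (at 0)" by simp
    then have "((\<lambda>h::real. (max 0 h)\<^sup>2 / h) \<longlongrightarrow> 0) (at 0)"
      by (rule Lim_transform_eventually)
         (auto simp: eventually_at_filter max_def power2_eq_square)
    then show ?thesis using 3 by (simp add: DERIV_def)
  qed
qed

text \<open>Difference quotients integrate to zero by translation invariance. The mean value theorem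
  bounds them by the supremum of g on a fixed ball, so dominated convergence carries this over to
  the derivative.\<close>

lemma integral_directional_derivative_eq_0:
  fixes f g :: "'a::euclidean_space \<Rightarrow> real"
  assumes der: "\<And>x. ((\<lambda>r. f (x + r *\<^sub>R b)) has_real_derivative g x) (at 0)"
    and cf: "continuous_on UNIV f" and cg: "continuous_on UNIV g"
    and f0: "\<And>x. norm x \<ge> 1 \<Longrightarrow> f x = 0"
    and g0: "\<And>x. norm x \<ge> 1 \<Longrightarrow> g x = 0"
  shows "integral\<^sup>L lborel g = 0"
proof -
  have "bounded (g ` cball 0 1)"
    by (intro compact_imp_bounded compact_continuous_image continuous_on_subset[OF cg]) auto
  then obtain C where C: "C > 0" "\<And>x. x \<in> cball 0 1 \<Longrightarrow> \<bar>g x\<bar> \<le> C"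
    by (auto simp: bounded_pos)
  have C': "\<bar>g x\<bar> \<le> C" for x
    using C g0[of x] by (cases "norm x \<le> 1") auto
  define B where "B = cball (0::'a) (1 + norm b)"
  define q where "q k x = (f (x + (1 / real (Suc k)) *\<^sub>R b) - f x) * real (Suc k)" for k x
  have fm [measurable]: "f \<in> borel_measurable borel" and gm [measurable]: "g \<in> borel_measurable borel"
    using cf cg by (auto intro: borel_measurable_continuous_onI)
  have qm: "q k \<in> borel_measurable borel" for k
    unfolding q_def[abs_def] by measurable
  have mvt: "\<bar>q k x\<bar> \<le> C" for k x
  proof -
    have d: "((\<lambda>r. f (x + r *\<^sub>R b)) has_real_derivative g (x + r *\<^sub>R b)) (at r)" for r
    proof -
      have "((\<lambda>h. f ((x + r *\<^sub>R b) + h *\<^sub>R b)) has_real_derivative g (x + r *\<^sub>R b)) (at (r - r))"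
        using der[of "x + r *\<^sub>R b"] by simp
      then have "((\<lambda>t. f ((x + r *\<^sub>R b) + (t - r) *\<^sub>R b)) has_real_derivative g (x + r *\<^sub>R b) * 1) (at r)"
        by (rule DERIV_chain2[where g="\<lambda>t. t - r"]) (auto intro!: derivative_eq_intros)
      then show ?thesis by (simp add: algebra_simps)
    qed
    obtain z where "f (x + (1 / real (Suc k)) *\<^sub>R b) - f (x + 0 *\<^sub>R b)
        = (1 / real (Suc k) - 0) * g (x + z *\<^sub>R b)"
      using MVT2[of 0 "1 / real (Suc k)" "\<lambda>r. f (x + r *\<^sub>R b)" "\<lambda>r. g (x + r *\<^sub>R b)"] d by auto
    then have "q k x = g (x + z *\<^sub>R b)" by (simp add: q_def)
    then show ?thesis using C' by simp
  qed
  have fi: "integrable lborel f"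
  proof -
    have "integrable lborel (\<lambda>x. indicator (cball 0 1) x *\<^sub>R f x)"
      by (intro borel_integrable_compact continuous_on_subset[OF cf]) auto
    moreover have "(\<lambda>x. indicator (cball 0 1) x *\<^sub>R f x) = f"
      using f0 by (auto simp: fun_eq_iff indicator_def)
    ultimately show ?thesis by simp
  qed
  have q0: "integral\<^sup>L lborel (q k) = 0" for k
  proof -
    let ?c = "(1 / real (Suc k)) *\<^sub>R b"
    have i1: "integrable lborel (\<lambda>x. f (?c + x))"
      using integrable_distr[of "(+) ?c" lborel borel f] fi lborel_distr_plus[of ?c] by simp
    have "integral\<^sup>L lborel (\<lambda>x. f (?c + x)) = integral\<^sup>L lborel f"
      using integral_distr[of "(+) ?c" lborel borel f] lborel_distr_plus[of ?c] by simp
    then show ?thesis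
      using i1 fi unfolding q_def by (simp add: add.commute)
  qed
  have "(\<lambda>k. integral\<^sup>L lborel (q k)) \<longlonglongrightarrow> integral\<^sup>L lborel g"
  proof (rule integral_dominated_convergence[where w="\<lambda>x. indicator B x *\<^sub>R C"])
    show "integrable lborel (\<lambda>x. indicator B x *\<^sub>R C)"
      unfolding B_def by (intro borel_integrable_compact) auto
    show "AE x in lborel. (\<lambda>k. q k x) \<longlonglongrightarrow> g x"
    proof (rule AE_I2)
      fix x :: 'a
      have "((\<lambda>h. (f (x + h *\<^sub>R b) - f x) / h) \<longlongrightarrow> g x) (at 0)"
        using der[of x] by (simp add: DERIV_def)
      moreover have "filterlim (\<lambda>k. 1 / real (Suc k)) (at 0) sequentially"
        by (intro filterlim_atI LIMSEQ_Suc[OF lim_1_over_n] always_eventually) auto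
      ultimately have "(\<lambda>k. (f (x + (1 / real (Suc k)) *\<^sub>R b) - f x) / (1 / real (Suc k))) \<longlonglongrightarrow> g x"
        by (rule filterlim_compose)
      then show "(\<lambda>k. q k x) \<longlonglongrightarrow> g x" by (simp add: q_def)
    qed
    show "AE x in lborel. norm (q k x) \<le> indicator B x *\<^sub>R C" for k
    proof (rule AE_I2)
      fix x :: 'a
      show "norm (q k x) \<le> indicator B x *\<^sub>R C"
      proof (cases "x \<in> B")
        case True then show ?thesis using mvt by simp
      next
        case False
        then have x: "norm x > 1 + norm b" by (simp add: B_def)
        have "norm ((1 / real (Suc k)) *\<^sub>R b) \<le> norm b"
          by (simp add: divide_le_eq mult_le_cancel_left1)
        moreover have "norm x \<le> norm (x + (1 / real (Suc k)) *\<^sub>R b) + norm ((1 / real (Suc k)) *\<^sub>R b)"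
          using norm_triangle_ineq4[of "x + (1 / real (Suc k)) *\<^sub>R b" "(1 / real (Suc k)) *\<^sub>R b"] by simp
        ultimately have "norm (x + (1 / real (Suc k)) *\<^sub>R b) \<ge> 1" using x by linarith
        moreover have "norm x \<ge> 1" using x norm_ge_zero[of b] by linarith
        ultimately show ?thesis using f0 C(1) by (simp add: q_def)
      qed
    qed
  qed (use qm in auto)
  then show ?thesis using q0 by (simp add: LIMSEQ_const_iff)
qed

lemma has_derivative_imp_directional:
  assumes "(F has_derivative F') (at x)"
  shows "((\<lambda>r. F (x + r *\<^sub>R b)) has_real_derivative F' b) (at 0)"
proof -
  have F: "(F has_derivative F') (at (x + 0 *\<^sub>R b))" using assms by simp
  have "((\<lambda>r. x + r *\<^sub>R b) has_derivative (\<lambda>r. r *\<^sub>R b)) (at 0)"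
    by (auto intro!: derivative_eq_intros)
  from has_derivative_compose[OF this F]
  have "((\<lambda>r. F (x + r *\<^sub>R b)) has_derivative (\<lambda>r. F' (r *\<^sub>R b))) (at 0)" .
  moreover have "(\<lambda>r. F' (r *\<^sub>R b)) = (*) (F' b)"
    using linear_scale[OF has_derivative_linear[OF assms]] by (auto simp: fun_eq_iff)
  ultimately show ?thesis by (simp add: has_field_derivative_def)
qed

lemma C2_onE:
  assumes "C2_on F (- {0})"
  obtains DF D2F where
    "\<And>x. x \<noteq> 0 \<Longrightarrow> (F has_derivative DF x) (at x)"
    "\<And>x v. x \<noteq> 0 \<Longrightarrow> ((\<lambda>y. DF y v) has_derivative D2F x v) (at x)"
    "\<And>v w. continuous_on (- {0}) (\<lambda>y. D2F y v w)"
    "continuous_on (- {0}) F" "\<And>v. continuous_on (- {0}) (\<lambda>y. DF y v)"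
proof -
  obtain DF D2F where all: "\<forall>x\<in>- {0}. (F has_derivative DF x) (at x) \<and>
        (\<forall>v. ((\<lambda>y. DF y v) has_derivative D2F x v) (at x)) \<and>
        (\<forall>v w. continuous_on (- {0}) (\<lambda>y. D2F y v w))"
    using assms unfolding C2_on_def by blast
  then have *: "\<And>x. x \<in> - {0} \<Longrightarrow> (F has_derivative DF x) (at x)"
    "\<And>x v. x \<in> - {0} \<Longrightarrow> ((\<lambda>y. DF y v) has_derivative D2F x v) (at x)"
    "\<And>v w x. x \<in> - {0} \<Longrightarrow> continuous_on (- {0}) (\<lambda>y. D2F y v w)"
    by blast+
  show ?thesis
  proof (rule that[of DF D2F])
    show "continuous_on (- {0}) F"
      by (intro continuous_at_imp_continuous_on ballI has_derivative_continuous[OF *(1)])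
    show "continuous_on (- {0}) (\<lambda>y. DF y v)" for v
      by (intro continuous_at_imp_continuous_on ballI has_derivative_continuous[OF *(2)])
    show "continuous_on (- {0}) (\<lambda>y. D2F y v w)" for v w
    proof (cases "- {0} = ({} :: 'a set)")
      case False then show ?thesis using *(3) by blast
    qed simp
  qed (use * in auto)
qed

lemma hom_ext_scale: "c > 0 \<Longrightarrow> hom_ext a (c *\<^sub>R x) = hom_ext a x"
  by (cases "x = 0") (auto simp: hom_ext_def field_simps)

lemma hom_ext_sphere: "x \<in> sphere 0 1 \<Longrightarrow> hom_ext a x = a x"
  by (simp add: hom_ext_def)

text \<open>The inner \<open>deriv\<close> has to be identified on a whole neighbourhood of 0 on the
  line, and \<open>x \<noteq> 0\<close> provides this neighbourhood.\<close>

lemma eucl_lap_eq: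
  fixes F :: "'a::euclidean_space \<Rightarrow> real"
  assumes D: "\<And>x. x \<noteq> 0 \<Longrightarrow> (F has_derivative DF x) (at x)"
    and D2: "\<And>x v. x \<noteq> 0 \<Longrightarrow> ((\<lambda>y. DF y v) has_derivative D2F x v) (at x)"
    and x: "x \<noteq> 0"
  shows "eucl_lap F x = (\<Sum>b\<in>Basis. D2F x b b)"
  unfolding eucl_lap_def
proof (rule sum.cong[OF refl])
  fix b :: 'a
  have "eventually (\<lambda>r::real. x + r *\<^sub>R b \<noteq> 0) (nhds 0)"
  proof -
    have "((\<lambda>r. x + r *\<^sub>R b) \<longlongrightarrow> x + 0 *\<^sub>R b) (nhds 0)"
      by (intro tendsto_intros filterlim_ident)
    then show ?thesis
      using x tendsto_imp_eventually_ne by fastforce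
  qed
  then have ev: "eventually (\<lambda>r. deriv (\<lambda>r. F (x + r *\<^sub>R b)) r = DF (x + r *\<^sub>R b) b) (nhds 0)"
  proof (rule eventually_mono)
    fix r :: real assume "x + r *\<^sub>R b \<noteq> 0"
    then have "((\<lambda>h. F ((x + r *\<^sub>R b) + h *\<^sub>R b)) has_real_derivative DF (x + r *\<^sub>R b) b) (at (r - r))"
      using has_derivative_imp_directional[OF D] by simp
    then have "((\<lambda>t. F ((x + r *\<^sub>R b) + (t - r) *\<^sub>R b)) has_real_derivative DF (x + r *\<^sub>R b) b * 1) (at r)"
      by (rule DERIV_chain2[where g="\<lambda>t. t - r"]) (auto intro!: derivative_eq_intros)
    then have "((\<lambda>r. F (x + r *\<^sub>R b)) has_real_derivative DF (x + r *\<^sub>R b) b) (at r)"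
      by (simp add: algebra_simps)
    then show "deriv (\<lambda>r. F (x + r *\<^sub>R b)) r = DF (x + r *\<^sub>R b) b" by (rule DERIV_imp_deriv)
  qed
  have "deriv (deriv (\<lambda>r. F (x + r *\<^sub>R b))) 0 = deriv (\<lambda>r. DF (x + r *\<^sub>R b) b) 0"
    by (rule deriv_cong_ev[OF ev refl])
  also have "\<dots> = D2F x b b"
    by (rule DERIV_imp_deriv, rule has_derivative_imp_directional[OF D2[OF x]])
  finally show "deriv (deriv (\<lambda>r. F (x + r *\<^sub>R b))) 0 = D2F x b b" .
qed

text \<open>Euler's identity in degree zero: F is constant along the ray through x.\<close>

lemma hom_derivative_radial:
  fixes F :: "'a::euclidean_space \<Rightarrow> real"
  assumes hom: "\<And>c x. c > 0 \<Longrightarrow> F (c *\<^sub>R x) = F x"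
    and D: "(F has_derivative F') (at x)"
  shows "F' x = 0"
proof -
  have "((\<lambda>r. F (x + r *\<^sub>R x)) has_real_derivative F' x) (at 0)"
    by (rule has_derivative_imp_directional[OF D])
  moreover have "((\<lambda>r. F (x + r *\<^sub>R x)) has_real_derivative 0) (at 0)"
  proof (rule has_field_derivative_transform_within[where d=1])
    show "((\<lambda>r. F x) has_real_derivative 0) (at 0)" by simp
    show "F x = F (x + r *\<^sub>R x)" if "dist r 0 < 1" for r
      using hom[of "1 + r" x] that by (simp add: dist_real_def algebra_simps)
  qed auto
  ultimately show ?thesis by (rule DERIV_unique)
qed

lemma hom_second_derivative_scale:
  fixes F :: "'a::euclidean_space \<Rightarrow> real"
  assumes hom: "\<And>c x. c > 0 \<Longrightarrow> F (c *\<^sub>R x) = F x"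
    and D: "\<And>x. x \<noteq> 0 \<Longrightarrow> (F has_derivative DF x) (at x)"
    and D2: "\<And>x v. x \<noteq> 0 \<Longrightarrow> ((\<lambda>y. DF y v) has_derivative D2F x v) (at x)"
    and x: "x \<noteq> 0" and c: "c > 0"
  shows "D2F x v w = c\<^sup>2 * D2F (c *\<^sub>R x) v w"
proof -
  have sc: "((\<lambda>y. c *\<^sub>R y) has_derivative (\<lambda>y. c *\<^sub>R y)) (at y)" for y :: 'a
    by (auto intro!: derivative_eq_intros)
  have 1: "DF y v = c * DF (c *\<^sub>R y) v" if y: "y \<noteq> 0" for y v
  proof -
    have cy: "c *\<^sub>R y \<noteq> 0" using y c by simp
    have "((\<lambda>y. F (c *\<^sub>R y)) has_derivative (\<lambda>v. DF (c *\<^sub>R y) (c *\<^sub>R v))) (at y)"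
      by (rule has_derivative_compose[OF sc D[OF cy]])
    then have "(F has_derivative (\<lambda>v. DF (c *\<^sub>R y) (c *\<^sub>R v))) (at y)"
      using hom[OF c] by simp
    from has_derivative_unique[OF D[OF y] this]
    show ?thesis
      using linear_scale[OF has_derivative_linear[OF D[OF cy]]] by (auto simp: fun_eq_iff)
  qed
  have cx: "c *\<^sub>R x \<noteq> 0" using x c by simp
  have "((\<lambda>y. DF (c *\<^sub>R y) v) has_derivative (\<lambda>w. D2F (c *\<^sub>R x) v (c *\<^sub>R w))) (at x)"
    by (rule has_derivative_compose[OF sc D2[OF cx]])
  then have "((\<lambda>y. c * DF (c *\<^sub>R y) v) has_derivative (\<lambda>w. c * D2F (c *\<^sub>R x) v (c *\<^sub>R w))) (at x)"
    by (rule has_derivative_mult_right)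
  then have "((\<lambda>y. DF y v) has_derivative (\<lambda>w. c * D2F (c *\<^sub>R x) v (c *\<^sub>R w))) (at x)"
    by (rule has_derivative_transform_within_open[where s="- {0}"]) (use x 1 in auto)
  from has_derivative_unique[OF D2[OF x] this]
  show ?thesis
    using linear_scale[OF has_derivative_linear[OF D2[OF cx]]] by (auto simp: fun_eq_iff power2_eq_square)
qed

lemma C2_hom_ext_continuous:
  assumes "C2_on (hom_ext a) (- {0})"
  shows "continuous_on (sphere 0 1) a" "continuous_on (sphere 0 1) (sph_lap a)"
proof -
  obtain DF D2F where F: "\<And>x. x \<noteq> 0 \<Longrightarrow> (hom_ext a has_derivative DF x) (at x)"
    "\<And>x v. x \<noteq> 0 \<Longrightarrow> ((\<lambda>y. DF y v) has_derivative D2F x v) (at x)"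
    "\<And>v w. continuous_on (- {0}) (\<lambda>y. D2F y v w)" "continuous_on (- {0}) (hom_ext a)"
    using C2_onE[OF assms] by metis
  have sub: "sphere 0 1 \<subseteq> - {0::'a}" by auto
  have "continuous_on (sphere 0 1) (hom_ext a)"
    by (rule continuous_on_subset[OF F(4) sub])
  then show "continuous_on (sphere 0 1) a"
    by (rule continuous_on_eq) (simp add: hom_ext_sphere)
  have "continuous_on (sphere 0 1) (\<lambda>x. \<Sum>b\<in>Basis. D2F x b b)"
    by (intro continuous_on_sum continuous_on_subset[OF F(3) sub])
  then show "continuous_on (sphere 0 1) (sph_lap a)"
    by (rule continuous_on_eq) (auto simp: sph_lap_def intro!: eucl_lap_eq[OF F(1,2), symmetric])
qed

text \<open>The field B grad A - A grad B of the degree-zero extensions has divergence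
  \<open>L\<close>, and by Euler's identity it has no radial component. Multiplication by a radial
  cutoff thus creates no extra term in the divergence, and the cut-off divergence integrates to zero
  over the ball. Since \<open>L\<close> is homogeneous of degree -2, its integral over the ball
  carries the spherical integral of \<open>D\<close>.\<close>

theorem sph_green:
  fixes a b :: "'a::euclidean_space \<Rightarrow> real"
  assumes a: "C2_on (hom_ext a) (- {0})" and b: "C2_on (hom_ext b) (- {0})"
  shows "(LINT x|sph_measure. sph_lap a x * b x) = (LINT x|sph_measure. a x * sph_lap b x)"
proof -
  let ?A = "hom_ext a" and ?B = "hom_ext b"
  obtain DA D2A where A: "\<And>x. x \<noteq> 0 \<Longrightarrow> (?A has_derivative DA x) (at x)"
    "\<And>x v. x \<noteq> 0 \<Longrightarrow> ((\<lambda>y. DA y v) has_derivative D2A x v) (at x)"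
    "\<And>v w. continuous_on (- {0}) (\<lambda>y. D2A y v w)"
    "continuous_on (- {0}) ?A" "\<And>v. continuous_on (- {0}) (\<lambda>y. DA y v)"
    using C2_onE[OF a] by metis
  obtain DB D2B where B: "\<And>x. x \<noteq> 0 \<Longrightarrow> (?B has_derivative DB x) (at x)"
    "\<And>x v. x \<noteq> 0 \<Longrightarrow> ((\<lambda>y. DB y v) has_derivative D2B x v) (at x)"
    "\<And>v w. continuous_on (- {0}) (\<lambda>y. D2B y v w)"
    "continuous_on (- {0}) ?B" "\<And>v. continuous_on (- {0}) (\<lambda>y. DB y v)"
    using C2_onE[OF b] by metis
  define L where "L x = ?B x * (\<Sum>i\<in>Basis. D2A x i i) - ?A x * (\<Sum>i\<in>Basis. D2B x i i)" for x
  define D where "D y = sph_lap a y * b y - a y * sph_lap b y" for y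
  have DL: "D y = L y" if "y \<in> sphere 0 1" for y
  proof -
    have "y \<noteq> 0" using that by auto
    then show ?thesis
      using that eucl_lap_eq[OF A(1,2)] eucl_lap_eq[OF B(1,2)]
      by (simp add: D_def L_def sph_lap_def hom_ext_sphere)
  qed
  have Lx: "L x = D (x /\<^sub>R norm x) / (x \<bullet> x)" if x: "x \<noteq> 0" for x
  proof -
    let ?c = "inverse (norm x)"
    have c: "?c > 0" using x by simp
    have sa: "(\<Sum>i\<in>Basis. D2A x i i) = ?c\<^sup>2 * (\<Sum>i\<in>Basis. D2A (?c *\<^sub>R x) i i)"
      unfolding sum_distrib_left
      by (intro sum.cong refl hom_second_derivative_scale[OF hom_ext_scale A(1,2) x c])
    have sb: "(\<Sum>i\<in>Basis. D2B x i i) = ?c\<^sup>2 * (\<Sum>i\<in>Basis. D2B (?c *\<^sub>R x) i i)"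
      unfolding sum_distrib_left
      by (intro sum.cong refl hom_second_derivative_scale[OF hom_ext_scale B(1,2) x c])
    have "L x = ?c\<^sup>2 * L (?c *\<^sub>R x)"
      unfolding L_def hom_ext_scale[OF c] sa sb by (simp add: algebra_simps)
    moreover have "?c *\<^sub>R x \<in> sphere 0 1" using x by simp
    ultimately have "L x = ?c\<^sup>2 * D (?c *\<^sub>R x)" using DL by metis
    then show ?thesis by (simp add: power2_eq_square dot_square_norm divide_inverse mult_ac)
  qed
  have Dc: "continuous_on (sphere 0 1) D"
    unfolding D_def using C2_hom_ext_continuous[OF a] C2_hom_ext_continuous[OF b]
    by (intro continuous_intros)
  obtain C where C: "C > 0" "\<And>x. x \<in> sphere 0 1 \<Longrightarrow> \<bar>D x\<bar> \<le> C"
    using bounded_on_sphere[OF Dc] by blast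
  \<comment> \<open>Here r is the squared norm. The leading factor r compensates the degree -2 of
    \<open>L\<close>. The first positive part removes r \<le> 1/(j+1), the second one r \<ge> 1, and
    both tend to 1 for 0 < r < 1. Squaring makes the cutoffs continuously differentiable.\<close>
  define X where "X j r = r * (max 0 (1 - 1 / (real (Suc j) * r)))\<^sup>2 * (max 0 (1 - r ^ Suc j))\<^sup>2" for j r
  define X' where "X' j r = (max 0 (1 - 1 / (real (Suc j) * r)))\<^sup>2 * (max 0 (1 - r ^ Suc j))\<^sup>2
      + r * (2 * max 0 (1 - 1 / (real (Suc j) * r)) * (1 / (real (Suc j) * r\<^sup>2))) * (max 0 (1 - r ^ Suc j))\<^sup>2
      - r * (max 0 (1 - 1 / (real (Suc j) * r)))\<^sup>2 * (2 * max 0 (1 - r ^ Suc j) * (real (Suc j) * r ^ j))" for j r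
  have dX: "(X j has_real_derivative X' j r) (at r)" if r: "r > 0" for j r
  proof -
    have 1: "((\<lambda>r. (max 0 (1 - 1 / (real (Suc j) * r)))\<^sup>2) has_real_derivative
        2 * max 0 (1 - 1 / (real (Suc j) * r)) * (1 / (real (Suc j) * r\<^sup>2))) (at r)"
    proof (rule DERIV_chain2[OF has_real_derivative_max0_square])
      have "((\<lambda>r. 1 - 1 / (c * r)) has_real_derivative 1 / (c * r\<^sup>2)) (at r)" if "c > 0" for c
        by (rule derivative_eq_intros refl | use r that in \<open>simp add: power2_eq_square\<close>)+
      from this[of "real (Suc j)"]
      show "((\<lambda>r. 1 - 1 / (real (Suc j) * r)) has_real_derivative 1 / (real (Suc j) * r\<^sup>2)) (at r)"
        by (simp del: of_nat_Suc)
    qed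
    have 2: "((\<lambda>r. (max 0 (1 - r ^ Suc j))\<^sup>2) has_real_derivative
        2 * max 0 (1 - r ^ Suc j) * (- (real (Suc j) * r ^ j))) (at r)"
      by (rule DERIV_chain2[OF has_real_derivative_max0_square])
         (auto intro!: derivative_eq_intros simp del: power_Suc)
    show ?thesis
      unfolding X_def[abs_def]
      by (rule DERIV_cong[OF DERIV_mult[OF DERIV_mult[OF DERIV_ident 1] 2]])
         (simp add: X'_def algebra_simps)
  qed
  have X0: "X j r = 0" and X'0: "r \<noteq> 0 \<Longrightarrow> X' j r = 0" if "0 \<le> r" "r < 1 / real (Suc j)" for j r
  proof -
    have m: "max 0 (1 - 1 / (real (Suc j) * r)) = 0" if "r \<noteq> 0"
    proof -
      have "0 < real (Suc j) * r" using that \<open>0 \<le> r\<close> by simp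
      moreover have "real (Suc j) * r < 1" using \<open>r < 1 / real (Suc j)\<close> by (simp add: field_simps)
      ultimately have "1 / (real (Suc j) * r) > 1" by (rule less_divide_eq_1_pos[THEN iffD2])
      then show ?thesis by simp
    qed
    show "X j r = 0"
    proof (cases "r = 0")
      case False
      show ?thesis by (simp only: X_def m[OF False]) simp
    qed (simp add: X_def)
    show "X' j r = 0" if "r \<noteq> 0" by (simp only: X'_def m[OF that], simp)
  qed
  have X1: "X j r = 0" and X'1: "X' j r = 0" if "r \<ge> 1" for j r
  proof -
    have "max 0 (1 - r ^ Suc j) = 0" using one_le_power[OF that, of "Suc j"] by (simp del: power_Suc)
    then show "X j r = 0" "X' j r = 0" by (simp_all only: X_def X'_def) simp_all
  qed
  have Xb: "\<bar>X j r\<bar> \<le> r" if "0 < r" for j r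
  proof -
    have "(max 0 (1 - 1 / (real (Suc j) * r)))\<^sup>2 \<le> 1" "(max 0 (1 - r ^ Suc j))\<^sup>2 \<le> 1"
      using that by (auto simp: power_le_one_iff max_def simp del: power_Suc)
    then have "(max 0 (1 - 1 / (real (Suc j) * r)))\<^sup>2 * (max 0 (1 - r ^ Suc j))\<^sup>2 \<le> 1"
      by (intro mult_le_one) auto
    then show ?thesis
      using that by (simp add: X_def abs_mult mult.assoc mult_left_le del: power_Suc)
  qed
  have Xc: "continuous_on {0<..} (X j)" for j
    using dX by (meson DERIV_continuous_on greaterThan_iff has_field_derivative_at_within)
  have X'c: "continuous_on {0<..} (X' j)" for j
    unfolding X'_def by (intro continuous_intros) auto
  define f where "f j i x = X j (x \<bullet> x) * (?B x * DA x i - ?A x * DB x i)" for j i x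
  define g where "g j i x = 2 * X' j (x \<bullet> x) * (x \<bullet> i) * (?B x * DA x i - ?A x * DB x i)
      + X j (x \<bullet> x) * (?B x * D2A x i i - ?A x * D2B x i i)" for j i x
  have near0: "f j i x = 0" "g j i x = 0" if "norm x < 1 / real (Suc j)" for j i x
  proof -
    have "x \<bullet> x \<le> norm x * 1"
      unfolding dot_square_norm power2_eq_square using that
      by (intro mult_left_mono order.trans[OF less_imp_le[OF that]]) auto
    then have r: "x \<bullet> x < 1 / real (Suc j)" using that by simp
    show "f j i x = 0" "g j i x = 0"
      using X0[OF inner_ge_zero r] X'0[OF inner_ge_zero r] by (cases "x = 0"; simp add: f_def g_def)+
  qed
  have cont: "continuous_on UNIV h" if h: "\<And>x. norm x < 1 / real (Suc j) \<Longrightarrow> h x = 0"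
     and hc: "continuous_on (- {0}) h" for h :: "'a \<Rightarrow> real" and j
  proof -
    have "continuous_on (ball 0 (1 / real (Suc j))) h"
      by (rule continuous_on_eq[of _ "\<lambda>_. 0"]) (use h in auto)
    then have "continuous_on (ball 0 (1 / real (Suc j)) \<union> - {0}) h"
      using hc by (intro continuous_on_open_Un) auto
    moreover have "ball 0 (1 / real (Suc j)) \<union> - {0} = (UNIV :: 'a set)" by auto
    ultimately show ?thesis by simp
  qed
  have in0: "(\<lambda>x. x \<bullet> x) ` (- {0::'a}) \<subseteq> {0<..}" by auto
  have Xc': "continuous_on (- {0::'a}) (\<lambda>x. X j (x \<bullet> x))" for j
    by (rule continuous_on_compose2[OF Xc _ in0]) (intro continuous_intros)
  have X'c': "continuous_on (- {0::'a}) (\<lambda>x. X' j (x \<bullet> x))" for j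
    by (rule continuous_on_compose2[OF X'c _ in0]) (intro continuous_intros)
  have fc: "continuous_on UNIV (f j i)" for j i
    by (rule cont[of j, OF near0(1)], assumption, unfold f_def)
       (intro continuous_intros Xc' A B)
  have gc: "continuous_on UNIV (g j i)" for j i
    by (rule cont[of j, OF near0(2)], assumption, unfold g_def)
       (intro continuous_intros Xc' X'c' A B)
  have far: "f j i x = 0" "g j i x = 0" if "norm x \<ge> 1" for j i x
  proof -
    have "x \<bullet> x \<ge> 1" using that by (simp add: dot_square_norm)
    then show "f j i x = 0" "g j i x = 0" using X1 X'1 by (auto simp: f_def g_def)
  qed
  have der: "((\<lambda>r. f j i (x + r *\<^sub>R i)) has_real_derivative g j i x) (at 0)" for j i x
  proof (cases "x = 0")
    case True
    show ?thesis
    proof (rule has_field_derivative_transform_within[where d="1 / (real (Suc j) * (norm i + 1))"])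
      show "((\<lambda>r. 0) has_real_derivative g j i x) (at 0)"
        using near0(2)[of x j i] True by simp
      show "0 = f j i (x + r *\<^sub>R i)" if "dist r 0 < 1 / (real (Suc j) * (norm i + 1))" for r
      proof -
        have "\<bar>r\<bar> * norm i \<le> \<bar>r\<bar> * (norm i + 1)" by (intro mult_left_mono) auto
        also have "\<dots> < 1 / real (Suc j)"
          using that by (simp add: field_simps add_pos_nonneg)
        finally show ?thesis using near0(1)[of "x + r *\<^sub>R i" j i] True by simp
      qed
    qed (auto simp: add_nonneg_pos)
  next
    case False
    then have r: "x \<bullet> x > 0" by simp
    have n: "((\<lambda>r. (x + r *\<^sub>R i) \<bullet> (x + r *\<^sub>R i)) has_real_derivative 2 * (x \<bullet> i)) (at 0)"
      by (rule has_derivative_imp_directional[of "\<lambda>x. x \<bullet> x" "\<lambda>h. 2 * (x \<bullet> h)", simplified])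
         (auto intro!: derivative_eq_intros simp: inner_commute)
    have "((\<lambda>r. X j ((x + r *\<^sub>R i) \<bullet> (x + r *\<^sub>R i))) has_real_derivative
        X' j (x \<bullet> x) * (2 * (x \<bullet> i))) (at 0)"
      by (rule DERIV_chain2[OF _ n]) (use dX[OF r] in simp)
    from DERIV_mult[OF this DERIV_diff[OF
        DERIV_mult[OF has_derivative_imp_directional[OF B(1)[OF False]]
          has_derivative_imp_directional[OF A(2)[OF False]]]
        DERIV_mult[OF has_derivative_imp_directional[OF A(1)[OF False]]
          has_derivative_imp_directional[OF B(2)[OF False]]]], of i i i i i]
    show ?thesis
      unfolding f_def g_def by (rule DERIV_cong) (simp add: algebra_simps)
  qed
  have gi: "integrable lborel (g j i)" for j i
  proof -
    have "integrable lborel (\<lambda>x. indicator (cball 0 1) x *\<^sub>R g j i x)"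
      by (intro borel_integrable_compact continuous_on_subset[OF gc]) auto
    moreover have "(\<lambda>x. indicator (cball 0 1) x *\<^sub>R g j i x) = g j i"
      using far by (auto simp: fun_eq_iff indicator_def)
    ultimately show ?thesis by simp
  qed
  have g0: "integral\<^sup>L lborel (g j i) = 0" for j i
    by (rule integral_directional_derivative_eq_0[OF der fc gc far])
  \<comment> \<open>The terms with \<open>X'\<close> collect into radial derivatives of the two
    extensions, which vanish.\<close>
  have sumg: "(\<Sum>i\<in>Basis. g j i x) = X j (x \<bullet> x) * L x" for j x
  proof (cases "x = 0")
    case True
    then show ?thesis using near0(2)[of x] X0[of 0] by simp
  next
    case False
    have lin: "(\<Sum>i\<in>Basis. (x \<bullet> i) * F' i) = F' x" if "(F has_derivative F') (at x)"
      for F :: "'a \<Rightarrow> real" and F'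
    proof -
      have l: "linear F'" by (rule has_derivative_linear[OF that])
      have "F' x = F' (\<Sum>i\<in>Basis. (x \<bullet> i) *\<^sub>R i)" by (simp add: euclidean_representation)
      also have "\<dots> = (\<Sum>i\<in>Basis. (x \<bullet> i) * F' i)"
        by (simp add: linear_sum[OF l] linear_scale[OF l])
      finally show ?thesis by simp
    qed
    have "(\<Sum>i\<in>Basis. g j i x) = 2 * X' j (x \<bullet> x) *
        (?B x * (\<Sum>i\<in>Basis. (x \<bullet> i) * DA x i) - ?A x * (\<Sum>i\<in>Basis. (x \<bullet> i) * DB x i))
        + X j (x \<bullet> x) * L x"
      unfolding g_def L_def
      by (simp add: sum.distrib sum_subtractf sum_distrib_left algebra_simps)
    also have "(\<Sum>i\<in>Basis. (x \<bullet> i) * DA x i) = 0"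
      using lin[OF A(1)[OF False]] hom_derivative_radial[OF hom_ext_scale A(1)[OF False]] by simp
    also have "(\<Sum>i\<in>Basis. (x \<bullet> i) * DB x i) = 0"
      using lin[OF B(1)[OF False]] hom_derivative_radial[OF hom_ext_scale B(1)[OF False]] by simp
    finally show ?thesis by simp
  qed
  have int0: "(LINT x|lborel. X j (x \<bullet> x) * L x) = 0" for j
    unfolding sumg[symmetric] using gi g0 by (subst Bochner_Integration.integral_sum) auto
  have meas: "(\<lambda>x. X j (x \<bullet> x) * L x) \<in> borel_measurable lborel" for j
    unfolding sumg[symmetric] using gi by (intro borel_measurable_sum borel_measurable_integrable)
  let ?I = "\<lambda>x. indicator (ball 0 1 - {0}) x *\<^sub>R D (x /\<^sub>R norm x)"
  have lim: "(\<lambda>j. X j (x \<bullet> x) * L x) \<longlonglongrightarrow> ?I x" for x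
  proof (cases "x = 0")
    case True
    then show ?thesis by (simp add: X_def)
  next
    case x: False
    let ?r = "x \<bullet> x"
    show ?thesis
    proof (cases "norm x < 1")
      case True
      then have r: "0 < ?r" "?r < 1" using x by (auto simp: dot_square_norm power_less_one_iff)
      have "(\<lambda>j. 1 / real (Suc j) * (1 / ?r)) \<longlonglongrightarrow> 0 * (1 / ?r)"
        by (intro tendsto_intros LIMSEQ_Suc[OF lim_1_over_n])
      then have 1: "(\<lambda>j. 1 / (real (Suc j) * ?r)) \<longlonglongrightarrow> 0" by simp
      have 2: "(\<lambda>j. ?r ^ Suc j) \<longlonglongrightarrow> 0"
        using r by (intro LIMSEQ_Suc[OF LIMSEQ_realpow_zero]) auto
      have "(\<lambda>j. X j ?r * L x) \<longlonglongrightarrow> ?r * (max 0 (1 - 0))\<^sup>2 * (max 0 (1 - 0))\<^sup>2 * L x"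
        unfolding X_def by (intro tendsto_intros 1 2)
      then show ?thesis using True x Lx[OF x] r by simp
    next
      case False
      then have "?r \<ge> 1" by (simp add: dot_square_norm)
      then show ?thesis using X1 False by simp
    qed
  qed
  have "(\<lambda>j. LINT x|lborel. X j (x \<bullet> x) * L x) \<longlonglongrightarrow> (LINT x|lborel. ?I x)"
  proof (rule integral_dominated_convergence[where w="\<lambda>x. indicator (cball 0 1) x *\<^sub>R C"])
    show "?I \<in> borel_measurable lborel"
      by (rule borel_measurable_LIMSEQ_metric[OF meas lim])
    show "integrable lborel (\<lambda>x. indicator (cball (0::'a) 1) x *\<^sub>R C)"
      by (intro borel_integrable_compact) auto
    show "AE x in lborel. norm (X j (x \<bullet> x) * L x) \<le> indicator (cball 0 1) x *\<^sub>R C" for j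
    proof (rule AE_I2)
      fix x :: 'a
      consider "x = 0" | "norm x > 1" | "x \<noteq> 0" "norm x \<le> 1" by linarith
      then show "norm (X j (x \<bullet> x) * L x) \<le> indicator (cball 0 1) x *\<^sub>R C"
      proof cases
        case 1 then show ?thesis using C by (simp add: X_def)
      next
        case 2 then show ?thesis using X1[of "x \<bullet> x"] by (simp add: dot_square_norm)
      next
        case 3
        have r: "0 < x \<bullet> x" using 3 by simp
        have "norm (X j (x \<bullet> x) * L x) = \<bar>X j (x \<bullet> x)\<bar> / (x \<bullet> x) * \<bar>D (x /\<^sub>R norm x)\<bar>"
          using Lx[OF 3(1)] r by (simp add: abs_mult)
        also have "\<dots> \<le> 1 * C"
          using Xb[OF r] r C(2)[of "x /\<^sub>R norm x"] 3 by (intro mult_mono) auto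
        finally show ?thesis using 3 by simp
      qed
    qed
  qed (use meas lim in auto)
  then have "(LINT x|lborel. ?I x) = 0" using int0 by (simp add: LIMSEQ_const_iff)
  then have "integral\<^sup>L sph_measure D = 0" using integral_sph_measure_eq[OF Dc] by simp
  moreover have "integrable sph_measure (\<lambda>x. sph_lap a x * b x)" "integrable sph_measure (\<lambda>x. a x * sph_lap b x)"
    using C2_hom_ext_continuous[OF a] C2_hom_ext_continuous[OF b]
    by (auto intro!: integrable_sph_continuous continuous_intros)
  ultimately show ?thesis by (simp add: D_def[abs_def])
qed

section \<open>Poisson-type kernels\<close>

lemma has_derivative_inverse_norm:
  fixes x :: "'a::euclidean_space"
  assumes "x \<noteq> 0"
  shows "((\<lambda>x. inverse (norm x)) has_derivative (\<lambda>h. - (x \<bullet> h) * inverse (norm x) ^ 3)) (at x)"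
proof -
  have "((\<lambda>x. inverse (norm x)) has_derivative
      (\<lambda>h. - (inverse (norm x) * (h \<bullet> sgn x) * inverse (norm x)))) (at x)"
    by (rule Deriv.has_derivative_inverse[OF _ has_derivative_norm[OF assms]]) (use assms in simp)
  then show ?thesis
    by (rule has_derivative_eq_rhs)
       (auto simp: fun_eq_iff sgn_div_norm inner_commute power3_eq_cube)
qed

section \<open>Zonal functions and their Laplacian\<close>

lemma sphere_inner_bounds:
  fixes x y :: "'a::euclidean_space"
  assumes "x \<in> sphere 0 1" "y \<in> sphere 0 1"
  shows "x \<bullet> y \<in> {-1..1}"
  using Cauchy_Schwarz_ineq2[of x y] assms by auto

lemma sphere_dist_square:
  fixes x y :: "'a::euclidean_space"
  assumes "x \<in> sphere 0 1" "y \<in> sphere 0 1"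
  shows "(dist y x)\<^sup>2 = 2 - 2 * (x \<bullet> y)"
proof -
  have "norm x = 1" "norm y = 1" using assms by auto
  then have "x \<bullet> y = (1 + 1 - (norm (x - y))\<^sup>2) / 2" using dot_norm_neg[of x y] by simp
  moreover have "dist y x = norm (x - y)" by (simp add: dist_norm norm_minus_commute)
  ultimately show ?thesis by simp
qed

text \<open>Chain rule for f after q(x) = (x \<bullet> z) / |x|, whose first and second derivatives
  are \<open>T\<close> and \<open>T2\<close>. On the n-sphere the height t satisfies |grad t|^2 = 1
  - t^2 and Delta t = -n t, which gives the Gegenbauer operator. Two-sided derivatives at the end
  points are required because q attains -1 and 1 in the interior of its domain.\<close>

lemma zonal_C2_and_lap:
  fixes z :: "'a::euclidean_space" and f :: "real \<Rightarrow> real"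
  assumes z: "z \<in> sphere 0 1"
    and d1: "\<And>t. t \<in> {-1..1} \<Longrightarrow> (f has_real_derivative f' t) (at t)"
    and d2: "\<And>t. t \<in> {-1..1} \<Longrightarrow> (f' has_real_derivative f'' t) (at t)"
    and c2: "continuous_on {-1..1} f''"
  shows "C2_on (hom_ext (\<lambda>x. f (x \<bullet> z))) (- {0})"
    and "x \<in> sphere 0 1 \<Longrightarrow> sph_lap (\<lambda>x. f (x \<bullet> z)) x
      = (1 - (x \<bullet> z)\<^sup>2) * f'' (x \<bullet> z) - (real DIM('a) - 1) * (x \<bullet> z) * f' (x \<bullet> z)"
proof -
  define m where "m x = inverse (norm x)" for x :: 'a
  have dm: "(m has_derivative (\<lambda>h. - (x \<bullet> h) * m x ^ 3)) (at x)" if "x \<noteq> 0" for x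
    using has_derivative_inverse_norm[OF that] by (simp add: m_def[abs_def])
  define q where "q x = (x \<bullet> z) * m x" for x
  define T where "T x v = (v \<bullet> z) * m x - (x \<bullet> z) * (x \<bullet> v) * m x ^ 3" for x v
  define T2 where "T2 x v w = - (v \<bullet> z) * (x \<bullet> w) * m x ^ 3 - (w \<bullet> z) * (x \<bullet> v) * m x ^ 3
      - (x \<bullet> z) * (w \<bullet> v) * m x ^ 3 + 3 * (x \<bullet> z) * (x \<bullet> v) * (x \<bullet> w) * m x ^ 5" for x v w
  have F: "hom_ext (\<lambda>x. f (x \<bullet> z)) x = f (q x)" for x
    by (simp add: hom_ext_def q_def m_def mult.commute)
  have qb: "q x \<in> {-1..1}" if "x \<noteq> 0" for x
  proof -
    have "q x = (x /\<^sub>R norm x) \<bullet> z" by (simp add: q_def m_def mult.commute)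
    moreover have "x /\<^sub>R norm x \<in> sphere 0 1" using that by simp
    ultimately show ?thesis using sphere_inner_bounds[OF _ z] by metis
  qed
  have dq: "(q has_derivative T x) (at x)" if "x \<noteq> 0" for x
    unfolding q_def[abs_def] T_def[abs_def]
    by (auto intro!: derivative_eq_intros dm that simp: fun_eq_iff algebra_simps)
  have dT: "((\<lambda>y. T y v) has_derivative T2 x v) (at x)" if "x \<noteq> 0" for x v
  proof -
    have i: "((\<lambda>y. y \<bullet> u) has_derivative (\<lambda>h. h \<bullet> u)) (at x)" for u
      by (intro has_derivative_inner_left has_derivative_ident)
    have two: "(3::nat) - 1 = 2" by simp
    have p: "((\<lambda>y. m y ^ 3) has_derivative (\<lambda>h. of_nat 3 * (- (x \<bullet> h) * m x ^ 3) * m x ^ 2)) (at x)"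
      using has_derivative_power[OF dm[OF that], of 3] unfolding two .
    have m5: "m x ^ 5 = m x ^ 2 * m x ^ 3" by (simp flip: power_add)
    have alg: "a * (- c * k3) - (t * r * (of_nat 3 * (- c * k3) * k2) + (t * d + w * r) * k3)
        = - a * c * k3 - w * r * k3 - t * d * k3 + 3 * t * r * c * (k2 * k3)"
      for a c d t r w k2 k3 :: real by (simp add: algebra_simps)
    from has_derivative_diff[OF has_derivative_mult_right[OF dm[OF that], of "v \<bullet> z"]
        has_derivative_mult[OF has_derivative_mult[OF i[of z] i[of v]] p]]
    show ?thesis
      unfolding T_def by (rule has_derivative_eq_rhs) (rule ext, simp only: T2_def m5 alg)
  qed
  define DF where "DF x v = f' (q x) * T x v" for x v
  define D2F where "D2F x v w = f'' (q x) * T x w * T x v + f' (q x) * T2 x v w" for x v w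
  have D1: "(hom_ext (\<lambda>x. f (x \<bullet> z)) has_derivative DF x) (at x)" if "x \<noteq> 0" for x
  proof -
    have "((\<lambda>x. f (q x)) has_derivative (\<lambda>v. f' (q x) * T x v)) (at x)"
      using has_derivative_compose[OF dq[OF that] d1[OF qb[OF that], unfolded has_field_derivative_def]]
      by simp
    then show ?thesis by (simp add: F[abs_def] DF_def[abs_def])
  qed
  have D2: "((\<lambda>y. DF y v) has_derivative D2F x v) (at x)" if "x \<noteq> 0" for x v
  proof -
    have "((\<lambda>x. f' (q x)) has_derivative (\<lambda>v. f'' (q x) * T x v)) (at x)"
      using has_derivative_compose[OF dq[OF that] d2[OF qb[OF that], unfolded has_field_derivative_def]]
      by simp
    from has_derivative_mult[OF this dT[OF that, of v]]
    show ?thesis unfolding DF_def D2F_def[abs_def]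
      by (rule has_derivative_eq_rhs) (auto simp: fun_eq_iff algebra_simps)
  qed
  have mc: "continuous_on (- {0}) m"
    by (auto intro!: continuous_at_imp_continuous_on has_derivative_continuous[OF dm])
  have qc: "continuous_on (- {0}) q"
    by (auto intro!: continuous_at_imp_continuous_on has_derivative_continuous[OF dq])
  have c1: "continuous_on {-1..1} f'"
    by (auto intro!: continuous_at_imp_continuous_on DERIV_isCont[OF d2])
  have cc: "continuous_on (- {0}) (\<lambda>y. D2F y v w)" for v w
  proof -
    have "continuous_on (- {0}) (\<lambda>y. f' (q y))"
      by (rule continuous_on_compose2[OF c1 qc], intro image_subsetI qb, simp)
    moreover have "continuous_on (- {0}) (\<lambda>y. f'' (q y))"
      by (rule continuous_on_compose2[OF c2 qc], intro image_subsetI qb, simp)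
    ultimately show ?thesis
      unfolding D2F_def T_def T2_def by (intro continuous_intros mc)
  qed
  show "C2_on (hom_ext (\<lambda>x. f (x \<bullet> z))) (- {0})"
    unfolding C2_on_def using D1 D2 cc by (intro conjI exI[of _ DF] exI[of _ D2F]) auto
  assume x: "x \<in> sphere 0 1"
  then have x0: "x \<noteq> 0" and mx: "m x = 1" and xx: "x \<bullet> x = 1" by (auto simp: m_def dot_square_norm)
  have zz: "z \<bullet> z = 1" using z by (simp add: dot_square_norm)
  have S1: "(\<Sum>b\<in>Basis. (b \<bullet> u) * (b \<bullet> v)) = u \<bullet> v" for u v :: 'a
    by (simp add: euclidean_inner[of u v] inner_commute)
  have S2: "(\<Sum>b\<in>(Basis::'a set). b \<bullet> b) = real DIM('a)"
    by (simp add: inner_Basis)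
  have lin: "(\<Sum>b\<in>(Basis::'a set). A * (P b - B * Q b + C * R b) + D * (- 2 * Q b - E * W b + G * R b))
      = A * (sum P Basis - B * sum Q Basis + C * sum R Basis)
        + D * (- 2 * sum Q Basis - E * sum W Basis + G * sum R Basis)"
    for A B C D E G :: real and P Q R W
    by (simp add: sum.distrib sum_subtractf sum_negf sum_distrib_left right_diff_distrib distrib_left)
  have "eucl_lap (hom_ext (\<lambda>x. f (x \<bullet> z))) x = (\<Sum>b\<in>Basis. D2F x b b)"
    by (rule eucl_lap_eq[OF D1 D2 x0])
  also have "\<dots> = (\<Sum>b\<in>Basis. f'' (x \<bullet> z) * ((b \<bullet> z) * (b \<bullet> z)
        - 2 * (x \<bullet> z) * ((b \<bullet> z) * (b \<bullet> x)) + (x \<bullet> z)\<^sup>2 * ((b \<bullet> x) * (b \<bullet> x)))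
      + f' (x \<bullet> z) * (- 2 * ((b \<bullet> z) * (b \<bullet> x)) - (x \<bullet> z) * (b \<bullet> b) + 3 * (x \<bullet> z) * ((b \<bullet> x) * (b \<bullet> x))))"
  proof (rule sum.cong[OF refl])
    fix b :: 'a
    have c: "x \<bullet> b = b \<bullet> x" by (rule inner_commute)
    have alg: "A * (p - t * r) * (p - t * r) + B * (- p * r - p * r - t * c + 3 * t * r * r)
        = A * (p * p - 2 * t * (p * r) + t\<^sup>2 * (r * r)) + B * (- 2 * (p * r) - t * c + 3 * t * (r * r))"
      for A B p r t c :: real by (simp add: power2_eq_square algebra_simps)
    show "D2F x b b = f'' (x \<bullet> z) * ((b \<bullet> z) * (b \<bullet> z)
        - 2 * (x \<bullet> z) * ((b \<bullet> z) * (b \<bullet> x)) + (x \<bullet> z)\<^sup>2 * ((b \<bullet> x) * (b \<bullet> x)))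
      + f' (x \<bullet> z) * (- 2 * ((b \<bullet> z) * (b \<bullet> x)) - (x \<bullet> z) * (b \<bullet> b) + 3 * (x \<bullet> z) * ((b \<bullet> x) * (b \<bullet> x)))"
      by (simp only: D2F_def T_def T2_def q_def mx c power_one mult_1_right alg)
  qed
  also have "\<dots> = f'' (x \<bullet> z) * (z \<bullet> z - 2 * (x \<bullet> z) * (z \<bullet> x) + (x \<bullet> z)\<^sup>2 * (x \<bullet> x))
      + f' (x \<bullet> z) * (- 2 * (z \<bullet> x) - (x \<bullet> z) * real DIM('a) + 3 * (x \<bullet> z) * (x \<bullet> x))"
    unfolding lin S1 S2 by simp
  finally show "sph_lap (\<lambda>x. f (x \<bullet> z)) x
      = (1 - (x \<bullet> z)\<^sup>2) * f'' (x \<bullet> z) - (real DIM('a) - 1) * (x \<bullet> z) * f' (x \<bullet> z)"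
    by (simp add: sph_lap_def xx zz inner_commute power2_eq_square algebra_simps)
qed

lemma sph_lap_const: "x \<in> sphere 0 1 \<Longrightarrow> sph_lap (\<lambda>_. c) x = 0"
  and C2_hom_ext_const: "C2_on (hom_ext (\<lambda>_::'a::euclidean_space. c)) (- {0})"
proof -
  obtain b :: 'a where b: "b \<in> Basis" using nonempty_Basis by blast
  have *: "b \<in> sphere 0 1" using b by simp
  show "C2_on (hom_ext (\<lambda>_::'a. c)) (- {0})"
    using zonal_C2_and_lap(1)[OF *, of "\<lambda>_. c" "\<lambda>_. 0" "\<lambda>_. 0"] by simp
  show "sph_lap (\<lambda>_. c) x = 0" if "x \<in> sphere 0 1" for x :: 'b
    by (simp add: sph_lap_def hom_ext_def[abs_def] eucl_lap_def)
qed

lemma integral_sph_lap_eq_0: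
  assumes "C2_on (hom_ext a) (- {0})"
  shows "integral\<^sup>L sph_measure (sph_lap a) = 0"
proof -
  have "(LINT x|sph_measure. sph_lap a x * 1) = (LINT x|sph_measure. a x * sph_lap (\<lambda>_. 1) x)"
    by (rule sph_green[OF assms C2_hom_ext_const])
  also have "\<dots> = (LINT x|(sph_measure::'a measure). 0)"
    by (rule Bochner_Integration.integral_cong) (auto simp: sph_lap_const)
  finally show ?thesis by simp
qed

section \<open>Mass of the Poisson-type kernels\<close>

lemma has_real_derivative_integral:
  fixes F F' :: "real \<Rightarrow> 'b \<Rightarrow> real"
  assumes fin: "finite_measure M" and t0: "t0 \<in> {a<..<b}"
    and der: "\<And>t x. t \<in> {a<..<b} \<Longrightarrow> x \<in> space M \<Longrightarrow> ((\<lambda>t. F t x) has_real_derivative F' t x) (at t)"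
    and int: "\<And>t. t \<in> {a<..<b} \<Longrightarrow> integrable M (F t)"
    and meas: "F' t0 \<in> borel_measurable M"
    and bd: "\<And>t x. t \<in> {a<..<b} \<Longrightarrow> x \<in> space M \<Longrightarrow> \<bar>F' t x\<bar> \<le> C"
  shows "((\<lambda>t. integral\<^sup>L M (F t)) has_real_derivative integral\<^sup>L M (F' t0)) (at t0)"
proof -
  interpret finite_measure M by (rule fin)
  have "((\<lambda>t. (integral\<^sup>L M (F t) - integral\<^sup>L M (F t0)) / (t - t0)) \<longlongrightarrow> integral\<^sup>L M (F' t0))
      (at t0 within {a<..<b})"
    unfolding tendsto_at_iff_sequentially
  proof (intro allI impI)
    fix X assume X: "\<forall>i. X i \<in> {a<..<b} - {t0}" "X \<longlonglongrightarrow> t0"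
    have lim: "filterlim X (at t0) sequentially"
      using X by (intro filterlim_atI) auto
    have "(\<lambda>i. LINT x|M. (F (X i) x - F t0 x) / (X i - t0)) \<longlonglongrightarrow> integral\<^sup>L M (F' t0)"
    proof (rule integral_dominated_convergence[where w="\<lambda>_. C"])
      show "AE x in M. (\<lambda>i. (F (X i) x - F t0 x) / (X i - t0)) \<longlonglongrightarrow> F' t0 x"
      proof (rule AE_I2)
        fix x assume x: "x \<in> space M"
        have "((\<lambda>t. (F t x - F t0 x) / (t - t0)) \<longlongrightarrow> F' t0 x) (at t0)"
          using der[OF t0 x] by (simp add: has_field_derivative_iff)
        then show "(\<lambda>i. (F (X i) x - F t0 x) / (X i - t0)) \<longlonglongrightarrow> F' t0 x"
          using lim by (rule filterlim_compose)
      qed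
      show "AE x in M. norm ((F (X i) x - F t0 x) / (X i - t0)) \<le> C" for i
      proof (rule AE_I2)
        fix x assume x: "x \<in> space M"
        have Xi: "X i \<in> {a<..<b}" "X i \<noteq> t0" using X by auto
        have "\<bar>F (X i) x - F t0 x\<bar> \<le> C * \<bar>X i - t0\<bar>"
          using field_differentiable_bound[of "{a<..<b}" "\<lambda>t. F t x" "\<lambda>t. F' t x" C "X i" t0]
            der[OF _ x] bd[OF _ x] Xi t0
          by (auto intro: has_field_derivative_at_within)
        then show "norm ((F (X i) x - F t0 x) / (X i - t0)) \<le> C"
          using Xi by (simp add: divide_le_eq)
      qed
      show "(\<lambda>x. (F (X i) x - F t0 x) / (X i - t0)) \<in> borel_measurable M" for i
        using X int[of "X i"] int[OF t0] by (auto intro!: borel_measurable_divide borel_measurable_diff)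
    qed (use meas in auto)
    moreover have "(LINT x|M. (F (X i) x - F t0 x) / (X i - t0))
        = (integral\<^sup>L M (F (X i)) - integral\<^sup>L M (F t0)) / (X i - t0)" for i
      using X int[of "X i"] int[OF t0] by (simp add: Bochner_Integration.integral_diff)
    moreover have "X i \<noteq> t0" for i using X by auto
    ultimately show "((\<lambda>t. (integral\<^sup>L M (F t) - integral\<^sup>L M (F t0)) / (t - t0)) \<circ> X)
        \<longlonglongrightarrow> integral\<^sup>L M (F' t0)"
      by (simp add: comp_def)
  qed
  then have "((\<lambda>t. (integral\<^sup>L M (F t) - integral\<^sup>L M (F t0)) / (t - t0)) \<longlongrightarrow> integral\<^sup>L M (F' t0)) (at t0)"
    using t0 by (simp add: at_within_open[OF t0])
  then show ?thesis by (simp add: has_field_derivative_iff)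
qed

lemma cosh_sinh_lower:
  fixes T t :: real
  assumes "\<bar>T\<bar> \<le> K" "t \<in> {-1..1}"
  shows "cosh T - sinh T * t \<ge> exp (- K)"
proof -
  have "sinh T * t \<le> \<bar>sinh T\<bar> * \<bar>t\<bar>" using abs_ge_self[of "sinh T * t"] by (simp add: abs_mult)
  also have "\<dots> \<le> \<bar>sinh T\<bar> * 1" using assms by (intro mult_left_mono) auto
  finally have "cosh T - sinh T * t \<ge> cosh T - \<bar>sinh T\<bar>" by simp
  also have "cosh T - \<bar>sinh T\<bar> = exp (- \<bar>T\<bar>)"
    using cosh_minus_sinh[of "\<bar>T\<bar>"] by (auto simp: abs_if)
  also have "exp (- \<bar>T\<bar>) \<ge> exp (- K)" using assms by simp
  finally show ?thesis .
qed

lemma continuous_zonal: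
  fixes x :: "'a::euclidean_space" and f :: "real \<Rightarrow> real"
  assumes "continuous_on {-1..1} f" "x \<in> sphere 0 1"
  shows "continuous_on (sphere 0 1) (\<lambda>y. f (x \<bullet> y))"
  by (rule continuous_on_compose2[OF assms(1)])
     (use sphere_inner_bounds[OF assms(2)] in \<open>auto intro!: continuous_intros\<close>)

text \<open>The integrand is the Jacobian of a conformal automorphism of the sphere; its
  derivative in T is minus the divergence of the field obtained by multiplying the integrand
  with the gradient of the height function.\<close>

lemma integral_poisson_cosh:
  fixes x :: "'a::euclidean_space"
  assumes x: "x \<in> sphere 0 1" and dim: "DIM('a) \<ge> 3"
  shows "(LINT y|sph_measure. 1 / (cosh T - sinh T * (x \<bullet> y)) ^ (DIM('a) - 1))
    = measure (sph_measure :: 'a measure) (sphere 0 1)"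
proof -
  define n where "n = DIM('a) - 1"
  have n: "n \<ge> 2" "real n = real DIM('a) - 1" using dim by (auto simp: n_def)
  define w where "w T t = cosh T - sinh T * t" for T t :: real
  have wpos: "w T t > 0" if "t \<in> {-1..1}" for T t
    using cosh_sinh_lower[OF order_refl that, of T] exp_gt_zero[of "- \<bar>T\<bar>"] unfolding w_def by linarith
  have wn: "w T t \<noteq> 0" if "t \<in> {-1..1}" for T t
    using wpos[OF that, of T] by simp
  define F where "F T y = 1 / w T (x \<bullet> y) ^ n" for T y
  define F' where "F' T y = - (real n * (sinh T - cosh T * (x \<bullet> y))) / w T (x \<bullet> y) ^ (n + 1)" for T y
  define I where "I T = integral\<^sup>L sph_measure (F T)" for T
  have b: "x \<bullet> y \<in> {-1..1}" if "y \<in> sphere 0 1" for y using sphere_inner_bounds[OF x that] .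
  have intF: "integrable sph_measure (F T)" for T
    unfolding F_def w_def
    by (intro integrable_sph_continuous continuous_intros) (use wn b in \<open>auto simp: w_def\<close>)
  have F'm: "continuous_on (sphere 0 1) (F' T)" for T
    unfolding F'_def w_def
    by (intro continuous_intros) (use wn b in \<open>auto simp: w_def\<close>)
  have F'0: "integral\<^sup>L sph_measure (F' T) = 0" for T
  \<comment> \<open>The potential of the field divides by \<open>sinh T\<close>; at T = 0 the field
    is the gradient of the height function itself.\<close>
  proof (cases "T = 0")
    case True
    have "integral\<^sup>L sph_measure (sph_lap (\<lambda>y. y \<bullet> x)) = 0"
      by (rule integral_sph_lap_eq_0)
         (rule zonal_C2_and_lap(1)[OF x, of "\<lambda>t. t" "\<lambda>_. 1" "\<lambda>_. 0"], auto intro!: derivative_eq_intros)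
    moreover have "integral\<^sup>L sph_measure (sph_lap (\<lambda>y. y \<bullet> x)) = (LINT y|sph_measure. - F' T y)"
    proof (rule Bochner_Integration.integral_cong[OF refl])
      fix y :: 'a assume "y \<in> space sph_measure"
      then have y: "y \<in> sphere 0 1" by simp
      have "sph_lap (\<lambda>y. y \<bullet> x) y = (1 - (y \<bullet> x)\<^sup>2) * 0 - (real DIM('a) - 1) * (y \<bullet> x) * 1"
        by (rule zonal_C2_and_lap(2)[OF x _ _ _ y, of "\<lambda>t. t" "\<lambda>_. 1" "\<lambda>_. 0"])
           (auto intro!: derivative_eq_intros)
      then show "sph_lap (\<lambda>y. y \<bullet> x) y = - F' T y"
        using True n by (simp add: F'_def w_def inner_commute)
    qed
    ultimately show ?thesis by simp
  next
    case False
    then have s: "sinh T \<noteq> 0" by simp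
    \<comment> \<open>A primitive in t of \<open>1 / w T t ^ n\<close>: the field is the gradient of
      \<open>a\<close> applied to the height, so its divergence is a Laplacian and integrates to
      zero.\<close>
    define a where "a t = 1 / (real (n - 1) * sinh T * w T t ^ (n - 1))" for t
    define a1 where "a1 t = 1 / w T t ^ n" for t
    define a2 where "a2 t = real n * sinh T / w T t ^ (n + 1)" for t
    have dw: "(w T has_real_derivative - sinh T) (at t)" for t
      unfolding w_def[abs_def] by (auto intro!: derivative_eq_intros)
    have dpow: "((\<lambda>t. 1 / w T t ^ m) has_real_derivative real m * sinh T / w T t ^ (m + 1)) (at t)"
      if "t \<in> {-1..1}" for t m
    proof (cases m)
      case (Suc k)
      have "((\<lambda>t. 1 / w T t ^ m) has_real_derivative
          (0 * w T t ^ m - 1 * (real m * (w T t ^ (m - 1) * - sinh T))) / (w T t ^ m * w T t ^ m)) (at t)"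
        using wpos[OF that, of T] by (intro DERIV_divide DERIV_const DERIV_power[OF dw, THEN DERIV_cong]) auto
      then show ?thesis
        by (rule DERIV_cong) (use wpos[OF that, of T] in \<open>simp add: Suc field_simps\<close>)
    qed simp
    have d1: "(a has_real_derivative a1 t) (at t)" if "t \<in> {-1..1}" for t
    proof -
      have "a = (\<lambda>t. 1 / (real (n - 1) * sinh T) * (1 / w T t ^ (n - 1)))"
        by (simp add: a_def fun_eq_iff)
      moreover have "((\<lambda>t. 1 / (real (n - 1) * sinh T) * (1 / w T t ^ (n - 1))) has_real_derivative
          1 / (real (n - 1) * sinh T) * (real (n - 1) * sinh T / w T t ^ (n - 1 + 1))) (at t)"
        by (rule DERIV_cmult[OF dpow[OF that]])
      ultimately show ?thesis using s n by (simp add: a1_def)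
    qed
    have d2: "(a1 has_real_derivative a2 t) (at t)" if "t \<in> {-1..1}" for t
      unfolding a1_def[abs_def] a2_def by (rule dpow[OF that])
    have c2: "continuous_on {-1..1} a2"
      unfolding a2_def w_def
      by (intro continuous_intros) (use wn in \<open>auto simp: w_def\<close>)
    have "integral\<^sup>L sph_measure (sph_lap (\<lambda>y. a (y \<bullet> x))) = 0"
      by (rule integral_sph_lap_eq_0, rule zonal_C2_and_lap(1)[OF x d1 d2 c2])
    moreover have "integral\<^sup>L sph_measure (sph_lap (\<lambda>y. a (y \<bullet> x))) = (LINT y|sph_measure. - F' T y)"
    proof (rule Bochner_Integration.integral_cong[OF refl])
      fix y :: 'a assume "y \<in> space sph_measure"
      then have y: "y \<in> sphere 0 1" by simp
      let ?t = "x \<bullet> y"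
      have W: "w T ?t > 0" using wpos[OF b[OF y]] .
      have "sph_lap (\<lambda>y. a (y \<bullet> x)) y = (1 - ?t\<^sup>2) * a2 ?t - real n * ?t * a1 ?t"
        using zonal_C2_and_lap(2)[OF x d1 d2 c2 y] n by (simp add: inner_commute)
      also have "\<dots> = real n * ((1 - ?t\<^sup>2) * sinh T - ?t * w T ?t) / w T ?t ^ (n + 1)"
        using W by (simp add: a1_def a2_def field_simps)
      also have "(1 - ?t\<^sup>2) * sinh T - ?t * w T ?t = sinh T - cosh T * ?t"
        by (simp add: w_def power2_eq_square algebra_simps)
      finally show "sph_lap (\<lambda>y. a (y \<bullet> x)) y = - F' T y" by (simp add: F'_def)
    qed
    ultimately show ?thesis by simp
  qed
  have derI: "(I has_real_derivative 0) (at T)" for T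
  proof -
    let ?K = "\<bar>T\<bar> + 1"
    have "((\<lambda>t. integral\<^sup>L sph_measure (F t)) has_real_derivative integral\<^sup>L sph_measure (F' T)) (at T)"
    proof (rule has_real_derivative_integral[where F=F and F'=F' and ?t0.0=T and a="-?K" and b="?K"
          and C="real n * (2 * cosh ?K) / exp (- ?K) ^ (n + 1)"])
      show "finite_measure (sph_measure :: 'a measure)" by (rule finite_measure_sph)
      fix t y assume t: "t \<in> {-?K<..<?K}" and "y \<in> space (sph_measure :: 'a measure)"
      then have y: "x \<bullet> y \<in> {-1..1}" using b by simp
      have W: "w t (x \<bullet> y) > 0" using wpos[OF y] .
      have dwt: "((\<lambda>t. w t (x \<bullet> y)) has_real_derivative sinh t - cosh t * (x \<bullet> y)) (at t)"
        unfolding w_def by (auto intro!: derivative_eq_intros)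
      have "((\<lambda>t. 1 / w t (x \<bullet> y) ^ n) has_real_derivative
          (0 * w t (x \<bullet> y) ^ n - 1 * (real n * (w t (x \<bullet> y) ^ (n - 1) * (sinh t - cosh t * (x \<bullet> y)))))
            / (w t (x \<bullet> y) ^ n * w t (x \<bullet> y) ^ n)) (at t)"
        using W by (intro DERIV_divide DERIV_const DERIV_power[OF dwt, THEN DERIV_cong]) auto
      moreover obtain k where k: "n = Suc k" using n by (cases n) auto
      ultimately show "((\<lambda>t. F t y) has_real_derivative F' t y) (at t)"
        unfolding F_def F'_def
        by (rule_tac DERIV_cong) (use W in \<open>auto simp: k field_simps\<close>)
      have lb: "exp (- ?K) \<le> w t (x \<bullet> y)"
        unfolding w_def by (rule cosh_sinh_lower[OF _ y]) (use t in auto)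
      have ch: "cosh t \<le> cosh ?K"
        using t cosh_real_nonneg_le_iff[of "\<bar>t\<bar>" ?K] by auto
      have "\<bar>cosh t * (x \<bullet> y)\<bar> \<le> cosh t * 1"
        unfolding abs_mult using y by (intro mult_mono) auto
      moreover have "\<bar>sinh t\<bar> \<le> cosh t"
        using sinh_less_cosh_real[of t] sinh_less_cosh_real[of "- t"] by (auto simp: abs_if)
      ultimately have num: "\<bar>sinh t - cosh t * (x \<bullet> y)\<bar> \<le> 2 * cosh ?K"
        using ch by linarith
      have "\<bar>F' t y\<bar> = real n * \<bar>sinh t - cosh t * (x \<bullet> y)\<bar> / w t (x \<bullet> y) ^ (n + 1)"
        using W by (simp add: F'_def abs_mult abs_divide)
      also have "\<dots> \<le> real n * (2 * cosh ?K) / exp (- ?K) ^ (n + 1)"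
        using num lb by (intro frac_le mult_left_mono power_mono) auto
      finally show "\<bar>F' t y\<bar> \<le> real n * (2 * cosh ?K) / exp (- ?K) ^ (n + 1)" .
    qed (use intF measurable_sph_continuous[OF F'm] in auto)
    then show ?thesis by (simp add: I_def[abs_def] F'0)
  qed
  have "I T = I 0"
    by (rule DERIV_isconst_all) (use derI in auto)
  also have "I 0 = measure (sph_measure :: 'a measure) (sphere 0 1)"
    by (simp add: I_def F_def[abs_def] w_def)
  finally show ?thesis by (simp add: I_def F_def[abs_def] w_def n_def)
qed

text \<open>A unit timelike vector (v0, v) has the form (cosh T, sinh T e) with a unit vector e, so
  this is the preceding mass identity in Lorentz-invariant form.\<close>

lemma integral_poisson_lorentz:
  fixes v :: "'a::euclidean_space"
  assumes v: "v0\<^sup>2 = 1 + v \<bullet> v" "v0 > 0" and dim: "DIM('a) \<ge> 3"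
  shows "(LINT x|sph_measure. 1 / (v0 - v \<bullet> x) ^ (DIM('a) - 1))
    = measure (sph_measure :: 'a measure) (sphere 0 1)"
proof (cases "v = 0")
  case True
  then have "v0\<^sup>2 = 1" using v by simp
  then have "v0 = 1" using v(2) by (simp add: power2_eq_1_iff)
  then show ?thesis using True by simp
next
  case False
  define e where "e = v /\<^sub>R norm v"
  define T where "T = arsinh (norm v)"
  have e: "e \<in> sphere 0 1" using False by (simp add: e_def)
  have s: "sinh T = norm v" by (simp add: T_def)
  have "cosh T ^ 2 = v0\<^sup>2" using v(1) by (simp add: cosh_square_eq s dot_square_norm)
  then have "cosh T = v0" using v(2) by (simp add: power2_eq_iff_nonneg)
  moreover have "v \<bullet> x = sinh T * (e \<bullet> x)" for x
    using False by (simp add: s e_def)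
  ultimately show ?thesis using integral_poisson_cosh[OF e dim, of T] by simp
qed

text \<open>The kernels are divided by their own mass, because the powers to which this is applied
  later come without a convenient formula for it. Concentration asks that a uniform bound off each
  cap be negligible against the total mass.\<close>

lemma sph_approx_identity:
  fixes x :: "'a::euclidean_space" and k :: "nat \<Rightarrow> real \<Rightarrow> real"
  assumes x: "x \<in> sphere 0 1" and h: "continuous_on (sphere 0 1) h"
    and int: "\<And>j. integrable sph_measure (\<lambda>y. k j (x \<bullet> y))"
    and nn: "\<And>j t. t \<in> {-1..1} \<Longrightarrow> 0 \<le> k j t"
    and pos: "\<And>j. (LINT y|sph_measure. k j (x \<bullet> y)) > 0"
    and conc: "\<And>c. c < 1 \<Longrightarrow> \<exists>M. (\<forall>j. \<forall>t\<in>{-1..c}. k j t \<le> M j) \<and>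
        (\<lambda>j. M j / (LINT y|sph_measure. k j (x \<bullet> y))) \<longlonglongrightarrow> 0"
  shows "(\<lambda>j. (LINT y|sph_measure. k j (x \<bullet> y) * h y) / (LINT y|sph_measure. k j (x \<bullet> y))) \<longlonglongrightarrow> h x"
proof -
  let ?m = "\<lambda>j. LINT y|sph_measure. k j (x \<bullet> y)"
  let ?\<sigma> = "measure (sph_measure :: 'a measure) (sphere 0 1)"
  obtain C where C: "C > 0" "\<And>y. y \<in> sphere 0 1 \<Longrightarrow> \<bar>h y\<bar> \<le> C"
    using bounded_on_sphere[OF h] by blast
  have hm [measurable]: "h \<in> borel_measurable sph_measure" by (rule measurable_sph_continuous[OF h])
  have b: "x \<bullet> y \<in> {-1..1}" if "y \<in> sphere 0 1" for y using sphere_inner_bounds[OF x that] .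
  have inth: "integrable sph_measure (\<lambda>y. k j (x \<bullet> y) * h y)" for j
  proof (rule Bochner_Integration.integrable_bound)
    show "integrable sph_measure (\<lambda>y. C * k j (x \<bullet> y))" using int by simp
    show "(\<lambda>y. k j (x \<bullet> y) * h y) \<in> borel_measurable sph_measure"
      using int[of j] by (intro borel_measurable_times hm) auto
    show "AE y in sph_measure. norm (k j (x \<bullet> y) * h y) \<le> norm (C * k j (x \<bullet> y))"
    proof (rule AE_I2)
      fix y :: 'a assume "y \<in> space sph_measure"
      then have y: "y \<in> sphere 0 1" by simp
      have "k j (x \<bullet> y) * \<bar>h y\<bar> \<le> k j (x \<bullet> y) * C"
        by (rule mult_left_mono[OF C(2)[OF y] nn[OF b[OF y]]])
      then show "norm (k j (x \<bullet> y) * h y) \<le> norm (C * k j (x \<bullet> y))"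
        using C(1) nn[OF b[OF y], of j] by (simp add: abs_mult mult.commute)
    qed
  qed
  have abs_div: "\<bar>a / m - c\<bar> = \<bar>a - c * m\<bar> / m" if "m > 0" for a c m :: real
  proof -
    have "a / m - c = (a - c * m) / m" using that by (simp add: field_simps)
    then show ?thesis using that by (simp add: abs_divide)
  qed
  show ?thesis
  proof (rule LIMSEQ_I)
    fix r :: real assume r: "r > 0"
    have "\<exists>d>0. \<forall>y\<in>sphere 0 1. dist y x < d \<longrightarrow> dist (h y) (h x) < r / 2"
      using h[unfolded continuous_on_iff, rule_format, OF x, of "r / 2"] r by auto
    then obtain d where d: "d > 0" "\<And>y. y \<in> sphere 0 1 \<Longrightarrow> dist y x < d \<Longrightarrow> \<bar>h y - h x\<bar> < r / 2"
      by (auto simp: dist_real_def)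
    \<comment> \<open>On the sphere the squared distance of x and y is 2 - 2 (x \<bullet> y), so the
      cap x \<bullet> y > c is the part of the sphere within distance d of x.\<close>
    define c where "c = 1 - d\<^sup>2 / 2"
    have c: "c < 1" using d by (simp add: c_def)
    have near: "\<bar>h y - h x\<bar> < r / 2" if y: "y \<in> sphere 0 1" "x \<bullet> y > c" for y
    proof (rule d(2)[OF y(1)])
      have "(dist y x)\<^sup>2 = 2 - 2 * (x \<bullet> y)"
        by (rule sphere_dist_square[OF x y(1)])
      also have "\<dots> < d\<^sup>2" using y(2) by (simp add: c_def)
      finally show "dist y x < d" using d(1) by (simp add: power2_less_imp_less)
    qed
    from conc[OF c] obtain M where M0: "(\<forall>j. \<forall>t\<in>{-1..c}. k j t \<le> M j) \<and> (\<lambda>j. M j / ?m j) \<longlonglongrightarrow> 0"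
      by (rule exE)
    then have M: "\<And>j t. t \<in> {-1..c} \<Longrightarrow> k j t \<le> M j" "(\<lambda>j. M j / ?m j) \<longlonglongrightarrow> 0"
      by simp_all
    have "(\<lambda>j. 2 * C * ?\<sigma> * (M j / ?m j)) \<longlonglongrightarrow> 2 * C * ?\<sigma> * 0"
      by (intro tendsto_intros M)
    then have "eventually (\<lambda>j. 2 * C * ?\<sigma> * (M j / ?m j) < r / 2) sequentially"
      using r by (intro order_tendstoD) auto
    then obtain N where N: "\<And>j. j \<ge> N \<Longrightarrow> 2 * C * ?\<sigma> * (M j / ?m j) < r / 2"
      by (auto simp: eventually_sequentially)
    have "norm ((LINT y|sph_measure. k j (x \<bullet> y) * h y) / ?m j - h x) < r" if j: "j \<ge> N" for j
    proof -
      have "\<bar>(LINT y|sph_measure. k j (x \<bullet> y) * h y) - h x * ?m j\<bar>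
          = \<bar>LINT y|sph_measure. k j (x \<bullet> y) * h y - h x * k j (x \<bullet> y)\<bar>"
        using int[of j] inth[of j] by simp
      also have "\<dots> \<le> (LINT y|sph_measure. \<bar>k j (x \<bullet> y) * h y - h x * k j (x \<bullet> y)\<bar>)"
        by (rule integral_abs_bound)
      also have "\<dots> \<le> (LINT y|sph_measure. r / 2 * k j (x \<bullet> y) + 2 * C * max 0 (M j))"
      proof (rule integral_mono)
        show "integrable sph_measure (\<lambda>y. \<bar>k j (x \<bullet> y) * h y - h x * k j (x \<bullet> y)\<bar>)"
          using int[of j] inth[of j] by auto
        show "integrable sph_measure (\<lambda>y. r / 2 * k j (x \<bullet> y) + 2 * C * max 0 (M j))"
          using int[of j] by auto
        fix y :: 'a assume "y \<in> space sph_measure"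
        then have y: "y \<in> sphere 0 1" by simp
        have k0: "k j (x \<bullet> y) \<ge> 0" using nn[OF b[OF y]] .
        have eq: "\<bar>k j (x \<bullet> y) * h y - h x * k j (x \<bullet> y)\<bar> = k j (x \<bullet> y) * \<bar>h y - h x\<bar>"
        proof -
          have "k j (x \<bullet> y) * h y - h x * k j (x \<bullet> y) = k j (x \<bullet> y) * (h y - h x)"
            by (simp add: algebra_simps)
          then show ?thesis using k0 by (simp add: abs_mult)
        qed
        show "\<bar>k j (x \<bullet> y) * h y - h x * k j (x \<bullet> y)\<bar> \<le> r / 2 * k j (x \<bullet> y) + 2 * C * max 0 (M j)"
        proof (cases "x \<bullet> y > c")
          case True
          have "k j (x \<bullet> y) * \<bar>h y - h x\<bar> \<le> k j (x \<bullet> y) * (r / 2)"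
            using near[OF y True] k0 by (intro mult_left_mono) auto
          moreover have "2 * C * max 0 (M j) \<ge> 0" using C by simp
          moreover have "k j (x \<bullet> y) * (r / 2) = r / 2 * k j (x \<bullet> y)" by simp
          ultimately show ?thesis unfolding eq by linarith
        next
          case False
          then have "k j (x \<bullet> y) \<le> max 0 (M j)" using M(1)[of "x \<bullet> y" j] b[OF y] by auto
          moreover have "\<bar>h y - h x\<bar> \<le> 2 * C" using C(2)[OF y] C(2)[OF x] by linarith
          ultimately have "k j (x \<bullet> y) * \<bar>h y - h x\<bar> \<le> max 0 (M j) * (2 * C)"
            using k0 by (intro mult_mono) auto
          moreover have "r / 2 * k j (x \<bullet> y) \<ge> 0" using k0 r by simp
          moreover have "max 0 (M j) * (2 * C) = 2 * C * max 0 (M j)" by simp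
          ultimately show ?thesis unfolding eq by linarith
        qed
      qed
      also have "\<dots> = r / 2 * ?m j + 2 * C * max 0 (M j) * ?\<sigma>"
        using int[of j] by simp
      finally have *: "\<bar>(LINT y|sph_measure. k j (x \<bullet> y) * h y) - h x * ?m j\<bar>
          \<le> r / 2 * ?m j + 2 * C * max 0 (M j) * ?\<sigma>" .
      have "norm ((LINT y|sph_measure. k j (x \<bullet> y) * h y) / ?m j - h x)
          = \<bar>(LINT y|sph_measure. k j (x \<bullet> y) * h y) - h x * ?m j\<bar> / ?m j"
        using abs_div[OF pos[of j]] by simp
      also have "\<dots> \<le> (r / 2 * ?m j + 2 * C * max 0 (M j) * ?\<sigma>) / ?m j"
        using pos[of j] * by (intro divide_right_mono) auto
      also have "\<dots> = r / 2 + 2 * C * ?\<sigma> * (max 0 (M j) / ?m j)"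
        using pos[of j] by (simp add: field_simps)
      also have "\<dots> < r"
      proof -
        have "2 * C * ?\<sigma> * (max 0 (M j) / ?m j) < r / 2"
          using N[OF j] r by (cases "M j \<ge> 0") auto
        then show ?thesis by simp
      qed
      finally show ?thesis .
    qed
    then show "\<exists>no. \<forall>j\<ge>no. norm ((LINT y|sph_measure. k j (x \<bullet> y) * h y) / ?m j - h x) < r"
      by blast
  qed
qed

section \<open>Reflections and conformal boosts\<close>

abbreviation sph_total :: "'a::euclidean_space itself \<Rightarrow> real" where
  "sph_total _ \<equiv> measure (sph_measure :: 'a measure) (sphere 0 1)"

lemma sph_total_pos: "sph_total TYPE('a::euclidean_space) > 0"
proof -
  obtain b :: 'a where "b \<in> Basis" using nonempty_Basis by blast
  then have b: "b \<in> sphere 0 1" by simp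
  have "{y \<in> sphere 0 1. b \<bullet> y > -2} = sphere 0 1"
    using sphere_inner_bounds[OF b] by fastforce
  then show ?thesis using measure_sph_cap_pos[OF b, of "-2"] by simp
qed

interpretation sph_pair: pair_sigma_finite "sph_measure :: 'a::euclidean_space measure" "sph_measure :: 'a measure"
  by (rule pair_sigma_finite.intro[OF sph.sigma_finite_measure_axioms sph.sigma_finite_measure_axioms])

text \<open>Closed subsets of the sphere form an intersection-stable generator, and their indicators
  are limits of the functions max(0, 1 - j dist(x, C)).\<close>

lemma sph_measure_eqI:
  fixes M :: "'a::euclidean_space measure"
  assumes fin: "finite_measure M" and sets: "sets M = sets sph_measure"
    and eq: "\<And>h::'a \<Rightarrow> real. continuous_on (sphere 0 1) h \<Longrightarrow> integral\<^sup>L M h = integral\<^sup>L sph_measure h"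
  shows "M = sph_measure"
proof (rule measure_eqI_generator_eq[where A="\<lambda>_. sphere 0 1"])
  let ?E = "{C. closed C \<and> C \<subseteq> sphere (0::'a) 1}"
  interpret finite_measure M by (rule fin)
  have "sets (sph_measure :: 'a measure) = (\<inter>) (sphere 0 1) ` sets borel"
    by (simp add: sets_sph_measure sets_restrict_space)
  also have "sets (borel :: 'a measure) = sigma_sets UNIV (Collect closed)"
    by (simp add: borel_eq_closed)
  also have "(\<inter>) (sphere 0 1) ` sigma_sets UNIV (Collect closed)
      = sigma_sets (sphere (0::'a) 1) ((\<inter>) (sphere 0 1) ` Collect closed)"
    by (rule sigma_sets_Int) auto
  also have "(\<inter>) (sphere (0::'a) 1) ` Collect closed = ?E"
  proof
    show "(\<inter>) (sphere (0::'a) 1) ` Collect closed \<subseteq> ?E" by (auto intro: closed_Int)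
    show "?E \<subseteq> (\<inter>) (sphere (0::'a) 1) ` Collect closed"
    proof
      fix C :: "'a set" assume C: "C \<in> ?E"
      then have "C = sphere 0 1 \<inter> C" by auto
      then show "C \<in> (\<inter>) (sphere 0 1) ` Collect closed" using C by blast
    qed
  qed
  finally show s: "sets (sph_measure :: 'a measure) = sigma_sets (sphere 0 1) ?E" .
  then show "sets M = sigma_sets (sphere 0 1) ?E" using sets by simp
  show "Int_stable ?E" by (auto simp: Int_stable_def)
  show "?E \<subseteq> Pow (sphere 0 1)" by auto
  show "range (\<lambda>_. sphere 0 1) \<subseteq> ?E" by auto
  show "(\<Union>i::nat. sphere (0::'a) 1) = sphere 0 1" by simp
  show "emeasure M (sphere 0 1) \<noteq> \<infinity>" by simp
  have spM: "space M = sphere 0 1" using sets_eq_imp_space_eq[OF sets] by simp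
  show "emeasure M C = emeasure sph_measure C" if C: "C \<in> ?E" for C
  proof (cases "C = {}")
    case False
    define h where "h j x = max 0 (1 - real j * infdist x C)" for j x
    have hc: "continuous_on (sphere 0 1) (h j)" for j
      unfolding h_def by (intro continuous_intros)
    have hm: "h j \<in> borel_measurable sph_measure" for j
      by (rule measurable_sph_continuous[OF hc])
    have hM: "h j \<in> borel_measurable M" for j
      using hm[of j] measurable_cong_sets[OF sets refl] by blast
    have Cs: "C \<in> sets sph_measure" using C unfolding s by (rule sigma_sets.Basic)
    have CM: "C \<in> sets M" using Cs sets by simp
    have lim: "(\<lambda>j. h j x) \<longlonglongrightarrow> indicator C x" for x
    proof (cases "x \<in> C")
      case True
      then show ?thesis by (simp add: h_def)
    next
      case x: False
      have d: "infdist x C > 0" using C False x by (intro infdist_pos_not_in_closed) auto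
      obtain N where N: "1 < real N * infdist x C" using reals_Archimedean3[OF d] by blast
      have "eventually (\<lambda>j. h j x = indicator C x) sequentially"
        unfolding eventually_sequentially
      proof (intro exI allI impI)
        fix j assume "N \<le> j"
        then have "real N * infdist x C \<le> real j * infdist x C" using d by simp
        then show "h j x = indicator C x" using N x by (simp add: h_def)
      qed
      then show ?thesis by (rule tendsto_eventually)
    qed
    have bd: "norm (h j x) \<le> 1" for j x by (simp add: h_def infdist_nonneg)
    have "(\<lambda>j. integral\<^sup>L M (h j)) \<longlonglongrightarrow> integral\<^sup>L M (indicator C)"
      by (rule integral_dominated_convergence[where w="\<lambda>_. 1"])
         (use CM hM lim bd in auto)
    moreover have "(\<lambda>j. integral\<^sup>L sph_measure (h j)) \<longlonglongrightarrow> integral\<^sup>L sph_measure (indicator C)"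
      by (rule integral_dominated_convergence[where w="\<lambda>_. 1"])
         (use Cs hm lim bd in auto)
    ultimately have "integral\<^sup>L M (indicator C) = (integral\<^sup>L sph_measure (indicator C) :: real)"
      unfolding eq[OF hc] by (rule LIMSEQ_unique)
    moreover have "C \<subseteq> sphere 0 1" using C by simp
    ultimately have "measure M C = measure sph_measure C"
      using CM Cs spM by (simp add: Int_absorb2)
    then show ?thesis
      by (simp add: emeasure_eq_measure sph.emeasure_eq_measure)
  qed simp
qed

text \<open>The Poisson-type kernels below form an approximate identity, so a map that preserves
  their total mass preserves the integral of every continuous function.\<close>

lemma conformal_change_of_variables:
  fixes \<psi> :: "'a::euclidean_space \<Rightarrow> 'a"
  assumes dim: "DIM('a) \<ge> 3"
    and c\<psi>: "continuous_on (sphere 0 1) \<psi>" and m\<psi>: "\<And>x. x \<in> sphere 0 1 \<Longrightarrow> \<psi> x \<in> sphere 0 1"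
    and c\<rho>: "continuous_on (sphere 0 1) \<rho>" and \<rho>0: "\<And>x. x \<in> sphere 0 1 \<Longrightarrow> \<rho> x \<ge> 0"
    and key: "\<And>T y. y \<in> sphere 0 1 \<Longrightarrow> (LINT x|sph_measure.
        1 / (cosh T - sinh T * (\<psi> x \<bullet> y)) ^ (DIM('a) - 1) * \<rho> x ^ (DIM('a) - 1)) = sph_total TYPE('a)"
  shows "distr (density sph_measure (\<lambda>x. ennreal (\<rho> x ^ (DIM('a) - 1)))) sph_measure \<psi> = sph_measure"
proof (rule sph_measure_eqI)
  define n where "n = DIM('a) - 1"
  have n: "n > 0" using dim by (simp add: n_def)
  let ?t = "sph_total TYPE('a)"
  let ?D = "density sph_measure (\<lambda>x. ennreal (\<rho> x ^ (DIM('a) - 1)))"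
  have \<psi>m [measurable]: "\<psi> \<in> borel_measurable sph_measure" by (rule measurable_sph_continuous[OF c\<psi>])
  have \<psi>s: "\<psi> \<in> sph_measure \<rightarrow>\<^sub>M sph_measure"
    unfolding measurable_cong_sets[OF refl sets_sph_measure]
    by (rule measurable_restrict_space2) (use m\<psi> in auto)
  have \<rho>m [measurable]: "\<rho> \<in> borel_measurable sph_measure" by (rule measurable_sph_continuous[OF c\<rho>])
  have \<psi>D: "\<psi> \<in> ?D \<rightarrow>\<^sub>M sph_measure" using \<psi>s by simp
  have \<rho>n: "continuous_on (sphere 0 1) (\<lambda>x. \<rho> x ^ n)" by (intro continuous_intros c\<rho>)
  show "finite_measure (distr ?D sph_measure \<psi>)"
  proof (rule finite_measure.finite_measure_distr[OF _ \<psi>D], rule finite_measureI)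
    have "(\<lambda>x. ennreal (\<rho> x ^ (DIM('a) - 1))) \<in> borel_measurable sph_measure" by measurable
    then have "emeasure ?D (space sph_measure)
        = (\<integral>\<^sup>+x. ennreal (\<rho> x ^ (DIM('a) - 1)) * indicator (space sph_measure) x \<partial>sph_measure)"
      by (rule emeasure_density) (rule sets.top)
    also have "\<dots> = (\<integral>\<^sup>+x. ennreal (\<rho> x ^ n) \<partial>sph_measure)"
      unfolding n_def by (rule nn_integral_cong) simp
    also have "\<dots> = ennreal (LINT x|sph_measure. \<rho> x ^ n)"
      using integrable_sph_continuous[OF \<rho>n] \<rho>0 by (intro nn_integral_eq_integral) auto
    finally show "emeasure ?D (space ?D) \<noteq> \<infinity>" unfolding space_density by simp
  qed
  show "sets (distr ?D sph_measure \<psi>) = sets sph_measure" by simp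
  fix h :: "'a \<Rightarrow> real" assume h: "continuous_on (sphere 0 1) h"
  have hm [measurable]: "h \<in> borel_measurable sph_measure" by (rule measurable_sph_continuous[OF h])
  obtain C where C: "C > 0" "\<And>x. x \<in> sphere 0 1 \<Longrightarrow> \<bar>h x\<bar> \<le> C"
    using bounded_on_sphere[OF h] by blast
  \<comment> \<open>The kernel with parameter T = j + 1; for T to infinity its mass stays fixed and
    gathers at t = 1.\<close>
  define w where "w j t = cosh (real (Suc j)) - sinh (real (Suc j)) * t" for j t
  define P where "P j t = 1 / w j t ^ n" for j t
  have w1: "w j t \<ge> exp (- real (Suc j))" if "t \<in> {-1..1}" for j t
    unfolding w_def by (rule cosh_sinh_lower) (use that in auto)
  have wpos: "w j t > 0" if "t \<in> {-1..1}" for j t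
    using w1[OF that, of j] exp_gt_zero[of "- real (Suc j)"] by linarith
  have P0: "P j t \<ge> 0" if "t \<in> {-1..1}" for j t
    using wpos[OF that, of j] by (simp add: P_def)
  have Pb: "P j t \<le> 1 / exp (- real (Suc j)) ^ n" if "t \<in> {-1..1}" for j t
    unfolding P_def using w1[OF that, of j] by (intro frac_le power_mono) auto
  have Pm [measurable]: "P j \<in> borel_measurable borel" for j
    unfolding P_def w_def by measurable
  have Pint: "integrable sph_measure (\<lambda>y. P j (x \<bullet> y))" if x: "x \<in> sphere 0 1" for x :: 'a and j
  proof (rule integrable_sph_bounded)
    show "(\<lambda>y. P j (x \<bullet> y)) \<in> borel_measurable sph_measure" by measurable
    fix y :: 'a assume "y \<in> sphere 0 1"
    then have "x \<bullet> y \<in> {-1..1}" by (rule sphere_inner_bounds[OF x])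
    then show "\<bar>P j (x \<bullet> y)\<bar> \<le> 1 / exp (- real (Suc j)) ^ n" using P0 Pb by simp
  qed
  have mass: "(LINT y|sph_measure. P j (x \<bullet> y)) = ?t" if x: "x \<in> sphere 0 1" for x :: 'a and j
    unfolding P_def w_def n_def by (rule integral_poisson_cosh[OF x dim])
  define H where "H j x = (LINT y|sph_measure. P j (x \<bullet> y) * h y)" for j x
  have lim: "(\<lambda>j. H j x / ?t) \<longlonglongrightarrow> h x" if x: "x \<in> sphere 0 1" for x
  proof -
    have "(\<lambda>j. (LINT y|sph_measure. P j (x \<bullet> y) * h y) / (LINT y|sph_measure. P j (x \<bullet> y))) \<longlonglongrightarrow> h x"
    proof (rule sph_approx_identity[OF x h Pint[OF x] P0])
      show "(LINT y|sph_measure. P j (x \<bullet> y)) > 0" for j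
        using mass[OF x] sph_total_pos by simp
      fix c :: real assume c: "c < 1"
      \<comment> \<open>From cosh T > sinh T one gets w \<ge> sinh T (1 - c) for t \<le> c, and
        \<open>M\<close> is the resulting bound on the kernel.\<close>
      define M where "M j = (1 / (1 - c)) ^ n * inverse (sinh (real (Suc j))) ^ n" for j
      have "P j t \<le> M j" if t: "t \<in> {-1..c}" for j t
      proof -
        have s: "sinh (real (Suc j)) > 0" by simp
        have "sinh (real (Suc j)) * t \<le> sinh (real (Suc j)) * c"
          by (rule mult_left_mono) (use t less_imp_le[OF s] in auto)
        moreover have "sinh (real (Suc j)) < cosh (real (Suc j))" by (rule sinh_less_cosh_real)
        ultimately have "w j t \<ge> sinh (real (Suc j)) * (1 - c)"
          unfolding w_def right_diff_distrib mult_1_right by linarith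
        then have "P j t \<le> 1 / (sinh (real (Suc j)) * (1 - c)) ^ n"
          unfolding P_def using s c by (intro frac_le power_mono) auto
        also have "\<dots> = M j"
          using s c by (simp only: M_def power_mult_distrib power_one_over power_inverse) (simp add: field_simps)
        finally show ?thesis .
      qed
      moreover have "(\<lambda>j. M j / (LINT y|sph_measure. P j (x \<bullet> y))) \<longlonglongrightarrow> 0"
      proof -
        have "filterlim (\<lambda>j. real (Suc j)) at_top sequentially"
          by (rule filterlim_compose[OF filterlim_real_sequentially filterlim_Suc])
        from filterlim_compose[OF sinh_real_at_top this]
        have "filterlim (\<lambda>j. sinh (real (Suc j))) at_top sequentially" .
        from tendsto_inverse_0_at_top[OF this]
        have "(\<lambda>j. inverse (sinh (real (Suc j)))) \<longlonglongrightarrow> 0" .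
        then have "(\<lambda>j. inverse (sinh (real (Suc j))) ^ n) \<longlonglongrightarrow> 0"
          using n by (rule tendsto_null_power)
        from tendsto_mult_left[OF this, of "(1 / (1 - c)) ^ n / ?t"]
        show ?thesis unfolding mass[OF x] M_def by simp
      qed
      ultimately show "\<exists>M. (\<forall>j. \<forall>t\<in>{-1..c}. P j t \<le> M j) \<and>
          (\<lambda>j. M j / (LINT y|sph_measure. P j (x \<bullet> y))) \<longlonglongrightarrow> 0"
        by blast
    qed
    then show ?thesis using mass[OF x] by (simp add: H_def)
  qed
  have Hb: "\<bar>H j x / ?t\<bar> \<le> C" if x: "x \<in> sphere 0 1" for j x
  proof -
    have "\<bar>H j x\<bar> \<le> (LINT y|sph_measure. \<bar>P j (x \<bullet> y) * h y\<bar>)"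
      unfolding H_def by (rule integral_abs_bound)
    also have "\<dots> \<le> (LINT y|sph_measure. C * P j (x \<bullet> y))"
    proof (rule integral_mono')
      show "integrable sph_measure (\<lambda>y. C * P j (x \<bullet> y))" using Pint[OF x] by simp
      fix y :: 'a assume "y \<in> space sph_measure"
      then have y: "y \<in> sphere 0 1" by simp
      have p: "P j (x \<bullet> y) \<ge> 0" by (rule P0[OF sphere_inner_bounds[OF x y]])
      show "\<bar>P j (x \<bullet> y) * h y\<bar> \<le> C * P j (x \<bullet> y)"
        using mult_left_mono[OF C(2)[OF y] p] p by (simp add: abs_mult mult.commute)
      show "0 \<le> C * P j (x \<bullet> y)" using C(1) p by simp
    qed
    also have "\<dots> = C * ?t" using mass[OF x] by simp
    finally show ?thesis using sph_total_pos[where 'a='a] by (simp add: field_simps)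
  qed
  have Hm [measurable]: "(\<lambda>x. H j (\<psi> x)) \<in> borel_measurable sph_measure" for j
    unfolding H_def by measurable
  have "(\<lambda>j. LINT x|sph_measure. H j (\<psi> x) / ?t * \<rho> x ^ n) \<longlonglongrightarrow> (LINT x|sph_measure. h (\<psi> x) * \<rho> x ^ n)"
  proof (rule integral_dominated_convergence[where w="\<lambda>x. C * \<rho> x ^ n"])
    show "(\<lambda>x. h (\<psi> x) * \<rho> x ^ n) \<in> borel_measurable sph_measure"
      using measurable_compose[OF \<psi>s hm] by measurable
    show "integrable sph_measure (\<lambda>x. C * \<rho> x ^ n)"
      using integrable_sph_continuous[OF \<rho>n] by simp
    show "AE x in sph_measure. (\<lambda>j. H j (\<psi> x) / ?t * \<rho> x ^ n) \<longlonglongrightarrow> h (\<psi> x) * \<rho> x ^ n"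
      by (intro AE_I2 tendsto_mult_right lim m\<psi>) simp
    show "AE x in sph_measure. norm (H j (\<psi> x) / ?t * \<rho> x ^ n) \<le> C * \<rho> x ^ n" for j
    proof (rule AE_I2)
      fix x :: 'a assume "x \<in> space sph_measure"
      then have x: "x \<in> sphere 0 1" by simp
      show "norm (H j (\<psi> x) / ?t * \<rho> x ^ n) \<le> C * \<rho> x ^ n"
        unfolding real_norm_def abs_mult using Hb[OF m\<psi>[OF x]] \<rho>0[OF x] C(1)
        by (intro mult_mono) auto
    qed
  qed measurable
  \<comment> \<open>By Fubini the integration over x is carried out first; there \<open>key\<close>
    evaluates the pulled-back kernel to the total mass for every y.\<close>
  moreover have "(LINT x|sph_measure. H j (\<psi> x) / ?t * \<rho> x ^ n) = integral\<^sup>L sph_measure h" for j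
  proof -
    obtain R where R: "R > 0" "\<And>x. x \<in> sphere 0 1 \<Longrightarrow> \<bar>\<rho> x ^ n\<bar> \<le> R"
      using bounded_on_sphere[OF \<rho>n] by blast
    define f where "f x y = P j (\<psi> x \<bullet> y) * h y * \<rho> x ^ n" for x y
    interpret pf: finite_measure "(sph_measure :: 'a measure) \<Otimes>\<^sub>M (sph_measure :: 'a measure)"
      by (rule finite_measure_pair_measure[OF finite_measure_sph finite_measure_sph])
    have "integrable (sph_measure \<Otimes>\<^sub>M sph_measure) (\<lambda>(x, y). f x y)"
    proof (rule pf.integrable_const_bound[where B="1 / exp (- real (Suc j)) ^ n * C * R"])
      show "(\<lambda>(x, y). f x y) \<in> borel_measurable (sph_measure \<Otimes>\<^sub>M sph_measure)"
        unfolding f_def by measurable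
      show "AE z in sph_measure \<Otimes>\<^sub>M sph_measure. norm (case z of (x, y) \<Rightarrow> f x y)
          \<le> 1 / exp (- real (Suc j)) ^ n * C * R"
      proof (rule AE_I2)
        fix z :: "'a \<times> 'a" assume "z \<in> space (sph_measure \<Otimes>\<^sub>M sph_measure)"
        then obtain x y where z: "z = (x, y)" and x: "x \<in> sphere 0 1" and y: "y \<in> sphere 0 1"
          by (auto simp: space_pair_measure)
        have b: "\<psi> x \<bullet> y \<in> {-1..1}" by (rule sphere_inner_bounds[OF m\<psi>[OF x] y])
        have "\<bar>P j (\<psi> x \<bullet> y)\<bar> * \<bar>h y\<bar> * \<bar>\<rho> x ^ n\<bar> \<le> 1 / exp (- real (Suc j)) ^ n * C * R"
          using P0[OF b, of j] Pb[OF b, of j] C R x y by (intro mult_mono) auto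
        then show "norm (case z of (x, y) \<Rightarrow> f x y) \<le> 1 / exp (- real (Suc j)) ^ n * C * R"
          by (simp add: z f_def abs_mult)
      qed
    qed
    then have "(LINT y|sph_measure. LINT x|sph_measure. f x y) = (LINT x|sph_measure. LINT y|sph_measure. f x y)"
      by (rule sph_pair.Fubini_integral)
    moreover have "(LINT x|sph_measure. f x y) = h y * ?t" if y: "y \<in> sphere 0 1" for y
    proof -
      have "(LINT x|sph_measure. f x y) = (LINT x|sph_measure. h y * (P j (\<psi> x \<bullet> y) * \<rho> x ^ n))"
        by (simp add: f_def mult_ac)
      also have "\<dots> = h y * (LINT x|sph_measure. P j (\<psi> x \<bullet> y) * \<rho> x ^ n)"
        by (rule integral_mult_right_zero)
      also have "(LINT x|sph_measure. P j (\<psi> x \<bullet> y) * \<rho> x ^ n) = ?t"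
        unfolding P_def w_def n_def by (rule key[OF y])
      finally show ?thesis .
    qed
    then have "(LINT y|sph_measure. LINT x|sph_measure. f x y) = (LINT y|sph_measure. h y * ?t)"
      by (intro Bochner_Integration.integral_cong refl) simp
    moreover have "(LINT y|sph_measure. f x y) = H j (\<psi> x) * \<rho> x ^ n" for x
      unfolding f_def H_def by (rule integral_mult_left_zero)
    ultimately have "(LINT x|sph_measure. H j (\<psi> x) * \<rho> x ^ n) = integral\<^sup>L sph_measure h * ?t"
      by simp
    moreover have "(LINT x|sph_measure. H j (\<psi> x) / ?t * \<rho> x ^ n)
        = 1 / ?t * (LINT x|sph_measure. H j (\<psi> x) * \<rho> x ^ n)"
      unfolding integral_mult_right_zero[symmetric]
      by (rule Bochner_Integration.integral_cong) auto
    ultimately show ?thesis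
      using sph_total_pos[where 'a='a] by simp
  qed
  ultimately have eq: "(LINT x|sph_measure. h (\<psi> x) * \<rho> x ^ n) = integral\<^sup>L sph_measure h"
    by (simp add: LIMSEQ_const_iff)
  have "integral\<^sup>L (distr ?D sph_measure \<psi>) h = integral\<^sup>L ?D (\<lambda>x. h (\<psi> x))"
    by (rule integral_distr[OF \<psi>D hm])
  also have "\<dots> = (LINT x|sph_measure. \<rho> x ^ (DIM('a) - 1) *\<^sub>R h (\<psi> x))"
    by (rule integral_density) (use measurable_compose[OF \<psi>s hm] \<rho>0 in auto)
  also have "\<dots> = (LINT x|sph_measure. h (\<psi> x) * \<rho> x ^ n)"
    by (simp add: n_def mult.commute)
  finally show "integral\<^sup>L (distr ?D sph_measure \<psi>) h = integral\<^sup>L sph_measure h" using eq by simp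
qed

section \<open>Reflections in hyperplanes through the origin\<close>

definition sph_refl :: "'a::euclidean_space \<Rightarrow> 'a \<Rightarrow> 'a" where
  "sph_refl e x = x - (2 * (x \<bullet> e)) *\<^sub>R e"

lemma sph_refl_inner_swap: "sph_refl e x \<bullet> y = x \<bullet> sph_refl e y"
  by (simp add: sph_refl_def inner_diff_left inner_diff_right inner_commute)

context
  fixes e :: "'a::euclidean_space"
  assumes e: "e \<in> sphere 0 1"
begin

lemma sph_refl_refl [simp]: "sph_refl e (sph_refl e x) = x"
proof -
  have "e \<bullet> e = 1" using e by (simp add: dot_square_norm)
  then show ?thesis by (simp add: sph_refl_def inner_diff_left algebra_simps)
qed

lemma sph_refl_inner_axis: "sph_refl e x \<bullet> e = - (x \<bullet> e)"
proof -
  have "e \<bullet> e = 1" using e by (simp add: dot_square_norm)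
  then show ?thesis by (simp add: sph_refl_def inner_diff_left)
qed

lemma sph_refl_inner: "sph_refl e x \<bullet> sph_refl e y = x \<bullet> y"
  by (simp add: sph_refl_inner_swap)

lemma sph_refl_sphere: "x \<in> sphere 0 1 \<Longrightarrow> sph_refl e x \<in> sphere 0 1"
  using sph_refl_inner[of x x] by (simp add: norm_eq_sqrt_inner)

lemma continuous_on_sph_refl: "continuous_on A (sph_refl e)"
  unfolding sph_refl_def by (intro continuous_intros)

text \<open>The reflection is treated as a conformal map with factor 1. By its symmetry it can be
  moved onto the centre y of the kernel, and the kernel mass is the same for all centres.\<close>

lemma distr_sph_refl:
  assumes dim: "DIM('a) \<ge> 3"
  shows "distr sph_measure sph_measure (sph_refl e) = sph_measure"
proof -
  have "distr (density sph_measure (\<lambda>x. ennreal ((\<lambda>_. 1) x ^ (DIM('a) - 1)))) sph_measure (sph_refl e)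
      = sph_measure"
  proof (rule conformal_change_of_variables[OF dim continuous_on_sph_refl sph_refl_sphere])
    fix T :: real and y :: 'a assume y: "y \<in> sphere 0 1"
    have "sph_refl e x \<bullet> y = sph_refl e y \<bullet> x" for x
      using sph_refl_inner_swap[of e x y] by (simp only: inner_commute)
    then show "(LINT x|sph_measure. 1 / (cosh T - sinh T * (sph_refl e x \<bullet> y)) ^ (DIM('a) - 1)
        * 1 ^ (DIM('a) - 1)) = sph_total TYPE('a)"
      using integral_poisson_cosh[OF sph_refl_sphere[OF y] dim, of T]
      by (simp only: power_one mult_1_right)
  qed auto
  then show ?thesis by (simp add: density_1)
qed

lemma measurable_sph_refl: "sph_refl e \<in> sph_measure \<rightarrow>\<^sub>M sph_measure"
  unfolding measurable_cong_sets[OF refl sets_sph_measure]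
  by (rule measurable_restrict_space2)
     (use sph_refl_sphere measurable_sph_continuous[OF continuous_on_sph_refl] in auto)

lemma integral_sph_refl:
  fixes f :: "'a \<Rightarrow> real"
  assumes dim: "DIM('a) \<ge> 3" and f: "f \<in> borel_measurable sph_measure"
  shows "(LINT x|sph_measure. f (sph_refl e x)) = integral\<^sup>L sph_measure f"
  using integral_distr[OF measurable_sph_refl f] distr_sph_refl[OF dim] by simp

end

text \<open>The mirror is the bisecting hyperplane. Hence reflections act transitively on the
  sphere, which gives independence of the centre for zonal integrals and lets an inequality valid
  for all axes compare arbitrary pairs of points.\<close>

lemma sph_refl_swap:
  fixes x y :: "'a::euclidean_space"
  assumes "x \<in> sphere 0 1" "y \<in> sphere 0 1" "x \<noteq> y"
  defines "e \<equiv> (x - y) /\<^sub>R norm (x - y)"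
  shows "e \<in> sphere 0 1" "sph_refl e x = y" "x \<bullet> e > 0"
proof -
  have nz: "norm (x - y) > 0" using assms by simp
  show "e \<in> sphere 0 1" using nz by (simp add: e_def)
  have xx: "x \<bullet> x = 1" "y \<bullet> y = 1" using assms by (simp_all add: dot_square_norm)
  have n2: "(norm (x - y))\<^sup>2 = 2 * (1 - x \<bullet> y)"
    using xx by (simp add: power2_norm_eq_inner inner_diff_left inner_diff_right inner_commute)
  have xe: "x \<bullet> e = (1 - x \<bullet> y) / norm (x - y)"
    using xx by (simp add: e_def inner_diff_right divide_inverse mult.commute)
  also have "\<dots> = norm (x - y) / 2"
    using n2 nz by (simp add: field_simps power2_eq_square)
  finally have xe: "x \<bullet> e = norm (x - y) / 2" .
  then show "x \<bullet> e > 0" using nz by linarith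
  show "sph_refl e x = y"
    unfolding sph_refl_def xe using nz by (simp add: e_def)
qed

section \<open>Conformal boosts\<close>

definition boost_factor :: "real \<Rightarrow> 'a::euclidean_space \<Rightarrow> 'a \<Rightarrow> real" where
  "boost_factor l e x = sqrt (1 - l\<^sup>2) / (1 + l * (x \<bullet> e))"

text \<open>The Lorentz boost of velocity l along e, applied to the light-like vector (1, x) and
  rescaled to time component 1. As l tends to 1 it pushes every point other than -e towards e.
  \<open>boost_factor\<close> is its conformal factor, with the n-th power as Jacobian.\<close>

definition boost :: "real \<Rightarrow> 'a::euclidean_space \<Rightarrow> 'a \<Rightarrow> 'a" where
  "boost l e x = (1 / (1 + l * (x \<bullet> e))) *\<^sub>R
     (sqrt (1 - l\<^sup>2) *\<^sub>R (x - (x \<bullet> e) *\<^sub>R e) + (x \<bullet> e + l) *\<^sub>R e)"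

lemma boost_0 [simp]: "boost 0 e x = x" "boost_factor 0 e x = 1"
  by (simp_all add: boost_def boost_factor_def)

lemma boost_denom_pos:
  fixes x e :: "'a::euclidean_space"
  assumes "e \<in> sphere 0 1" "\<bar>l\<bar> < 1" "x \<in> sphere 0 1"
  shows "1 + l * (x \<bullet> e) > 0"
proof -
  have "\<bar>l * (x \<bullet> e)\<bar> \<le> \<bar>l\<bar> * 1"
    unfolding abs_mult using sphere_inner_bounds[OF assms(3,1)] by (intro mult_left_mono) auto
  then show ?thesis using assms(2) by linarith
qed

context
  fixes e :: "'a::euclidean_space" and l :: real
  assumes e: "e \<in> sphere 0 1" and l: "\<bar>l\<bar> < 1"
begin

lemma boost_sqrt_pos: "sqrt (1 - l\<^sup>2) > 0" "(sqrt (1 - l\<^sup>2))\<^sup>2 = 1 - l\<^sup>2"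
proof -
  have "l\<^sup>2 < 1" using l by (simp add: abs_square_less_1)
  then show "sqrt (1 - l\<^sup>2) > 0" "(sqrt (1 - l\<^sup>2))\<^sup>2 = 1 - l\<^sup>2" by simp_all
qed

lemma boost_factor_pos: "x \<in> sphere 0 1 \<Longrightarrow> boost_factor l e x > 0"
  unfolding boost_factor_def using boost_sqrt_pos(1) boost_denom_pos[OF e l] by simp

text \<open>The Minkowski product of (1, x) and (1, y) is 1 - x \<bullet> y up to sign and is
  preserved by the linear boost; the two factors come from rescaling to time component 1. The case x
  = y shows that the sphere is preserved.\<close>

lemma boost_inner:
  assumes x: "x \<in> sphere 0 1" and y: "y \<in> sphere 0 1"
  shows "1 - boost l e x \<bullet> boost l e y = boost_factor l e x * boost_factor l e y * (1 - x \<bullet> y)"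
proof -
  let ?s = "sqrt (1 - l\<^sup>2)" and ?a = "1 + l * (x \<bullet> e)" and ?b = "1 + l * (y \<bullet> e)"
  let ?u = "x \<bullet> e" and ?v = "y \<bullet> e"
  have ee: "e \<bullet> e = 1" using e by (simp add: dot_square_norm)
  have a: "?a > 0" and b: "?b > 0" using boost_denom_pos[OF e l] x y by auto
  have "(?s *\<^sub>R (x - ?u *\<^sub>R e) + (?u + l) *\<^sub>R e) \<bullet> (?s *\<^sub>R (y - ?v *\<^sub>R e) + (?v + l) *\<^sub>R e)
      = ?s\<^sup>2 * (x \<bullet> y - ?u * ?v) + (?u + l) * (?v + l)"
    using ee by (simp add: inner_add_left inner_add_right inner_diff_left inner_diff_right
        inner_commute[of e x] inner_commute[of e y] power2_eq_square algebra_simps)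
  also have "\<dots> = ?a * ?b - ?s\<^sup>2 * (1 - x \<bullet> y)"
    unfolding boost_sqrt_pos(2) by (simp add: power2_eq_square algebra_simps)
  finally have *: "(?s *\<^sub>R (x - ?u *\<^sub>R e) + (?u + l) *\<^sub>R e) \<bullet> (?s *\<^sub>R (y - ?v *\<^sub>R e) + (?v + l) *\<^sub>R e)
      = ?a * ?b - ?s\<^sup>2 * (1 - x \<bullet> y)" .
  have "boost l e x \<bullet> boost l e y = (1 / ?a) * ((1 / ?b) * (?a * ?b - ?s\<^sup>2 * (1 - x \<bullet> y)))"
    unfolding boost_def inner_scaleR_left inner_scaleR_right * by (rule refl mult.left_commute)
  also have "\<dots> = 1 - (?s / ?a) * (?s / ?b) * (1 - x \<bullet> y)"
  proof -
    have "(1 / a) * ((1 / b) * (a * b - s\<^sup>2 * d)) = 1 - (s / a) * (s / b) * d"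
      if "a > 0" "b > 0" for a b s d :: real
      using that by (simp add: field_simps power2_eq_square)
    from this[OF a b] show ?thesis .
  qed
  finally show ?thesis by (simp add: boost_factor_def)
qed

lemma boost_sphere: "x \<in> sphere 0 1 \<Longrightarrow> boost l e x \<in> sphere 0 1"
  using boost_inner[of x x] by (simp add: norm_eq_sqrt_inner)

lemma continuous_on_boost: "continuous_on (sphere 0 1) (boost l e)"
  and continuous_on_boost_factor: "continuous_on (sphere 0 1) (boost_factor l e)"
proof -
  have nz: "1 + l * (x \<bullet> e) \<noteq> 0" if "x \<in> sphere 0 1" for x
    using boost_denom_pos[OF e l that] by simp
  show "continuous_on (sphere 0 1) (boost l e)"
    unfolding boost_def by (intro continuous_intros) (use nz in auto)
  show "continuous_on (sphere 0 1) (boost_factor l e)"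
    unfolding boost_factor_def by (intro continuous_intros) (use nz in auto)
qed

text \<open>Boosts are the restrictions of Lorentz transformations to light rays, so they permute
  the kernels whose mass was computed in the lemma on Lorentz vectors.\<close>

lemma distr_boost:
  assumes dim: "DIM('a) \<ge> 3"
  shows "distr (density sph_measure (\<lambda>x. ennreal (boost_factor l e x ^ (DIM('a) - 1)))) sph_measure (boost l e)
    = sph_measure"
proof (rule conformal_change_of_variables[OF dim continuous_on_boost boost_sphere continuous_on_boost_factor])
  show "x \<in> sphere 0 1 \<Longrightarrow> 0 \<le> boost_factor l e x" for x
    using boost_factor_pos[of x] by simp
  fix T :: real and y :: 'a assume y: "y \<in> sphere 0 1"
  let ?s = "sqrt (1 - l\<^sup>2)" and ?h = "y \<bullet> e" and ?c = "cosh T" and ?b = "sinh T"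
  \<comment> \<open>(v0, v) is the Lorentz vector (cosh T, sinh T y) transformed by the inverse
    boost: only the time component and the component along e change, and \<open>k\<close> is the
    change of the latter.\<close>
  define k where "k = (?b * ?h - ?c * l) / ?s - ?b * ?h"
  define v0 where "v0 = (?c - ?b * l * ?h) / ?s"
  define v where "v = ?b *\<^sub>R y + k *\<^sub>R e"
  have ee: "e \<bullet> e = 1" and yy: "y \<bullet> y = 1" using e y by (simp_all add: dot_square_norm)
  have s: "?s > 0" "?s\<^sup>2 = 1 - l\<^sup>2" by (rule boost_sqrt_pos)+
  have cb: "?c\<^sup>2 = 1 + ?b\<^sup>2" by (simp add: cosh_square_eq)
  have "v \<bullet> v = ?b\<^sup>2 * (1 - ?h\<^sup>2) + (?b * ?h + k)\<^sup>2"
    using ee yy by (simp add: v_def inner_add_left inner_add_right inner_commute[of e y]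
        power2_eq_square algebra_simps)
  also have "?b * ?h + k = (?b * ?h - ?c * l) / ?s" by (simp add: k_def)
  finally have vv: "v \<bullet> v = ?b\<^sup>2 * (1 - ?h\<^sup>2) + (?b * ?h - ?c * l)\<^sup>2 / (1 - l\<^sup>2)"
    by (simp add: power_divide s(2))
  have l2: "1 - l\<^sup>2 > 0" using l by (simp add: abs_square_less_1)
  have "v0\<^sup>2 = (?c - ?b * l * ?h)\<^sup>2 / (1 - l\<^sup>2)" by (simp add: v0_def power_divide s(2))
  also have "(?c - ?b * l * ?h)\<^sup>2 = (1 - l\<^sup>2) * (1 + ?b\<^sup>2 * (1 - ?h\<^sup>2)) + (?b * ?h - ?c * l)\<^sup>2"
  proof -
    have "(?c - ?b * l * ?h)\<^sup>2 - (?b * ?h - ?c * l)\<^sup>2 = (?c\<^sup>2 - ?b\<^sup>2 * ?h\<^sup>2) * (1 - l\<^sup>2)"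
      by (simp add: power2_eq_square algebra_simps)
    also have "?c\<^sup>2 - ?b\<^sup>2 * ?h\<^sup>2 = 1 + ?b\<^sup>2 * (1 - ?h\<^sup>2)" using cb by (simp add: algebra_simps)
    finally show ?thesis by (simp add: algebra_simps)
  qed
  also have "\<dots> / (1 - l\<^sup>2) = 1 + v \<bullet> v"
    unfolding vv add_divide_distrib using l2 by simp
  finally have v2: "v0\<^sup>2 = 1 + v \<bullet> v" .
  have "\<bar>?b\<bar> * (\<bar>l\<bar> * \<bar>?h\<bar>) \<le> \<bar>?b\<bar> * (1 * 1)"
    using l sphere_inner_bounds[OF y e] by (intro mult_left_mono mult_mono) auto
  then have "?b * l * ?h \<le> \<bar>?b\<bar>"
    using abs_ge_self[of "?b * l * ?h"] by (simp add: abs_mult mult.assoc)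
  also have "\<bar>?b\<bar> < ?c"
    using sinh_less_cosh_real[of T] sinh_less_cosh_real[of "- T"] by (auto simp: abs_if)
  finally have v0: "v0 > 0" using s by (simp add: v0_def)
  have step: "1 / (?c - ?b * (boost l e x \<bullet> y)) ^ (DIM('a) - 1) * boost_factor l e x ^ (DIM('a) - 1)
      = 1 / (v0 - v \<bullet> x) ^ (DIM('a) - 1)" if x: "x \<in> sphere 0 1" for x
  proof -
    let ?a = "1 + l * (x \<bullet> e)"
    have a: "?a > 0" by (rule boost_denom_pos[OF e l x])
    have f: "boost_factor l e x > 0" by (rule boost_factor_pos[OF x])
    have "?a * (boost l e x \<bullet> y) = ?s * (x \<bullet> y - (x \<bullet> e) * ?h) + (x \<bullet> e + l) * ?h"
    proof -
      have "boost l e x \<bullet> y = (1 / ?a) * (?s * (x \<bullet> y - (x \<bullet> e) * ?h) + (x \<bullet> e + l) * ?h)"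
        unfolding boost_def inner_scaleR_left inner_add_left inner_diff_left inner_commute[of e y] ..
      then show ?thesis using a by simp
    qed
    then have "?a * (?c - ?b * (boost l e x \<bullet> y))
        = ?c * ?a - ?b * (?s * (x \<bullet> y - (x \<bullet> e) * ?h) + (x \<bullet> e + l) * ?h)"
      by (simp add: right_diff_distrib mult.left_commute mult.commute)
    also have "\<dots> = (?c - ?b * l * ?h) - ?s * (?b * (x \<bullet> y) + ((?b * ?h - ?c * l) / ?s - ?b * ?h) * (x \<bullet> e))"
      using s(1) by (simp add: field_simps)
    also have "\<dots> = ?s * (v0 - v \<bullet> x)"
    proof -
      have "?s * v0 = ?c - ?b * l * ?h" using s(1) by (simp add: v0_def)
      moreover have "v \<bullet> x = ?b * (x \<bullet> y) + k * (x \<bullet> e)"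
        unfolding v_def inner_add_left inner_scaleR_left inner_commute[of e x] inner_commute[of y x] ..
      ultimately show ?thesis by (simp only: right_diff_distrib k_def)
    qed
    finally have "v0 - v \<bullet> x = (?c - ?b * (boost l e x \<bullet> y)) / boost_factor l e x"
      using s(1) a by (simp add: boost_factor_def field_simps)
    then show ?thesis using f by (simp add: power_divide)
  qed
  have "(LINT x|sph_measure. 1 / (?c - ?b * (boost l e x \<bullet> y)) ^ (DIM('a) - 1) * boost_factor l e x ^ (DIM('a) - 1))
      = (LINT x|sph_measure. 1 / (v0 - v \<bullet> x) ^ (DIM('a) - 1))"
    by (rule Bochner_Integration.integral_cong[OF refl], rule step) simp
  also have "\<dots> = sph_total TYPE('a)" by (rule integral_poisson_lorentz[OF v2 v0 dim])
  finally show "(LINT x|sph_measure. 1 / (?c - ?b * (boost l e x \<bullet> y)) ^ (DIM('a) - 1)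
      * boost_factor l e x ^ (DIM('a) - 1)) = sph_total TYPE('a)" .
qed

lemma measurable_boost: "boost l e \<in> sph_measure \<rightarrow>\<^sub>M sph_measure"
  unfolding measurable_cong_sets[OF refl sets_sph_measure]
  by (rule measurable_restrict_space2)
     (use boost_sphere measurable_sph_continuous[OF continuous_on_boost] in auto)

lemma
  fixes f :: "'a \<Rightarrow> real"
  assumes dim: "DIM('a) \<ge> 3" and f: "f \<in> borel_measurable sph_measure"
  shows integral_boost: "(LINT x|sph_measure. boost_factor l e x ^ (DIM('a) - 1) * f (boost l e x))
      = integral\<^sup>L sph_measure f"
    and integrable_boost: "integrable sph_measure (\<lambda>x. boost_factor l e x ^ (DIM('a) - 1) * f (boost l e x))
      \<longleftrightarrow> integrable sph_measure f"
proof -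
  let ?D = "density sph_measure (\<lambda>x. ennreal (boost_factor l e x ^ (DIM('a) - 1)))"
  have mD: "boost l e \<in> ?D \<rightarrow>\<^sub>M sph_measure" using measurable_boost by simp
  have fm: "(\<lambda>x. f (boost l e x)) \<in> borel_measurable sph_measure"
    by (rule measurable_compose[OF measurable_boost f])
  have bm: "(\<lambda>x. boost_factor l e x ^ (DIM('a) - 1)) \<in> borel_measurable sph_measure"
    by (intro borel_measurable_power measurable_sph_continuous[OF continuous_on_boost_factor])
  have nn: "AE x in sph_measure. 0 \<le> boost_factor l e x ^ (DIM('a) - 1)"
  proof (rule AE_I2)
    fix x :: 'a assume "x \<in> space sph_measure"
    then have "boost_factor l e x > 0" by (intro boost_factor_pos) simp
    then show "0 \<le> boost_factor l e x ^ (DIM('a) - 1)" by simp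
  qed
  show "(LINT x|sph_measure. boost_factor l e x ^ (DIM('a) - 1) * f (boost l e x)) = integral\<^sup>L sph_measure f"
    using integral_distr[OF mD f] integral_density[OF fm bm nn] distr_boost[OF dim] by simp
  show "integrable sph_measure (\<lambda>x. boost_factor l e x ^ (DIM('a) - 1) * f (boost l e x))
      \<longleftrightarrow> integrable sph_measure f"
    using integrable_distr_eq[OF mD f] integrable_density[OF fm bm nn] distr_boost[OF dim] by simp
qed

end

section \<open>Zonal harmonics\<close>

definition sph_eig :: "real \<Rightarrow> nat \<Rightarrow> real" where
  "sph_eig n k = real k * (real k + n - 1)"

lemma sph_eig_less:
  assumes "n > 1" "i < k"
  shows "sph_eig n i < sph_eig n k"
  unfolding sph_eig_def using assms by (intro mult_strict_mono) auto

text \<open>The coefficient of t^(k - 2j), normalised so that the polynomial is monic. The recursion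
  makes the power that the second derivative produces from one term cancel against the eigenvalue
  mismatch of the next.\<close>

primrec gegen_coeff :: "real \<Rightarrow> nat \<Rightarrow> nat \<Rightarrow> real" where
  "gegen_coeff n k 0 = 1"
| "gegen_coeff n k (Suc j) = - (real (k - 2 * j) * real (k - 2 * j - 1))
      / (sph_eig n k - sph_eig n (k - 2 * j - 2)) * gegen_coeff n k j"

text \<open>Up to normalisation the Gegenbauer polynomial of degree k, that is, the polynomial
  eigenfunction of the zonal part of the Laplacian.\<close>

definition gegen :: "real \<Rightarrow> nat \<Rightarrow> real \<Rightarrow> real" where
  "gegen n k t = (\<Sum>j\<le>k div 2. gegen_coeff n k j * t ^ (k - 2 * j))"

definition gegen' :: "real \<Rightarrow> nat \<Rightarrow> real \<Rightarrow> real" where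
  "gegen' n k t = (\<Sum>j\<le>k div 2. gegen_coeff n k j * (real (k - 2 * j) * t ^ (k - 2 * j - 1)))"

definition gegen'' :: "real \<Rightarrow> nat \<Rightarrow> real \<Rightarrow> real" where
  "gegen'' n k t = (\<Sum>j\<le>k div 2. gegen_coeff n k j *
     (real (k - 2 * j) * (real (k - 2 * j - 1) * t ^ (k - 2 * j - 2))))"

lemma gegen_derivs:
  "(gegen n k has_real_derivative gegen' n k t) (at t)"
  "(gegen' n k has_real_derivative gegen'' n k t) (at t)"
proof -
  have pow: "((\<lambda>t. t ^ m) has_real_derivative real m * t ^ (m - 1)) (at t)" for m and t :: real
    by (rule DERIV_pow[of m t, simplified One_nat_def[symmetric]])
  show "(gegen n k has_real_derivative gegen' n k t) (at t)"
    unfolding gegen_def[abs_def] gegen'_def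
    by (intro DERIV_sum DERIV_cmult pow)
  show "(gegen' n k has_real_derivative gegen'' n k t) (at t)"
    unfolding gegen'_def[abs_def] gegen''_def
  proof (intro DERIV_sum DERIV_cmult)
    fix j
    show "((\<lambda>t. t ^ (k - 2 * j - 1)) has_real_derivative real (k - 2 * j - 1) * t ^ (k - 2 * j - 2)) (at t)"
      using pow[of "k - 2 * j - 1" t] by (simp add: diff_diff_eq)
  qed
qed

lemma continuous_gegen'': "continuous_on A (gegen'' n k)"
  unfolding gegen''_def by (intro continuous_intros)

text \<open>This parity supplies the sign (-1)^k when kernels in 1 + x \<bullet> y are exchanged for
  kernels in 1 - x \<bullet> y.\<close>

lemma gegen_minus: "gegen n k (- t) = (-1) ^ k * gegen n k t"
  unfolding gegen_def sum_distrib_left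
proof (rule sum.cong[OF refl])
  fix j assume "j \<in> {..k div 2}"
  then have "(-1::real) ^ k = (-1) ^ (k - 2 * j) * (-1) ^ (2 * j)"
    unfolding power_add[symmetric] by simp
  then have "(-1::real) ^ k = (-1) ^ (k - 2 * j)" by simp
  then show "gegen_coeff n k j * (- t) ^ (k - 2 * j) = (-1) ^ k * (gegen_coeff n k j * t ^ (k - 2 * j))"
    by (simp add: power_minus[of t] mult_ac)
qed

text \<open>The operator sends t^m to m (m - 1) t^(m-2) - \<open>sph_eig n m\<close> t^m. The sum
  therefore telescopes through U (j + 1) = - T j, and the last T vanishes since the remaining degree
  is 0 or 1.\<close>

lemma gegen_ode:
  assumes n: "n > 1"
  shows "(1 - t\<^sup>2) * gegen'' n k t - n * t * gegen' n k t = - sph_eig n k * gegen n k t"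
proof -
  define T where "T j = gegen_coeff n k j * (real (k - 2 * j) * (real (k - 2 * j - 1) * t ^ (k - 2 * j - 2)))" for j
  define U where "U j = gegen_coeff n k j * (sph_eig n k - sph_eig n (k - 2 * j)) * t ^ (k - 2 * j)" for j
  have tm: "(1 - t\<^sup>2) * (gegen_coeff n k j * (real m * (real (m - 1) * t ^ (m - 2))))
      - n * t * (gegen_coeff n k j * (real m * t ^ (m - 1)))
    = gegen_coeff n k j * (real m * (real (m - 1) * t ^ (m - 2)))
      - gegen_coeff n k j * sph_eig n m * t ^ m" for j m
  proof -
    consider "m = 0" | "m = 1" | i where "m = Suc (Suc i)" by (cases m; cases "m - 1") auto
    then show ?thesis
      by cases (auto simp: sph_eig_def power2_eq_square algebra_simps)
  qed
  have "(1 - t\<^sup>2) * gegen'' n k t - n * t * gegen' n k t + sph_eig n k * gegen n k t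
      = (\<Sum>j\<le>k div 2. T j + U j)"
    unfolding gegen_def gegen'_def gegen''_def sum_distrib_left sum_subtractf[symmetric] sum.distrib[symmetric]
    by (intro sum.cong refl) (simp only: tm T_def U_def, simp add: algebra_simps)
  also have "\<dots> = T (k div 2)"
  proof -
    have "(\<Sum>j\<le>m. T j + U j) = T m" if "m \<le> k div 2" for m
      using that
    proof (induction m)
      case 0
      then show ?case by (simp add: U_def)
    next
      case (Suc m)
      have less: "k - 2 * Suc m < k" using Suc.prems by presburger
      have e: "k - 2 * m - 2 = k - 2 * Suc m" by simp
      have "sph_eig n k - sph_eig n (k - 2 * Suc m) \<noteq> 0"
        using sph_eig_less[OF n less] by simp
      then have "U (Suc m) = - T m"
        unfolding U_def T_def gegen_coeff.simps(2) e by (simp add: field_simps)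
      then show ?case using Suc by simp
    qed
    then show ?thesis by simp
  qed
  also have "T (k div 2) = 0"
  proof -
    have "k - 2 * (k div 2) = 0 \<or> k - 2 * (k div 2) - 1 = 0" by presburger
    then show ?thesis by (auto simp: T_def)
  qed
  finally show ?thesis by simp
qed

lemma sph_eigenfn_gegen:
  fixes z :: "'a::euclidean_space"
  assumes z: "z \<in> sphere 0 1" and dim: "DIM('a) \<ge> 3"
  defines "n \<equiv> real DIM('a) - 1"
  shows "sph_eigenfn (sph_eig n k) (\<lambda>x. gegen n k (x \<bullet> z))"
  unfolding sph_eigenfn_def
proof (intro conjI ballI)
  show "C2_on (hom_ext (\<lambda>x. gegen n k (x \<bullet> z))) (- {0})"
    by (rule zonal_C2_and_lap(1)[OF z gegen_derivs continuous_gegen''])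
  fix x :: 'a assume x: "x \<in> sphere 0 1"
  have n1: "n > 1" using dim by (simp add: n_def)
  have "sph_lap (\<lambda>x. gegen n k (x \<bullet> z)) x
      = (1 - (x \<bullet> z)\<^sup>2) * gegen'' n k (x \<bullet> z) - n * (x \<bullet> z) * gegen' n k (x \<bullet> z)"
    unfolding n_def by (rule zonal_C2_and_lap(2)[OF z gegen_derivs continuous_gegen'' x])
  then show "- sph_lap (\<lambda>x. gegen n k (x \<bullet> z)) x = sph_eig n k * gegen n k (x \<bullet> z)"
    using gegen_ode[OF n1, of "x \<bullet> z" k] by simp
qed

text \<open>Green's formula for the \<beta>-th power of w = c + t, with 1 - t^2 = -w^2 + 2 c w -
  (c^2 - 1) expanded in powers of w. The shift c > 1 keeps the powers smooth on the sphere; the last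
  term carries the factor c^2 - 1, which vanishes as the shift is removed.\<close>

lemma zonal_powr_green:
  fixes x :: "'a::euclidean_space"
  assumes eig: "sph_eigenfn \<mu> \<phi>" and x: "x \<in> sphere 0 1" and c: "c > 1"
  defines "n \<equiv> real DIM('a) - 1"
  shows "(\<beta> * (\<beta> + n - 1) - \<mu>) * (LINT y|sph_measure. (c + x \<bullet> y) powr \<beta> * \<phi> y)
    = c * \<beta> * (2 * \<beta> + n - 2) * (LINT y|sph_measure. (c + x \<bullet> y) powr (\<beta> - 1) * \<phi> y)
      - (c\<^sup>2 - 1) * \<beta> * (\<beta> - 1) * (LINT y|sph_measure. (c + x \<bullet> y) powr (\<beta> - 2) * \<phi> y)"
proof -
  have C2: "C2_on (hom_ext \<phi>) (- {0})" using eig by (simp add: sph_eigenfn_def)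
  have lap: "sph_lap \<phi> y = - \<mu> * \<phi> y" if "y \<in> sphere 0 1" for y
  proof -
    have "- sph_lap \<phi> y = \<mu> * \<phi> y" using eig that unfolding sph_eigenfn_def by blast
    then show ?thesis by linarith
  qed
  have pos: "c + t > 0" if "t \<in> {-1..1}" for t using that c by auto
  have b: "x \<bullet> y \<in> {-1..1}" if "y \<in> sphere 0 1" for y by (rule sphere_inner_bounds[OF x that])
  have d: "((\<lambda>t. (c + t) powr a) has_real_derivative a * (c + t) powr (a - 1)) (at t)"
    if "t \<in> {-1..1}" for t a
    using pos[OF that] by (auto intro!: derivative_eq_intros)
  have d1: "((\<lambda>t. (c + t) powr \<beta>) has_real_derivative \<beta> * (c + t) powr (\<beta> - 1)) (at t)"
    if "t \<in> {-1..1}" for t by (rule d[OF that])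
  have d2: "((\<lambda>t. \<beta> * (c + t) powr (\<beta> - 1)) has_real_derivative \<beta> * ((\<beta> - 1) * (c + t) powr (\<beta> - 2))) (at t)"
    if "t \<in> {-1..1}" for t
    using DERIV_cmult[OF d[OF that, of "\<beta> - 1"], of \<beta>] by simp
  have cp: "continuous_on {-1..1} (\<lambda>t. (c + t) powr a)" for a
    by (auto intro!: continuous_at_imp_continuous_on DERIV_isCont[OF d])
  have c2: "continuous_on {-1..1} (\<lambda>t. \<beta> * ((\<beta> - 1) * (c + t) powr (\<beta> - 2)))"
    by (intro continuous_intros cp)
  let ?f = "\<lambda>y. (c + y \<bullet> x) powr \<beta>"
  have fC2: "C2_on (hom_ext ?f) (- {0})"
    by (rule zonal_C2_and_lap(1)[OF x d1 d2 c2])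
  have int: "integrable sph_measure (\<lambda>y. (c + x \<bullet> y) powr a * \<phi> y)" for a
    by (intro integrable_sph_continuous continuous_on_mult C2_hom_ext_continuous(1)[OF C2] continuous_zonal[OF cp x])
  have lapf: "sph_lap ?f y = - (\<beta> * (\<beta> + n - 1)) * (c + x \<bullet> y) powr \<beta>
      + c * \<beta> * (2 * \<beta> + n - 2) * (c + x \<bullet> y) powr (\<beta> - 1)
      - (c\<^sup>2 - 1) * \<beta> * (\<beta> - 1) * (c + x \<bullet> y) powr (\<beta> - 2)" if y: "y \<in> sphere 0 1" for y
  proof -
    define w where "w = c + x \<bullet> y"
    define W where "W = w powr (\<beta> - 2)"
    have w: "w > 0" unfolding w_def by (rule pos[OF b[OF y]])
    have w1: "w powr (\<beta> - 1) = w * W"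
      using powr_add[of w "1" "\<beta> - 2"] w by (simp add: W_def)
    have w2: "w powr \<beta> = w\<^sup>2 * W"
      using powr_add[of w "2" "\<beta> - 2"] w by (simp add: W_def powr_numeral)
    have t: "y \<bullet> x = w - c" by (simp add: w_def inner_commute)
    have "sph_lap ?f y = (1 - (y \<bullet> x)\<^sup>2) * (\<beta> * ((\<beta> - 1) * (c + y \<bullet> x) powr (\<beta> - 2)))
        - n * (y \<bullet> x) * (\<beta> * (c + y \<bullet> x) powr (\<beta> - 1))"
      unfolding n_def by (rule zonal_C2_and_lap(2)[OF x d1 d2 c2 y])
    also have "c + y \<bullet> x = w" by (simp add: w_def inner_commute)
    finally show ?thesis
      unfolding w_def[symmetric] w1 w2 W_def[symmetric] t
      by (simp add: power2_eq_square algebra_simps)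
  qed
  let ?I = "\<lambda>a. LINT y|sph_measure. (c + x \<bullet> y) powr a * \<phi> y"
  have "(LINT y|sph_measure. sph_lap ?f y * \<phi> y) = (LINT y|sph_measure. ?f y * sph_lap \<phi> y)"
    by (rule sph_green[OF fC2 C2])
  also have "(LINT y|sph_measure. ?f y * sph_lap \<phi> y) = (LINT y|sph_measure. - \<mu> * ((c + x \<bullet> y) powr \<beta> * \<phi> y))"
    by (rule Bochner_Integration.integral_cong) (auto simp: lap inner_commute)
  also have "\<dots> = - \<mu> * ?I \<beta>" by (rule integral_mult_right_zero)
  also have "(LINT y|sph_measure. sph_lap ?f y * \<phi> y) = (LINT y|sph_measure.
      - (\<beta> * (\<beta> + n - 1)) * ((c + x \<bullet> y) powr \<beta> * \<phi> y)
      + c * \<beta> * (2 * \<beta> + n - 2) * ((c + x \<bullet> y) powr (\<beta> - 1) * \<phi> y)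
      - (c\<^sup>2 - 1) * \<beta> * (\<beta> - 1) * ((c + x \<bullet> y) powr (\<beta> - 2) * \<phi> y))"
  proof (rule Bochner_Integration.integral_cong[OF refl])
    fix y :: 'a assume "y \<in> space sph_measure"
    then have y: "y \<in> sphere 0 1" by simp
    show "sph_lap ?f y * \<phi> y = - (\<beta> * (\<beta> + n - 1)) * ((c + x \<bullet> y) powr \<beta> * \<phi> y)
      + c * \<beta> * (2 * \<beta> + n - 2) * ((c + x \<bullet> y) powr (\<beta> - 1) * \<phi> y)
      - (c\<^sup>2 - 1) * \<beta> * (\<beta> - 1) * ((c + x \<bullet> y) powr (\<beta> - 2) * \<phi> y)"
      unfolding lapf[OF y] by (simp only: left_diff_distrib distrib_right mult.assoc)
  qed
  also have "\<dots> = - (\<beta> * (\<beta> + n - 1)) * ?I \<beta> + c * \<beta> * (2 * \<beta> + n - 2) * ?I (\<beta> - 1)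
      - (c\<^sup>2 - 1) * \<beta> * (\<beta> - 1) * ?I (\<beta> - 2)"
  proof -
    have "(LINT y|sph_measure. A * f y + B * g y - C * h y) = A * (LINT y|sph_measure. f y)
        + B * (LINT y|sph_measure. g y) - C * (LINT y|sph_measure. h y)"
      if "integrable sph_measure f" "integrable sph_measure g" "integrable sph_measure h"
      for A B C and f g h :: "'a \<Rightarrow> real"
      using that by simp
    from this[OF int int int] show ?thesis .
  qed
  finally show ?thesis by (simp only: left_diff_distrib minus_mult_left)
qed

section \<open>Bounds for integrals of shifted powers, uniform in the shift\<close>

lemma sph_eigenfn_const: "sph_eigenfn 0 (\<lambda>_::'a::euclidean_space. c)"
  unfolding sph_eigenfn_def by (auto simp: C2_hom_ext_const sph_lap_const)

lemma integrable_shifted_powr: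
  fixes x :: "'a::euclidean_space"
  assumes x: "x \<in> sphere 0 1" and c: "c > 1"
  shows "integrable sph_measure (\<lambda>y. (c + x \<bullet> y) powr a)"
proof (rule integrable_sph_continuous)
  have "continuous_on (sphere 0 1) (\<lambda>y. (c + x \<bullet> y) powr a)"
    by (intro continuous_intros) (use sphere_inner_bounds[OF x] c in force)
  then show "continuous_on (sphere 0 1) (\<lambda>y. (c + x \<bullet> y) powr a)" .
qed

lemma integral_shifted_powr_step:
  fixes x :: "'a::euclidean_space"
  assumes x: "x \<in> sphere 0 1" and c: "c > 1"
  defines "n \<equiv> real DIM('a) - 1"
  assumes \<gamma>: "0 < \<gamma>" "\<gamma> < n / 2" "\<gamma> \<noteq> 1"
  shows "(LINT y|sph_measure. (c + x \<bullet> y) powr (- \<gamma>))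
    \<le> (n - \<gamma>) / (n - 2 * \<gamma>) * (LINT y|sph_measure. (c + x \<bullet> y) powr (1 - \<gamma>))"
proof -
  let ?I = "\<lambda>a. LINT y|sph_measure. (c + x \<bullet> y) powr a"
  have I0: "?I a \<ge> 0" for a by (intro integral_nonneg_AE AE_I2) simp
  have "(1 - \<gamma>) * ((n - \<gamma>) * ?I (1 - \<gamma>))
      = (1 - \<gamma>) * (c * (n - 2 * \<gamma>) * ?I (- \<gamma>) + (c\<^sup>2 - 1) * \<gamma> * ?I (- \<gamma> - 1))"
  proof -
    have e: "1 - \<gamma> - 1 = - \<gamma>" "1 - \<gamma> - 2 = - \<gamma> - 1" "1 - \<gamma> + n - 1 = n - \<gamma>"
      "2 * (1 - \<gamma>) + n - 2 = n - 2 * \<gamma>" by simp_all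
    have alg: "b * (k * I1) = b * (c * m * I2 + d * g * I3)"
      if "(b * k - 0) * I1 = c * b * m * I2 - d * b * - g * I3" for b k I1 m I2 d g I3 :: real
      using that by (simp add: algebra_simps)
    from zonal_powr_green[OF sph_eigenfn_const[of 1] x c, of "1 - \<gamma>"]
    show ?thesis unfolding n_def[symmetric] e mult_1_right by (rule alg)
  qed
  then have eq: "(n - \<gamma>) * ?I (1 - \<gamma>) = c * (n - 2 * \<gamma>) * ?I (- \<gamma>) + (c\<^sup>2 - 1) * \<gamma> * ?I (- \<gamma> - 1)"
    using \<gamma>(3) by simp
  have "c\<^sup>2 - 1 \<ge> 0" using c by simp
  then have "(c\<^sup>2 - 1) * \<gamma> * ?I (- \<gamma> - 1) \<ge> 0" using \<gamma>(1) I0 by (intro mult_nonneg_nonneg) auto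
  then have "c * (n - 2 * \<gamma>) * ?I (- \<gamma>) \<le> (n - \<gamma>) * ?I (1 - \<gamma>)" using eq by linarith
  moreover have "1 * ((n - 2 * \<gamma>) * ?I (- \<gamma>)) \<le> c * ((n - 2 * \<gamma>) * ?I (- \<gamma>))"
    using c \<gamma>(2) I0 by (intro mult_right_mono mult_nonneg_nonneg) auto
  ultimately have "(n - 2 * \<gamma>) * ?I (- \<gamma>) \<le> (n - \<gamma>) * ?I (1 - \<gamma>)" by (simp only: mult.assoc mult_1_left)
  then show ?thesis using \<gamma>(2) by (simp add: field_simps)
qed

text \<open>Induction in unit steps of \<gamma>, starting from the bounded powers with \<gamma>
  \<le> 0. The excluded value \<gamma> = 1 is bridged by comparison with a slightly larger exponent.
  Uniformity in c is what permits the limit c to 1.\<close>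

lemma integral_shifted_powr_bound:
  assumes dim: "DIM('a::euclidean_space) \<ge> 4"
    and \<gamma>: "\<gamma> < (real DIM('a) - 1) / 2"
  shows "\<exists>C\<ge>0. \<forall>c\<in>{1<..2}. \<forall>x\<in>sphere (0::'a) 1. (LINT y|sph_measure. (c + x \<bullet> y) powr (- \<gamma>)) \<le> C"
proof -
  define n where "n = real DIM('a) - 1"
  have n3: "n \<ge> 3" using dim by (simp add: n_def)
  define B where "B \<gamma> \<longleftrightarrow> (\<exists>C\<ge>0. \<forall>c\<in>{1<..2}. \<forall>x\<in>sphere (0::'a) 1.
      (LINT y|sph_measure. (c + x \<bullet> y) powr (- \<gamma>)) \<le> C)" for \<gamma>
  have B0: "B \<gamma>" if "\<gamma> \<le> 0" for \<gamma>
    unfolding B_def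
  proof (intro exI[of _ "3 powr (- \<gamma>) * sph_total TYPE('a)"] conjI ballI)
    fix c :: real and x :: 'a assume c: "c \<in> {1<..2}" and x: "x \<in> sphere 0 1"
    have "(LINT y|sph_measure. (c + x \<bullet> y) powr (- \<gamma>)) \<le> (LINT y|(sph_measure::'a measure). 3 powr (- \<gamma>))"
    proof (rule integral_mono)
      show "integrable sph_measure (\<lambda>y. (c + x \<bullet> y) powr (- \<gamma>))"
        by (rule integrable_shifted_powr[OF x]) (use c in auto)
      fix y :: 'a assume "y \<in> space sph_measure"
      then have "x \<bullet> y \<in> {-1..1}" by (intro sphere_inner_bounds[OF x]) simp
      then show "(c + x \<bullet> y) powr (- \<gamma>) \<le> 3 powr (- \<gamma>)"
        using c that by (intro powr_mono2) auto
    qed simp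
    then show "(LINT y|sph_measure. (c + x \<bullet> y) powr (- \<gamma>)) \<le> 3 powr (- \<gamma>) * sph_total TYPE('a)"
      by (simp add: mult.commute)
  qed (simp add: measure_nonneg)
  have step: "B \<gamma>" if B: "B (\<gamma> - 1)" and g: "0 < \<gamma>" "\<gamma> < n / 2" "\<gamma> \<noteq> 1" for \<gamma>
  proof -
    from B[unfolded B_def] obtain C where C0: "0 \<le> C \<and> (\<forall>c\<in>{1<..2}. \<forall>x\<in>sphere (0::'a) 1.
        (LINT y|sph_measure. (c + x \<bullet> y) powr (- (\<gamma> - 1))) \<le> C)"
      by (rule exE)
    have C: "(LINT y|sph_measure. (c + x \<bullet> y) powr (- (\<gamma> - 1))) \<le> C"
      if "c \<in> {1<..2}" "x \<in> sphere (0::'a) 1" for c x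
      using bspec[OF bspec[OF conjunct2[OF C0] that(1)] that(2)] .
    have q: "(n - \<gamma>) / (n - 2 * \<gamma>) \<ge> 0" using g n3 by (intro divide_nonneg_pos) auto
    show ?thesis
      unfolding B_def
    proof (intro exI[of _ "(n - \<gamma>) / (n - 2 * \<gamma>) * C"] conjI ballI)
      show "0 \<le> (n - \<gamma>) / (n - 2 * \<gamma>) * C" using q conjunct1[OF C0] by (rule mult_nonneg_nonneg)
      fix c :: real and x :: 'a assume c: "c \<in> {1<..2}" and x: "x \<in> sphere 0 1"
      have c1: "c > 1" using c by simp
      have "(LINT y|sph_measure. (c + x \<bullet> y) powr (- \<gamma>))
          \<le> (n - \<gamma>) / (n - 2 * \<gamma>) * (LINT y|sph_measure. (c + x \<bullet> y) powr (1 - \<gamma>))"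
        unfolding n_def by (rule integral_shifted_powr_step[OF x c1 g[unfolded n_def]])
      also have "\<dots> \<le> (n - \<gamma>) / (n - 2 * \<gamma>) * C"
        using C[OF c x] by (intro mult_left_mono q) simp
      finally show "(LINT y|sph_measure. (c + x \<bullet> y) powr (- \<gamma>)) \<le> (n - \<gamma>) / (n - 2 * \<gamma>) * C" .
    qed
  qed
  have B1: "B 1"
  proof -
    \<comment> \<open>The exponent 5/4 lies between 1 and n/2, as n \<ge> 3, and is reached from 1/4
      by a unit step that avoids 1.\<close>
    have "B (1/4)" by (rule step[OF B0]) (use n3 in simp_all)
    then have "B (5/4 - 1)" by simp
    then have "B (5/4)" by (rule step) (use n3 in simp_all)
    from \<open>B (5/4)\<close>[unfolded B_def] obtain C where C0: "0 \<le> C \<and> (\<forall>c\<in>{1<..2}. \<forall>x\<in>sphere (0::'a) 1.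
        (LINT y|sph_measure. (c + x \<bullet> y) powr (- (5/4))) \<le> C)"
      by (rule exE)
    have C: "(LINT y|sph_measure. (c + x \<bullet> y) powr (- (5/4))) \<le> C"
      if "c \<in> {1<..2}" "x \<in> sphere (0::'a) 1" for c x
      using bspec[OF bspec[OF conjunct2[OF C0] that(1)] that(2)] .
    show ?thesis
      unfolding B_def
    proof (intro exI[of _ "C + sph_total TYPE('a)"] conjI ballI)
      show "0 \<le> C + sph_total TYPE('a)" using conjunct1[OF C0] by simp
      fix c :: real and x :: 'a assume c: "c \<in> {1<..2}" and x: "x \<in> sphere 0 1"
      have c1: "c > 1" using c by simp
      have "(LINT y|sph_measure. (c + x \<bullet> y) powr (- 1))
          \<le> (LINT y|sph_measure. (c + x \<bullet> y) powr (- (5/4)) + 1)"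
      proof (rule integral_mono)
        show "integrable sph_measure (\<lambda>y. (c + x \<bullet> y) powr (- 1))"
          by (rule integrable_shifted_powr[OF x c1])
        show "integrable sph_measure (\<lambda>y. (c + x \<bullet> y) powr (- (5/4)) + 1)"
          using integrable_shifted_powr[OF x c1] by simp
        fix y :: 'a assume "y \<in> space sph_measure"
        then have t: "x \<bullet> y \<in> {-1..1}" by (intro sphere_inner_bounds[OF x]) simp
        show "(c + x \<bullet> y) powr (- 1) \<le> (c + x \<bullet> y) powr (- (5/4)) + 1"
        proof (cases "c + x \<bullet> y \<le> 1")
          case True
          then have "(c + x \<bullet> y) powr (- 1) \<le> (c + x \<bullet> y) powr (- (5/4))"
            using t c1 by (intro powr_mono') auto
          then show ?thesis by simp
        next
          case False
          then have "(c + x \<bullet> y) powr (- 1) \<le> (c + x \<bullet> y) powr 0" by (intro powr_mono) auto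
          also have "\<dots> \<le> 1" by simp
          finally show ?thesis by (simp add: add_increasing)
        qed
      qed
      also have "\<dots> = (LINT y|sph_measure. (c + x \<bullet> y) powr (- (5/4))) + sph_total TYPE('a)"
        using integrable_shifted_powr[OF x c1] by simp
      also have "\<dots> \<le> C + sph_total TYPE('a)" using C[OF c x] by simp
      finally show "(LINT y|sph_measure. (c + x \<bullet> y) powr (- 1)) \<le> C + sph_total TYPE('a)" .
    qed
  qed
  have all: "\<forall>\<gamma>. \<gamma> \<le> real k \<longrightarrow> \<gamma> < n / 2 \<longrightarrow> B \<gamma>" for k
  proof (induction k)
    case 0
    show ?case by (intro allI impI B0) simp
  next
    case (Suc k)
    show ?case
    proof (intro allI impI)
      fix \<gamma> assume g: "\<gamma> \<le> real (Suc k)" "\<gamma> < n / 2"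
      consider "\<gamma> \<le> 0" | "\<gamma> = 1" | "\<gamma> > 0" "\<gamma> \<noteq> 1" by linarith
      then show "B \<gamma>"
      proof cases
        case 1
        then show ?thesis by (rule B0)
      next
        case 2
        then show ?thesis using B1 by (simp only:)
      next
        case 3
        have "\<gamma> - 1 \<le> real k" "\<gamma> - 1 < n / 2" using g by simp_all
        then have "B (\<gamma> - 1)" by (rule Suc.IH[rule_format])
        then show ?thesis by (rule step[OF _ 3(1) g(2) 3(2)])
      qed
    qed
  qed
  obtain k where "\<gamma> \<le> real k" using real_arch_simple[of \<gamma>] by (rule exE)
  then have "B \<gamma>" by (rule all[rule_format]) (use \<gamma> in \<open>simp add: n_def\<close>)
  then show ?thesis by (simp add: B_def)
qed

section \<open>Eigenvalues of Riesz potentials\<close>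

text \<open>On the set in question the function (1 + e + x \<bullet> y)^(-1) equals 1/e, while its
  integral stays bounded as e tends to 0; hence the measure of the set is at most C e for all small
  e.\<close>

lemma AE_not_antipode:
  fixes x :: "'a::euclidean_space"
  assumes dim: "DIM('a) \<ge> 4" and x: "x \<in> sphere 0 1"
  shows "AE y in sph_measure. -1 < x \<bullet> y"
proof -
  define A where "A = {y \<in> space sph_measure. x \<bullet> y \<le> -1}"
  have A: "A \<in> sets sph_measure" unfolding A_def by measurable
  have "(1::real) < (real DIM('a) - 1) / 2" using dim by simp
  from integral_shifted_powr_bound[OF dim this]
  obtain C where C0: "0 \<le> C \<and> (\<forall>c\<in>{1<..2}. \<forall>x\<in>sphere (0::'a) 1.
      (LINT y|sph_measure. (c + x \<bullet> y) powr (- 1)) \<le> C)"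
    by (rule exE)
  have bd: "measure sph_measure A \<le> C * e" if e: "0 < e" "e \<le> 1" for e
  proof -
    have "measure sph_measure A * (1 / e) = (LINT y|sph_measure. indicator A y * (1 / e))"
      using A by (simp add: Int_absorb2 sets.sets_into_space[OF A, simplified])
    also have "\<dots> \<le> (LINT y|sph_measure. (1 + e + x \<bullet> y) powr (- 1))"
    proof (rule integral_mono)
      show "integrable sph_measure (\<lambda>y. indicator A y * (1 / e))"
        using A by (intro integrable_mult_left integrable_real_indicator) (auto simp: sph.emeasure_eq_measure)
      show "integrable sph_measure (\<lambda>y. (1 + e + x \<bullet> y) powr (- 1))"
        by (rule integrable_shifted_powr[OF x]) (use e in simp)
      fix y :: 'a assume "y \<in> space sph_measure"
      then have "x \<bullet> y \<in> {-1..1}" by (intro sphere_inner_bounds[OF x]) simp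
      then have t: "-1 \<le> x \<bullet> y" by simp
      show "indicator A y * (1 / e) \<le> (1 + e + x \<bullet> y) powr (- 1)"
      proof (cases "y \<in> A")
        case True
        then have "x \<bullet> y = -1" using t by (simp add: A_def)
        then show ?thesis using True e by (simp add: powr_minus_divide)
      qed simp
    qed
    also have "\<dots> \<le> C"
      using bspec[OF bspec[OF conjunct2[OF C0], of "1 + e"] x] e by simp
    finally show ?thesis using e by (simp add: field_simps)
  qed
  have "measure sph_measure A = 0"
  proof (rule ccontr)
    assume "measure sph_measure A \<noteq> 0"
    then have m: "measure sph_measure A > 0" by (simp add: less_le)
    define e where "e = min 1 (measure sph_measure A / (2 * (C + 1)))"
    have C: "C \<ge> 0" using C0 by simp
    have e: "0 < e" "e \<le> 1" using m C by (auto simp: e_def)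
    have "measure sph_measure A \<le> C * e" by (rule bd[OF e])
    also have "\<dots> \<le> (C + 1) * e" using e by (intro mult_right_mono) auto
    also have "\<dots> \<le> (C + 1) * (measure sph_measure A / (2 * (C + 1)))"
      using C by (intro mult_left_mono) (auto simp: e_def)
    also have "\<dots> = measure sph_measure A / 2"
    proof -
      have "C + 1 \<noteq> 0" using C by simp
      then show ?thesis by (simp add: field_simps)
    qed
    finally show False using m by simp
  qed
  then have "A \<in> null_sets sph_measure"
    using A by (intro null_setsI) (auto simp: sph.emeasure_eq_measure)
  then show ?thesis
    by (rule AE_I') (auto simp: A_def)
qed

text \<open>Centred so that 1 + x \<bullet> y is largest at y = x: large exponents give an
  approximate identity at x, whereas negative ones are singular at the antipode.\<close>

definition riesz :: "real \<Rightarrow> ('a::euclidean_space \<Rightarrow> real) \<Rightarrow> 'a \<Rightarrow> real" where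
  "riesz \<beta> f x = (LINT y|sph_measure. (1 + x \<bullet> y) powr \<beta> * f y)"

text \<open>A sequence of shifts decreasing to 1 inside (1, 2], the range in which the bounds on
  shifted powers are uniform.\<close>

definition harm_shift :: "nat \<Rightarrow> real" where
  "harm_shift j = 1 + 1 / real (Suc j)"

lemma harm_shift: "harm_shift j > 1" "harm_shift j \<le> 2" "harm_shift \<longlonglongrightarrow> 1"
proof -
  show "harm_shift j > 1" by (simp add: harm_shift_def)
  show "harm_shift j \<le> 2" by (simp add: harm_shift_def)
  have "(\<lambda>j. 1 + 1 / real (Suc j)) \<longlonglongrightarrow> 1 + 0"
    by (intro tendsto_add tendsto_const LIMSEQ_Suc[OF lim_1_over_n])
  then show "harm_shift \<longlonglongrightarrow> 1" by (simp add: harm_shift_def[abs_def])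
qed

lemma tendsto_shifted_powr:
  assumes "t > -1"
  shows "(\<lambda>j. (harm_shift j + t) powr \<beta>) \<longlonglongrightarrow> (1 + t) powr \<beta>"
  by (intro tendsto_powr tendsto_add tendsto_const harm_shift(3)) (use assms in simp)

lemma integrable_riesz_kernel_fatou:
  fixes x :: "'a::euclidean_space"
  assumes x: "x \<in> sphere 0 1"
    and C: "\<And>j. (LINT y|sph_measure. (harm_shift j + x \<bullet> y) powr \<beta>) \<le> C"
  shows "integrable sph_measure (\<lambda>y. (1 + x \<bullet> y) powr \<beta>)"
proof -
  let ?w = "\<lambda>j y. ennreal ((harm_shift j + x \<bullet> y) powr \<beta>)"
  show ?thesis
  proof (rule integrableI_bounded)
    show "(\<lambda>y. (1 + x \<bullet> y) powr \<beta>) \<in> borel_measurable sph_measure" by measurable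
    have "(\<integral>\<^sup>+y. ennreal (norm ((1 + x \<bullet> y) powr \<beta>)) \<partial>sph_measure)
        \<le> (\<integral>\<^sup>+y. liminf (\<lambda>j. ?w j y) \<partial>sph_measure)"
    proof (rule nn_integral_mono)
      fix y :: 'a assume "y \<in> space sph_measure"
      then have "x \<bullet> y \<in> {-1..1}" by (intro sphere_inner_bounds[OF x]) simp
      \<comment> \<open>At the antipode \<open>0 powr \<beta>\<close> is 0, so there the bound is
        trivial; elsewhere the shifted powers converge.\<close>
      then consider "x \<bullet> y = -1" | "x \<bullet> y > -1" by fastforce
      then show "ennreal (norm ((1 + x \<bullet> y) powr \<beta>)) \<le> liminf (\<lambda>j. ?w j y)"
      proof cases
        case 2
        have "(\<lambda>j. ?w j y) \<longlonglongrightarrow> ennreal ((1 + x \<bullet> y) powr \<beta>)"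
          by (intro tendsto_ennrealI tendsto_shifted_powr[OF 2])
        from lim_imp_Liminf[OF _ this] show ?thesis by simp
      qed simp
    qed
    also have "\<dots> \<le> liminf (\<lambda>j. \<integral>\<^sup>+y. ?w j y \<partial>sph_measure)"
      by (rule nn_integral_liminf) measurable
    also have "\<dots> \<le> ennreal C"
    proof (rule Liminf_le[OF sequentially_bot], rule always_eventually, rule allI)
      fix j
      have "(\<integral>\<^sup>+y. ?w j y \<partial>sph_measure) = ennreal (LINT y|sph_measure. (harm_shift j + x \<bullet> y) powr \<beta>)"
        by (rule nn_integral_eq_integral[OF integrable_shifted_powr[OF x harm_shift(1)]]) simp
      also have "\<dots> \<le> ennreal C" by (rule ennreal_leI[OF C])
      finally show "(\<integral>\<^sup>+y. ?w j y \<partial>sph_measure) \<le> ennreal C" .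
    qed
    also have "\<dots> < \<infinity>" by simp
    finally show "(\<integral>\<^sup>+y. ennreal (norm ((1 + x \<bullet> y) powr \<beta>)) \<partial>sph_measure) < \<infinity>" .
  qed
qed

lemma integrable_riesz_kernel:
  fixes x :: "'a::euclidean_space"
  assumes dim: "DIM('a) \<ge> 4" and x: "x \<in> sphere 0 1"
    and \<beta>: "\<beta> > - (real DIM('a) - 1) / 2"
  shows "integrable sph_measure (\<lambda>y. (1 + x \<bullet> y) powr \<beta>)"
proof -
  have "- \<beta> < (real DIM('a) - 1) / 2" using \<beta> by simp
  from integral_shifted_powr_bound[OF dim this]
  obtain C where C0: "0 \<le> C \<and> (\<forall>c\<in>{1<..2}. \<forall>x\<in>sphere (0::'a) 1.
      (LINT y|sph_measure. (c + x \<bullet> y) powr (- (- \<beta>))) \<le> C)"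
    by (rule exE)
  show ?thesis
  proof (rule integrable_riesz_kernel_fatou[OF x])
    show "(LINT y|sph_measure. (harm_shift j + x \<bullet> y) powr \<beta>) \<le> C" for j
      using bspec[OF bspec[OF conjunct2[OF C0], of "harm_shift j"] x] harm_shift(1,2)[of j] by simp
  qed
qed

lemma shifted_powr_le:
  assumes t: "-1 < t" "t \<le> 1" and c: "1 \<le> c" "c \<le> (2::real)"
  shows "(c + t) powr \<beta> \<le> 3 powr \<bar>\<beta>\<bar> + (1 + t) powr \<beta>"
proof (cases "\<beta> \<ge> 0")
  case True
  have "(c + t) powr \<beta> \<le> 3 powr \<beta>" using True t c by (intro powr_mono2) auto
  then show ?thesis using True by (simp add: add_increasing2)
next
  case False
  have "(c + t) powr \<beta> \<le> (1 + t) powr \<beta>" using False t c by (intro powr_mono2') auto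
  then show ?thesis by (simp add: add_increasing)
qed

context
  fixes x :: "'a::euclidean_space" and f :: "'a \<Rightarrow> real" and F :: real
  assumes dim: "DIM('a) \<ge> 4" and x: "x \<in> sphere 0 1"
    and fm [measurable]: "f \<in> borel_measurable sph_measure"
    and fb: "\<And>y. y \<in> sphere 0 1 \<Longrightarrow> \<bar>f y\<bar> \<le> F"
begin

lemma F_nonneg: "F \<ge> 0"
  using fb[OF x] by linarith

lemma integrable_riesz:
  assumes \<beta>: "\<beta> > - (real DIM('a) - 1) / 2"
  shows "integrable sph_measure (\<lambda>y. (1 + x \<bullet> y) powr \<beta> * f y)"
proof (rule Bochner_Integration.integrable_bound)
  show "integrable sph_measure (\<lambda>y. (1 + x \<bullet> y) powr \<beta> * F)"
    using integrable_riesz_kernel[OF dim x \<beta>] by simp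
  show "(\<lambda>y. (1 + x \<bullet> y) powr \<beta> * f y) \<in> borel_measurable sph_measure" by measurable
  show "AE y in sph_measure. norm ((1 + x \<bullet> y) powr \<beta> * f y) \<le> norm ((1 + x \<bullet> y) powr \<beta> * F)"
  proof (rule AE_I2)
    fix y :: 'a assume "y \<in> space sph_measure"
    then have "\<bar>f y\<bar> \<le> F" by (intro fb) simp
    then show "norm ((1 + x \<bullet> y) powr \<beta> * f y) \<le> norm ((1 + x \<bullet> y) powr \<beta> * F)"
      using F_nonneg by (simp add: abs_mult mult_left_mono)
  qed
qed

lemma riesz_shifted_limit:
  assumes \<beta>: "\<beta> > - (real DIM('a) - 1) / 2"
  shows "(\<lambda>j. LINT y|sph_measure. (harm_shift j + x \<bullet> y) powr \<beta> * f y) \<longlonglongrightarrow> riesz \<beta> f x"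
  unfolding riesz_def
proof (rule integral_dominated_convergence[where w="\<lambda>y. (3 powr \<bar>\<beta>\<bar> + (1 + x \<bullet> y) powr \<beta>) * F"])
  show "integrable sph_measure (\<lambda>y. (3 powr \<bar>\<beta>\<bar> + (1 + x \<bullet> y) powr \<beta>) * F)"
    using integrable_riesz_kernel[OF dim x \<beta>] by simp
  show "AE y in sph_measure. (\<lambda>j. (harm_shift j + x \<bullet> y) powr \<beta> * f y) \<longlonglongrightarrow> (1 + x \<bullet> y) powr \<beta> * f y"
    using AE_not_antipode[OF dim x]
    by (rule AE_mp) (intro AE_I2 impI tendsto_mult_right tendsto_shifted_powr)
  show "AE y in sph_measure. norm ((harm_shift j + x \<bullet> y) powr \<beta> * f y)
      \<le> (3 powr \<bar>\<beta>\<bar> + (1 + x \<bullet> y) powr \<beta>) * F" for j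
    using AE_not_antipode[OF dim x]
  proof (rule AE_mp, intro AE_I2 impI)
    fix y :: 'a assume "y \<in> space sph_measure" and t: "-1 < x \<bullet> y"
    then have y: "y \<in> sphere 0 1" by simp
    have t1: "x \<bullet> y \<le> 1" using sphere_inner_bounds[OF x y] by simp
    have "(harm_shift j + x \<bullet> y) powr \<beta> \<le> 3 powr \<bar>\<beta>\<bar> + (1 + x \<bullet> y) powr \<beta>"
      by (rule shifted_powr_le[OF t t1]) (use harm_shift(1,2)[of j] in simp_all)
    then show "norm ((harm_shift j + x \<bullet> y) powr \<beta> * f y) \<le> (3 powr \<bar>\<beta>\<bar> + (1 + x \<bullet> y) powr \<beta>) * F"
      unfolding real_norm_def abs_mult using fb[OF y] by (intro mult_mono) auto
  qed
qed measurable

text \<open>With w = c + x \<bullet> y one has c^2 - 1 \<le> 3 (c - 1) \<le> 3 w, so the prefactor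
  buys back one power of w. Integrability of the exponent \<beta> - 1 then dominates, and pointwise
  the prefactor tends to 0.\<close>

lemma riesz_error_limit:
  assumes int: "integrable sph_measure (\<lambda>y. (1 + x \<bullet> y) powr (\<beta> - 1))"
  shows "(\<lambda>j. ((harm_shift j)\<^sup>2 - 1) * (LINT y|sph_measure. (harm_shift j + x \<bullet> y) powr (\<beta> - 2) * f y)) \<longlonglongrightarrow> 0"
proof -
  let ?g = "\<lambda>j y. ((harm_shift j)\<^sup>2 - 1) * ((harm_shift j + x \<bullet> y) powr (\<beta> - 2) * f y)"
  have "(\<lambda>j. LINT y|sph_measure. ?g j y) \<longlonglongrightarrow> (LINT y|(sph_measure::'a measure). 0)"
  proof (rule integral_dominated_convergence[where
        w="\<lambda>y. 3 * ((3 powr \<bar>\<beta> - 1\<bar> + (1 + x \<bullet> y) powr (\<beta> - 1)) * F)"])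
    show "integrable sph_measure (\<lambda>y. 3 * ((3 powr \<bar>\<beta> - 1\<bar> + (1 + x \<bullet> y) powr (\<beta> - 1)) * F))"
      using int by simp
    have h0: "(\<lambda>j. (harm_shift j)\<^sup>2 - 1) \<longlonglongrightarrow> 1\<^sup>2 - 1"
      by (intro tendsto_diff tendsto_power tendsto_const harm_shift(3))
    show "AE y in sph_measure. (\<lambda>j. ?g j y) \<longlonglongrightarrow> 0"
      using AE_not_antipode[OF dim x]
    proof (rule AE_mp, intro AE_I2 impI)
      fix y :: 'a assume "-1 < x \<bullet> y"
      then have "(\<lambda>j. ?g j y) \<longlonglongrightarrow> (1\<^sup>2 - 1) * ((1 + x \<bullet> y) powr (\<beta> - 2) * f y)"
        by (intro tendsto_mult[OF h0] tendsto_mult_right tendsto_shifted_powr)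
      then show "(\<lambda>j. ?g j y) \<longlonglongrightarrow> 0" by simp
    qed
    show "AE y in sph_measure. norm (?g j y)
        \<le> 3 * ((3 powr \<bar>\<beta> - 1\<bar> + (1 + x \<bullet> y) powr (\<beta> - 1)) * F)" for j
      using AE_not_antipode[OF dim x]
    proof (rule AE_mp, intro AE_I2 impI)
      fix y :: 'a assume "y \<in> space sph_measure" and t: "-1 < x \<bullet> y"
      then have y: "y \<in> sphere 0 1" by simp
      have t1: "x \<bullet> y \<le> 1" using sphere_inner_bounds[OF x y] by simp
      define c where "c = harm_shift j"
      define w where "w = c + x \<bullet> y"
      have c: "1 < c" "c \<le> 2" using harm_shift(1,2)[of j] by (simp_all add: c_def)
      have w: "w > 0" "c - 1 \<le> w" using t c by (simp_all add: w_def)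
      have "w powr (\<beta> - 1) = w powr 1 * w powr (\<beta> - 2)"
        unfolding powr_add[symmetric] by simp
      then have w1: "w powr (\<beta> - 1) = w * w powr (\<beta> - 2)" using w by simp
      have "(c\<^sup>2 - 1) * w powr (\<beta> - 2) = (c + 1) * ((c - 1) * w powr (\<beta> - 2))"
        by (simp add: power2_eq_square algebra_simps)
      also have "\<dots> \<le> 3 * (w * w powr (\<beta> - 2))"
        using c w by (intro mult_mono mult_right_mono) auto
      also have "\<dots> = 3 * w powr (\<beta> - 1)" using w1 by simp
      also have "\<dots> \<le> 3 * (3 powr \<bar>\<beta> - 1\<bar> + (1 + x \<bullet> y) powr (\<beta> - 1))"
        unfolding w_def using shifted_powr_le[OF t t1, of c "\<beta> - 1"] c by simp
      finally have le: "(c\<^sup>2 - 1) * w powr (\<beta> - 2) \<le> 3 * (3 powr \<bar>\<beta> - 1\<bar> + (1 + x \<bullet> y) powr (\<beta> - 1))" .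
      have c2: "c\<^sup>2 - 1 \<ge> 0" using c by simp
      have "norm ((c\<^sup>2 - 1) * (w powr (\<beta> - 2) * f y)) = ((c\<^sup>2 - 1) * w powr (\<beta> - 2)) * \<bar>f y\<bar>"
        using c2 by (simp add: abs_mult)
      also have "\<dots> \<le> (3 * (3 powr \<bar>\<beta> - 1\<bar> + (1 + x \<bullet> y) powr (\<beta> - 1))) * F"
        by (rule mult_mono[OF le fb[OF y]]) simp_all
      finally show "norm (?g j y) \<le> 3 * ((3 powr \<bar>\<beta> - 1\<bar> + (1 + x \<bullet> y) powr (\<beta> - 1)) * F)"
        by (simp only: c_def w_def mult.assoc)
    qed
  qed measurable
  then show ?thesis by simp
qed

end

text \<open>The limit c to 1 of Green's identity for shifted powers. The lower bound on \<beta>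
  keeps both exponents, \<beta> and \<beta> - 1, above -n/2.\<close>

lemma riesz_recursion:
  fixes x :: "'a::euclidean_space"
  assumes dim: "DIM('a) \<ge> 4" and x: "x \<in> sphere 0 1" and eig: "sph_eigenfn \<mu> \<phi>"
  defines "n \<equiv> real DIM('a) - 1"
  assumes \<beta>: "\<beta> > 1 - n / 2"
  shows "(\<beta> * (\<beta> + n - 1) - \<mu>) * riesz \<beta> \<phi> x = \<beta> * (2 * \<beta> + n - 2) * riesz (\<beta> - 1) \<phi> x"
proof -
  have c\<phi>: "continuous_on (sphere 0 1) \<phi>"
    using eig by (intro C2_hom_ext_continuous) (simp add: sph_eigenfn_def)
  obtain F where F: "F > 0" "\<And>y. y \<in> sphere 0 1 \<Longrightarrow> \<bar>\<phi> y\<bar> \<le> F"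
    using bounded_on_sphere[OF c\<phi>] by blast
  note m = measurable_sph_continuous[OF c\<phi>]
  have b0: "\<beta> > - (real DIM('a) - 1) / 2" and b1: "\<beta> - 1 > - (real DIM('a) - 1) / 2"
    using \<beta> by (simp_all add: n_def field_simps)
  let ?I = "\<lambda>a j. LINT y|sph_measure. (harm_shift j + x \<bullet> y) powr a * \<phi> y"
  have 1: "(\<lambda>j. (\<beta> * (\<beta> + n - 1) - \<mu>) * ?I \<beta> j) \<longlonglongrightarrow> (\<beta> * (\<beta> + n - 1) - \<mu>) * riesz \<beta> \<phi> x"
    by (intro tendsto_mult_left riesz_shifted_limit[OF dim x m F(2) b0])
  have "(\<lambda>j. harm_shift j * (\<beta> * (2 * \<beta> + n - 2)) * ?I (\<beta> - 1) j
        - \<beta> * (\<beta> - 1) * (((harm_shift j)\<^sup>2 - 1) * ?I (\<beta> - 2) j))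
      \<longlonglongrightarrow> 1 * (\<beta> * (2 * \<beta> + n - 2)) * riesz (\<beta> - 1) \<phi> x - \<beta> * (\<beta> - 1) * 0"
    by (intro tendsto_diff tendsto_mult tendsto_const harm_shift(3)
        riesz_shifted_limit[OF dim x m F(2) b1] riesz_error_limit[OF dim x m F(2) integrable_riesz_kernel[OF dim x b1]])
  moreover have "harm_shift j * (\<beta> * (2 * \<beta> + n - 2)) * ?I (\<beta> - 1) j
        - \<beta> * (\<beta> - 1) * (((harm_shift j)\<^sup>2 - 1) * ?I (\<beta> - 2) j)
      = (\<beta> * (\<beta> + n - 1) - \<mu>) * ?I \<beta> j" for j
    using zonal_powr_green[OF eig x harm_shift(1)[of j], of \<beta>] unfolding n_def[symmetric]
    by (simp add: mult_ac)
  ultimately have "(\<lambda>j. (\<beta> * (\<beta> + n - 1) - \<mu>) * ?I \<beta> j) \<longlonglongrightarrow> \<beta> * (2 * \<beta> + n - 2) * riesz (\<beta> - 1) \<phi> x"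
    by simp
  from LIMSEQ_unique[OF 1 this] show ?thesis .
qed

section \<open>Masses of the powers and their concentration for large exponents\<close>

lemma integral_zonal_const:
  fixes x x' :: "'a::euclidean_space"
  assumes dim: "DIM('a) \<ge> 3" and x: "x \<in> sphere 0 1" "x' \<in> sphere 0 1"
    and f [measurable]: "f \<in> borel_measurable borel"
  shows "(LINT y|sph_measure. f (x \<bullet> y)) = (LINT y|sph_measure. f (x' \<bullet> y) :: real)"
proof (cases "x = x'")
  case False
  define e where "e = (x - x') /\<^sub>R norm (x - x')"
  have e: "e \<in> sphere 0 1" "sph_refl e x = x'"
    unfolding e_def by (rule sph_refl_swap[OF x False])+
  have "(LINT y|sph_measure. f (x \<bullet> sph_refl e y)) = (LINT y|sph_measure. f (x \<bullet> y))"
    by (rule integral_sph_refl[OF e(1) dim]) measurable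
  moreover have "x \<bullet> sph_refl e y = x' \<bullet> y" for y
    using sph_refl_inner_swap[of e x y] e(2) by simp
  ultimately show ?thesis by simp
qed simp

lemma riesz_mass_const:
  fixes x x' :: "'a::euclidean_space"
  assumes "DIM('a) \<ge> 3" "x \<in> sphere 0 1" "x' \<in> sphere 0 1"
  shows "riesz \<beta> (\<lambda>_. 1) x = riesz \<beta> (\<lambda>_. 1) x'"
  using integral_zonal_const[OF assms, of "\<lambda>t. (1 + t) powr \<beta>"] by (simp add: riesz_def)

lemma riesz_mass_ge_cap:
  fixes x :: "'a::euclidean_space"
  assumes dim: "DIM('a) \<ge> 4" and x: "x \<in> sphere 0 1" and \<beta>: "\<beta> \<ge> 0" and c: "c \<ge> 0"
  shows "(1 + c) powr \<beta> * measure sph_measure {y \<in> sphere 0 1. x \<bullet> y > c} \<le> riesz \<beta> (\<lambda>_. 1) x"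
proof -
  let ?A = "{y \<in> sphere 0 1. x \<bullet> y > c}"
  have "?A = {y \<in> space sph_measure. x \<bullet> y > c}" by simp
  also have "\<dots> \<in> sets sph_measure" by measurable
  finally have A: "?A \<in> sets sph_measure" .
  have "\<beta> > - (real DIM('a) - 1) / 2" using \<beta> dim by simp
  then have int: "integrable sph_measure (\<lambda>y. (1 + x \<bullet> y) powr \<beta>)"
    by (rule integrable_riesz_kernel[OF dim x])
  have "(1 + c) powr \<beta> * measure sph_measure ?A = (LINT y|sph_measure. (1 + c) powr \<beta> * indicator ?A y)"
    using A by (simp add: Int_absorb2 sets.sets_into_space[OF A, simplified])
  also have "\<dots> \<le> (LINT y|sph_measure. (1 + x \<bullet> y) powr \<beta>)"
  proof (rule integral_mono)
    show "integrable sph_measure (\<lambda>y. (1 + c) powr \<beta> * indicator ?A y)"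
      using A by (intro integrable_mult_right integrable_real_indicator) (auto simp: sph.emeasure_eq_measure)
    show "integrable sph_measure (\<lambda>y. (1 + x \<bullet> y) powr \<beta>)" by (rule int)
    fix y :: 'a
    show "(1 + c) powr \<beta> * indicator ?A y \<le> (1 + x \<bullet> y) powr \<beta>"
      using \<beta> c by (cases "y \<in> ?A") (auto intro!: powr_mono2)
  qed
  finally show ?thesis by (simp add: riesz_def)
qed

lemma riesz_mass_pos:
  fixes x :: "'a::euclidean_space"
  assumes dim: "DIM('a) \<ge> 4" and x: "x \<in> sphere 0 1"
    and \<beta>: "\<beta> > - (real DIM('a) - 1) / 2"
  shows "riesz \<beta> (\<lambda>_. 1) x > 0"
proof (cases "\<beta> \<ge> 0")
  case True
  have "0 < (1 + 0) powr \<beta> * measure sph_measure {y \<in> sphere 0 1. x \<bullet> y > 0}"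
    using measure_sph_cap_pos[OF x, of 0] by simp
  also have "\<dots> \<le> riesz \<beta> (\<lambda>_. 1) x"
    by (rule riesz_mass_ge_cap[OF dim x True]) simp
  finally show ?thesis .
next
  case False
  have "0 < 2 powr \<beta> * sph_total TYPE('a)" using sph_total_pos[where 'a='a] by simp
  also have "\<dots> = (LINT y|(sph_measure::'a measure). 2 powr \<beta>)" by (simp add: mult.commute)
  also have "\<dots> \<le> (LINT y|sph_measure. (1 + x \<bullet> y) powr \<beta>)"
  proof (rule integral_mono_AE)
    show "integrable sph_measure (\<lambda>y. (1 + x \<bullet> y) powr \<beta>)" by (rule integrable_riesz_kernel[OF dim x \<beta>])
    show "AE y in sph_measure. 2 powr \<beta> \<le> (1 + x \<bullet> y) powr \<beta>"
      using AE_not_antipode[OF dim x]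
    proof (rule AE_mp, intro AE_I2 impI)
      fix y :: 'a assume "y \<in> space sph_measure" and t: "-1 < x \<bullet> y"
      then have "x \<bullet> y \<in> {-1..1}" by (intro sphere_inner_bounds[OF x]) simp
      then show "2 powr \<beta> \<le> (1 + x \<bullet> y) powr \<beta>" using t False by (intro powr_mono2') auto
    qed
  qed simp
  finally show ?thesis by (simp add: riesz_def)
qed

text \<open>For c0 < c1 < 1 the kernel is at most (1 + c0)^(\<beta>+j) off the larger cap, while its
  mass is at least (1 + c1)^(\<beta>+j) times the measure of the smaller cap. The quotient decays
  geometrically in j.\<close>

lemma riesz_approx_identity:
  fixes x :: "'a::euclidean_space"
  assumes dim: "DIM('a) \<ge> 4" and x: "x \<in> sphere 0 1" and \<beta>: "\<beta> \<ge> 0"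
    and h: "continuous_on (sphere 0 1) h"
  shows "(\<lambda>j. riesz (\<beta> + real j) h x / riesz (\<beta> + real j) (\<lambda>_. 1) x) \<longlonglongrightarrow> h x"
proof -
  have bj: "\<beta> + real j > - (real DIM('a) - 1) / 2" for j
  proof -
    have "- (real DIM('a) - 1) / 2 < 0" using dim by simp
    then show ?thesis using \<beta> by (simp add: less_le_trans)
  qed
  have mass: "(LINT y|sph_measure. (1 + x \<bullet> y) powr (\<beta> + real j)) = riesz (\<beta> + real j) (\<lambda>_. 1) x" for j
    by (simp add: riesz_def)
  have "(\<lambda>j. (LINT y|sph_measure. (1 + x \<bullet> y) powr (\<beta> + real j) * h y)
      / (LINT y|sph_measure. (1 + x \<bullet> y) powr (\<beta> + real j))) \<longlonglongrightarrow> h x"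
  proof (rule sph_approx_identity[OF x h, where k="\<lambda>j t. (1 + t) powr (\<beta> + real j)"])
    show "integrable sph_measure (\<lambda>y. (1 + x \<bullet> y) powr (\<beta> + real j))" for j
      by (rule integrable_riesz_kernel[OF dim x bj])
    show "(LINT y|sph_measure. (1 + x \<bullet> y) powr (\<beta> + real j)) > 0" for j
      unfolding mass by (rule riesz_mass_pos[OF dim x bj])
    fix c :: real assume c: "c < 1"
    define c0 where "c0 = max c 0"
    define c1 where "c1 = (c0 + 1) / 2"
    have c01: "0 \<le> c0" "c0 < c1" "c1 < 1" "c \<le> c0" using c by (auto simp: c0_def c1_def)
    define S where "S = measure sph_measure {y \<in> sphere 0 1. x \<bullet> y > c1}"
    have S: "S > 0" unfolding S_def by (rule measure_sph_cap_pos[OF x c01(3)])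
    define q where "q = (1 + c0) / (1 + c1)"
    have q: "0 < q" "q < 1" using c01 by (auto simp: q_def)
    have "\<forall>j. \<forall>t\<in>{-1..c}. (1 + t) powr (\<beta> + real j) \<le> (1 + c0) powr (\<beta> + real j)"
      using \<beta> c01 by (auto intro!: powr_mono2)
    moreover have "(\<lambda>j. (1 + c0) powr (\<beta> + real j) / riesz (\<beta> + real j) (\<lambda>_. 1) x) \<longlonglongrightarrow> 0"
    proof (rule tendsto_sandwich[OF _ _ tendsto_const])
      show "\<forall>\<^sub>F j in sequentially. 0 \<le> (1 + c0) powr (\<beta> + real j) / riesz (\<beta> + real j) (\<lambda>_. 1) x"
        using riesz_mass_pos[OF dim x bj] by (intro always_eventually allI divide_nonneg_pos) auto
      show "\<forall>\<^sub>F j in sequentially. (1 + c0) powr (\<beta> + real j) / riesz (\<beta> + real j) (\<lambda>_. 1) x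
          \<le> q powr \<beta> * q ^ j / S"
      proof (intro always_eventually allI)
        fix j
        have p: "(1 + c1) powr (\<beta> + real j) > 0" using c01 by simp
        have "(1 + c1) powr (\<beta> + real j) * S \<le> riesz (\<beta> + real j) (\<lambda>_. 1) x"
          unfolding S_def by (rule riesz_mass_ge_cap[OF dim x]) (use \<beta> c01 in auto)
        then have "(1 + c0) powr (\<beta> + real j) / riesz (\<beta> + real j) (\<lambda>_. 1) x
            \<le> (1 + c0) powr (\<beta> + real j) / ((1 + c1) powr (\<beta> + real j) * S)"
          using p S by (intro divide_left_mono) (auto intro!: mult_pos_pos riesz_mass_pos[OF dim x bj])
        also have "\<dots> = q powr (\<beta> + real j) / S"
          using c01 by (simp add: q_def powr_divide)
        also have "q powr (\<beta> + real j) = q powr \<beta> * q ^ j"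
          using q by (simp add: powr_add powr_realpow)
        finally show "(1 + c0) powr (\<beta> + real j) / riesz (\<beta> + real j) (\<lambda>_. 1) x \<le> q powr \<beta> * q ^ j / S" .
      qed
      have "(\<lambda>j. q powr \<beta> * q ^ j / S) \<longlonglongrightarrow> q powr \<beta> * 0 / S"
        using q S by (intro tendsto_divide tendsto_mult tendsto_const LIMSEQ_realpow_zero) auto
      then show "(\<lambda>j. q powr \<beta> * q ^ j / S) \<longlonglongrightarrow> 0" by simp
    qed
    ultimately show "\<exists>M. (\<forall>j. \<forall>t\<in>{-1..c}. (1 + t) powr (\<beta> + real j) \<le> M j) \<and>
        (\<lambda>j. M j / (LINT y|sph_measure. (1 + x \<bullet> y) powr (\<beta> + real j))) \<longlonglongrightarrow> 0"
      unfolding mass by (intro exI[of _ "\<lambda>j. (1 + c0) powr (\<beta> + real j)"] conjI)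
  qed simp
  then show ?thesis unfolding mass by (simp add: riesz_def)
qed

text \<open>The eigenvalue of the kernel on harmonics of degree k divided by that on constants. Up
  to the sign (-1)^k it is a quotient of Gamma functions, but as a finite product it is meaningful
  for all \<beta> + n > 0, including integers where the Gamma form has poles.\<close>

definition riesz_ratio :: "real \<Rightarrow> nat \<Rightarrow> real \<Rightarrow> real" where
  "riesz_ratio n k \<beta> = (\<Prod>i<k. (\<beta> - real i) / (\<beta> + n + real i))"

text \<open>Lowering \<beta> by one shifts the products in numerator and denominator by one place,
  so that only the end factors change. These are the coefficients in the recursion for the
  potentials, once for degree k and once for constants.\<close>

lemma riesz_ratio_step:
  assumes "\<beta> + n - 1 > 0"
  shows "riesz_ratio n k (\<beta> - 1) * (\<beta> * (\<beta> + n - 1))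
    = riesz_ratio n k \<beta> * ((\<beta> - real k) * (\<beta> + n + real k - 1))"
proof (induction k)
  case 0
  then show ?case by (simp add: riesz_ratio_def)
next
  case (Suc k)
  have S: "riesz_ratio n (Suc k) b = riesz_ratio n k b * ((b - real k) / (b + n + real k))" for b
    by (simp add: riesz_ratio_def)
  have p: "\<beta> + n + real k - 1 > 0" "\<beta> + n + real k > 0" using assms by (simp_all add: add_pos_nonneg)
  have "riesz_ratio n (Suc k) (\<beta> - 1) * (\<beta> * (\<beta> + n - 1))
      = (riesz_ratio n k (\<beta> - 1) * (\<beta> * (\<beta> + n - 1))) * ((\<beta> - 1 - real k) / (\<beta> - 1 + n + real k))"
    unfolding S by (simp only: mult_ac)
  also have "\<dots> = riesz_ratio n k \<beta> * ((\<beta> - real k) * (\<beta> + n + real k - 1))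
      * ((\<beta> - 1 - real k) / (\<beta> + n + real k - 1))"
    unfolding Suc.IH by (simp add: algebra_simps)
  also have "\<dots> = riesz_ratio n k \<beta> * ((\<beta> - real k) * (\<beta> - 1 - real k))"
    using p by simp
  also have "\<dots> = riesz_ratio n (Suc k) \<beta> * ((\<beta> - real (Suc k)) * (\<beta> + n + real (Suc k) - 1))"
    unfolding S using p by (simp add: divide_simps) (simp add: algebra_simps)
  finally show ?case .
qed

lemma riesz_ratio_limit: "(\<lambda>m. riesz_ratio n k (\<beta> + real m)) \<longlonglongrightarrow> 1"
proof -
  have fac: "(\<lambda>m. (\<beta> + real m - real i) / (\<beta> + real m + n + real i)) \<longlonglongrightarrow> 1" for i
  proof -
    have top: "filterlim (\<lambda>m. (\<beta> + n + real i) + real m) at_top sequentially"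
      by (rule filterlim_tendsto_add_at_top[OF tendsto_const filterlim_real_sequentially])
    have "(\<lambda>m. 1 - (n + 2 * real i) * inverse ((\<beta> + n + real i) + real m)) \<longlonglongrightarrow> 1 - (n + 2 * real i) * 0"
      by (intro tendsto_diff tendsto_mult tendsto_const tendsto_inverse_0_at_top[OF top])
    moreover have "eventually (\<lambda>m. (\<beta> + n + real i) + real m > 0) sequentially"
      using top by (rule filterlim_at_top_dense[THEN iffD1, rule_format])
    then have "eventually (\<lambda>m. 1 - (n + 2 * real i) * inverse ((\<beta> + n + real i) + real m)
        = (\<beta> + real m - real i) / (\<beta> + real m + n + real i)) sequentially"
    proof (rule eventually_mono)
      fix m assume p: "(\<beta> + n + real i) + real m > 0"
      have e: "\<beta> + real m + n + real i = (\<beta> + n + real i) + real m" by simp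
      define d where "d = (\<beta> + n + real i) + real m"
      have num: "\<beta> + real m - real i = d - (n + 2 * real i)" by (simp add: d_def)
      have "d \<noteq> 0" using p by (simp add: d_def)
      then have "1 - (n + 2 * real i) * inverse d = (d - (n + 2 * real i)) / d"
        by (simp add: field_simps)
      then show "1 - (n + 2 * real i) * inverse ((\<beta> + n + real i) + real m)
          = (\<beta> + real m - real i) / (\<beta> + real m + n + real i)"
        unfolding e num d_def[symmetric] .
    qed
    ultimately show ?thesis by (simp add: Lim_transform_eventually)
  qed
  have "(\<lambda>m. \<Prod>i<k. (\<beta> + real m - real i) / (\<beta> + real m + n + real i)) \<longlonglongrightarrow> (\<Prod>i<k. 1)"
    by (intro tendsto_prod fac)
  then show ?thesis by (simp add: riesz_ratio_def)
qed

lemma riesz_ratio_nonzero: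
  assumes "\<beta> \<notin> \<int>" "\<beta> + n > 0"
  shows "riesz_ratio n k \<beta> \<noteq> 0"
proof -
  have "(\<beta> - real i) / (\<beta> + n + real i) \<noteq> 0" for i
  proof -
    have "\<beta> \<noteq> real i" using assms(1) by auto
    moreover have "\<beta> + n + real i > 0" using assms(2) by (simp add: add_pos_nonneg)
    ultimately show ?thesis by simp
  qed
  then show ?thesis by (simp add: riesz_ratio_def)
qed

text \<open>The quotient of both sides is 1-periodic in the exponent by the recursion and tends to 1
  along integer shifts; integer exponents follow by continuity.\<close>

lemma riesz_eigenvalue:
  fixes x :: "'a::euclidean_space"
  assumes dim: "DIM('a) \<ge> 4" and x: "x \<in> sphere 0 1"
  defines "n \<equiv> real DIM('a) - 1"
  assumes eig: "sph_eigenfn (sph_eig n k) \<phi>" and \<beta>: "\<beta> > - n / 2"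
  shows "riesz \<beta> \<phi> x = riesz \<beta> (\<lambda>_. 1) x * riesz_ratio n k \<beta> * \<phi> x"
proof -
  have n3: "n \<ge> 3" using dim by (simp add: n_def)
  have c\<phi>: "continuous_on (sphere 0 1) \<phi>"
    using eig by (intro C2_hom_ext_continuous) (simp add: sph_eigenfn_def)
  have mp: "riesz b (\<lambda>_. 1) x > 0" if "b > - n / 2" for b
    by (rule riesz_mass_pos[OF dim x]) (use that in \<open>simp add: n_def\<close>)
  \<comment> \<open>The conjectured eigenvalue is divided out; what remains is to show that this
    quotient is the value of the eigenfunction at x.\<close>
  define Q where "Q b = riesz b \<phi> x / (riesz b (\<lambda>_. 1) x * riesz_ratio n k b)" for b
  have step: "Q (b - 1) = Q b" if b: "b > 1 - n / 2" "b \<notin> \<int>" for b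
  proof -
    have b0: "b \<noteq> 0" using b(2) by auto
    have bn: "b + n - 1 > 0" "2 * b + n - 2 > 0" using b(1) n3 by linarith+
    have bk: "b \<noteq> real k" using b(2) by auto
    have bk1: "b + n + real k - 1 > 0" using bn(1) by (simp add: add_pos_nonneg add.commute add.left_commute)
    have nint: "b - 1 \<notin> \<int>" using b(2) by (metis Ints_1 Ints_add diff_add_cancel)
    have m: "riesz (b - 1) (\<lambda>_. 1) x > 0" "riesz b (\<lambda>_. 1) x > 0" using b(1) by (auto intro!: mp)
    have "b - 1 + n > 0" "b + n > 0" using bn(1) by linarith+
    then have r: "riesz_ratio n k (b - 1) \<noteq> 0" "riesz_ratio n k b \<noteq> 0"
      using riesz_ratio_nonzero[OF nint] riesz_ratio_nonzero[OF b(2)] by simp_all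
    define A where "A = b * (2 * b + n - 2)"
    define D where "D = (b - real k) * (b + n + real k - 1)"
    define E where "E = b * (b + n - 1)"
    have nz: "A \<noteq> 0" "D \<noteq> 0" "E \<noteq> 0"
      using b0 bn bk bk1 by (simp_all add: A_def D_def E_def)
    have 1: "D * riesz b \<phi> x = A * riesz (b - 1) \<phi> x"
    proof -
      have "b * (b + n - 1) - sph_eig n k = D" by (simp add: D_def sph_eig_def algebra_simps)
      then show ?thesis
        using riesz_recursion[OF dim x eig, of b] b(1) by (simp add: A_def n_def)
    qed
    have 2: "E * riesz b (\<lambda>_. 1) x = A * riesz (b - 1) (\<lambda>_. 1) x"
      using riesz_recursion[OF dim x sph_eigenfn_const[of 1], of b] b(1) by (simp add: A_def E_def n_def)
    have 3: "riesz_ratio n k (b - 1) * E = riesz_ratio n k b * D"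
      unfolding E_def D_def by (rule riesz_ratio_step[OF bn(1)])
    have a1: "riesz (b - 1) \<phi> x = D * riesz b \<phi> x / A" using 1 nz by (simp add: field_simps)
    have a2: "riesz (b - 1) (\<lambda>_. 1) x = E * riesz b (\<lambda>_. 1) x / A" using 2 nz by (simp add: field_simps)
    have a3: "riesz_ratio n k (b - 1) = riesz_ratio n k b * D / E" using 3 nz by (simp add: field_simps)
    show ?thesis
      unfolding Q_def a1 a2 a3 using nz m(2) r(2) by (simp add: field_simps)
  qed
  \<comment> \<open>At integer exponents the factors b or b - k, and with them
    \<open>riesz_ratio\<close>, may vanish and could not be divided by.\<close>
  have nonint: "riesz b \<phi> x = riesz b (\<lambda>_. 1) x * riesz_ratio n k b * \<phi> x"
    if b: "b > - n / 2" "b \<notin> \<int>" for b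
  proof -
    have per: "Q (b + real m) = Q b" for m
    proof (induction m)
      case (Suc m)
      have "b + real m + 1 \<notin> \<int>"
      proof
        assume "b + real m + 1 \<in> \<int>"
        then have "b + real m + 1 - real (Suc m) \<in> \<int>" by (intro Ints_diff Ints_of_nat)
        then show False using b(2) by simp
      qed
      moreover have "b + real m + 1 > 1 - n / 2"
      proof -
        have "b + real m \<ge> b" by simp
        then show ?thesis using b(1) by linarith
      qed
      ultimately have "Q (b + real m + 1 - 1) = Q (b + real m + 1)" by (intro step)
      moreover have "b + real m + 1 - 1 = b + real m" "b + real (Suc m) = b + real m + 1" by simp_all
      ultimately show ?case using Suc.IH by (simp only:)
    qed simp
    obtain m0 where m0: "- b \<le> real m0" using real_arch_simple[of "- b"] by (rule exE)
    have "(\<lambda>j. riesz (b + real m0 + real j) \<phi> x / riesz (b + real m0 + real j) (\<lambda>_. 1) x) \<longlonglongrightarrow> \<phi> x"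
      by (rule riesz_approx_identity[OF dim x _ c\<phi>]) (use m0 in simp)
    from tendsto_divide[OF this riesz_ratio_limit[of n k "b + real m0"]]
    have "(\<lambda>j. Q (b + real m0 + real j)) \<longlonglongrightarrow> \<phi> x"
      by (simp add: Q_def)
    moreover have "Q (b + real m0 + real j) = Q b" for j
      using per[of "m0 + j"] by (simp add: add.assoc)
    ultimately have "Q b = \<phi> x" by (simp add: LIMSEQ_const_iff)
    moreover have "riesz b (\<lambda>_. 1) x \<noteq> 0" using mp[OF b(1)] by simp
    moreover have "riesz_ratio n k b \<noteq> 0"
      by (rule riesz_ratio_nonzero[OF b(2)]) (use b(1) n3 in linarith)
    ultimately show ?thesis by (simp add: Q_def field_simps)
  qed
  show ?thesis
  proof (cases "\<beta> \<in> \<int>")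
    case False
    then show ?thesis by (rule nonint[OF \<beta>])
  next
    case int: True
    \<comment> \<open>Non-integers decreasing to the integer \<beta>; the index shift by two keeps
      the increment strictly below 1.\<close>
    define b where "b j = \<beta> + 1 / real (Suc (Suc j))" for j
    have bpos: "0 < 1 / real (Suc (Suc j))" "1 / real (Suc (Suc j)) < 1" for j by auto
    have bni: "b j \<notin> \<int>" for j
    proof
      assume "b j \<in> \<int>"
      then have "b j - \<beta> \<in> \<int>" using int by (rule Ints_diff)
      then obtain i where i: "b j - \<beta> = of_int i" by (auto elim: Ints_cases)
      then have "of_int i = 1 / real (Suc (Suc j))" by (simp add: b_def)
      then have "0 < (of_int i :: real)" "(of_int i :: real) < 1" using bpos[of j] by simp_all
      then show False by simp
    qed
    have bb: "b j > \<beta>" "b j \<le> \<beta> + 1" for j using bpos[of j] by (simp_all add: b_def)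
    have blim: "b \<longlonglongrightarrow> \<beta>"
    proof -
      have "(\<lambda>j. \<beta> + 1 / real (Suc (Suc j))) \<longlonglongrightarrow> \<beta> + 0"
        by (intro tendsto_add tendsto_const LIMSEQ_Suc[OF LIMSEQ_Suc[OF lim_1_over_n]])
      then show ?thesis by (simp add: b_def[abs_def])
    qed
    have lim: "(\<lambda>j. riesz (b j) f x) \<longlonglongrightarrow> riesz \<beta> f x" if f: "continuous_on (sphere 0 1) f" for f
    proof -
      obtain F where F: "F > 0" "\<And>y. y \<in> sphere 0 1 \<Longrightarrow> \<bar>f y\<bar> \<le> F" using bounded_on_sphere[OF f] by blast
      have [measurable]: "f \<in> borel_measurable sph_measure" by (rule measurable_sph_continuous[OF f])
      show ?thesis
        unfolding riesz_def
      proof (rule integral_dominated_convergence[where w="\<lambda>y. (2 powr (\<bar>\<beta>\<bar> + 1) + (1 + x \<bullet> y) powr \<beta>) * F"])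
        show "integrable sph_measure (\<lambda>y. (2 powr (\<bar>\<beta>\<bar> + 1) + (1 + x \<bullet> y) powr \<beta>) * F)"
          using integrable_riesz_kernel[OF dim x, of \<beta>] \<beta> by (simp add: n_def)
        show "AE y in sph_measure. (\<lambda>j. (1 + x \<bullet> y) powr b j * f y) \<longlonglongrightarrow> (1 + x \<bullet> y) powr \<beta> * f y"
          using AE_not_antipode[OF dim x]
        proof (rule AE_mp, intro AE_I2 impI)
          fix y :: 'a assume "-1 < x \<bullet> y"
          then show "(\<lambda>j. (1 + x \<bullet> y) powr b j * f y) \<longlonglongrightarrow> (1 + x \<bullet> y) powr \<beta> * f y"
            by (intro tendsto_mult_right tendsto_powr tendsto_const blim) simp
        qed
        show "AE y in sph_measure. norm ((1 + x \<bullet> y) powr b j * f y)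
            \<le> (2 powr (\<bar>\<beta>\<bar> + 1) + (1 + x \<bullet> y) powr \<beta>) * F" for j
        proof (rule AE_I2)
          fix y :: 'a assume "y \<in> space sph_measure"
          then have y: "y \<in> sphere 0 1" by simp
          have t: "0 \<le> 1 + x \<bullet> y" "1 + x \<bullet> y \<le> 2" using sphere_inner_bounds[OF x y] by simp_all
          have "(1 + x \<bullet> y) powr b j \<le> 2 powr (\<bar>\<beta>\<bar> + 1) + (1 + x \<bullet> y) powr \<beta>"
          proof (cases "1 + x \<bullet> y \<le> 1")
            case True
            have "(1 + x \<bullet> y) powr b j \<le> (1 + x \<bullet> y) powr \<beta>"
              by (rule powr_mono') (use bb(1)[of j] t True in simp_all)
            then show ?thesis by (simp add: add_increasing)
          next
            case False
            have "b j \<le> \<bar>\<beta>\<bar> + 1" using bb(2)[of j] by linarith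
            then have "(1 + x \<bullet> y) powr b j \<le> (1 + x \<bullet> y) powr (\<bar>\<beta>\<bar> + 1)"
              using False by (intro powr_mono) simp_all
            also have "\<dots> \<le> 2 powr (\<bar>\<beta>\<bar> + 1)" using t by (intro powr_mono2) simp_all
            finally show ?thesis by (simp add: add_increasing2)
          qed
          then show "norm ((1 + x \<bullet> y) powr b j * f y) \<le> (2 powr (\<bar>\<beta>\<bar> + 1) + (1 + x \<bullet> y) powr \<beta>) * F"
            unfolding real_norm_def abs_mult using F(2)[OF y] by (intro mult_mono) auto
        qed
      qed measurable
    qed
    have rlim: "(\<lambda>j. riesz_ratio n k (b j)) \<longlonglongrightarrow> riesz_ratio n k \<beta>"
      unfolding riesz_ratio_def
    proof (intro tendsto_prod tendsto_divide tendsto_diff tendsto_add tendsto_const blim)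
      fix i
      have "\<beta> + n > 0" using \<beta> n3 by linarith
      then have "\<beta> + n + real i > 0" by (simp add: add_pos_nonneg)
      then show "\<beta> + n + real i \<noteq> 0" by simp
    qed
    have "(\<lambda>j. riesz (b j) (\<lambda>_. 1) x * riesz_ratio n k (b j) * \<phi> x)
        \<longlonglongrightarrow> riesz \<beta> (\<lambda>_. 1) x * riesz_ratio n k \<beta> * \<phi> x"
      by (intro tendsto_mult tendsto_const rlim lim continuous_on_const)
    moreover have "riesz (b j) \<phi> x = riesz (b j) (\<lambda>_. 1) x * riesz_ratio n k (b j) * \<phi> x" for j
      by (rule nonint[OF _ bni]) (use bb(1)[of j] \<beta> in linarith)
    ultimately have "(\<lambda>j. riesz (b j) \<phi> x) \<longlonglongrightarrow> riesz \<beta> (\<lambda>_. 1) x * riesz_ratio n k \<beta> * \<phi> x"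
      by simp
    from LIMSEQ_unique[OF lim[OF c\<phi>] this] show ?thesis .
  qed
qed

section \<open>The integral equation\<close>

text \<open>The potential with its singularity on the diagonal. Up to a constant the kernel is the
  power 2 \<beta> of the distance, so \<beta> = s - n/2 gives the Riesz kernel of order 2s.\<close>

definition rpot :: "real \<Rightarrow> ('a::euclidean_space \<Rightarrow> real) \<Rightarrow> 'a \<Rightarrow> real" where
  "rpot \<beta> f x = (LINT y|sph_measure. (1 - x \<bullet> y) powr \<beta> * f y)"

lemma rpot_eq_riesz: "rpot \<beta> f x = riesz \<beta> f (- x)"
  by (simp add: rpot_def riesz_def)

lemma minus_sphere: "(x::'a::euclidean_space) \<in> sphere 0 1 \<Longrightarrow> - x \<in> sphere 0 1"
  by simp

lemma rpot_mass_const: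
  fixes x x' :: "'a::euclidean_space"
  assumes "DIM('a) \<ge> 3" "x \<in> sphere 0 1" "x' \<in> sphere 0 1"
  shows "rpot \<beta> (\<lambda>_. 1) x = rpot \<beta> (\<lambda>_. 1) x'"
  unfolding rpot_eq_riesz using assms by (intro riesz_mass_const minus_sphere)

lemma rpot_mass_pos:
  fixes x :: "'a::euclidean_space"
  assumes "DIM('a) \<ge> 4" "x \<in> sphere 0 1" "\<beta> > - (real DIM('a) - 1) / 2"
  shows "rpot \<beta> (\<lambda>_. 1) x > 0"
  unfolding rpot_eq_riesz using assms by (intro riesz_mass_pos minus_sphere)

lemma AE_not_equal:
  fixes x :: "'a::euclidean_space"
  assumes dim: "DIM('a) \<ge> 4" and x: "x \<in> sphere 0 1"
  shows "AE y in sph_measure. x \<bullet> y < 1"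
  using AE_not_antipode[OF dim minus_sphere[OF x]] by simp

lemma integrable_rpot_kernel:
  fixes x :: "'a::euclidean_space"
  assumes dim: "DIM('a) \<ge> 4" and x: "x \<in> sphere 0 1"
    and \<beta>: "\<beta> > - (real DIM('a) - 1) / 2"
  shows "integrable sph_measure (\<lambda>y. (1 - x \<bullet> y) powr \<beta>)"
  using integrable_riesz_kernel[OF dim minus_sphere[OF x] \<beta>] by simp

section \<open>Symmetry and continuity of potentials\<close>

lemma integrable_zonal_times_bounded:
  fixes x :: "'a::euclidean_space" and k :: "real \<Rightarrow> real"
  assumes int: "integrable sph_measure (\<lambda>y. k (x \<bullet> y))"
    and fm [measurable]: "f \<in> borel_measurable sph_measure"
    and fb: "\<And>y. y \<in> sphere 0 1 \<Longrightarrow> \<bar>f y\<bar> \<le> F"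
  shows "integrable sph_measure (\<lambda>y. k (x \<bullet> y) * f y)"
proof (rule Bochner_Integration.integrable_bound)
  show "integrable sph_measure (\<lambda>y. F * k (x \<bullet> y))" using int by simp
  show "(\<lambda>y. k (x \<bullet> y) * f y) \<in> borel_measurable sph_measure"
    by (rule borel_measurable_times[OF borel_measurable_integrable[OF int] fm])
  show "AE y in sph_measure. norm (k (x \<bullet> y) * f y) \<le> norm (F * k (x \<bullet> y))"
  proof (rule AE_I2)
    fix y :: 'a assume "y \<in> space sph_measure"
    then have y: "\<bar>f y\<bar> \<le> F" by (intro fb) simp
    have "\<bar>f y\<bar> * \<bar>k (x \<bullet> y)\<bar> \<le> \<bar>F\<bar> * \<bar>k (x \<bullet> y)\<bar>" using y by (intro mult_right_mono) auto
    then show "norm (k (x \<bullet> y) * f y) \<le> norm (F * k (x \<bullet> y))"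
      by (simp only: real_norm_def abs_mult mult.commute[of "\<bar>k (x \<bullet> y)\<bar>" "\<bar>f y\<bar>"])
  qed
qed

text \<open>The kernel may be unbounded, but the integral of its absolute value does not depend on
  the centre. This yields absolute integrability of the double integral against bounded
  functions.\<close>

lemma zonal_fubini:
  fixes k :: "real \<Rightarrow> real" and a b :: "'a::euclidean_space \<Rightarrow> real"
  assumes dim: "DIM('a) \<ge> 3" and km [measurable]: "k \<in> borel_measurable borel"
    and int: "\<And>x::'a. x \<in> sphere 0 1 \<Longrightarrow> integrable sph_measure (\<lambda>y. k (x \<bullet> y))"
    and am [measurable]: "a \<in> borel_measurable sph_measure" and ab: "\<And>y. y \<in> sphere 0 1 \<Longrightarrow> \<bar>a y\<bar> \<le> A"
    and bm [measurable]: "b \<in> borel_measurable sph_measure" and bb: "\<And>y. y \<in> sphere 0 1 \<Longrightarrow> \<bar>b y\<bar> \<le> B"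
  shows "(LINT x|sph_measure. (LINT y|sph_measure. k (x \<bullet> y) * b y) * a x)
    = (LINT y|sph_measure. (LINT x|sph_measure. k (x \<bullet> y) * a x) * b y)"
proof -
  define f where "f x y = k (x \<bullet> y) * b y * a x" for x y
  obtain e :: 'a where "e \<in> Basis" using nonempty_Basis by blast
  then have e: "e \<in> sphere 0 1" by simp
  define m where "m = (LINT y|sph_measure. \<bar>k (e \<bullet> y)\<bar>)"
  have m: "(LINT y|sph_measure. \<bar>k (x \<bullet> y)\<bar>) = m" if "x \<in> sphere 0 1" for x :: 'a
    unfolding m_def by (rule integral_zonal_const[OF dim that e, of "\<lambda>t. \<bar>k t\<bar>"]) measurable
  have fm [measurable]: "(\<lambda>(x, y). f x y) \<in> borel_measurable (sph_measure \<Otimes>\<^sub>M sph_measure)"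
    unfolding f_def by measurable
  have fi: "integrable sph_measure (f x)" if x: "x \<in> sphere 0 1" for x
    unfolding f_def using integrable_zonal_times_bounded[OF int[OF x] bm bb] by simp
  have "integrable (sph_measure \<Otimes>\<^sub>M sph_measure) (\<lambda>(x, y). f x y)"
  proof (rule sph_pair.Fubini_integrable[OF fm])
    show "AE x in sph_measure. integrable sph_measure (\<lambda>y. case (x, y) of (x, y) \<Rightarrow> f x y)"
      using fi by (intro AE_I2) simp
    have "integrable sph_measure (\<lambda>x. LINT y|sph_measure. norm (f x y))"
    proof (rule integrable_sph_bounded)
      show "(\<lambda>x. LINT y|sph_measure. norm (f x y)) \<in> borel_measurable sph_measure" by measurable
      fix x :: 'a assume x: "x \<in> sphere 0 1"
      have "(LINT y|sph_measure. norm (f x y)) \<le> (LINT y|sph_measure. \<bar>k (x \<bullet> y)\<bar> * (\<bar>B\<bar> * A))"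
      proof (rule integral_mono)
        show "integrable sph_measure (\<lambda>y. norm (f x y))" using fi[OF x] by simp
        show "integrable sph_measure (\<lambda>y. \<bar>k (x \<bullet> y)\<bar> * (\<bar>B\<bar> * A))" using int[OF x] by simp
        fix y :: 'a assume "y \<in> space sph_measure"
        then have y: "\<bar>b y\<bar> \<le> \<bar>B\<bar>" using bb[of y] by simp
        show "norm (f x y) \<le> \<bar>k (x \<bullet> y)\<bar> * (\<bar>B\<bar> * A)"
          unfolding f_def real_norm_def abs_mult mult.assoc
          using y ab[OF x] by (intro mult_left_mono mult_mono) auto
      qed
      also have "\<dots> = m * (\<bar>B\<bar> * A)" using m[OF x] by simp
      finally have "(LINT y|sph_measure. norm (f x y)) \<le> m * (\<bar>B\<bar> * A)" .
      moreover have "(LINT y|sph_measure. norm (f x y)) \<ge> 0" by (intro integral_nonneg_AE AE_I2) simp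
      ultimately show "\<bar>LINT y|sph_measure. norm (f x y)\<bar> \<le> m * (\<bar>B\<bar> * A)" by simp
    qed
    then show "integrable sph_measure (\<lambda>x. LINT y|sph_measure. norm (case (x, y) of (x, y) \<Rightarrow> f x y))"
      by simp
  qed
  then have "(LINT y|sph_measure. LINT x|sph_measure. f x y) = (LINT x|sph_measure. LINT y|sph_measure. f x y)"
    by (rule sph_pair.Fubini_integral)
  moreover have "(LINT y|sph_measure. f x y) = (LINT y|sph_measure. k (x \<bullet> y) * b y) * a x" for x
    unfolding f_def by (rule integral_mult_left_zero)
  moreover have "(LINT x|sph_measure. f x y) = (LINT x|sph_measure. k (x \<bullet> y) * a x) * b y" for y
  proof -
    have "(LINT x|sph_measure. f x y) = (LINT x|sph_measure. k (x \<bullet> y) * a x * b y)"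
      unfolding f_def by (simp only: mult.assoc mult.commute[of "b y"])
    then show ?thesis by (simp only: integral_mult_left_zero)
  qed
  ultimately show ?thesis by simp
qed

text \<open>A uniform limit of the potentials with shifted kernels. The L1 distance between shifted
  and singular kernel is the same at every centre, and it is a difference of masses tending to 0,
  because for \<beta> \<le> 0 the shifted kernel lies below the singular one.\<close>

lemma continuous_on_riesz:
  fixes f :: "'a::euclidean_space \<Rightarrow> real"
  assumes dim: "DIM('a) \<ge> 4" and \<beta>: "\<beta> > - (real DIM('a) - 1) / 2" "\<beta> \<le> 0"
    and fm [measurable]: "f \<in> borel_measurable sph_measure" and fb: "\<And>y. y \<in> sphere 0 1 \<Longrightarrow> \<bar>f y\<bar> \<le> F"
  shows "continuous_on (sphere 0 1) (riesz \<beta> f)"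
proof -
  have dim3: "DIM('a) \<ge> 3" using dim by simp
  obtain e :: 'a where "e \<in> Basis" using nonempty_Basis by blast
  then have e: "e \<in> sphere 0 1" by simp
  define r where "r j x = (LINT y|sph_measure. (harm_shift j + x \<bullet> y) powr \<beta> * f y)" for j and x :: 'a
  define d where "d j t = \<bar>(1 + t) powr \<beta> - (harm_shift j + t) powr \<beta>\<bar>" for j t
  define m where "m j = (LINT y|sph_measure. d j (e \<bullet> y))" for j
  have dm [measurable]: "d j \<in> borel_measurable borel" for j
    unfolding d_def by measurable
  have mconst: "(LINT y|sph_measure. d j (x \<bullet> y)) = m j" if "x \<in> sphere 0 1" for x :: 'a and j
    unfolding m_def by (rule integral_zonal_const[OF dim3 that e]) measurable
  have di: "integrable sph_measure (\<lambda>y. d j (x \<bullet> y))" if x: "x \<in> sphere 0 1" for x :: 'a and j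
    unfolding d_def
    by (intro integrable_abs Bochner_Integration.integrable_diff integrable_riesz_kernel[OF dim x \<beta>(1)]
        integrable_shifted_powr[OF x harm_shift(1)])
  have mlim: "m \<longlonglongrightarrow> 0"
  proof -
    have one: "\<bar>1::real\<bar> \<le> 1" by simp
    have "m j = riesz \<beta> (\<lambda>_. 1) e - (LINT y|sph_measure. (harm_shift j + e \<bullet> y) powr \<beta> * 1)" for j
    proof -
      have "m j = (LINT y|sph_measure. (1 + e \<bullet> y) powr \<beta> - (harm_shift j + e \<bullet> y) powr \<beta>)"
        unfolding m_def
      proof (rule integral_cong_AE)
        show "AE y in sph_measure. d j (e \<bullet> y) = (1 + e \<bullet> y) powr \<beta> - (harm_shift j + e \<bullet> y) powr \<beta>"
          using AE_not_antipode[OF dim e]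
        proof (rule AE_mp, intro AE_I2 impI)
          fix y :: 'a assume "-1 < e \<bullet> y"
          then have "(harm_shift j + e \<bullet> y) powr \<beta> \<le> (1 + e \<bullet> y) powr \<beta>"
            using \<beta>(2) less_imp_le[OF harm_shift(1)[of j]] by (intro powr_mono2') auto
          then show "d j (e \<bullet> y) = (1 + e \<bullet> y) powr \<beta> - (harm_shift j + e \<bullet> y) powr \<beta>"
            by (simp add: d_def)
        qed
      qed measurable
      then show ?thesis
        using integrable_riesz_kernel[OF dim e \<beta>(1)] integrable_shifted_powr[OF e harm_shift(1)[of j]]
        by (simp add: riesz_def)
    qed
    moreover have "(\<lambda>j. riesz \<beta> (\<lambda>_. 1) e - (LINT y|sph_measure. (harm_shift j + e \<bullet> y) powr \<beta> * 1))
        \<longlonglongrightarrow> riesz \<beta> (\<lambda>_. 1) e - riesz \<beta> (\<lambda>_. 1) e"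
      by (intro tendsto_diff tendsto_const riesz_shifted_limit[OF dim e _ one \<beta>(1)]) simp
    ultimately have "(\<lambda>j. m j) \<longlonglongrightarrow> riesz \<beta> (\<lambda>_. 1) e - riesz \<beta> (\<lambda>_. 1) e"
      by (simp only:)
    then show ?thesis by simp
  qed
  have close: "dist (r j x) (riesz \<beta> f x) \<le> F * m j" if x: "x \<in> sphere 0 1" for x j
  proof -
    have i1: "integrable sph_measure (\<lambda>y. (harm_shift j + x \<bullet> y) powr \<beta> * f y)"
      by (rule integrable_zonal_times_bounded[OF integrable_shifted_powr[OF x harm_shift(1)] fm fb])
    have i2: "integrable sph_measure (\<lambda>y. (1 + x \<bullet> y) powr \<beta> * f y)"
      by (rule integrable_riesz[OF dim x fm fb \<beta>(1)])
    have "dist (r j x) (riesz \<beta> f x) = \<bar>riesz \<beta> f x - r j x\<bar>" by (simp add: dist_real_def abs_minus_commute)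
    also have "\<dots> = \<bar>LINT y|sph_measure. (1 + x \<bullet> y) powr \<beta> * f y - (harm_shift j + x \<bullet> y) powr \<beta> * f y\<bar>"
      using i1 i2 by (simp add: riesz_def r_def)
    also have "\<dots> \<le> (LINT y|sph_measure. \<bar>(1 + x \<bullet> y) powr \<beta> * f y - (harm_shift j + x \<bullet> y) powr \<beta> * f y\<bar>)"
      by (rule integral_abs_bound)
    also have "\<dots> \<le> (LINT y|sph_measure. F * d j (x \<bullet> y))"
    proof (rule integral_mono)
      show "integrable sph_measure (\<lambda>y. \<bar>(1 + x \<bullet> y) powr \<beta> * f y - (harm_shift j + x \<bullet> y) powr \<beta> * f y\<bar>)"
        using i1 i2 by (intro integrable_abs Bochner_Integration.integrable_diff)
      show "integrable sph_measure (\<lambda>y. F * d j (x \<bullet> y))" using di[OF x] by simp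
      fix y :: 'a assume "y \<in> space sph_measure"
      then have y: "\<bar>f y\<bar> \<le> F" by (intro fb) simp
      have "\<bar>(1 + x \<bullet> y) powr \<beta> * f y - (harm_shift j + x \<bullet> y) powr \<beta> * f y\<bar> = d j (x \<bullet> y) * \<bar>f y\<bar>"
        unfolding d_def abs_mult[symmetric] left_diff_distrib ..
      also have "\<dots> \<le> d j (x \<bullet> y) * F" using y by (intro mult_left_mono) (auto simp: d_def)
      finally show "\<bar>(1 + x \<bullet> y) powr \<beta> * f y - (harm_shift j + x \<bullet> y) powr \<beta> * f y\<bar> \<le> F * d j (x \<bullet> y)"
        by (simp only: mult.commute)
    qed
    also have "\<dots> = F * m j" using mconst[OF x] by simp
    finally show ?thesis .
  qed
  have rc: "continuous_on (sphere 0 1) (r j)" for j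
    unfolding continuous_on_sequentially
  proof (intro allI ballI impI)
    fix X :: "nat \<Rightarrow> 'a" and a assume a: "a \<in> sphere 0 1"
      and X: "(\<forall>n. X n \<in> sphere 0 1) \<and> X \<longlonglongrightarrow> a"
    then have Xs: "X n \<in> sphere 0 1" and Xl: "X \<longlonglongrightarrow> a" for n by auto
    define K where "K = (harm_shift j - 1) powr \<beta> * F"
    have "(\<lambda>n. r j (X n)) \<longlonglongrightarrow> r j a"
      unfolding r_def
    proof (rule integral_dominated_convergence[where w="\<lambda>_. K"])
      show "AE y in sph_measure. (\<lambda>n. (harm_shift j + X n \<bullet> y) powr \<beta> * f y) \<longlonglongrightarrow> (harm_shift j + a \<bullet> y) powr \<beta> * f y"
      proof (rule AE_I2)
        fix y :: 'a assume "y \<in> space sph_measure"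
        then have y: "y \<in> sphere 0 1" by simp
        have "harm_shift j + a \<bullet> y > 0" using sphere_inner_bounds[OF a y] harm_shift(1)[of j] by simp
        then have "harm_shift j + a \<bullet> y \<noteq> 0" by simp
        then show "(\<lambda>n. (harm_shift j + X n \<bullet> y) powr \<beta> * f y) \<longlonglongrightarrow> (harm_shift j + a \<bullet> y) powr \<beta> * f y"
          by (intro tendsto_mult_right tendsto_powr tendsto_add tendsto_const tendsto_inner Xl)
      qed
      show "AE y in sph_measure. norm ((harm_shift j + X n \<bullet> y) powr \<beta> * f y) \<le> K" for n
      proof (rule AE_I2)
        fix y :: 'a assume "y \<in> space sph_measure"
        then have y: "y \<in> sphere 0 1" by simp
        have "(harm_shift j + X n \<bullet> y) powr \<beta> \<le> (harm_shift j - 1) powr \<beta>"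
          using sphere_inner_bounds[OF Xs y, of n] harm_shift(1)[of j] \<beta>(2) by (intro powr_mono2') auto
        then show "norm ((harm_shift j + X n \<bullet> y) powr \<beta> * f y) \<le> K"
          unfolding K_def real_norm_def abs_mult using fb[OF y] by (intro mult_mono) auto
      qed
    qed (simp, simp, simp, measurable)
    then show "(r j \<circ> X) \<longlonglongrightarrow> r j a" by (simp add: comp_def)
  qed
  have "uniform_limit (sphere 0 1) r (riesz \<beta> f) sequentially"
    unfolding uniform_limit_iff
  proof (intro allI impI)
    fix \<epsilon> :: real assume \<epsilon>: "\<epsilon> > 0"
    have "(\<lambda>j. F * m j) \<longlonglongrightarrow> F * 0" by (intro tendsto_mult_left mlim)
    then have "eventually (\<lambda>j. F * m j < \<epsilon>) sequentially" using \<epsilon> by (intro order_tendstoD(2)) auto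
    then show "\<forall>\<^sub>F j in sequentially. \<forall>x\<in>sphere 0 1. dist (r j x) (riesz \<beta> f x) < \<epsilon>"
    proof (rule eventually_mono, intro ballI)
      fix j and x :: 'a assume "F * m j < \<epsilon>" and x: "x \<in> sphere 0 1"
      then show "dist (r j x) (riesz \<beta> f x) < \<epsilon>" using close[OF x, of j] by linarith
    qed
  qed
  then show ?thesis
    by (rule uniform_limit_theorem[rotated]) (auto intro: always_eventually rc)
qed

lemma continuous_on_rpot:
  fixes f :: "'a::euclidean_space \<Rightarrow> real"
  assumes dim: "DIM('a) \<ge> 4" and \<beta>: "\<beta> > - (real DIM('a) - 1) / 2" "\<beta> \<le> 0"
    and fm: "f \<in> borel_measurable sph_measure" and fb: "\<And>y. y \<in> sphere 0 1 \<Longrightarrow> \<bar>f y\<bar> \<le> F"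
  shows "continuous_on (sphere 0 1) (rpot \<beta> f)"
  unfolding rpot_eq_riesz[abs_def]
  by (rule continuous_on_compose2[OF continuous_on_riesz[OF assms]])
     (auto intro!: continuous_intros)

text \<open>By the binomial theorem vanishing zonal moments annihilate all potentials with kernel (1
  + x \<bullet> y)^j, and these kernels, normalised, form an approximate identity.\<close>

lemma sph_completeness:
  fixes h :: "'a::euclidean_space \<Rightarrow> real"
  assumes dim: "DIM('a) \<ge> 4" and h: "continuous_on (sphere 0 1) h"
    and mom: "\<And>m z. z \<in> sphere 0 1 \<Longrightarrow> (LINT y|sph_measure. h y * (y \<bullet> z) ^ m) = 0"
    and x: "x \<in> sphere 0 1"
  shows "h x = 0"
proof -
  have "riesz (0 + real j) h x = 0" for j
  proof -
    have "riesz (0 + real j) h x = (LINT y|sph_measure. (\<Sum>i\<le>j. real (j choose i) * (h y * (y \<bullet> x) ^ i)))"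
      unfolding riesz_def
    proof (rule integral_cong_AE)
      show "(\<lambda>y. (1 + x \<bullet> y) powr (0 + real j) * h y) \<in> borel_measurable sph_measure"
        using measurable_sph_continuous[OF h] by measurable
      show "(\<lambda>y. \<Sum>i\<le>j. real (j choose i) * (h y * (y \<bullet> x) ^ i)) \<in> borel_measurable sph_measure"
        using measurable_sph_continuous[OF h] by measurable
      show "AE y in sph_measure. (1 + x \<bullet> y) powr (0 + real j) * h y = (\<Sum>i\<le>j. real (j choose i) * (h y * (y \<bullet> x) ^ i))"
        using AE_not_antipode[OF dim x]
      proof (rule AE_mp, intro AE_I2 impI)
        fix y :: 'a assume "-1 < x \<bullet> y"
        then have "(1 + x \<bullet> y) powr (0 + real j) = (y \<bullet> x + 1) ^ j"
          by (simp add: powr_realpow inner_commute add.commute)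
        also have "\<dots> = (\<Sum>i\<le>j. real (j choose i) * (y \<bullet> x) ^ i)"
          by (simp add: binomial_ring)
        finally have "(1 + x \<bullet> y) powr (0 + real j) * h y = (\<Sum>i\<le>j. real (j choose i) * (y \<bullet> x) ^ i * h y)"
          by (simp only: sum_distrib_right)
        also have "\<dots> = (\<Sum>i\<le>j. real (j choose i) * (h y * (y \<bullet> x) ^ i))"
          by (intro sum.cong refl) simp
        finally show "(1 + x \<bullet> y) powr (0 + real j) * h y = (\<Sum>i\<le>j. real (j choose i) * (h y * (y \<bullet> x) ^ i))" .
      qed
    qed
    also have "\<dots> = (\<Sum>i\<le>j. real (j choose i) * (LINT y|sph_measure. h y * (y \<bullet> x) ^ i))"
    proof -
      have "integrable sph_measure (\<lambda>y. h y * (y \<bullet> x) ^ i)" for i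
        by (intro integrable_sph_continuous continuous_intros h)
      then show ?thesis by (subst Bochner_Integration.integral_sum) auto
    qed
    also have "\<dots> = 0" using mom[OF x] by simp
    finally show ?thesis .
  qed
  then have "(\<lambda>j. 0) \<longlonglongrightarrow> h x"
    using riesz_approx_identity[OF dim x order_refl h] by simp
  then show ?thesis by (simp add: LIMSEQ_const_iff)
qed

text \<open>The Gegenbauer polynomials are monic, so the passage from them to the powers of the
  height is triangular and the moments vanish by induction on the degree.\<close>

lemma sph_completeness_gegen:
  fixes h :: "'a::euclidean_space \<Rightarrow> real"
  assumes dim: "DIM('a) \<ge> 4" and h: "continuous_on (sphere 0 1) h"
    and orth: "\<And>k z. z \<in> sphere 0 1 \<Longrightarrow> (LINT y|sph_measure. h y * gegen n k (y \<bullet> z)) = 0"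
    and x: "x \<in> sphere 0 1"
  shows "h x = 0"
proof (rule sph_completeness[OF dim h _ x])
  fix m and z :: 'a assume z: "z \<in> sphere 0 1"
  show "(LINT y|sph_measure. h y * (y \<bullet> z) ^ m) = 0"
  proof (induction m rule: less_induct)
    case (less k)
    have int: "integrable sph_measure (\<lambda>y. h y * (y \<bullet> z) ^ i)" for i
      by (intro integrable_sph_continuous continuous_intros h)
    have "0 = (LINT y|sph_measure. h y * gegen n k (y \<bullet> z))" using orth[OF z] by simp
    also have "\<dots> = (LINT y|sph_measure. (\<Sum>j\<le>k div 2. gegen_coeff n k j * (h y * (y \<bullet> z) ^ (k - 2 * j))))"
      by (simp add: gegen_def sum_distrib_left mult_ac)
    also have "\<dots> = (\<Sum>j\<le>k div 2. gegen_coeff n k j * (LINT y|sph_measure. h y * (y \<bullet> z) ^ (k - 2 * j)))"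
      using int by (subst Bochner_Integration.integral_sum) auto
    also have "\<dots> = (\<Sum>j\<le>k div 2. if j = 0 then (LINT y|sph_measure. h y * (y \<bullet> z) ^ k) else 0)"
    proof (rule sum.cong[OF refl])
      fix j assume j: "j \<in> {..k div 2}"
      show "gegen_coeff n k j * (LINT y|sph_measure. h y * (y \<bullet> z) ^ (k - 2 * j))
          = (if j = 0 then (LINT y|sph_measure. h y * (y \<bullet> z) ^ k) else 0)"
      proof (cases "j = 0")
        case False
        then have "k - 2 * j < k" using j by auto
        from less.IH[OF this] show ?thesis using False by simp
      qed simp
    qed
    also have "\<dots> = (LINT y|sph_measure. h y * (y \<bullet> z) ^ k)" by (simp add: sum.delta)
    finally show ?case by simp
  qed
qed

text \<open>For the eigenvalue k (k + n - 1) the radicand is a perfect square, and B becomes k + (n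
  - 1)/2.\<close>

lemma Ps_mult_sph_eig:
  assumes n: "n \<ge> 1"
  shows "Ps_mult n s (sph_eig n k) = Gamma (n / 2 + s + real k) / Gamma (n / 2 - s + real k)"
proof -
  have "sph_eig n k + ((n - 1) / 2)\<^sup>2 = (real k + (n - 1) / 2)\<^sup>2"
    by (simp add: sph_eig_def power2_eq_square field_simps)
  moreover have "real k + (n - 1) / 2 \<ge> 0" using n by simp
  ultimately have "sqrt (sph_eig n k + ((n - 1) / 2)\<^sup>2) = real k + (n - 1) / 2" by simp
  moreover have "real k + (n - 1) / 2 + 1 / 2 + s = n / 2 + s + real k"
    "real k + (n - 1) / 2 + 1 / 2 - s = n / 2 - s + real k" by (simp_all add: field_simps)
  ultimately show ?thesis unfolding Ps_mult_def Let_def by (simp only:)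
qed

text \<open>Passing from k to k + 1 multiplies the Gamma quotient by a/b, by the functional equation
  of Gamma, and \<open>riesz_ratio\<close> by -b/a. The product keeps its value at k = 0, so the two
  multipliers are inverse up to a constant.\<close>

lemma Ps_mult_riesz_ratio:
  assumes n: "n \<ge> 1" and s: "0 < s" "s < n / 2"
  shows "Ps_mult n s (sph_eig n k) * ((-1) ^ k * riesz_ratio n k (s - n / 2)) = d_ns n s"
    and "Ps_mult n s (sph_eig n k) > 0"
proof -
  have p: "n / 2 - s > 0" "n / 2 + s > 0" using n s by simp_all
  have Gs: "Gamma (b + real (Suc k)) = (b + real k) * Gamma (b + real k)" if "b > 0" for b :: real and k
  proof -
    have "b + real k > 0" using that by (simp add: add_pos_nonneg)
    then have "b + real k \<notin> \<int>\<^sub>\<le>\<^sub>0" by (meson nonpos_Ints_nonpos not_less)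
    from Gamma_plus1[OF this] have "Gamma (b + real k + 1) = (b + real k) * Gamma (b + real k)" .
    moreover have "b + real (Suc k) = b + real k + 1" by simp
    ultimately show ?thesis by (simp only:)
  qed
  have Gp: "Gamma (b + real k) > 0" if "b > 0" for b :: real and k
    by (rule Gamma_real_pos) (use that in \<open>simp add: add_pos_nonneg\<close>)
  show "Ps_mult n s (sph_eig n k) > 0"
    unfolding Ps_mult_sph_eig[OF n] using Gp p by simp
  show "Ps_mult n s (sph_eig n k) * ((-1) ^ k * riesz_ratio n k (s - n / 2)) = d_ns n s"
    unfolding Ps_mult_sph_eig[OF n]
  proof (induction k)
    case 0
    then show ?case by (simp add: riesz_ratio_def d_ns_def)
  next
    case (Suc k)
    define P where "P = Gamma (n / 2 + s + real k)"
    define M where "M = Gamma (n / 2 - s + real k)"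
    define r where "r = riesz_ratio n k (s - n / 2)"
    define a where "a = n / 2 + s + real k"
    define b where "b = n / 2 - s + real k"
    have ab: "a > 0" "b > 0" "M > 0" unfolding a_def b_def M_def using p Gp by (auto simp: add_pos_nonneg)
    have r: "riesz_ratio n (Suc k) (s - n / 2) = r * (- b / a)"
    proof -
      have "s - n / 2 - real k = - b" "s - n / 2 + n + real k = a" by (simp_all add: a_def b_def field_simps)
      then show ?thesis by (simp add: riesz_ratio_def r_def)
    qed
    have "Gamma (n / 2 + s + real (Suc k)) = a * P" "Gamma (n / 2 - s + real (Suc k)) = b * M"
      unfolding a_def b_def P_def M_def using Gs p by blast+
    then have "Gamma (n / 2 + s + real (Suc k)) / Gamma (n / 2 - s + real (Suc k))
        * ((-1) ^ Suc k * riesz_ratio n (Suc k) (s - n / 2))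
      = a * P / (b * M) * ((-1) ^ Suc k * (r * (- b / a)))" unfolding r by simp
    also have "\<dots> = P / M * ((-1) ^ k * r)" using ab by simp
    finally show ?case using Suc.IH by (simp add: P_def M_def r_def)
  qed
qed

lemma d_ns_pos: "n \<ge> 1 \<Longrightarrow> 0 < s \<Longrightarrow> s < n / 2 \<Longrightarrow> d_ns n s > 0"
  unfolding d_ns_def by (intro divide_pos_pos Gamma_real_pos) auto

text \<open>Fractional powers of the conformal Laplacian are inverted by Riesz potentials: both sides
  have the same moments against all zonal harmonics.\<close>

theorem weak_sol_integral_equation:
  fixes u :: "'a::euclidean_space \<Rightarrow> real" and e :: 'a
  assumes dim: "DIM('a) \<ge> 4"
  defines "n \<equiv> real DIM('a) - 1"
  assumes s: "0 < s" "s < n / 2" and u: "continuous_on (sphere 0 1) u"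
    and g: "continuous_on (sphere 0 1) g" and g_eq: "\<And>x. x \<in> sphere 0 1 \<Longrightarrow> g x = f (u x) + d_ns n s * u x"
    and sol: "weak_sol s f u" and e: "e \<in> sphere 0 1" and x: "x \<in> sphere 0 1"
  shows "u x = 1 / (rpot (s - n / 2) (\<lambda>_. 1) e * d_ns n s) * rpot (s - n / 2) g x"
proof -
  define \<beta> where "\<beta> = s - n / 2"
  have dim3: "DIM('a) \<ge> 3" using dim by simp
  have n3: "n \<ge> 3" "n \<ge> 1" using dim by (simp_all add: n_def)
  have \<beta>: "\<beta> > - n / 2" "\<beta> \<le> 0" using s by (simp_all add: \<beta>_def)
  have \<beta>': "\<beta> > - (real DIM('a) - 1) / 2" using \<beta>(1) by (simp add: n_def)
  define E where "E = rpot \<beta> (\<lambda>_. 1) e"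
  have E: "E > 0" unfolding E_def by (rule rpot_mass_pos[OF dim e \<beta>'])
  have d: "d_ns n s > 0" by (rule d_ns_pos[OF n3(2) s])
  obtain G where G: "G > 0" "\<And>y. y \<in> sphere 0 1 \<Longrightarrow> \<bar>g y\<bar> \<le> G"
    using bounded_on_sphere[OF g] by blast
  have gm: "g \<in> borel_measurable sph_measure" by (rule measurable_sph_continuous[OF g])
  define h where "h y = u y - 1 / (E * d_ns n s) * rpot \<beta> g y" for y
  have pc: "continuous_on (sphere 0 1) (rpot \<beta> g)"
    by (rule continuous_on_rpot[OF dim \<beta>' \<beta>(2) gm G(2)])
  have hc: "continuous_on (sphere 0 1) h"
    unfolding h_def by (intro continuous_intros u pc)
  have "h x = 0"
  proof (rule sph_completeness_gegen[OF dim hc _ x, where n=n])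
    fix k and z :: 'a assume z: "z \<in> sphere 0 1"
    define \<phi> where "\<phi> y = gegen n k (y \<bullet> z)" for y
    have eig: "sph_eigenfn (sph_eig n k) \<phi>"
      unfolding \<phi>_def n_def by (rule sph_eigenfn_gegen[OF z dim3])
    have \<phi>c: "continuous_on (sphere 0 1) \<phi>"
      using eig by (intro C2_hom_ext_continuous) (simp add: sph_eigenfn_def)
    obtain F where F: "F > 0" "\<And>y. y \<in> sphere 0 1 \<Longrightarrow> \<bar>\<phi> y\<bar> \<le> F"
      using bounded_on_sphere[OF \<phi>c] by blast
    have \<phi>m: "\<phi> \<in> borel_measurable sph_measure" by (rule measurable_sph_continuous[OF \<phi>c])
    let ?P = "Ps_mult n s (sph_eig n k)"
    have P: "?P > 0" by (rule Ps_mult_riesz_ratio(2)[OF n3(2) s])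
    have ug: "?P * (LINT y|sph_measure. u y * \<phi> y) = (LINT y|sph_measure. g y * \<phi> y)"
    proof -
      have "?P * sph_int (\<lambda>x. u x * \<phi> x) = sph_int (\<lambda>x. (f (u x) + d_ns n s * u x) * \<phi> x)"
        using sol eig unfolding weak_sol_def n_def by blast
      moreover have "sph_int (\<lambda>x. u x * \<phi> x) = real DIM('a) * (LINT y|sph_measure. u y * \<phi> y)"
        by (intro sph_int_eq_integral continuous_intros u \<phi>c)
      moreover have "sph_int (\<lambda>x. (f (u x) + d_ns n s * u x) * \<phi> x) = real DIM('a) * (LINT y|sph_measure. g y * \<phi> y)"
      proof -
        have gc: "continuous_on (sphere 0 1) (\<lambda>x. g x * \<phi> x)" by (intro continuous_intros g \<phi>c)
        have "continuous_on (sphere 0 1) (\<lambda>x. (f (u x) + d_ns n s * u x) * \<phi> x)"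
          by (rule continuous_on_eq[OF gc]) (use g_eq in simp)
        then have "sph_int (\<lambda>x. (f (u x) + d_ns n s * u x) * \<phi> x)
            = real DIM('a) * (LINT x|sph_measure. (f (u x) + d_ns n s * u x) * \<phi> x)"
          by (rule sph_int_eq_integral)
        also have "(LINT x|sph_measure. (f (u x) + d_ns n s * u x) * \<phi> x) = (LINT y|sph_measure. g y * \<phi> y)"
          by (rule Bochner_Integration.integral_cong) (use g_eq in auto)
        finally show ?thesis .
      qed
      ultimately have "real DIM('a) * (?P * (LINT y|sph_measure. u y * \<phi> y)) = real DIM('a) * (LINT y|sph_measure. g y * \<phi> y)"
        by (simp only: mult.left_commute)
      then show ?thesis by simp
    qed
    \<comment> \<open>The kernel singular on the diagonal is the antipodal one evaluated at -y,
      hence the parity factor (-1)^k next to the common mass \<open>E\<close>.\<close>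
    have pot\<phi>: "rpot \<beta> \<phi> y = E * ((-1) ^ k * riesz_ratio n k \<beta>) * \<phi> y" if y: "y \<in> sphere 0 1" for y
    proof -
      have "rpot \<beta> \<phi> y = riesz \<beta> (\<lambda>_. 1) (- y) * riesz_ratio n k \<beta> * \<phi> (- y)"
        unfolding rpot_eq_riesz
        by (rule riesz_eigenvalue[OF dim minus_sphere[OF y], folded n_def, OF eig \<beta>(1)])
      also have "riesz \<beta> (\<lambda>_. 1) (- y) = E"
        unfolding E_def rpot_eq_riesz by (rule riesz_mass_const[OF dim3 minus_sphere[OF y] minus_sphere[OF e]])
      also have "\<phi> (- y) = (-1) ^ k * \<phi> y" by (simp add: \<phi>_def gegen_minus)
      finally show ?thesis by (simp add: mult_ac)
    qed
    \<comment> \<open>By symmetry the kernel is moved onto the harmonic, where it acts by its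
      eigenvalue; the tested equation \<open>ug\<close> then replaces g by u, and the multipliers
      cancel.\<close>
    have "(LINT y|sph_measure. rpot \<beta> g y * \<phi> y) = (LINT w|sph_measure. (LINT y|sph_measure. (1 - y \<bullet> w) powr \<beta> * \<phi> y) * g w)"
      unfolding rpot_def
      by (rule zonal_fubini[OF dim3, where k="\<lambda>t. (1 - t) powr \<beta>"])
         (use integrable_rpot_kernel[OF dim _ \<beta>'] \<phi>m F(2) gm G(2) in auto)
    also have "\<dots> = (LINT w|sph_measure. E * ((-1) ^ k * riesz_ratio n k \<beta>) * (g w * \<phi> w))"
    proof (rule Bochner_Integration.integral_cong[OF refl])
      fix w :: 'a assume "w \<in> space sph_measure"
      then have w: "w \<in> sphere 0 1" by simp
      have "(LINT y|sph_measure. (1 - y \<bullet> w) powr \<beta> * \<phi> y) = rpot \<beta> \<phi> w"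
        unfolding rpot_def by (simp only: inner_commute)
      then show "(LINT y|sph_measure. (1 - y \<bullet> w) powr \<beta> * \<phi> y) * g w
          = E * ((-1) ^ k * riesz_ratio n k \<beta>) * (g w * \<phi> w)"
        unfolding pot\<phi>[OF w] by (simp only: mult_ac)
    qed
    also have "\<dots> = E * ((-1) ^ k * riesz_ratio n k \<beta>) * (?P * (LINT y|sph_measure. u y * \<phi> y))"
      unfolding ug by (rule integral_mult_right_zero)
    also have "\<dots> = E * (?P * ((-1) ^ k * riesz_ratio n k \<beta>)) * (LINT y|sph_measure. u y * \<phi> y)"
      by (simp only: mult_ac)
    also have "?P * ((-1) ^ k * riesz_ratio n k \<beta>) = d_ns n s"
      unfolding \<beta>_def by (rule Ps_mult_riesz_ratio(1)[OF n3(2) s])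
    finally have pg: "(LINT y|sph_measure. rpot \<beta> g y * \<phi> y) = E * d_ns n s * (LINT y|sph_measure. u y * \<phi> y)" .
    have i1: "integrable sph_measure (\<lambda>y. u y * \<phi> y)" and i2: "integrable sph_measure (\<lambda>y. rpot \<beta> g y * \<phi> y)"
      by (intro integrable_sph_continuous continuous_on_mult u pc \<phi>c)+
    have "(LINT y|sph_measure. h y * \<phi> y)
        = (LINT y|sph_measure. u y * \<phi> y - 1 / (E * d_ns n s) * (rpot \<beta> g y * \<phi> y))"
      unfolding h_def by (simp only: left_diff_distrib mult.assoc)
    also have "\<dots> = (LINT y|sph_measure. u y * \<phi> y) - 1 / (E * d_ns n s) * (LINT y|sph_measure. rpot \<beta> g y * \<phi> y)"
      using i1 i2 by simp
    also have "\<dots> = 0" unfolding pg using E d by simp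
    finally show "(LINT y|sph_measure. h y * gegen n k (y \<bullet> z)) = 0" by (simp add: \<phi>_def)
  qed
  then show ?thesis by (simp add: h_def E_def \<beta>_def)
qed

section \<open>A maximum principle for Riesz potentials\<close>

text \<open>Non-integrability at and beyond the critical exponent -n/2, by contradiction. At \<beta>
  = 1 - n/2 Green's identity reduces to I(\<beta>) = (c^2 - 1) I(\<beta> - 2), where I(a) is the
  integral of the shifted power of exponent a. The left side is bounded below, whereas integrability
  of the exponent -n/2 would force the right side to 0.\<close>

lemma shifted_powr_unbounded:
  fixes x :: "'a::euclidean_space"
  assumes dim: "DIM('a) \<ge> 4" and x: "x \<in> sphere 0 1"
    and \<gamma>: "\<gamma> \<ge> (real DIM('a) - 1) / 2"
  shows "\<exists>j. (LINT y|sph_measure. (harm_shift j + x \<bullet> y) powr (- \<gamma>)) > C"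
proof (rule ccontr)
  assume "\<not> ?thesis"
  then have C: "(LINT y|sph_measure. (harm_shift j + x \<bullet> y) powr (- \<gamma>)) \<le> C" for j
    by (auto simp: not_less)
  define n where "n = real DIM('a) - 1"
  \<comment> \<open>For this exponent the coefficient 2 \<beta> + n - 2 of the middle term vanishes,
    and \<beta> - 1 is the critical exponent.\<close>
  define \<beta> where "\<beta> = 1 - n / 2"
  have n3: "n \<ge> 3" using dim by (simp add: n_def)
  have \<gamma>n: "\<gamma> \<ge> n / 2" using \<gamma> by (simp add: n_def)
  have int: "integrable sph_measure (\<lambda>y. (1 + x \<bullet> y) powr (\<beta> - 1))"
  proof (rule integrable_riesz_kernel_fatou[OF x])
    fix j
    have "(LINT y|sph_measure. (harm_shift j + x \<bullet> y) powr (\<beta> - 1))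
        \<le> (LINT y|sph_measure. 3 powr (\<gamma> - n / 2) * (harm_shift j + x \<bullet> y) powr (- \<gamma>))"
    proof (rule integral_mono)
      show "integrable sph_measure (\<lambda>y. (harm_shift j + x \<bullet> y) powr (\<beta> - 1))"
        by (rule integrable_shifted_powr[OF x harm_shift(1)])
      show "integrable sph_measure (\<lambda>y. 3 powr (\<gamma> - n / 2) * (harm_shift j + x \<bullet> y) powr (- \<gamma>))"
        using integrable_shifted_powr[OF x harm_shift(1)] by simp
      fix y :: 'a assume "y \<in> space sph_measure"
      then have y: "y \<in> sphere 0 1" by simp
      define w where "w = harm_shift j + x \<bullet> y"
      have w: "w > 0" "w \<le> 3"
        using sphere_inner_bounds[OF x y] harm_shift(1,2)[of j] by (simp_all add: w_def)
      have "w powr (\<beta> - 1) = w powr (\<gamma> - n / 2) * w powr (- \<gamma>)"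
        unfolding powr_add[symmetric] by (simp add: \<beta>_def)
      also have "\<dots> \<le> 3 powr (\<gamma> - n / 2) * w powr (- \<gamma>)"
        using w \<gamma>n by (intro mult_right_mono powr_mono2) auto
      finally show "(harm_shift j + x \<bullet> y) powr (\<beta> - 1) \<le> 3 powr (\<gamma> - n / 2) * (harm_shift j + x \<bullet> y) powr (- \<gamma>)"
        by (simp only: w_def)
    qed
    also have "\<dots> = 3 powr (\<gamma> - n / 2) * (LINT y|sph_measure. (harm_shift j + x \<bullet> y) powr (- \<gamma>))"
      by (rule integral_mult_right_zero)
    also have "\<dots> \<le> 3 powr (\<gamma> - n / 2) * C" using C[of j] by (intro mult_left_mono) auto
    finally show "(LINT y|sph_measure. (harm_shift j + x \<bullet> y) powr (\<beta> - 1)) \<le> 3 powr (\<gamma> - n / 2) * C" .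
  qed
  have one: "\<bar>1::real\<bar> \<le> 1" by simp
  have lim: "(\<lambda>j. ((harm_shift j)\<^sup>2 - 1) * (LINT y|sph_measure. (harm_shift j + x \<bullet> y) powr (\<beta> - 2) * 1)) \<longlonglongrightarrow> 0"
    by (rule riesz_error_limit[OF dim x _ one int]) simp
  have lb: "3 powr \<beta> * sph_total TYPE('a)
      \<le> ((harm_shift j)\<^sup>2 - 1) * (LINT y|sph_measure. (harm_shift j + x \<bullet> y) powr (\<beta> - 2) * 1)" for j
  proof -
    let ?I = "\<lambda>a. LINT y|sph_measure. (harm_shift j + x \<bullet> y) powr a * 1"
    have e: "\<beta> + n - 1 = n / 2" "2 * \<beta> + n - 2 = 0" "\<beta> - 1 = - (n / 2)" by (simp_all add: \<beta>_def)
    have alg: "I = c * J" if "(b * m - 0) * I = k * b * 0 * L - c * b * - m * J" "b \<noteq> 0" "m \<noteq> 0"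
      for b m I c J k L :: real
    proof -
      have "(b * m) * I = (b * m) * (c * J)" using that(1) by (simp add: algebra_simps)
      then show ?thesis using that(2,3) by simp
    qed
    have b0: "\<beta> \<noteq> 0" "n / 2 \<noteq> 0" using n3 by (simp_all add: \<beta>_def)
    have "?I \<beta> = ((harm_shift j)\<^sup>2 - 1) * ?I (\<beta> - 2)"
    proof (rule alg[OF _ b0])
      show "(\<beta> * (n / 2) - 0) * ?I \<beta> = harm_shift j * \<beta> * 0 * ?I (\<beta> - 1)
          - ((harm_shift j)\<^sup>2 - 1) * \<beta> * - (n / 2) * ?I (\<beta> - 2)"
        using zonal_powr_green[OF sph_eigenfn_const[of 1] x harm_shift(1)[of j], of \<beta>]
        unfolding n_def[symmetric] e .
    qed
    moreover have "3 powr \<beta> * sph_total TYPE('a) \<le> ?I \<beta>"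
    proof -
      have "3 powr \<beta> * sph_total TYPE('a) = (LINT y|(sph_measure::'a measure). 3 powr \<beta>)" by (simp add: mult.commute)
      also have "\<dots> \<le> (LINT y|sph_measure. (harm_shift j + x \<bullet> y) powr \<beta> * 1)"
      proof (rule integral_mono)
        show "integrable sph_measure (\<lambda>y. (harm_shift j + x \<bullet> y) powr \<beta> * 1)"
          using integrable_shifted_powr[OF x harm_shift(1)] by simp
        fix y :: 'a assume "y \<in> space sph_measure"
        then have y: "y \<in> sphere 0 1" by simp
        have "harm_shift j + x \<bullet> y > 0" "harm_shift j + x \<bullet> y \<le> 3"
          using sphere_inner_bounds[OF x y] harm_shift(1,2)[of j] by simp_all
        moreover have "\<beta> \<le> 0" using n3 by (simp add: \<beta>_def)
        ultimately show "3 powr \<beta> \<le> (harm_shift j + x \<bullet> y) powr \<beta> * 1" by (simp add: powr_mono2')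
      qed simp
      finally show ?thesis .
    qed
    ultimately show ?thesis by simp
  qed
  have "3 powr \<beta> * sph_total TYPE('a) \<le> 0"
    by (rule LIMSEQ_le_const[OF lim]) (use lb in blast)
  moreover have "3 powr \<beta> * sph_total TYPE('a) > 0" using sph_total_pos[where 'a='a] by simp
  ultimately show False by linarith
qed

section \<open>The defect of a power kernel under boosts and its concentration\<close>

lemma powr_diff_bounds:
  fixes a b \<beta> :: real
  assumes "0 < a" "a < b" "\<beta> \<le> 0"
  shows "(b - a) * (- \<beta> * b powr (\<beta> - 1)) \<le> a powr \<beta> - b powr \<beta>"
    and "a powr \<beta> - b powr \<beta> \<le> (b - a) * (- \<beta> * a powr (\<beta> - 1))"
proof -
  have "\<exists>z>a. z < b \<and> b powr \<beta> - a powr \<beta> = (b - a) * (\<beta> * z powr (\<beta> - 1))"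
    by (rule MVT2[OF assms(2)]) (use assms(1) in \<open>auto intro!: derivative_eq_intros\<close>)
  then obtain z where z: "a < z" "z < b" "b powr \<beta> - a powr \<beta> = (b - a) * (\<beta> * z powr (\<beta> - 1))"
    by blast
  have eq: "a powr \<beta> - b powr \<beta> = (b - a) * (- \<beta> * z powr (\<beta> - 1))" using z(3) by simp
  have m: "b powr (\<beta> - 1) \<le> z powr (\<beta> - 1)" "z powr (\<beta> - 1) \<le> a powr (\<beta> - 1)"
    using z assms by (auto intro!: powr_mono2')
  show "(b - a) * (- \<beta> * b powr (\<beta> - 1)) \<le> a powr \<beta> - b powr \<beta>"
    unfolding eq by (rule mult_left_mono[OF mult_left_mono[OF m(1)]]) (use assms in auto)
  show "a powr \<beta> - b powr \<beta> \<le> (b - a) * (- \<beta> * a powr (\<beta> - 1))"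
    unfolding eq by (rule mult_left_mono[OF mult_left_mono[OF m(2)]]) (use assms in auto)
qed

text \<open>A rescaled Riesz kernel minus the potential, up to a constant, of a boost weight centred
  at the same point. For l near 1 it behaves like - \<beta> (1 - l) (1 - t)^(\<beta> - 1), one
  exponent more singular than the Riesz kernel.\<close>

definition boost_defect :: "real \<Rightarrow> real \<Rightarrow> real \<Rightarrow> real" where
  "boost_defect \<beta> l t = (l - l * t) powr \<beta> - (1 - l * t) powr \<beta>"

lemma boost_defect_nonneg:
  assumes "0 < l" "l < 1" "t < 1" "\<beta> \<le> 0"
  shows "boost_defect \<beta> l t \<ge> 0"
proof -
  have "0 < l * (1 - t)" using assms by simp
  then have "l - l * t > 0" by (simp add: algebra_simps)
  then have "(1 - l * t) powr \<beta> \<le> (l - l * t) powr \<beta>" using assms by (intro powr_mono2') auto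
  then show ?thesis by (simp add: boost_defect_def)
qed

lemma boost_defect_measurable [measurable]: "boost_defect \<beta> l \<in> borel_measurable borel"
  unfolding boost_defect_def by measurable

lemma one_minus_mult_pos:
  fixes l t :: real
  assumes "0 < l" "l < 1" "t \<in> {-1..1}"
  shows "1 - l * t > 0"
proof -
  have "l * t \<le> l * 1" using assms by (intro mult_left_mono) auto
  then show ?thesis using assms(2) by linarith
qed

lemma integrable_boost_defect:
  fixes x :: "'a::euclidean_space"
  assumes dim: "DIM('a) \<ge> 4" and x: "x \<in> sphere 0 1" and \<beta>: "\<beta> > - (real DIM('a) - 1) / 2"
    and l: "0 < l" "l < 1"
  shows "integrable sph_measure (\<lambda>y. boost_defect \<beta> l (x \<bullet> y))"
    and "integrable sph_measure (\<lambda>y. (l - l * (x \<bullet> y)) powr \<beta>)"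
    and "integrable sph_measure (\<lambda>y. (1 - l * (x \<bullet> y)) powr \<beta>)"
proof -
  have "(l - l * (x \<bullet> y)) powr \<beta> = l powr \<beta> * (1 - x \<bullet> y) powr \<beta>" if "y \<in> sphere 0 1" for y
  proof -
    have "l - l * (x \<bullet> y) = l * (1 - x \<bullet> y)" by (simp add: algebra_simps)
    then show ?thesis using l sphere_inner_bounds[OF x that] by (simp add: powr_mult)
  qed
  then show 1: "integrable sph_measure (\<lambda>y. (l - l * (x \<bullet> y)) powr \<beta>)"
    using integrable_rpot_kernel[OF dim x \<beta>]
    by (subst Bochner_Integration.integrable_cong[OF refl, where g="\<lambda>y. l powr \<beta> * (1 - x \<bullet> y) powr \<beta>"]) auto
  show 2: "integrable sph_measure (\<lambda>y. (1 - l * (x \<bullet> y)) powr \<beta>)"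
  proof (rule integrable_sph_continuous, intro continuous_intros ballI disjI1)
    fix y :: 'a assume "y \<in> sphere 0 1"
    from one_minus_mult_pos[OF l sphere_inner_bounds[OF x this]]
    show "1 - l * (x \<bullet> y) \<noteq> 0" by simp
  qed
  show "integrable sph_measure (\<lambda>y. boost_defect \<beta> l (x \<bullet> y))"
    unfolding boost_defect_def using 1 2 by (rule Bochner_Integration.integrable_diff)
qed

text \<open>Here the order restriction enters: the defect kernels concentrate at the diagonal because
  the kernel with exponent one less is not integrable.\<close>

lemma boost_defect_concentration:
  fixes x :: "'a::euclidean_space"
  assumes dim: "DIM('a) \<ge> 4" and x: "x \<in> sphere 0 1"
    and \<beta>: "\<beta> > - (real DIM('a) - 1) / 2" "\<beta> \<le> 1 - (real DIM('a) - 1) / 2"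
    and c: "c < 1" and \<epsilon>: "\<epsilon> > 0"
  obtains l where "0 < l" "l < 1" "(LINT y|sph_measure. boost_defect \<beta> l (x \<bullet> y)) > 0"
    "(LINT y|sph_measure. indicator {y. x \<bullet> y \<le> c} y * boost_defect \<beta> l (x \<bullet> y))
      \<le> \<epsilon> * (LINT y|sph_measure. boost_defect \<beta> l (x \<bullet> y))"
proof -
  have "(real DIM('a) - 1) / 2 \<ge> 3 / 2" using dim by simp
  then have \<beta>0: "\<beta> < 0" by (rule order.strict_trans1[OF order.trans[OF \<beta>(2) diff_left_mono]]) simp
  \<comment> \<open>A lower bound for l - l t on the region t \<le> c, valid because l will be at
    least 1/2.\<close>
  define a0 where "a0 = (1 - c) / 2"
  have a0: "a0 > 0" using c by (simp add: a0_def)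
  define C1 where "C1 = - \<beta> * a0 powr (\<beta> - 1) * sph_total TYPE('a)"
  have C1: "C1 \<ge> 0" using \<beta>0 by (simp add: C1_def mult_nonpos_nonneg measure_nonneg)
  have "- (\<beta> - 1) \<ge> (real DIM('a) - 1) / 2" using \<beta>(2) by linarith
  from shifted_powr_unbounded[OF dim minus_sphere[OF x] this, of "C1 / (\<epsilon> * - \<beta>)"]
  obtain j where j: "(LINT y|sph_measure. (harm_shift j + - x \<bullet> y) powr (\<beta> - 1)) > C1 / (\<epsilon> * - \<beta>)"
    by auto
  \<comment> \<open>This choice gives 1 - l t = l (\<open>harm_shift j\<close> - t), so the mean
    value bound for the defect is expressed by the shifted powers whose integrals are
    unbounded.\<close>
  define l where "l = 1 / harm_shift j"
  have hs: "harm_shift j > 1" "harm_shift j \<le> 2" by (rule harm_shift)+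
  have l: "0 < l" "l < 1" "1 / 2 \<le> l" using hs by (auto simp: l_def field_simps)
  have lh: "l * harm_shift j = 1" using hs by (simp add: l_def)
  note int = integrable_boost_defect[OF dim x \<beta>(1) l(1,2)]
  let ?J = "LINT y|sph_measure. (harm_shift j + - x \<bullet> y) powr (\<beta> - 1)"
  have lower: "(1 - l) * (- \<beta> * ?J) \<le> (LINT y|sph_measure. boost_defect \<beta> l (x \<bullet> y))"
  proof -
    have "(1 - l) * (- \<beta> * ?J) = (LINT y|sph_measure. (1 - l) * (- \<beta> * (harm_shift j + - x \<bullet> y) powr (\<beta> - 1)))"
      by (simp only: integral_mult_right_zero)
    also have "\<dots> \<le> (LINT y|sph_measure. boost_defect \<beta> l (x \<bullet> y))"
    proof (rule integral_mono_AE)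
      show "integrable sph_measure (\<lambda>y. (1 - l) * (- \<beta> * (harm_shift j + - x \<bullet> y) powr (\<beta> - 1)))"
        by (intro integrable_mult_right integrable_shifted_powr[OF minus_sphere[OF x] hs(1)])
      show "AE y in sph_measure. (1 - l) * (- \<beta> * (harm_shift j + - x \<bullet> y) powr (\<beta> - 1)) \<le> boost_defect \<beta> l (x \<bullet> y)"
        using AE_not_equal[OF dim x]
      proof (rule AE_mp, intro AE_I2 impI)
        fix y :: 'a assume "y \<in> space sph_measure" and t: "x \<bullet> y < 1"
        then have y: "y \<in> sphere 0 1" by simp
        define t where "t = x \<bullet> y"
        have tb: "t \<in> {-1..1}" "t < 1" using sphere_inner_bounds[OF x y] t by (simp_all add: t_def)
        have "0 < l * (1 - t)" using l tb by simp
        then have a: "0 < l - l * t" by (simp add: algebra_simps)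
        have eqw: "1 - l * t = l * (harm_shift j - t)" using lh by (simp add: algebra_simps)
        have w: "harm_shift j - t > 0" using hs tb by simp
        have "(harm_shift j - t) powr (\<beta> - 1) \<le> (1 - l * t) powr (\<beta> - 1)"
        proof (rule powr_mono2')
          show "1 - l * t \<le> harm_shift j - t" unfolding eqw using w l by simp
          show "1 - l * t > 0" unfolding eqw using w l by simp
        qed (use \<beta>0 in simp)
        then have "(1 - l) * (- \<beta> * (harm_shift j - t) powr (\<beta> - 1)) \<le> (1 - l) * (- \<beta> * (1 - l * t) powr (\<beta> - 1))"
          using \<beta>0 l by (intro mult_left_mono) auto
        also have "\<dots> = ((1 - l * t) - (l - l * t)) * (- \<beta> * (1 - l * t) powr (\<beta> - 1))" by simp
        also have "\<dots> \<le> boost_defect \<beta> l t"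
          unfolding boost_defect_def by (rule powr_diff_bounds(1)[OF a]) (use l \<beta>0 in auto)
        finally show "(1 - l) * (- \<beta> * (harm_shift j + - x \<bullet> y) powr (\<beta> - 1)) \<le> boost_defect \<beta> l (x \<bullet> y)"
          by (simp add: t_def)
      qed
    qed (rule int(1))
    finally show ?thesis .
  qed
  have upper: "(LINT y|sph_measure. indicator {y. x \<bullet> y \<le> c} y * boost_defect \<beta> l (x \<bullet> y)) \<le> (1 - l) * C1"
  proof -
    have "(LINT y|sph_measure. indicator {y. x \<bullet> y \<le> c} y * boost_defect \<beta> l (x \<bullet> y))
        \<le> (LINT y|(sph_measure::'a measure). (1 - l) * (- \<beta> * a0 powr (\<beta> - 1)))"
    proof (rule integral_mono')
      fix y :: 'a assume "y \<in> space sph_measure"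
      then have y: "y \<in> sphere 0 1" by simp
      show nn: "0 \<le> (1 - l) * (- \<beta> * a0 powr (\<beta> - 1))"
        by (intro mult_nonneg_nonneg) (use l \<beta>0 in auto)
      show "indicator {y. x \<bullet> y \<le> c} y * boost_defect \<beta> l (x \<bullet> y) \<le> (1 - l) * (- \<beta> * a0 powr (\<beta> - 1))"
      proof (cases "x \<bullet> y \<le> c")
        case True
        define t where "t = x \<bullet> y"
        have t: "t \<le> c" "t < 1" using True c by (simp_all add: t_def)
        have "1 / 2 * (1 - c) \<le> l * (1 - t)" using l t c by (intro mult_mono) auto
        then have a: "a0 \<le> l - l * t" by (simp add: a0_def algebra_simps)
        then have a': "0 < l - l * t" using a0 by linarith
        have "boost_defect \<beta> l t \<le> ((1 - l * t) - (l - l * t)) * (- \<beta> * (l - l * t) powr (\<beta> - 1))"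
          unfolding boost_defect_def by (rule powr_diff_bounds(2)[OF a']) (use l \<beta>0 in auto)
        also have "\<dots> = (1 - l) * (- \<beta> * (l - l * t) powr (\<beta> - 1))" by simp
        also have "\<dots> \<le> (1 - l) * (- \<beta> * a0 powr (\<beta> - 1))"
          using l \<beta>0 a a0 by (intro mult_left_mono powr_mono2') auto
        finally show ?thesis using True by (simp add: t_def)
      next
        case False
        then show ?thesis using nn by simp
      qed
    qed simp
    also have "\<dots> = (1 - l) * C1" by (simp add: C1_def)
    finally show ?thesis .
  qed
  have "C1 < \<epsilon> * (- \<beta> * ?J)"
  proof -
    have p: "\<epsilon> * - \<beta> > 0" using \<epsilon> \<beta>0 by (intro mult_pos_pos) auto
    then have "\<epsilon> * - \<beta> \<noteq> 0" by linarith
    then have "C1 = C1 / (\<epsilon> * - \<beta>) * (\<epsilon> * - \<beta>)" by (rule nonzero_divide_eq_eq[THEN iffD1, OF _ refl])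
    also have "\<dots> < ?J * (\<epsilon> * - \<beta>)" by (rule mult_strict_right_mono[OF j p])
    finally show ?thesis by (simp only: mult_ac)
  qed
  then have "(1 - l) * C1 < (1 - l) * (\<epsilon> * (- \<beta> * ?J))" by (rule mult_strict_left_mono) (use l in simp)
  also have "\<dots> = \<epsilon> * ((1 - l) * (- \<beta> * ?J))" by (simp only: mult.left_commute)
  also have "\<dots> \<le> \<epsilon> * (LINT y|sph_measure. boost_defect \<beta> l (x \<bullet> y))"
    using lower \<epsilon> by (intro mult_left_mono) auto
  finally have fin: "(1 - l) * C1 < \<epsilon> * (LINT y|sph_measure. boost_defect \<beta> l (x \<bullet> y))" .
  show ?thesis
  proof (rule that[OF l(1,2)])
    have "0 \<le> (1 - l) * C1" using l C1 by simp
    then have "0 < \<epsilon> * (LINT y|sph_measure. boost_defect \<beta> l (x \<bullet> y))" using fin by linarith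
    then show "0 < (LINT y|sph_measure. boost_defect \<beta> l (x \<bullet> y))" using \<epsilon> by (simp add: zero_less_mult_iff)
    show "(LINT y|sph_measure. indicator {y. x \<bullet> y \<le> c} y * boost_defect \<beta> l (x \<bullet> y))
      \<le> \<epsilon> * (LINT y|sph_measure. boost_defect \<beta> l (x \<bullet> y))" using upper fin by linarith
  qed
qed

text \<open>Conformal covariance: the kernel contributes the factor at x and at y to the power
  \<beta>, and the change of variables contributes the n-th power of the factor at y.\<close>

lemma rpot_boost:
  fixes e x :: "'a::euclidean_space" and g :: "'a \<Rightarrow> real"
  assumes dim: "DIM('a) \<ge> 4" and e: "e \<in> sphere 0 1" and l: "\<bar>l\<bar> < 1" and x: "x \<in> sphere 0 1"
    and gm [measurable]: "g \<in> borel_measurable sph_measure"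
  shows "rpot \<beta> g (boost l e x) = boost_factor l e x powr \<beta> *
    rpot \<beta> (\<lambda>y. boost_factor l e y powr (real DIM('a) - 1 + \<beta>) * g (boost l e y)) x"
proof -
  have dim3: "DIM('a) \<ge> 3" using dim by simp
  let ?\<rho> = "boost_factor l e" and ?\<psi> = "boost l e"
  have \<rho>: "?\<rho> y > 0" if "y \<in> sphere 0 1" for y by (rule boost_factor_pos[OF e l that])
  let ?f = "\<lambda>w. (1 - ?\<psi> x \<bullet> w) powr \<beta> * g w"
  have fm: "?f \<in> borel_measurable sph_measure" by measurable
  have "rpot \<beta> g (?\<psi> x) = (LINT y|sph_measure. ?\<rho> y ^ (DIM('a) - 1) * ?f (?\<psi> y))"
    unfolding rpot_def by (rule integral_boost[OF e l dim3 fm, symmetric])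
  also have "\<dots> = (LINT y|sph_measure. ?\<rho> x powr \<beta> *
      ((1 - x \<bullet> y) powr \<beta> * (?\<rho> y powr (real DIM('a) - 1 + \<beta>) * g (?\<psi> y))))"
  proof (rule Bochner_Integration.integral_cong[OF refl])
    fix y :: 'a assume "y \<in> space sph_measure"
    then have y: "y \<in> sphere 0 1" by simp
    have A: "(1 - ?\<psi> x \<bullet> ?\<psi> y) powr \<beta> = ?\<rho> x powr \<beta> * ?\<rho> y powr \<beta> * (1 - x \<bullet> y) powr \<beta>"
      unfolding boost_inner[OF e l x y]
      using \<rho>[OF x] \<rho>[OF y] sphere_inner_bounds[OF x y] by (simp add: powr_mult)
    have B: "?\<rho> y ^ (DIM('a) - 1) * ?\<rho> y powr \<beta> = ?\<rho> y powr (real DIM('a) - 1 + \<beta>)"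
    proof -
      have "?\<rho> y ^ (DIM('a) - 1) = ?\<rho> y powr (real (DIM('a) - 1))"
        using \<rho>[OF y] by (simp only: powr_realpow)
      also have "real (DIM('a) - 1) = real DIM('a) - 1" using dim by simp
      finally show ?thesis by (simp only: powr_add)
    qed
    have "?\<rho> y ^ (DIM('a) - 1) * ?f (?\<psi> y) = ?\<rho> x powr \<beta> *
      ((1 - x \<bullet> y) powr \<beta> * ((?\<rho> y ^ (DIM('a) - 1) * ?\<rho> y powr \<beta>) * g (?\<psi> y)))"
      unfolding A by (simp only: mult_ac)
    then show "?\<rho> y ^ (DIM('a) - 1) * ?f (?\<psi> y) = ?\<rho> x powr \<beta> *
      ((1 - x \<bullet> y) powr \<beta> * (?\<rho> y powr (real DIM('a) - 1 + \<beta>) * g (?\<psi> y)))"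
      unfolding B .
  qed
  also have "\<dots> = ?\<rho> x powr \<beta> * rpot \<beta> (\<lambda>y. ?\<rho> y powr (real DIM('a) - 1 + \<beta>) * g (?\<psi> y)) x"
    unfolding rpot_def by (rule integral_mult_right_zero)
  finally show ?thesis .
qed

text \<open>The operator below multiplies by a constant and subtracts a positive kernel operator;
  applied to a Riesz potential it reproduces the density up to an approximate identity.\<close>

lemma boost_operator:
  fixes x :: "'a::euclidean_space" and H :: "'a \<Rightarrow> real"
  assumes dim: "DIM('a) \<ge> 4" and x: "x \<in> sphere 0 1" and l: "0 < l" "l < 1"
    and \<beta>: "\<beta> > - (real DIM('a) - 1) / 2" "\<beta> \<le> 0"
    and Hm [measurable]: "H \<in> borel_measurable sph_measure" and Hb: "\<And>y. y \<in> sphere 0 1 \<Longrightarrow> \<bar>H y\<bar> \<le> B"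
  defines "E \<equiv> rpot \<beta> (\<lambda>_. 1) x" and "S \<equiv> sqrt (1 - l\<^sup>2) powr (- \<beta>)"
    and "b \<equiv> \<lambda>y. boost_factor l (- x) y powr (real DIM('a) - 1 + \<beta>)"
  shows "E * S * l powr \<beta> * rpot \<beta> H x - (LINT y|sph_measure. rpot \<beta> H y * b y)
    = E * S * (LINT w|sph_measure. boost_defect \<beta> l (x \<bullet> w) * H w)"
proof -
  have dim3: "DIM('a) \<ge> 3" using dim by simp
  have e: "- x \<in> sphere 0 1" by (rule minus_sphere[OF x])
  have l': "\<bar>l\<bar> < 1" using l by simp
  let ?\<rho> = "boost_factor l (- x)"
  have \<rho>: "?\<rho> y > 0" if "y \<in> sphere 0 1" for y by (rule boost_factor_pos[OF e l' that])
  have \<rho>c: "continuous_on (sphere 0 1) ?\<rho>" by (rule continuous_on_boost_factor[OF e l'])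
  have bc: "continuous_on (sphere 0 1) b"
    unfolding b_def by (intro continuous_on_powr \<rho>c continuous_on_const) (use \<rho> in force)
  obtain A where A: "A > 0" "\<And>y. y \<in> sphere 0 1 \<Longrightarrow> \<bar>b y\<bar> \<le> A" using bounded_on_sphere[OF bc] by blast
  have bm: "b \<in> borel_measurable sph_measure" by (rule measurable_sph_continuous[OF bc])
  \<comment> \<open>Covariance applied to the constant density, whose potential is the constant E,
    makes the potential of the weight b explicit. The boost axis is -x, so that b is largest at
    x.\<close>
  have star: "rpot \<beta> b z = E * S * (1 - l * (x \<bullet> z)) powr \<beta>" if z: "z \<in> sphere 0 1" for z
  proof -
    have E: "rpot \<beta> (\<lambda>_. 1) (boost l (- x) z) = E"
      unfolding E_def by (rule rpot_mass_const[OF dim3 boost_sphere[OF e l' z] x])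
    have "E = ?\<rho> z powr \<beta> * rpot \<beta> b z"
      using rpot_boost[OF dim e l' z, of "\<lambda>_. 1" \<beta>] unfolding E b_def by simp
    then have "?\<rho> z powr (- \<beta>) * E = (?\<rho> z powr (- \<beta>) * ?\<rho> z powr \<beta>) * rpot \<beta> b z" by (simp only: mult.assoc)
    also have "?\<rho> z powr (- \<beta>) * ?\<rho> z powr \<beta> = 1"
      using \<rho>[OF z] by (simp flip: powr_add)
    finally have "rpot \<beta> b z = ?\<rho> z powr (- \<beta>) * E" by simp
    also have "?\<rho> z powr (- \<beta>) = S * (1 - l * (x \<bullet> z)) powr \<beta>"
    proof -
      have p: "1 - l * (x \<bullet> z) > 0" by (rule one_minus_mult_pos[OF l sphere_inner_bounds[OF x z]])
      have "?\<rho> z = sqrt (1 - l\<^sup>2) / (1 - l * (x \<bullet> z))" by (simp add: boost_factor_def inner_commute)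
      then have "?\<rho> z powr (- \<beta>) = S / (1 - l * (x \<bullet> z)) powr (- \<beta>)"
        using p boost_sqrt_pos(1)[OF e l'] by (simp add: S_def powr_divide)
      also have "\<dots> = S * (1 - l * (x \<bullet> z)) powr \<beta>" by (simp add: powr_minus divide_inverse)
      finally show ?thesis .
    qed
    finally show ?thesis by (simp only: mult_ac)
  qed
  have "(LINT y|sph_measure. rpot \<beta> H y * b y) = (LINT w|sph_measure. (LINT y|sph_measure. (1 - y \<bullet> w) powr \<beta> * b y) * H w)"
    unfolding rpot_def
    by (rule zonal_fubini[OF dim3, where k="\<lambda>t. (1 - t) powr \<beta>"])
       (use integrable_rpot_kernel[OF dim _ \<beta>(1)] bm A(2) Hm Hb in auto)
  also have "\<dots> = (LINT w|sph_measure. E * S * ((1 - l * (x \<bullet> w)) powr \<beta> * H w))"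
  proof (rule Bochner_Integration.integral_cong[OF refl])
    fix w :: 'a assume "w \<in> space sph_measure"
    then have w: "w \<in> sphere 0 1" by simp
    have "(LINT y|sph_measure. (1 - y \<bullet> w) powr \<beta> * b y) = rpot \<beta> b w"
      unfolding rpot_def by (simp only: inner_commute)
    then show "(LINT y|sph_measure. (1 - y \<bullet> w) powr \<beta> * b y) * H w = E * S * ((1 - l * (x \<bullet> w)) powr \<beta> * H w)"
      unfolding star[OF w] by (simp only: mult.assoc)
  qed
  also have "\<dots> = E * S * (LINT w|sph_measure. (1 - l * (x \<bullet> w)) powr \<beta> * H w)" by (rule integral_mult_right_zero)
  finally have Bz: "(LINT y|sph_measure. rpot \<beta> H y * b y) = E * S * (LINT w|sph_measure. (1 - l * (x \<bullet> w)) powr \<beta> * H w)" .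
  have Az: "l powr \<beta> * rpot \<beta> H x = (LINT w|sph_measure. (l - l * (x \<bullet> w)) powr \<beta> * H w)"
  proof -
    have "l powr \<beta> * rpot \<beta> H x = (LINT w|sph_measure. l powr \<beta> * ((1 - x \<bullet> w) powr \<beta> * H w))"
      unfolding rpot_def by (rule integral_mult_right_zero[symmetric])
    also have "\<dots> = (LINT w|sph_measure. (l - l * (x \<bullet> w)) powr \<beta> * H w)"
    proof (rule Bochner_Integration.integral_cong[OF refl])
      fix w :: 'a assume "w \<in> space sph_measure"
      then have "x \<bullet> w \<in> {-1..1}" by (intro sphere_inner_bounds[OF x]) simp
      moreover have "l - l * (x \<bullet> w) = l * (1 - x \<bullet> w)" by (simp add: algebra_simps)
      ultimately have "(l - l * (x \<bullet> w)) powr \<beta> = l powr \<beta> * (1 - x \<bullet> w) powr \<beta>"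
        using l by (simp add: powr_mult)
      then show "l powr \<beta> * ((1 - x \<bullet> w) powr \<beta> * H w) = (l - l * (x \<bullet> w)) powr \<beta> * H w" by (simp only: mult.assoc)
    qed
    finally show ?thesis .
  qed
  have i1: "integrable sph_measure (\<lambda>w. (l - l * (x \<bullet> w)) powr \<beta> * H w)"
    by (rule integrable_zonal_times_bounded[where k="\<lambda>t. (l - l * t) powr \<beta>", OF integrable_boost_defect(2)[OF dim x \<beta>(1) l] Hm Hb])
  have i2: "integrable sph_measure (\<lambda>w. (1 - l * (x \<bullet> w)) powr \<beta> * H w)"
    by (rule integrable_zonal_times_bounded[where k="\<lambda>t. (1 - l * t) powr \<beta>", OF integrable_boost_defect(3)[OF dim x \<beta>(1) l] Hm Hb])
  have "E * S * l powr \<beta> * rpot \<beta> H x - (LINT y|sph_measure. rpot \<beta> H y * b y)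
      = E * S * ((LINT w|sph_measure. (l - l * (x \<bullet> w)) powr \<beta> * H w) - (LINT w|sph_measure. (1 - l * (x \<bullet> w)) powr \<beta> * H w))"
    unfolding Bz mult.assoc Az by (simp only: right_diff_distrib mult.assoc)
  also have "(LINT w|sph_measure. (l - l * (x \<bullet> w)) powr \<beta> * H w) - (LINT w|sph_measure. (1 - l * (x \<bullet> w)) powr \<beta> * H w)
      = (LINT w|sph_measure. boost_defect \<beta> l (x \<bullet> w) * H w)"
    unfolding boost_defect_def left_diff_distrib using i1 i2 by simp
  finally show ?thesis .
qed

lemma inner_sph_refl: "x \<bullet> sph_refl e y = x \<bullet> y - 2 * (y \<bullet> e) * (x \<bullet> e)"
  by (simp add: sph_refl_def inner_diff_right)

text \<open>The boost operator is applied at a negative minimum x0 of the potential z on the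
  half-sphere. Antisymmetry and the monotonicity of b under reflection bound its value by the
  negative number z(x0) S D, with D the mass of the defect kernel. On the density side the same
  value is at least -E S B \<epsilon> D, because H \<ge> 0 near x0 and the defect gathers there; a
  small \<epsilon> is a contradiction. The exponent bound enters through this concentration.\<close>

lemma maximum_principle:
  fixes e :: "'a::euclidean_space" and H :: "'a \<Rightarrow> real"
  assumes dim: "DIM('a) \<ge> 4" and e: "e \<in> sphere 0 1"
    and \<beta>: "\<beta> > - (real DIM('a) - 1) / 2" "\<beta> \<le> 1 - (real DIM('a) - 1) / 2"
    and Hm [measurable]: "H \<in> borel_measurable sph_measure" and Hb: "\<And>y. y \<in> sphere 0 1 \<Longrightarrow> \<bar>H y\<bar> \<le> B"
    and anti: "\<And>y. y \<in> sphere 0 1 \<Longrightarrow> rpot \<beta> H (sph_refl e y) = - rpot \<beta> H y"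
    and super: "\<And>y. y \<in> sphere 0 1 \<Longrightarrow> y \<bullet> e > 0 \<Longrightarrow> rpot \<beta> H y < 0 \<Longrightarrow> H y \<ge> 0"
    and x: "x \<in> sphere 0 1" "x \<bullet> e \<ge> 0"
  shows "rpot \<beta> H x \<ge> 0"
proof (rule ccontr)
  assume neg: "\<not> rpot \<beta> H x \<ge> 0"
  have dim3: "DIM('a) \<ge> 3" using dim by simp
  have "(real DIM('a) - 1) / 2 \<ge> 3 / 2" using dim by simp
  then have "\<beta> < 0" by (rule order.strict_trans1[OF order.trans[OF \<beta>(2) diff_left_mono]]) simp
  then have \<beta>0: "\<beta> \<le> 0" "\<beta> < 0" by simp_all
  have B0: "B \<ge> 0" using Hb[OF e] by linarith
  define z where "z = rpot \<beta> H"
  have zc: "continuous_on (sphere 0 1) z" unfolding z_def by (rule continuous_on_rpot[OF dim \<beta>(1) \<beta>0(1) Hm Hb])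
  define \<Omega> where "\<Omega> = sphere 0 1 \<inter> {y. y \<bullet> e \<ge> 0}"
  have \<Omega>c: "compact \<Omega>"
    unfolding \<Omega>_def by (intro compact_Int_closed closed_Collect_le continuous_intros) auto
  have x\<Omega>: "x \<in> \<Omega>" using x by (simp add: \<Omega>_def)
  have "continuous_on \<Omega> z" by (rule continuous_on_subset[OF zc]) (auto simp: \<Omega>_def)
  then have "\<exists>x0\<in>\<Omega>. \<forall>y\<in>\<Omega>. z x0 \<le> z y" using \<Omega>c x\<Omega> by (intro continuous_attains_inf) auto
  then obtain x0 where x0: "x0 \<in> \<Omega>" "\<And>y. y \<in> \<Omega> \<Longrightarrow> z x0 \<le> z y" by blast
  have z0: "z x0 < 0" using x0(2)[OF x\<Omega>] neg by (simp add: z_def)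
  have x0s: "x0 \<in> sphere 0 1" "x0 \<bullet> e \<ge> 0" using x0(1) by (simp_all add: \<Omega>_def)
  have x0e: "x0 \<bullet> e > 0"
  proof (rule ccontr)
    assume "\<not> x0 \<bullet> e > 0"
    then have "x0 \<bullet> e = 0" using x0s by simp
    then have "sph_refl e x0 = x0" by (simp add: sph_refl_def)
    then show False using anti[OF x0s(1)] z0 by (simp add: z_def)
  qed
  have "\<exists>d>0. \<forall>y\<in>sphere 0 1. dist y x0 < d \<longrightarrow> dist (z y) (z x0) < - z x0"
    using zc[unfolded continuous_on_iff, rule_format, OF x0s(1), of "- z x0"] z0 by auto
  then obtain d1 where d1: "d1 > 0" "\<And>y. y \<in> sphere 0 1 \<Longrightarrow> dist y x0 < d1 \<Longrightarrow> dist (z y) (z x0) < - z x0" by blast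
  \<comment> \<open>Within this distance of x0 the potential stays negative and the point stays on
    the positive side of the mirror, so \<open>super\<close> applies.\<close>
  define d where "d = min d1 (x0 \<bullet> e)"
  have d: "d > 0" using d1 x0e by (simp add: d_def)
  define c where "c = 1 - d\<^sup>2 / 2"
  have c: "c < 1" using d by (simp add: c_def)
  have near: "H y \<ge> 0" if y: "y \<in> sphere 0 1" "x0 \<bullet> y > c" for y
  proof -
    have "(dist y x0)\<^sup>2 < d\<^sup>2" unfolding sphere_dist_square[OF x0s(1) y(1)] using y(2) by (simp add: c_def)
    then have dd: "dist y x0 < d" using d by (simp add: power2_less_imp_less)
    then have "dist (z y) (z x0) < - z x0" using d1(2)[OF y(1)] by (simp add: d_def)
    then have "z y < 0" by (simp add: dist_real_def abs_less_iff)
    moreover have "y \<bullet> e > 0"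
    proof -
      have "\<bar>(y - x0) \<bullet> e\<bar> \<le> norm (y - x0) * norm e" by (rule Cauchy_Schwarz_ineq2)
      then have "\<bar>y \<bullet> e - x0 \<bullet> e\<bar> \<le> dist y x0" using e by (simp add: inner_diff_left dist_norm)
      moreover have "dist y x0 < x0 \<bullet> e" using dd by (simp add: d_def)
      ultimately show ?thesis by linarith
    qed
    ultimately show ?thesis using super[OF y(1)] by (simp add: z_def)
  qed
  define E where "E = rpot \<beta> (\<lambda>_. 1) x0"
  have E: "E > 0" unfolding E_def by (rule rpot_mass_pos[OF dim x0s(1) \<beta>(1)])
  \<comment> \<open>Chosen to give E B \<epsilon> < - z(x0); the summand 1 covers the case B =
    0.\<close>
  define \<epsilon> where "\<epsilon> = - z x0 / (2 * (E * B + 1))"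
  have EB: "E * B + 1 > 0" using E B0 by (simp add: add_nonneg_pos)
  have \<epsilon>: "\<epsilon> > 0" unfolding \<epsilon>_def by (intro divide_pos_pos mult_pos_pos EB) (use z0 in simp_all)
  obtain l where l: "0 < l" "l < 1" "(LINT y|sph_measure. boost_defect \<beta> l (x0 \<bullet> y)) > 0"
    "(LINT y|sph_measure. indicator {y. x0 \<bullet> y \<le> c} y * boost_defect \<beta> l (x0 \<bullet> y))
      \<le> \<epsilon> * (LINT y|sph_measure. boost_defect \<beta> l (x0 \<bullet> y))"
    by (rule boost_defect_concentration[OF dim x0s(1) \<beta> c \<epsilon>])
  define D where "D = (LINT y|sph_measure. boost_defect \<beta> l (x0 \<bullet> y))"
  define S where "S = sqrt (1 - l\<^sup>2) powr (- \<beta>)"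
  have e0: "- x0 \<in> sphere 0 1" by (rule minus_sphere[OF x0s(1)])
  have l': "\<bar>l\<bar> < 1" using l by simp
  have sq: "sqrt (1 - l\<^sup>2) > 0" by (rule boost_sqrt_pos(1)[OF e0 l'])
  have S: "S > 0" unfolding S_def using sq by simp
  define p where "p = real DIM('a) - 1 + \<beta>"
  have p: "p \<ge> 0" using \<beta>(1) dim by (simp add: p_def field_simps)
  define b where "b y = boost_factor l (- x0) y powr p" for y
  have beq: "b y = (sqrt (1 - l\<^sup>2) / (1 - l * (x0 \<bullet> y))) powr p" for y
    by (simp add: b_def boost_factor_def inner_commute)
  have \<rho>: "boost_factor l (- x0) y > 0" if "y \<in> sphere 0 1" for y by (rule boost_factor_pos[OF e0 l' that])
  have bc: "continuous_on (sphere 0 1) b"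
    unfolding b_def by (intro continuous_on_powr continuous_on_boost_factor[OF e0 l'] continuous_on_const) (use \<rho> in force)
  have bm: "b \<in> borel_measurable sph_measure" by (rule measurable_sph_continuous[OF bc])
  have b0: "b y \<ge> 0" for y by (simp add: b_def)
  have op1: "E * S * l powr \<beta> * z x0 - (LINT y|sph_measure. z y * b y)
      = E * S * (LINT w|sph_measure. boost_defect \<beta> l (x0 \<bullet> w) * H w)"
    unfolding E_def S_def z_def b_def p_def by (rule boost_operator[OF dim x0s(1) l(1,2) \<beta>(1) \<beta>0(1) Hm Hb])
  have one: "\<bar>1::real\<bar> \<le> 1" by simp
  \<comment> \<open>The operator identity for the density 1 evaluates the mass of b in terms of
    D.\<close>
  have op2: "E * (S * l powr \<beta> * E - (LINT y|sph_measure. b y)) = E * (S * D)"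
  proof -
    have "E * S * l powr \<beta> * rpot \<beta> (\<lambda>_. 1) x0 - (LINT y|sph_measure. rpot \<beta> (\<lambda>_. 1) y * b y)
        = E * S * (LINT w|sph_measure. boost_defect \<beta> l (x0 \<bullet> w) * 1)"
      unfolding E_def S_def b_def p_def by (rule boost_operator[OF dim x0s(1) l(1,2) \<beta>(1) \<beta>0(1) _ one]) simp
    moreover have "(LINT y|sph_measure. rpot \<beta> (\<lambda>_. 1) y * b y) = (LINT y|sph_measure. E * b y)"
      unfolding E_def
      by (rule Bochner_Integration.integral_cong[OF refl]) (simp add: rpot_mass_const[OF dim3 _ x0s(1)])
    ultimately show ?thesis by (simp add: D_def E_def[symmetric] algebra_simps)
  qed
  then have mass: "S * l powr \<beta> * E - (LINT y|sph_measure. b y) = S * D" using E by simp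
  have zm: "z \<in> borel_measurable sph_measure" by (rule measurable_sph_continuous[OF zc])
  let ?R = "sph_refl e"
  have Rs: "?R y \<in> sphere 0 1" if "y \<in> sphere 0 1" for y by (rule sph_refl_sphere[OF e that])
  \<comment> \<open>On the positive side y has the larger inner product with x0 than its mirror
    image, and b increases with this inner product.\<close>
  have bmono: "b (?R y) \<le> b y" if y: "y \<in> sphere 0 1" "y \<bullet> e \<ge> 0" for y
  proof -
    have le: "x0 \<bullet> ?R y \<le> x0 \<bullet> y" unfolding inner_sph_refl using y(2) x0s(2) by simp
    have pos: "1 - l * (x0 \<bullet> y) > 0" by (rule one_minus_mult_pos[OF l(1,2) sphere_inner_bounds[OF x0s(1) y(1)]])
    have "1 - l * (x0 \<bullet> y) \<le> 1 - l * (x0 \<bullet> ?R y)" using le l by simp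
    then have "sqrt (1 - l\<^sup>2) / (1 - l * (x0 \<bullet> ?R y)) \<le> sqrt (1 - l\<^sup>2) / (1 - l * (x0 \<bullet> y))"
      using pos sq by (intro divide_left_mono mult_pos_pos) auto
    moreover have "sqrt (1 - l\<^sup>2) / (1 - l * (x0 \<bullet> ?R y)) \<ge> 0"
      using pos \<open>1 - l * (x0 \<bullet> y) \<le> 1 - l * (x0 \<bullet> ?R y)\<close> sq by (intro divide_nonneg_pos) auto
    ultimately show ?thesis unfolding beq using p by (intro powr_mono2)
  qed
  have pt: "z x0 * (b y + b (?R y)) \<le> (b y - b (?R y)) * z y" if y: "y \<in> sphere 0 1" "y \<bullet> e \<ge> 0" for y
  proof -
    have "z x0 \<le> z y" using x0(2)[of y] y by (simp add: \<Omega>_def)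
    then have "(b y - b (?R y)) * z x0 \<le> (b y - b (?R y)) * z y" using bmono[OF y] by (intro mult_left_mono) auto
    moreover have "(b y + b (?R y)) * z x0 \<le> (b y - b (?R y)) * z x0"
      using b0[of "?R y"] z0 by (intro mult_right_mono_neg) auto
    ultimately show ?thesis by (simp only: mult.commute[of "z x0"])
  qed
  have bRc: "continuous_on (sphere 0 1) (\<lambda>y. b (?R y))"
    by (rule continuous_on_compose2[OF bc continuous_on_sph_refl[OF e]]) (use Rs in auto)
  have ints: "integrable sph_measure b" "integrable sph_measure (\<lambda>y. b (?R y))"
    "integrable sph_measure (\<lambda>y. b y * z y)" "integrable sph_measure (\<lambda>y. b (?R y) * z y)"
    by (intro integrable_sph_continuous continuous_on_mult bc bRc zc)+
  \<comment> \<open>Both integrals are symmetrised under the reflection: b and its reflection have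
    equal mass, and antisymmetry of z doubles the integral of z b. This reduces the claim to the
    pointwise bound \<open>pt\<close> on one half-sphere.\<close>
  have "2 * (z x0 * integral\<^sup>L sph_measure b) = (LINT y|sph_measure. z x0 * (b y + b (?R y)))"
  proof -
    have "(LINT y|sph_measure. b (?R y)) = integral\<^sup>L sph_measure b" by (rule integral_sph_refl[OF e dim3 bm])
    then show ?thesis using ints by (simp add: algebra_simps)
  qed
  also have "\<dots> \<le> (LINT y|sph_measure. (b y - b (?R y)) * z y)"
  proof (rule integral_mono)
    show "integrable sph_measure (\<lambda>y. z x0 * (b y + b (?R y)))" using ints by simp
    show "integrable sph_measure (\<lambda>y. (b y - b (?R y)) * z y)" unfolding left_diff_distrib using ints by simp
    fix y :: 'a assume "y \<in> space sph_measure"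
    then have y: "y \<in> sphere 0 1" by simp
    show "z x0 * (b y + b (?R y)) \<le> (b y - b (?R y)) * z y"
    proof (cases "y \<bullet> e \<ge> 0")
      case True then show ?thesis by (rule pt[OF y])
    next
      case False
      then have "?R y \<bullet> e \<ge> 0" by (simp add: sph_refl_inner_axis[OF e])
      from pt[OF Rs[OF y] this]
      have "z x0 * (b (?R y) + b y) \<le> (b (?R y) - b y) * z (?R y)" by (simp add: sph_refl_refl[OF e])
      also have "z (?R y) = - z y" unfolding z_def by (rule anti[OF y])
      finally show ?thesis by (simp add: algebra_simps)
    qed
  qed
  also have "\<dots> = 2 * (LINT y|sph_measure. z y * b y)"
  proof -
    have "(LINT y|sph_measure. b (?R y) * z y) = (LINT y|sph_measure. - (b (?R y) * z (?R y)))"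
      by (rule Bochner_Integration.integral_cong[OF refl]) (simp add: z_def anti)
    also have "\<dots> = - (LINT y|sph_measure. b (?R y) * z (?R y))" by simp
    also have "(LINT y|sph_measure. b (?R y) * z (?R y)) = (LINT y|sph_measure. b y * z y)"
      by (rule integral_sph_refl[OF e dim3, where f="\<lambda>y. b y * z y"]) (rule borel_measurable_times[OF bm zm])
    finally show ?thesis unfolding left_diff_distrib using ints by (simp add: mult.commute)
  qed
  finally have Bz: "z x0 * integral\<^sup>L sph_measure b \<le> (LINT y|sph_measure. z y * b y)" by simp
  have "E * S * (LINT w|sph_measure. boost_defect \<beta> l (x0 \<bullet> w) * H w) \<le> z x0 * (S * D)"
  proof -
    have "E * S * (LINT w|sph_measure. boost_defect \<beta> l (x0 \<bullet> w) * H w)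
        \<le> E * S * l powr \<beta> * z x0 - z x0 * integral\<^sup>L sph_measure b" using op1 Bz by linarith
    also have "\<dots> = z x0 * (S * l powr \<beta> * E - integral\<^sup>L sph_measure b)" by (simp add: algebra_simps)
    finally show ?thesis unfolding mass .
  qed
  then have "S * (E * (LINT w|sph_measure. boost_defect \<beta> l (x0 \<bullet> w) * H w)) \<le> S * (z x0 * D)"
    by (simp only: mult_ac)
  then have main: "E * (LINT w|sph_measure. boost_defect \<beta> l (x0 \<bullet> w) * H w) \<le> z x0 * D"
    using S by simp
  have low: "- B * (\<epsilon> * D) \<le> (LINT w|sph_measure. boost_defect \<beta> l (x0 \<bullet> w) * H w)"
  proof -
    let ?I = "\<lambda>y. indicator {y. x0 \<bullet> y \<le> c} y * boost_defect \<beta> l (x0 \<bullet> y)"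
    have i0: "integrable sph_measure (\<lambda>y. boost_defect \<beta> l (x0 \<bullet> y))"
      by (rule integrable_boost_defect(1)[OF dim x0s(1) \<beta>(1) l(1,2)])
    have Im: "?I \<in> borel_measurable sph_measure"
    proof -
      have "(\<lambda>y::'a. indicator {t. t \<le> c} (x0 \<bullet> y) * boost_defect \<beta> l (x0 \<bullet> y)) \<in> borel_measurable sph_measure"
        by measurable
      moreover have "indicator {t. t \<le> c} (x0 \<bullet> y) = (indicator {y. x0 \<bullet> y \<le> c} y :: real)" for y
        by (simp add: indicator_def)
      ultimately show ?thesis by simp
    qed
    have Ii: "integrable sph_measure ?I"
      by (rule Bochner_Integration.integrable_bound[OF i0 Im]) (auto simp: indicator_def)
    have "- B * (\<epsilon> * D) \<le> - B * (LINT y|sph_measure. ?I y)"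
      using l(4) B0 unfolding D_def[symmetric] by (intro mult_left_mono_neg) auto
    also have "\<dots> = (LINT y|sph_measure. - B * ?I y)" by (rule integral_mult_right_zero[symmetric])
    also have "\<dots> \<le> (LINT w|sph_measure. boost_defect \<beta> l (x0 \<bullet> w) * H w)"
    proof (rule integral_mono_AE)
      show "integrable sph_measure (\<lambda>y. - B * ?I y)" using Ii by simp
      show "integrable sph_measure (\<lambda>w. boost_defect \<beta> l (x0 \<bullet> w) * H w)"
        by (rule integrable_zonal_times_bounded[OF i0 Hm Hb])
      show "AE y in sph_measure. - B * ?I y \<le> boost_defect \<beta> l (x0 \<bullet> y) * H y"
        using AE_not_equal[OF dim x0s(1)]
      proof (rule AE_mp, intro AE_I2 impI)
        fix y :: 'a assume "y \<in> space sph_measure" and t: "x0 \<bullet> y < 1"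
        then have y: "y \<in> sphere 0 1" by simp
        have bd: "boost_defect \<beta> l (x0 \<bullet> y) \<ge> 0" by (rule boost_defect_nonneg[OF l(1,2) t \<beta>0(1)])
        show "- B * ?I y \<le> boost_defect \<beta> l (x0 \<bullet> y) * H y"
        proof (cases "x0 \<bullet> y \<le> c")
          case True
          have "boost_defect \<beta> l (x0 \<bullet> y) * (- B) \<le> boost_defect \<beta> l (x0 \<bullet> y) * H y"
            using Hb[OF y] bd by (intro mult_left_mono) auto
          then show ?thesis using True by (simp add: mult.commute)
        next
          case False
          then show ?thesis using near[OF y] bd by simp
        qed
      qed
    qed
    finally show ?thesis .
  qed
  have "E * (- B * (\<epsilon> * D)) \<le> z x0 * D" using main low E by (meson mult_left_mono less_imp_le order.trans)
  then have "(- (E * B * \<epsilon>)) * D \<le> z x0 * D" by (simp add: algebra_simps)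
  then have "- (E * B * \<epsilon>) \<le> z x0"
    by (rule mult_right_le_imp_le) (use l(3) in \<open>simp only: D_def\<close>)
  moreover have "E * B * \<epsilon> < - z x0"
  proof -
    have "E * B * \<epsilon> \<le> (E * B + 1) * \<epsilon>" using \<epsilon> by (intro mult_right_mono) auto
    also have "\<dots> = - z x0 / 2" using EB by (simp add: \<epsilon>_def field_simps)
    also have "\<dots> < - z x0" using z0 by simp
    finally show ?thesis .
  qed
  ultimately show False by linarith
qed

section \<open>Moving spheres\<close>

lemma integrable_rpot:
  fixes x :: "'a::euclidean_space"
  assumes dim: "DIM('a) \<ge> 4" and x: "x \<in> sphere 0 1" and \<beta>: "\<beta> > - (real DIM('a) - 1) / 2"
    and "f \<in> borel_measurable sph_measure" "\<And>y. y \<in> sphere 0 1 \<Longrightarrow> \<bar>f y\<bar> \<le> B"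
  shows "integrable sph_measure (\<lambda>y. (1 - x \<bullet> y) powr \<beta> * f y)"
  by (rule integrable_zonal_times_bounded[where k="\<lambda>t. (1 - t) powr \<beta>", OF integrable_rpot_kernel[OF dim x \<beta>] assms(4,5)])

lemma rpot_le:
  fixes x :: "'a::euclidean_space"
  assumes dim: "DIM('a) \<ge> 4" and x: "x \<in> sphere 0 1" and \<beta>: "\<beta> > - (real DIM('a) - 1) / 2"
    and g: "g \<in> borel_measurable sph_measure" "\<And>y. y \<in> sphere 0 1 \<Longrightarrow> \<bar>g y\<bar> \<le> B"
    and le: "\<And>y. y \<in> sphere 0 1 \<Longrightarrow> f y \<le> g y" and nn: "\<And>y. y \<in> sphere 0 1 \<Longrightarrow> 0 \<le> g y"
  shows "rpot \<beta> f x \<le> rpot \<beta> g x"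
  unfolding rpot_def
proof (rule integral_mono')
  show "integrable sph_measure (\<lambda>y. (1 - x \<bullet> y) powr \<beta> * g y)" by (rule integrable_rpot[OF dim x \<beta> g])
  fix y :: 'a assume "y \<in> space sph_measure"
  then have y: "y \<in> sphere 0 1" by simp
  show "(1 - x \<bullet> y) powr \<beta> * f y \<le> (1 - x \<bullet> y) powr \<beta> * g y" using le[OF y] by (intro mult_left_mono) auto
  show "0 \<le> (1 - x \<bullet> y) powr \<beta> * g y" using nn[OF y] by simp
qed

section \<open>Antisymmetric densities and comparison\<close>

lemma rpot_sph_refl:
  fixes e :: "'a::euclidean_space"
  assumes dim: "DIM('a) \<ge> 3" and e: "e \<in> sphere 0 1" and fm [measurable]: "f \<in> borel_measurable sph_measure"
  shows "rpot \<beta> f (sph_refl e x) = rpot \<beta> (\<lambda>y. f (sph_refl e y)) x"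
proof -
  have "rpot \<beta> f (sph_refl e x) = (LINT y|sph_measure. (1 - sph_refl e x \<bullet> sph_refl e y) powr \<beta> * f (sph_refl e y))"
    unfolding rpot_def
    by (rule integral_sph_refl[OF e dim, where f="\<lambda>y. (1 - sph_refl e x \<bullet> y) powr \<beta> * f y", symmetric]) measurable
  then show ?thesis by (simp add: rpot_def sph_refl_inner[OF e])
qed

lemma rpot_cong: "(\<And>y. y \<in> sphere 0 1 \<Longrightarrow> f y = g y) \<Longrightarrow> rpot \<beta> f x = rpot \<beta> g x"
  unfolding rpot_def by (rule Bochner_Integration.integral_cong) auto

lemma rpot_minus: "rpot \<beta> (\<lambda>y. - f y) x = - rpot \<beta> f x"
  by (simp add: rpot_def)

lemma measurable_comp_refl:
  fixes e :: "'a::euclidean_space"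
  assumes "e \<in> sphere 0 1" "f \<in> borel_measurable sph_measure"
  shows "(\<lambda>y. f (sph_refl e y)) \<in> borel_measurable sph_measure"
  by (rule measurable_compose[OF measurable_sph_refl[OF assms(1)] assms(2)])

text \<open>The potential is antisymmetric as well, so twice its value at x is the integral of H
  against the kernel at x minus the kernel at the mirror image of x. This kernel difference is
  nonnegative on the positive side and nonpositive on the other, in agreement with the sign of
  H.\<close>

lemma rpot_antisymmetric_nonneg:
  fixes e x :: "'a::euclidean_space"
  assumes dim: "DIM('a) \<ge> 4" and e: "e \<in> sphere 0 1"
    and \<beta>: "\<beta> > - (real DIM('a) - 1) / 2" "\<beta> \<le> 0"
    and Hm: "H \<in> borel_measurable sph_measure" and Hb: "\<And>y. y \<in> sphere 0 1 \<Longrightarrow> \<bar>H y\<bar> \<le> B"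
    and anti: "\<And>y. y \<in> sphere 0 1 \<Longrightarrow> H (sph_refl e y) = - H y"
    and nn: "\<And>y. y \<in> sphere 0 1 \<Longrightarrow> y \<bullet> e > 0 \<Longrightarrow> 0 \<le> H y"
    and x: "x \<in> sphere 0 1" "x \<bullet> e \<ge> 0"
  shows "rpot \<beta> H x \<ge> 0"
proof -
  have dim3: "DIM('a) \<ge> 3" using dim by simp
  let ?R = "sph_refl e"
  have Rx: "?R x \<in> sphere 0 1" by (rule sph_refl_sphere[OF e x(1)])
  have "rpot \<beta> H (?R x) = rpot \<beta> (\<lambda>y. - H y) x"
    unfolding rpot_sph_refl[OF dim3 e Hm] by (rule rpot_cong) (rule anti)
  then have R: "rpot \<beta> H (?R x) = - rpot \<beta> H x" by (simp only: rpot_minus)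
  have i1: "integrable sph_measure (\<lambda>y. (1 - x \<bullet> y) powr \<beta> * H y)"
    and i2: "integrable sph_measure (\<lambda>y. (1 - ?R x \<bullet> y) powr \<beta> * H y)"
    by (rule integrable_rpot[OF dim _ \<beta>(1) Hm Hb], rule x Rx, assumption)+
  have "rpot \<beta> H x - rpot \<beta> H (?R x) = (LINT y|sph_measure. (1 - x \<bullet> y) powr \<beta> * H y - (1 - ?R x \<bullet> y) powr \<beta> * H y)"
    unfolding rpot_def using i1 i2 by simp
  also have "\<dots> \<ge> 0"
  proof (rule integral_nonneg_AE)
    show "AE y in sph_measure. 0 \<le> (1 - x \<bullet> y) powr \<beta> * H y - (1 - ?R x \<bullet> y) powr \<beta> * H y"
      using AE_space AE_not_equal[OF dim x(1)] AE_not_equal[OF dim Rx]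
    proof eventually_elim
      case (elim y)
      have rel: "?R x \<bullet> y = x \<bullet> y - 2 * (y \<bullet> e) * (x \<bullet> e)"
        unfolding sph_refl_inner_swap by (rule inner_sph_refl)
      show ?case
      proof (cases "y \<in> sphere 0 1")
        case y: True
        consider "y \<bullet> e > 0" | "y \<bullet> e = 0" | "y \<bullet> e < 0" by linarith
        then show ?thesis
        proof cases
          case 1
          then have "?R x \<bullet> y \<le> x \<bullet> y" unfolding rel using x(2) by simp
          then have "(1 - ?R x \<bullet> y) powr \<beta> \<le> (1 - x \<bullet> y) powr \<beta>" using elim \<beta>(2) by (intro powr_mono2') auto
          then show ?thesis using mult_right_mono[OF _ nn[OF y 1]] by simp
        next
          case 2
          then have "?R y = y" by (simp add: sph_refl_def)
          then have "H y = 0" using anti[OF y] by simp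
          then show ?thesis by simp
        next
          case 3
          then have "0 < ?R y \<bullet> e" by (simp add: sph_refl_inner_axis[OF e])
          from nn[OF sph_refl_sphere[OF e y] this] have H: "H y \<le> 0" using anti[OF y] by simp
          have "2 * (y \<bullet> e) * (x \<bullet> e) \<le> 0" by (rule mult_nonpos_nonneg) (use 3 x(2) in auto)
          then have "x \<bullet> y \<le> ?R x \<bullet> y" unfolding rel by linarith
          then have "(1 - x \<bullet> y) powr \<beta> \<le> (1 - ?R x \<bullet> y) powr \<beta>" using elim \<beta>(2) by (intro powr_mono2') auto
          then show ?thesis using mult_right_mono_neg[OF _ H] by simp
        qed
      next
        case False
        then show ?thesis using elim(1) by simp
      qed
    qed
  qed
  finally show ?thesis unfolding R by simp
qed

text \<open>\<open>N\<close> is the violation: the negative part of F where its potential is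
  negative. Adding the antisymmetrisation V of N gives a density H which is nonnegative wherever its
  potential is negative, since the potential of V is nonnegative on the half-sphere. The maximum
  principle, or positivity of H in the second alternative, shows that the potential of H is
  nonnegative; dropping the reflected part of V gives the bound.\<close>

lemma rpot_comparison:
  fixes e x :: "'a::euclidean_space" and F :: "'a \<Rightarrow> real"
  assumes dim: "DIM('a) \<ge> 4" and e: "e \<in> sphere 0 1"
    and \<beta>: "\<beta> > - (real DIM('a) - 1) / 2" "\<beta> \<le> 0"
    and Fm [measurable]: "F \<in> borel_measurable sph_measure" and Fb: "\<And>y. y \<in> sphere 0 1 \<Longrightarrow> \<bar>F y\<bar> \<le> B"
    and anti: "\<And>y. y \<in> sphere 0 1 \<Longrightarrow> F (sph_refl e y) = - F y"
    and alt: "\<beta> \<le> 1 - (real DIM('a) - 1) / 2 \<or>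
      (\<forall>y\<in>sphere 0 1. y \<bullet> e > 0 \<longrightarrow> 0 \<le> rpot \<beta> F y \<longrightarrow> 0 \<le> F y)"
    and x: "x \<in> sphere 0 1" "x \<bullet> e \<ge> 0"
  shows "- rpot \<beta> F x \<le> rpot \<beta> (\<lambda>y. if y \<bullet> e > 0 \<and> rpot \<beta> F y < 0 then max 0 (- F y) else 0) x"
proof -
  have dim3: "DIM('a) \<ge> 3" using dim by simp
  let ?R = "sph_refl e"
  define N where "N y = (if y \<bullet> e > 0 \<and> rpot \<beta> F y < 0 then max 0 (- F y) else 0)" for y
  have Rs: "?R y \<in> sphere 0 1" if "y \<in> sphere 0 1" for y by (rule sph_refl_sphere[OF e that])
  have Ra: "?R y \<bullet> e = - (y \<bullet> e)" for y by (rule sph_refl_inner_axis[OF e])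
  have B0: "B \<ge> 0" using Fb[OF e] by linarith
  have [measurable]: "rpot \<beta> F \<in> borel_measurable sph_measure"
    by (rule measurable_sph_continuous[OF continuous_on_rpot[OF dim \<beta> Fm Fb]])
  have Nm [measurable]: "N \<in> borel_measurable sph_measure" unfolding N_def by measurable
  have N0: "N y \<ge> 0" for y by (simp add: N_def)
  have Nb: "\<bar>N y\<bar> \<le> B" if "y \<in> sphere 0 1" for y using Fb[OF that] B0 by (auto simp: N_def)
  define V where "V y = N y - N (?R y)" for y
  have Vm [measurable]: "V \<in> borel_measurable sph_measure"
    unfolding V_def by (rule borel_measurable_diff[OF Nm measurable_comp_refl[OF e Nm]])
  have Vb: "\<bar>V y\<bar> \<le> 2 * B" if "y \<in> sphere 0 1" for y
    using Nb[OF that] Nb[OF Rs[OF that]] unfolding V_def by linarith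
  have Vanti: "V (?R y) = - V y" for y by (simp add: V_def sph_refl_refl[OF e])
  have NR: "N (?R y) = 0" if "y \<bullet> e > 0" for y using that by (simp add: N_def Ra)
  have V0: "V y = N y" if "y \<bullet> e > 0" for y using NR[OF that] by (simp add: V_def)
  define H where "H y = F y + V y" for y
  have Hm: "H \<in> borel_measurable sph_measure" unfolding H_def by measurable
  have Hb: "\<bar>H y\<bar> \<le> 3 * B" if "y \<in> sphere 0 1" for y
    using Fb[OF that] Vb[OF that] unfolding H_def by linarith
  have Hanti: "H (?R y) = - H y" if "y \<in> sphere 0 1" for y using anti[OF that] Vanti[of y] by (simp add: H_def)
  have sum: "rpot \<beta> H y = rpot \<beta> F y + rpot \<beta> V y" if "y \<in> sphere 0 1" for y
    unfolding rpot_def H_def distrib_left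
    by (rule Bochner_Integration.integral_add[OF integrable_rpot[OF dim that \<beta>(1) Fm Fb] integrable_rpot[OF dim that \<beta>(1) Vm Vb]])
  have vnn: "rpot \<beta> V y \<ge> 0" if "y \<in> sphere 0 1" "y \<bullet> e \<ge> 0" for y
    by (rule rpot_antisymmetric_nonneg[OF dim e \<beta> Vm Vb Vanti _ that]) (use V0 N0 in auto)
  have Hneg: "H y \<ge> 0" if "y \<bullet> e > 0" "rpot \<beta> F y < 0" for y
    using V0[OF that(1)] that by (simp add: H_def N_def)
  have "rpot \<beta> H x \<ge> 0"
    using alt
  proof
    assume b: "\<beta> \<le> 1 - (real DIM('a) - 1) / 2"
    show ?thesis
    proof (rule maximum_principle[OF dim e \<beta>(1) b Hm Hb _ _ x])
      fix y :: 'a assume y: "y \<in> sphere 0 1"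
      have "rpot \<beta> H (?R y) = rpot \<beta> (\<lambda>w. - H w) y"
        unfolding rpot_sph_refl[OF dim3 e Hm] by (rule rpot_cong) (rule Hanti)
      then show "rpot \<beta> H (?R y) = - rpot \<beta> H y" by (simp only: rpot_minus)
      assume ye: "y \<bullet> e > 0" and neg: "rpot \<beta> H y < 0"
      have "rpot \<beta> F y < 0" using neg vnn[OF y less_imp_le[OF ye]] unfolding sum[OF y] by linarith
      then show "H y \<ge> 0" by (rule Hneg[OF ye])
    qed
  next
    assume b: "\<forall>y\<in>sphere 0 1. y \<bullet> e > 0 \<longrightarrow> 0 \<le> rpot \<beta> F y \<longrightarrow> 0 \<le> F y"
    show ?thesis
    proof (rule rpot_antisymmetric_nonneg[OF dim e \<beta> Hm Hb Hanti _ x])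
      fix y :: 'a assume y: "y \<in> sphere 0 1" and ye: "y \<bullet> e > 0"
      show "0 \<le> H y"
      proof (cases "rpot \<beta> F y < 0")
        case True
        then show ?thesis by (rule Hneg[OF ye])
      next
        case False
        then have "0 \<le> F y" using b y ye by (simp add: not_less)
        then show ?thesis using V0[OF ye] N0[of y] by (simp add: H_def)
      qed
    qed
  qed
  then have "- rpot \<beta> F x \<le> rpot \<beta> V x" unfolding sum[OF x(1)] by linarith
  also have "\<dots> \<le> rpot \<beta> N x"
    by (rule rpot_le[OF dim x(1) \<beta>(1) Nm Nb]) (use N0 in \<open>auto simp: V_def\<close>)
  finally show ?thesis unfolding N_def .
qed

text \<open>Splitting the kernel at distance of order eta trades a small multiple of a more singular
  kernel for a bounded one.\<close>

lemma rpot_thin_strip: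
  fixes e :: "'a::euclidean_space"
  assumes dim: "DIM('a) \<ge> 4" and e: "e \<in> sphere 0 1"
    and \<beta>: "\<beta> > - (real DIM('a) - 1) / 2" "\<beta> \<le> 0" and \<epsilon>: "\<epsilon> > 0"
  shows "\<exists>t0>0. \<forall>x\<in>sphere 0 1. rpot \<beta> (indicator {y. 0 < y \<bullet> e \<and> y \<bullet> e < t0}) x \<le> \<epsilon>"
proof -
  have dim3: "DIM('a) \<ge> 3" using dim by simp
  \<comment> \<open>Midway between \<beta> and the critical exponent, so that the more singular
    kernel is still integrable.\<close>
  define \<beta>' where "\<beta>' = (\<beta> + - (real DIM('a) - 1) / 2) / 2"
  have \<beta>': "\<beta>' > - (real DIM('a) - 1) / 2" "\<beta>' < \<beta>" using \<beta>(1) by (simp_all add: \<beta>'_def field_simps)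
  define E where "E = rpot \<beta>' (\<lambda>_. 1) e"
  have E: "E > 0" unfolding E_def by (rule rpot_mass_pos[OF dim e \<beta>'(1)])
  \<comment> \<open>Solves \<eta>^(\<beta> - \<beta>') E = \<epsilon>/2: the part near the
    singularity takes half of the allowance, the measure of the strip the other half.\<close>
  define \<eta> where "\<eta> = (\<epsilon> / (2 * E)) powr (1 / (\<beta> - \<beta>'))"
  have \<eta>: "\<eta> > 0" using \<epsilon> E by (simp add: \<eta>_def)
  have \<eta>p: "\<eta> powr (\<beta> - \<beta>') = \<epsilon> / (2 * E)" using \<beta>' \<epsilon> E by (simp add: \<eta>_def powr_powr)
  define A where "A j = {y \<in> space (sph_measure :: 'a measure). 0 < y \<bullet> e \<and> y \<bullet> e < 1 / real (Suc j)}" for j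
  have Am: "A j \<in> sets sph_measure" for j unfolding A_def by measurable
  have "(\<lambda>j. LINT y|sph_measure. indicator (A j) y) \<longlonglongrightarrow> (LINT y|(sph_measure :: 'a measure). (0::real))"
  proof (rule integral_dominated_convergence[where w="\<lambda>_. 1"])
    show "AE y in sph_measure. (\<lambda>j. indicator (A j) y) \<longlonglongrightarrow> (0::real)"
    proof (rule AE_I2)
      fix y :: 'a
      show "(\<lambda>j. indicator (A j) y) \<longlonglongrightarrow> (0::real)"
      proof (cases "y \<bullet> e > 0")
        case True
        have "eventually (\<lambda>j. 1 / real (Suc j) < y \<bullet> e) sequentially"
          using order_tendstoD(2)[OF LIMSEQ_Suc[OF lim_1_over_n] True] .
        then have "eventually (\<lambda>j. indicator (A j) y = (0::real)) sequentially"
          by (rule eventually_mono) (simp add: A_def)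
        then show ?thesis by (rule tendsto_eventually)
      next
        case False
        then show ?thesis by (simp add: A_def)
      qed
    qed
    show "AE y in sph_measure. norm (indicator (A j) y :: real) \<le> 1" for j by (simp add: indicator_def)
  qed (use Am in auto)
  moreover have "(LINT y|sph_measure. indicator (A j) y :: real) = measure sph_measure (A j)" for j
  proof -
    have "A j \<inter> space sph_measure = A j" by (auto simp: A_def)
    then show ?thesis using Am[of j] by simp
  qed
  ultimately have "(\<lambda>j. \<eta> powr \<beta> * measure sph_measure (A j)) \<longlonglongrightarrow> \<eta> powr \<beta> * 0"
    by (intro tendsto_mult_left) simp
  then have "eventually (\<lambda>j. \<eta> powr \<beta> * measure sph_measure (A j) < \<epsilon> / 2) sequentially"
    using \<epsilon> by (intro order_tendstoD(2)) auto
  then obtain j where j: "\<eta> powr \<beta> * measure sph_measure (A j) < \<epsilon> / 2"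
    by (auto simp: eventually_sequentially)
  define t0 where "t0 = 1 / real (Suc j)"
  show ?thesis
  proof (intro exI[of _ t0] conjI ballI)
    show "t0 > 0" by (simp add: t0_def)
    fix x :: 'a assume x: "x \<in> sphere 0 1"
    let ?I = "indicator {y. 0 < y \<bullet> e \<and> y \<bullet> e < t0} :: 'a \<Rightarrow> real"
    have IA: "?I y = indicator (A j) y" if "y \<in> sphere 0 1" for y
      using that by (simp add: indicator_def A_def t0_def)
    have i: "integrable sph_measure (\<lambda>y. \<eta> powr (\<beta> - \<beta>') * (1 - x \<bullet> y) powr \<beta>' + \<eta> powr \<beta> * indicator (A j) y)"
      using integrable_rpot_kernel[OF dim x \<beta>'(1)] Am[of j]
      by (intro Bochner_Integration.integrable_add integrable_mult_right integrable_real_indicator)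
         (auto simp: sph.emeasure_eq_measure)
    have "rpot \<beta> ?I x \<le> (LINT y|sph_measure. \<eta> powr (\<beta> - \<beta>') * (1 - x \<bullet> y) powr \<beta>' + \<eta> powr \<beta> * indicator (A j) y)"
      unfolding rpot_def
    proof (rule integral_mono'[OF i])
      fix y :: 'a assume "y \<in> space sph_measure"
      then have y: "y \<in> sphere 0 1" by simp
      define v where "v = 1 - x \<bullet> y"
      have v: "v \<ge> 0" using sphere_inner_bounds[OF x y] by (simp add: v_def)
      show "(1 - x \<bullet> y) powr \<beta> * ?I y \<le> \<eta> powr (\<beta> - \<beta>') * (1 - x \<bullet> y) powr \<beta>' + \<eta> powr \<beta> * indicator (A j) y"
      proof (cases "v \<le> \<eta>")
        case True
        have "v powr \<beta> = v powr (\<beta> - \<beta>') * v powr \<beta>'" by (simp flip: powr_add)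
        also have "\<dots> \<le> \<eta> powr (\<beta> - \<beta>') * v powr \<beta>'" using True v \<beta>'(2) by (intro mult_right_mono powr_mono2) auto
        finally have "v powr \<beta> * ?I y \<le> \<eta> powr (\<beta> - \<beta>') * v powr \<beta>' * 1"
          by (intro mult_mono) (auto simp: indicator_def)
        moreover have "0 \<le> \<eta> powr \<beta> * indicator (A j) y" by simp
        ultimately show ?thesis unfolding v_def by linarith
      next
        case False
        have "v powr \<beta> \<le> \<eta> powr \<beta>" using False \<eta> \<beta>(2) by (intro powr_mono2') auto
        then have "v powr \<beta> * ?I y \<le> \<eta> powr \<beta> * indicator (A j) y"
          unfolding IA[OF y] by (intro mult_right_mono) auto
        moreover have "0 \<le> \<eta> powr (\<beta> - \<beta>') * v powr \<beta>'" by simp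
        ultimately show ?thesis unfolding v_def by linarith
      qed
    qed simp
    also have "\<dots> = \<eta> powr (\<beta> - \<beta>') * (LINT y|sph_measure. (1 - x \<bullet> y) powr \<beta>') + \<eta> powr \<beta> * measure sph_measure (A j)"
    proof -
      have "A j \<inter> space sph_measure = A j" by (auto simp: A_def)
      moreover have "integrable sph_measure (indicator (A j) :: 'a \<Rightarrow> real)"
        using Am[of j] by (intro integrable_real_indicator) (auto simp: sph.emeasure_eq_measure)
      ultimately show ?thesis using integrable_rpot_kernel[OF dim x \<beta>'(1)] Am[of j] by simp
    qed
    also have "(LINT y|sph_measure. (1 - x \<bullet> y) powr \<beta>') = E"
      unfolding E_def using rpot_mass_const[OF dim3 x e, of \<beta>'] by (simp add: rpot_def)
    also have "\<eta> powr (\<beta> - \<beta>') * E = \<epsilon> / 2" unfolding \<eta>p using E by simp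
    finally show "rpot \<beta> ?I x \<le> \<epsilon>" using j by linarith
  qed
qed

text \<open>The pull-back with the conformal weight that keeps the integral equation in form, where
  \<alpha> = n/2 - s.\<close>

definition mv_u :: "('a::euclidean_space \<Rightarrow> real) \<Rightarrow> real \<Rightarrow> 'a \<Rightarrow> real \<Rightarrow> 'a \<Rightarrow> real" where
  "mv_u u \<alpha> e l x = boost_factor l e x powr \<alpha> * u (boost l e x)"

text \<open>Nonnegativity on the side of e is what is propagated. The sign is natural there: towards
  e the conformal factor is small and at the mirror image it is large, and at l = 0 the difference
  is u at the mirror image minus u.\<close>

definition mv_diff :: "('a::euclidean_space \<Rightarrow> real) \<Rightarrow> real \<Rightarrow> 'a \<Rightarrow> real \<Rightarrow> 'a \<Rightarrow> real" where
  "mv_diff u \<alpha> e l x = mv_u u \<alpha> e l (sph_refl e x) - mv_u u \<alpha> e l x"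

lemma powr_mean_value_upper:
  fixes A B q :: real
  assumes "0 < B" "B < A" "q \<ge> 1"
  shows "A powr q - B powr q \<le> q * A powr (q - 1) * (A - B)"
proof -
  have "\<exists>z>B. z < A \<and> A powr q - B powr q = (A - B) * (q * z powr (q - 1))"
    by (rule MVT2[OF assms(2)]) (use assms(1) in \<open>auto intro!: derivative_eq_intros\<close>)
  then obtain z where z: "z > B" "z < A" "A powr q - B powr q = (A - B) * (q * z powr (q - 1))" by blast
  have "z powr (q - 1) \<le> A powr (q - 1)" using z assms by (intro powr_mono2) auto
  then have "(A - B) * (q * z powr (q - 1)) \<le> (A - B) * (q * A powr (q - 1))"
    using assms by (intro mult_left_mono) auto
  then show ?thesis unfolding z(3) by (simp only: mult.commute)
qed

section \<open>Moving spheres for the integral equation: \<alpha> is n/2 - s, \<open>q\<close> the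
  critical exponent, and \<open>alt\<close> separates s \<le> 1 from the monotone case\<close>

context
  fixes u :: "'a::euclidean_space \<Rightarrow> real" and h :: "real \<Rightarrow> real" and \<alpha> q \<kappa> m M n :: real
  assumes dim: "DIM('a) \<ge> 4" and n: "n = real DIM('a) - 1"
    and \<alpha>: "0 < \<alpha>" "\<alpha> < n / 2" and q: "q \<ge> 1" "\<alpha> * q = n - \<alpha>"
    and uc: "continuous_on (sphere 0 1) u" and m: "0 < m"
    and um: "\<And>x. x \<in> sphere 0 1 \<Longrightarrow> m \<le> u x" and uM: "\<And>x. x \<in> sphere 0 1 \<Longrightarrow> u x \<le> M"
    and hc: "continuous_on {0<..} h" and hdec: "\<And>a b. 0 < a \<Longrightarrow> a < b \<Longrightarrow> h b < h a"
    and \<kappa>: "\<kappa> > 0"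
    and rep: "\<And>x. x \<in> sphere 0 1 \<Longrightarrow> u x = \<kappa> * rpot (- \<alpha>) (\<lambda>y. h (u y) * u y powr q) x"
    and alt: "- \<alpha> \<le> 1 - n / 2 \<or> (\<forall>a b. 0 < a \<longrightarrow> a \<le> b \<longrightarrow> h a * a powr q \<le> h b * b powr q)"
begin

lemma mv_beta: "- \<alpha> > - (real DIM('a) - 1) / 2" "- \<alpha> \<le> 0"
  using \<alpha> n by simp_all

lemma mv_dim3: "DIM('a) \<ge> 3"
  using dim by simp

lemma hdec_le: "0 < a \<Longrightarrow> a \<le> b \<Longrightarrow> h b \<le> h a"
  using hdec[of a b] by (cases "a = b") auto

lemma mv_exponent: "\<alpha> * (q - 1) = n - 2 * \<alpha>"
  using q(2) by (simp add: algebra_simps)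

text \<open>A Lipschitz constant for A -> h A^q when u ranges over [m, M], before conformal weights;
  the maximum with 0 allows for negative values of h.\<close>

definition mv_C :: real where "mv_C = max 0 (h m) * (q * M powr (q - 1))"

lemma mv_C_nonneg: "mv_C \<ge> 0"
  unfolding mv_C_def using q by (intro mult_nonneg_nonneg) auto

text \<open>Convexity of the q-th power, with \<alpha> (q - 1) = n - 2 \<alpha>. The positive power
  of the conformal factor that remains is small for a nearly degenerate boost.\<close>

lemma mv_num_lipschitz:
  assumes a: "m \<le> a" "a \<le> M" and r: "0 < r" and A: "A = r powr \<alpha> * a" and B: "0 < B" "B < A"
  shows "h a * (A powr q - B powr q) \<le> mv_C * r powr (n - 2 * \<alpha>) * (A - B)"
proof -
  have a0: "0 < a" "0 < M" using a m by linarith+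
  have ABq: "0 \<le> A powr q - B powr q" using B q by (simp add: powr_mono2)
  have "A powr (q - 1) = r powr (n - 2 * \<alpha>) * a powr (q - 1)"
    using r a0 by (simp add: A powr_mult powr_powr mv_exponent)
  also have "\<dots> \<le> r powr (n - 2 * \<alpha>) * M powr (q - 1)"
    using a a0 q by (intro mult_left_mono powr_mono2) auto
  finally have A1: "A powr (q - 1) \<le> r powr (n - 2 * \<alpha>) * M powr (q - 1)" .
  have "h a * (A powr q - B powr q) \<le> max 0 (h m) * (A powr q - B powr q)"
    using hdec_le[OF m a(1)] ABq by (intro mult_right_mono) auto
  also have "\<dots> \<le> max 0 (h m) * (q * A powr (q - 1) * (A - B))"
    by (intro mult_left_mono powr_mean_value_upper[OF B q(1)]) auto
  also have "\<dots> \<le> max 0 (h m) * (q * (r powr (n - 2 * \<alpha>) * M powr (q - 1)) * (A - B))"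
    using A1 q B by (intro mult_left_mono mult_right_mono) auto
  also have "\<dots> = mv_C * r powr (n - 2 * \<alpha>) * (A - B)" by (simp add: mv_C_def mult_ac)
  finally show ?thesis .
qed

lemma mv_num_below:
  assumes "0 < r" "r \<le> r'" "0 < a" "0 < b" and lt: "r' powr \<alpha> * b < r powr \<alpha> * a"
  shows "b < a"
proof -
  have "r powr \<alpha> * a \<le> r' powr \<alpha> * a" using assms \<alpha> by (intro mult_right_mono powr_mono2) auto
  then have "r' powr \<alpha> * b < r' powr \<alpha> * a" using lt by linarith
  then show ?thesis using assms by simp
qed

text \<open>If the weighted value is smaller at the mirror image although the conformal factor is
  larger there, then b < a. So h b \<ge> h a, and replacing h b by h a leaves only a difference of
  powers.\<close>

lemma mv_num_neg:
  assumes a: "m \<le> a" "a \<le> M" and b: "0 < b" and r: "0 < r" "r \<le> r'"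
    and A: "A = r powr \<alpha> * a" and B: "B = r' powr \<alpha> * b" and lt: "B < A"
  shows "h a * A powr q - h b * B powr q \<le> mv_C * r powr (n - 2 * \<alpha>) * (A - B)"
proof -
  have a0: "0 < a" using a m by linarith
  have B0: "0 < B" using b r by (simp add: B)
  have "b < a" by (rule mv_num_below[OF r a0 b]) (use lt A B in simp)
  then have "h a * B powr q \<le> h b * B powr q" using hdec_le[OF b] by (intro mult_right_mono) auto
  then have "h a * A powr q - h b * B powr q \<le> h a * (A powr q - B powr q)" by (simp add: right_diff_distrib)
  also have "\<dots> \<le> mv_C * r powr (n - 2 * \<alpha>) * (A - B)" by (rule mv_num_lipschitz[OF a r(1) A B0 lt])
  finally show ?thesis .
qed

text \<open>A quantitative drop \<delta> of h improves the Lipschitz bound by a fixed amount,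
  independent of the size of A - B.\<close>

lemma mv_num_gain:
  assumes a: "m \<le> a" "a \<le> M" and b: "0 < b" and r: "0 < r"
    and A: "A = r powr \<alpha> * a" and B: "0 < B" "B < A" and \<delta>: "h a + \<delta> \<le> h b" "\<delta> \<ge> 0" and B0: "0 < B0" "B0 \<le> B"
  shows "h a * A powr q - h b * B powr q \<le> mv_C * r powr (n - 2 * \<alpha>) * (A - B) - \<delta> * B0 powr q"
proof -
  have "(h a + \<delta>) * B powr q \<le> h b * B powr q" using \<delta> by (intro mult_right_mono) auto
  moreover have "\<delta> * B0 powr q \<le> \<delta> * B powr q" using \<delta> B0 q by (intro mult_left_mono powr_mono2) auto
  ultimately have "h a * A powr q - h b * B powr q \<le> h a * (A powr q - B powr q) - \<delta> * B0 powr q"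
    by (simp add: algebra_simps)
  then show ?thesis using mv_num_lipschitz[OF a r A B] by linarith
qed

text \<open>With c = A / r'^\<alpha>, which is at most a and at most b, the decrease of h gives h a
  \<le> h c, and the monotonicity of h(t) t^q leads from c to b.\<close>

lemma mv_num_mono:
  assumes mono: "\<And>a b. 0 < a \<Longrightarrow> a \<le> b \<Longrightarrow> h a * a powr q \<le> h b * b powr q"
    and a: "0 < a" and b: "0 < b" and r: "0 < r" "r \<le> r'"
    and A: "A = r powr \<alpha> * a" and B: "B = r' powr \<alpha> * b" and le: "A \<le> B"
  shows "h a * A powr q \<le> h b * B powr q"
proof -
  define c where "c = A / r' powr \<alpha>"
  have rp: "r' powr \<alpha> > 0" "r powr \<alpha> > 0" "r powr \<alpha> \<le> r' powr \<alpha>" using r \<alpha> by (auto intro: powr_mono2)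
  have A0: "A > 0" using a rp by (simp add: A)
  have c: "0 < c" "c \<le> a" "c \<le> b"
  proof -
    show "0 < c" using A0 rp by (simp add: c_def)
    show "c \<le> a" unfolding c_def A using rp a by (simp add: field_simps)
    show "c \<le> b" unfolding c_def using le rp by (simp add: B field_simps)
  qed
  have Ac: "A = r' powr \<alpha> * c" using rp by (simp add: c_def)
  have "h a * A powr q \<le> h c * A powr q" using hdec_le[OF c(1,2)] by (intro mult_right_mono) auto
  also have "\<dots> = (r' powr \<alpha>) powr q * (h c * c powr q)" using c rp by (simp add: Ac powr_mult)
  also have "\<dots> \<le> (r' powr \<alpha>) powr q * (h b * b powr q)" by (intro mult_left_mono mono c) auto
  also have "\<dots> = h b * B powr q" using b rp by (simp add: B powr_mult)
  finally show ?thesis .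
qed

section \<open>Comparison along a fixed axis\<close>

context
  fixes e :: 'a
  assumes e: "e \<in> sphere 0 1"
begin

text \<open>The density of the pulled-back equation. Here h is evaluated at u itself and not at the
  weighted pull-back; the failure of conformal invariance sits in this factor.\<close>

definition mv_K :: "real \<Rightarrow> 'a \<Rightarrow> real" where
  "mv_K l y = h (u (boost l e y)) * mv_u u \<alpha> e l y powr q"

definition mv_F :: "real \<Rightarrow> 'a \<Rightarrow> real" where
  "mv_F l y = mv_K l (sph_refl e y) - mv_K l y"

lemma mv_u_pos:
  assumes "\<bar>l\<bar> < 1" "x \<in> sphere 0 1"
  shows "mv_u u \<alpha> e l x > 0"
proof -
  have "u (boost l e x) > 0" using um[OF boost_sphere[OF e assms]] m by linarith
  then show ?thesis unfolding mv_u_def using boost_factor_pos[OF e assms] by simp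
qed

lemma continuous_on_mv_u:
  assumes l: "\<bar>l\<bar> < 1"
  shows "continuous_on (sphere 0 1) (mv_u u \<alpha> e l)"
proof -
  have "continuous_on (sphere 0 1) (\<lambda>x. u (boost l e x))"
    by (rule continuous_on_compose2[OF uc continuous_on_boost[OF e l]]) (use boost_sphere[OF e l] in auto)
  moreover have "continuous_on (sphere 0 1) (\<lambda>x. boost_factor l e x powr \<alpha>)"
    by (intro continuous_on_powr continuous_on_boost_factor[OF e l] continuous_on_const)
       (use boost_factor_pos[OF e l] in force)
  ultimately show ?thesis unfolding mv_u_def[abs_def] by (intro continuous_on_mult)
qed

lemma continuous_on_mv_K:
  assumes l: "\<bar>l\<bar> < 1"
  shows "continuous_on (sphere 0 1) (mv_K l)"
proof -
  have u1: "continuous_on (sphere 0 1) (\<lambda>x. u (boost l e x))"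
    by (rule continuous_on_compose2[OF uc continuous_on_boost[OF e l]]) (use boost_sphere[OF e l] in auto)
  have "u (boost l e x) > 0" if "x \<in> sphere 0 1" for x
    using um[OF boost_sphere[OF e l that]] m by linarith
  then have "continuous_on (sphere 0 1) (\<lambda>x. h (u (boost l e x)))"
    by (intro continuous_on_compose2[OF hc u1]) auto
  moreover have "continuous_on (sphere 0 1) (\<lambda>x. mv_u u \<alpha> e l x powr q)"
    by (intro continuous_on_powr continuous_on_mv_u[OF l] continuous_on_const)
       (use mv_u_pos[OF l] in force)
  ultimately show ?thesis unfolding mv_K_def[abs_def] by (intro continuous_on_mult)
qed

lemma continuous_on_mv_F:
  assumes l: "\<bar>l\<bar> < 1"
  shows "continuous_on (sphere 0 1) (mv_F l)"
  unfolding mv_F_def[abs_def]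
  by (intro continuous_on_diff continuous_on_mv_K[OF l]
      continuous_on_compose2[OF continuous_on_mv_K[OF l] continuous_on_sph_refl[OF e]])
     (use sph_refl_sphere[OF e] in auto)

text \<open>The relation \<alpha> q = n - \<alpha> turns the weight produced by the covariance of
  the potential into the one contained in the q-th power of the pull-back.\<close>

lemma mv_u_equation:
  assumes l: "\<bar>l\<bar> < 1" and x: "x \<in> sphere 0 1"
  shows "mv_u u \<alpha> e l x = \<kappa> * rpot (- \<alpha>) (mv_K l) x"
proof -
  let ?g = "\<lambda>y. h (u y) * u y powr q" and ?\<rho> = "boost_factor l e"
  have u0: "u y > 0" if "y \<in> sphere 0 1" for y using um[OF that] m by linarith
  have "continuous_on (sphere 0 1) (\<lambda>y. h (u y))"
    by (rule continuous_on_compose2[OF hc uc]) (use u0 in auto)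
  moreover have "\<forall>y\<in>sphere 0 1. u y \<noteq> 0" using u0 by (intro ballI less_imp_neq[symmetric])
  ultimately have "continuous_on (sphere 0 1) ?g"
    by (intro continuous_on_mult continuous_on_powr uc continuous_on_const)
  then have gm: "?g \<in> borel_measurable sph_measure" by (rule measurable_sph_continuous)
  have \<rho>: "?\<rho> y > 0" if "y \<in> sphere 0 1" for y by (rule boost_factor_pos[OF e l that])
  have "rpot (- \<alpha>) (\<lambda>y. ?\<rho> y powr (real DIM('a) - 1 + - \<alpha>) * ?g (boost l e y)) x = rpot (- \<alpha>) (mv_K l) x"
  proof (rule rpot_cong)
    fix y :: 'a assume y: "y \<in> sphere 0 1"
    have "mv_u u \<alpha> e l y powr q = ?\<rho> y powr (n - \<alpha>) * u (boost l e y) powr q"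
      unfolding mv_u_def using \<rho>[OF y] u0[OF boost_sphere[OF e l y]]
      by (simp add: powr_mult powr_powr q(2))
    then show "?\<rho> y powr (real DIM('a) - 1 + - \<alpha>) * ?g (boost l e y) = mv_K l y"
      by (simp add: mv_K_def n mult_ac)
  qed
  then have pot: "rpot (- \<alpha>) ?g (boost l e x) = ?\<rho> x powr (- \<alpha>) * rpot (- \<alpha>) (mv_K l) x"
    using rpot_boost[OF dim e l x gm, of "- \<alpha>"] by (simp only:)
  have "mv_u u \<alpha> e l x = ?\<rho> x powr \<alpha> * (\<kappa> * (?\<rho> x powr (- \<alpha>) * rpot (- \<alpha>) (mv_K l) x))"
    unfolding mv_u_def rep[OF boost_sphere[OF e l x]] pot ..
  also have "\<dots> = (?\<rho> x powr \<alpha> * ?\<rho> x powr (- \<alpha>)) * (\<kappa> * rpot (- \<alpha>) (mv_K l) x)" by (simp only: mult_ac)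
  also have "?\<rho> x powr \<alpha> * ?\<rho> x powr (- \<alpha>) = 1" using \<rho>[OF x] by (simp flip: powr_add)
  finally show ?thesis by simp
qed

lemma mv_diff_equation:
  assumes l: "\<bar>l\<bar> < 1" and x: "x \<in> sphere 0 1"
  shows "mv_diff u \<alpha> e l x = \<kappa> * rpot (- \<alpha>) (mv_F l) x"
proof -
  have Kc: "continuous_on (sphere 0 1) (mv_K l)" by (rule continuous_on_mv_K[OF l])
  obtain B where B: "B > 0" "\<And>y. y \<in> sphere 0 1 \<Longrightarrow> \<bar>mv_K l y\<bar> \<le> B" using bounded_on_sphere[OF Kc] by blast
  have Km: "mv_K l \<in> borel_measurable sph_measure" by (rule measurable_sph_continuous[OF Kc])
  have KRb: "\<bar>mv_K l (sph_refl e y)\<bar> \<le> B" if "y \<in> sphere 0 1" for y by (rule B(2)[OF sph_refl_sphere[OF e that]])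
  have "rpot (- \<alpha>) (mv_F l) x = rpot (- \<alpha>) (\<lambda>y. mv_K l (sph_refl e y)) x - rpot (- \<alpha>) (mv_K l) x"
    unfolding rpot_def mv_F_def right_diff_distrib
    by (rule Bochner_Integration.integral_diff[OF
        integrable_rpot[OF dim x mv_beta(1) measurable_comp_refl[OF e Km] KRb]
        integrable_rpot[OF dim x mv_beta(1) Km B(2)]])
  also have "rpot (- \<alpha>) (\<lambda>y. mv_K l (sph_refl e y)) x = rpot (- \<alpha>) (mv_K l) (sph_refl e x)"
    by (rule rpot_sph_refl[OF mv_dim3 e Km, symmetric])
  finally show ?thesis
    unfolding mv_diff_def mv_u_equation[OF l x] mv_u_equation[OF l sph_refl_sphere[OF e x]]
    by (simp only: right_diff_distrib)
qed

lemma continuous_on_mv_diff: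
  assumes l: "\<bar>l\<bar> < 1"
  shows "continuous_on (sphere 0 1) (mv_diff u \<alpha> e l)"
  unfolding mv_diff_def[abs_def]
  by (intro continuous_on_diff continuous_on_mv_u[OF l]
      continuous_on_compose2[OF continuous_on_mv_u[OF l] continuous_on_sph_refl[OF e]])
     (use sph_refl_sphere[OF e] in auto)

lemma boost_factor_refl_bounds:
  assumes l: "0 \<le> l" "l < 1" and y: "y \<in> sphere 0 1" and t: "y \<bullet> e > 0"
  shows "boost_factor l e y \<le> sqrt (1 - l\<^sup>2)" "sqrt (1 - l\<^sup>2) \<le> boost_factor l e (sph_refl e y)"
    "boost_factor l e (sph_refl e y) = boost_factor l e y * ((1 + l * (y \<bullet> e)) / (1 - l * (y \<bullet> e)))"
    "1 - l * (y \<bullet> e) > 0"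
proof -
  have l': "\<bar>l\<bar> < 1" using l by simp
  have S: "sqrt (1 - l\<^sup>2) > 0" by (rule boost_sqrt_pos(1)[OF e l'])
  have d: "1 + l * (sph_refl e y \<bullet> e) > 0" by (rule boost_denom_pos[OF e l' sph_refl_sphere[OF e y]])
  then show d': "1 - l * (y \<bullet> e) > 0" by (simp add: sph_refl_inner_axis[OF e])
  have lt: "l * (y \<bullet> e) \<ge> 0" using l t by simp
  have r: "boost_factor l e y = sqrt (1 - l\<^sup>2) / (1 + l * (y \<bullet> e))"
    and r': "boost_factor l e (sph_refl e y) = sqrt (1 - l\<^sup>2) / (1 - l * (y \<bullet> e))"
    by (simp_all add: boost_factor_def sph_refl_inner_axis[OF e])
  have "sqrt (1 - l\<^sup>2) / (1 + l * (y \<bullet> e)) \<le> sqrt (1 - l\<^sup>2) / 1" using S lt by (intro divide_left_mono) auto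
  then show "boost_factor l e y \<le> sqrt (1 - l\<^sup>2)" unfolding r by simp
  have "sqrt (1 - l\<^sup>2) / 1 \<le> sqrt (1 - l\<^sup>2) / (1 - l * (y \<bullet> e))" using S lt d' by (intro divide_left_mono) auto
  then show "sqrt (1 - l\<^sup>2) \<le> boost_factor l e (sph_refl e y)" unfolding r' by simp
  have "1 + l * (y \<bullet> e) \<noteq> 0" using lt by linarith
  then show "boost_factor l e (sph_refl e y) = boost_factor l e y * ((1 + l * (y \<bullet> e)) / (1 - l * (y \<bullet> e)))"
    unfolding r r' by simp
qed

lemma mv_F_anti: "mv_F l (sph_refl e y) = - mv_F l y"
  by (simp add: mv_F_def sph_refl_refl[OF e])

text \<open>On the side of e the conformal factor is at most sqrt(1 - l^2), so the Lipschitz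
  constant for the violation tends to 0 as l tends to 1.\<close>

lemma mv_F_neg_bound:
  assumes l: "0 \<le> l" "l < 1" and y: "y \<in> sphere 0 1" and t: "y \<bullet> e > 0" and neg: "mv_diff u \<alpha> e l y < 0"
  shows "- mv_F l y \<le> mv_C * sqrt (1 - l\<^sup>2) powr (n - 2 * \<alpha>) * - mv_diff u \<alpha> e l y"
proof -
  have l': "\<bar>l\<bar> < 1" using l by simp
  let ?R = "sph_refl e" and ?\<rho> = "boost_factor l e" and ?\<psi> = "boost l e"
  note bf = boost_factor_refl_bounds[OF l y t]
  have Ry: "?R y \<in> sphere 0 1" by (rule sph_refl_sphere[OF e y])
  have r: "0 < ?\<rho> y" by (rule boost_factor_pos[OF e l' y])
  have b: "0 < u (?\<psi> (?R y))" using um[OF boost_sphere[OF e l' Ry]] m by linarith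
  have "- mv_F l y = h (u (?\<psi> y)) * mv_u u \<alpha> e l y powr q - h (u (?\<psi> (?R y))) * mv_u u \<alpha> e l (?R y) powr q"
    by (simp add: mv_F_def mv_K_def)
  also have "\<dots> \<le> mv_C * ?\<rho> y powr (n - 2 * \<alpha>) * (mv_u u \<alpha> e l y - mv_u u \<alpha> e l (?R y))"
  proof (rule mv_num_neg[OF um[OF boost_sphere[OF e l' y]] uM[OF boost_sphere[OF e l' y]] b r])
    show "?\<rho> y \<le> ?\<rho> (?R y)" using bf(1,2) by linarith
    show "mv_u u \<alpha> e l (?R y) < mv_u u \<alpha> e l y" using neg by (simp add: mv_diff_def)
  qed (simp_all add: mv_u_def)
  also have "\<dots> = mv_C * ?\<rho> y powr (n - 2 * \<alpha>) * - mv_diff u \<alpha> e l y" by (simp add: mv_diff_def)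
  also have "\<dots> \<le> mv_C * sqrt (1 - l\<^sup>2) powr (n - 2 * \<alpha>) * - mv_diff u \<alpha> e l y"
    using mv_C_nonneg bf(1) r neg \<alpha> by (intro mult_right_mono mult_left_mono powr_mono2) auto
  finally show ?thesis .
qed

text \<open>At a negative minimum of the difference, the comparison principle bounds its depth by the
  potential of the region where the right-hand side has the wrong sign.\<close>

lemma mv_minimum:
  assumes l: "0 \<le> l" "l < 1" and x: "x \<in> sphere 0 1" "x \<bullet> e \<ge> 0" "mv_diff u \<alpha> e l x < 0"
  obtains x1 where "x1 \<in> sphere 0 1" "x1 \<bullet> e \<ge> 0" "mv_diff u \<alpha> e l x1 < 0"
    "\<forall>y\<in>sphere 0 1. y \<bullet> e \<ge> 0 \<longrightarrow> mv_diff u \<alpha> e l x1 \<le> mv_diff u \<alpha> e l y"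
    "- mv_diff u \<alpha> e l x1 \<le> \<kappa> * rpot (- \<alpha>)
      (\<lambda>y. if y \<bullet> e > 0 \<and> mv_diff u \<alpha> e l y < 0 then max 0 (- mv_F l y) else 0) x1"
proof -
  have l': "\<bar>l\<bar> < 1" using l by simp
  let ?w = "mv_diff u \<alpha> e l"
  define \<Omega> where "\<Omega> = sphere 0 1 \<inter> {y. y \<bullet> e \<ge> 0}"
  have \<Omega>c: "compact \<Omega>"
    unfolding \<Omega>_def by (intro compact_Int_closed closed_Collect_le continuous_intros) auto
  have x\<Omega>: "x \<in> \<Omega>" using x by (simp add: \<Omega>_def)
  have "continuous_on \<Omega> ?w" by (rule continuous_on_subset[OF continuous_on_mv_diff[OF l']]) (auto simp: \<Omega>_def)
  then have "\<exists>x1\<in>\<Omega>. \<forall>y\<in>\<Omega>. ?w x1 \<le> ?w y" using \<Omega>c x\<Omega> by (intro continuous_attains_inf) auto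
  then obtain x1 where x1: "x1 \<in> \<Omega>" "\<And>y. y \<in> \<Omega> \<Longrightarrow> ?w x1 \<le> ?w y" by blast
  have x1s: "x1 \<in> sphere 0 1" "x1 \<bullet> e \<ge> 0" using x1(1) by (simp_all add: \<Omega>_def)
  have Fc: "continuous_on (sphere 0 1) (mv_F l)" by (rule continuous_on_mv_F[OF l'])
  obtain B where B: "B > 0" "\<And>y. y \<in> sphere 0 1 \<Longrightarrow> \<bar>mv_F l y\<bar> \<le> B" using bounded_on_sphere[OF Fc] by blast
  have Fm: "mv_F l \<in> borel_measurable sph_measure" by (rule measurable_sph_continuous[OF Fc])
  have sgn: "rpot (- \<alpha>) (mv_F l) y < 0 \<longleftrightarrow> ?w y < 0" if "y \<in> sphere 0 1" for y
    unfolding mv_diff_equation[OF l' that] using \<kappa> by (simp add: mult_less_0_iff)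
  have alt': "- \<alpha> \<le> 1 - (real DIM('a) - 1) / 2 \<or>
      (\<forall>y\<in>sphere 0 1. y \<bullet> e > 0 \<longrightarrow> 0 \<le> rpot (- \<alpha>) (mv_F l) y \<longrightarrow> 0 \<le> mv_F l y)"
    using alt
  proof
    assume "- \<alpha> \<le> 1 - n / 2"
    then show ?thesis by (simp add: n)
  next
    assume mono: "\<forall>a b. 0 < a \<longrightarrow> a \<le> b \<longrightarrow> h a * a powr q \<le> h b * b powr q"
    have "0 \<le> mv_F l y" if y: "y \<in> sphere 0 1" and t: "y \<bullet> e > 0" and nn: "0 \<le> rpot (- \<alpha>) (mv_F l) y" for y
    proof -
      let ?R = "sph_refl e" and ?\<rho> = "boost_factor l e" and ?\<psi> = "boost l e"
      note bf = boost_factor_refl_bounds[OF l y t]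
      have Ry: "?R y \<in> sphere 0 1" by (rule sph_refl_sphere[OF e y])
      have r: "0 < ?\<rho> y" by (rule boost_factor_pos[OF e l' y])
      have a: "0 < u (?\<psi> y)" using um[OF boost_sphere[OF e l' y]] m by linarith
      have b: "0 < u (?\<psi> (?R y))" using um[OF boost_sphere[OF e l' Ry]] m by linarith
      have "h (u (?\<psi> y)) * mv_u u \<alpha> e l y powr q \<le> h (u (?\<psi> (?R y))) * mv_u u \<alpha> e l (?R y) powr q"
      proof (rule mv_num_mono[OF mono[rule_format] a b r])
        show "?\<rho> y \<le> ?\<rho> (?R y)" using bf(1,2) by linarith
        have "\<not> ?w y < 0" using sgn[OF y] nn by simp
        then show "mv_u u \<alpha> e l y \<le> mv_u u \<alpha> e l (?R y)" by (simp add: mv_diff_def)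
      qed (simp_all add: mv_u_def)
      then show ?thesis by (simp add: mv_F_def mv_K_def)
    qed
    then show ?thesis by blast
  qed
  have "- rpot (- \<alpha>) (mv_F l) x1 \<le> rpot (- \<alpha>)
      (\<lambda>y. if y \<bullet> e > 0 \<and> rpot (- \<alpha>) (mv_F l) y < 0 then max 0 (- mv_F l y) else 0) x1"
    by (rule rpot_comparison[OF dim e mv_beta Fm B(2) mv_F_anti alt' x1s])
  also have "\<dots> = rpot (- \<alpha>) (\<lambda>y. if y \<bullet> e > 0 \<and> ?w y < 0 then max 0 (- mv_F l y) else 0) x1"
    by (rule rpot_cong) (simp add: sgn)
  finally have "\<kappa> * - rpot (- \<alpha>) (mv_F l) x1 \<le> \<kappa> * rpot (- \<alpha>) (\<lambda>y. if y \<bullet> e > 0 \<and> ?w y < 0 then max 0 (- mv_F l y) else 0) x1"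
    using \<kappa> by (intro mult_left_mono) auto
  then have fin: "- ?w x1 \<le> \<kappa> * rpot (- \<alpha>) (\<lambda>y. if y \<bullet> e > 0 \<and> ?w y < 0 then max 0 (- mv_F l y) else 0) x1"
    unfolding mv_diff_equation[OF l' x1s(1)] by simp
  show ?thesis
  proof (rule that[OF x1s _ _ fin])
    show "?w x1 < 0" using x1(2)[OF x\<Omega>] x(3) by linarith
    show "\<forall>y\<in>sphere 0 1. y \<bullet> e \<ge> 0 \<longrightarrow> ?w x1 \<le> ?w y" using x1(2) by (simp add: \<Omega>_def)
  qed
qed

text \<open>At the minimum, of depth \<nu>, the violation is at most a constant times \<nu>, so the
  bound on the depth reads \<nu> \<le> K \<nu>; \<open>small\<close> says K < 1.\<close>

lemma mv_start:
  assumes l: "0 \<le> l" "l < 1"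
    and small: "\<kappa> * (mv_C * sqrt (1 - l\<^sup>2) powr (n - 2 * \<alpha>)) * rpot (- \<alpha>) (\<lambda>_. 1) e < 1"
    and x: "x \<in> sphere 0 1" "x \<bullet> e \<ge> 0"
  shows "mv_diff u \<alpha> e l x \<ge> 0"
proof (rule ccontr)
  assume "\<not> ?thesis"
  then have "mv_diff u \<alpha> e l x < 0" by simp
  obtain x1 where x1: "x1 \<in> sphere 0 1" "x1 \<bullet> e \<ge> 0" "mv_diff u \<alpha> e l x1 < 0"
    and min: "\<forall>y\<in>sphere 0 1. y \<bullet> e \<ge> 0 \<longrightarrow> mv_diff u \<alpha> e l x1 \<le> mv_diff u \<alpha> e l y"
    and le: "- mv_diff u \<alpha> e l x1 \<le> \<kappa> * rpot (- \<alpha>)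
      (\<lambda>y. if y \<bullet> e > 0 \<and> mv_diff u \<alpha> e l y < 0 then max 0 (- mv_F l y) else 0) x1" by (rule mv_minimum[OF l x \<open>mv_diff u \<alpha> e l x < 0\<close>], rule that, assumption+)
  define \<nu> where "\<nu> = - mv_diff u \<alpha> e l x1"
  have \<nu>: "\<nu> > 0" using x1(3) by (simp add: \<nu>_def)
  define c where "c = mv_C * sqrt (1 - l\<^sup>2) powr (n - 2 * \<alpha>)"
  have c: "c \<ge> 0" using mv_C_nonneg by (simp add: c_def)
  have "rpot (- \<alpha>) (\<lambda>y. if y \<bullet> e > 0 \<and> mv_diff u \<alpha> e l y < 0 then max 0 (- mv_F l y) else 0) x1
      \<le> rpot (- \<alpha>) (\<lambda>_. c * \<nu>) x1"
  proof (rule rpot_le[OF dim x1(1) mv_beta(1)])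
    show "\<bar>c * \<nu>\<bar> \<le> c * \<nu>" "0 \<le> c * \<nu>" using c \<nu> by simp_all
    fix y :: 'a assume y: "y \<in> sphere 0 1"
    show "(if y \<bullet> e > 0 \<and> mv_diff u \<alpha> e l y < 0 then max 0 (- mv_F l y) else 0) \<le> c * \<nu>"
    proof (cases "y \<bullet> e > 0 \<and> mv_diff u \<alpha> e l y < 0")
      case True
      have "- mv_F l y \<le> c * - mv_diff u \<alpha> e l y"
        unfolding c_def by (rule mv_F_neg_bound[OF l y]) (use True in auto)
      also have "\<dots> \<le> c * \<nu>" using min[rule_format, OF y] True c by (intro mult_left_mono) (auto simp: \<nu>_def)
      finally show ?thesis using True c \<nu> by simp
    next
      case False
      have "0 \<le> c * \<nu>" using c \<nu> by simp
      then show ?thesis using False by (simp only: if_False)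
    qed
  qed simp
  also have "\<dots> = c * \<nu> * rpot (- \<alpha>) (\<lambda>_. 1) e"
  proof -
    have "rpot (- \<alpha>) (\<lambda>_. c * \<nu>) x1 = c * \<nu> * rpot (- \<alpha>) (\<lambda>_. 1) x1" by (simp add: rpot_def)
    then show ?thesis using rpot_mass_const[OF mv_dim3 x1(1) e] by simp
  qed
  finally have "\<kappa> * rpot (- \<alpha>) (\<lambda>y. if y \<bullet> e > 0 \<and> mv_diff u \<alpha> e l y < 0 then max 0 (- mv_F l y) else 0) x1
      \<le> \<kappa> * (c * \<nu> * rpot (- \<alpha>) (\<lambda>_. 1) e)" using \<kappa> by (intro mult_left_mono) auto
  then have "\<nu> \<le> \<kappa> * (c * \<nu> * rpot (- \<alpha>) (\<lambda>_. 1) e)" using le unfolding \<nu>_def by linarith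
  also have "\<dots> = (\<kappa> * c * rpot (- \<alpha>) (\<lambda>_. 1) e) * \<nu>" by (simp only: mult_ac)
  also have "\<dots> < 1 * \<nu>" using small \<nu> unfolding c_def[symmetric] by (intro mult_strict_right_mono)
  finally show False by simp
qed

lemma continuous_on_mv_diff_joint:
  "continuous_on ({-1<..<1} \<times> sphere 0 1) (\<lambda>p. mv_diff u \<alpha> e (fst p) (snd p))"
proof -
  let ?T = "{-1<..<1::real} \<times> sphere (0::'a) 1"
  have l': "\<bar>fst p\<bar> < 1" and xs: "snd p \<in> sphere 0 1" if "p \<in> ?T" for p
    using that by (auto simp: abs_less_iff)
  have nz: "1 + fst p * (snd p \<bullet> e) \<noteq> 0" if "p \<in> ?T" for p
    using boost_denom_pos[OF e l'[OF that] xs[OF that]] by simp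
  have fc: "continuous_on ?T (\<lambda>p. boost_factor (fst p) e (snd p))"
    unfolding boost_factor_def by (intro continuous_intros) (use nz in auto)
  have bc: "continuous_on ?T (\<lambda>p. boost (fst p) e (snd p))"
    unfolding boost_def by (intro continuous_intros) (use nz in auto)
  have uc': "continuous_on ?T (\<lambda>p. u (boost (fst p) e (snd p)))"
    by (rule continuous_on_compose2[OF uc bc], rule image_subsetI) (rule boost_sphere[OF e l' xs])
  have mc: "continuous_on ?T (\<lambda>p. mv_u u \<alpha> e (fst p) (snd p))"
    unfolding mv_u_def
    by (intro continuous_on_mult uc' continuous_on_powr fc continuous_on_const ballI
        less_imp_neq[symmetric] boost_factor_pos[OF e l' xs])
  have "continuous_on ?T (\<lambda>p. (fst p, sph_refl e (snd p)))"
    unfolding sph_refl_def by (intro continuous_intros)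
  then have "continuous_on ?T (\<lambda>p. mv_u u \<alpha> e (fst (fst p, sph_refl e (snd p))) (snd (fst p, sph_refl e (snd p))))"
  proof (rule continuous_on_compose2[OF mc], intro image_subsetI)
    fix p assume p: "p \<in> ?T"
    show "(fst p, sph_refl e (snd p)) \<in> ?T" using p sph_refl_sphere[OF e xs[OF p]] by (simp only: mem_Times_iff fst_conv snd_conv)
  qed
  then show ?thesis unfolding mv_diff_def using mc by (simp add: continuous_on_diff)
qed

text \<open>For l slightly below l0 the difference exceeds -\<epsilon>. Away from the equator, a
  negative difference forces the two values of u apart by a fixed ratio, so h gains \<delta>, which
  outweighs the Lipschitz loss of order \<epsilon>: no violation occurs there. What remains lies in
  a thin strip, whose small potential gives the same contraction as at the start. Only nonnegativity
  at l0 is assumed.\<close>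

lemma mv_step:
  assumes l0: "0 < l0" "l0 < 1"
    and nn: "\<And>x. x \<in> sphere 0 1 \<Longrightarrow> x \<bullet> e \<ge> 0 \<Longrightarrow> mv_diff u \<alpha> e l0 x \<ge> 0"
  shows "\<exists>\<eta>>0. \<forall>l. 0 \<le> l \<longrightarrow> l0 - \<eta> < l \<longrightarrow> l \<le> l0 \<longrightarrow>
    (\<forall>x\<in>sphere 0 1. x \<bullet> e \<ge> 0 \<longrightarrow> mv_diff u \<alpha> e l x \<ge> 0)"
proof -
  obtain t0 where t0: "t0 > 0" "\<And>x. x \<in> sphere 0 1 \<Longrightarrow>
      rpot (- \<alpha>) (indicator {y. 0 < y \<bullet> e \<and> y \<bullet> e < t0}) x \<le> 1 / (2 * (\<kappa> * mv_C + 1))"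
  proof -
    have "1 / (2 * (\<kappa> * mv_C + 1)) > 0" using \<kappa> mv_C_nonneg by (simp add: add_nonneg_pos)
    from rpot_thin_strip[OF dim e mv_beta this] show ?thesis using that by blast
  qed
  \<comment> \<open>A lower bound for l (y \<bullet> e) off the strip, given l \<ge> l0/2; the cap
    at 1/2 keeps 1 - \<tau> positive.\<close>
  define \<tau> where "\<tau> = min (1 / 2) (l0 * t0 / 2)"
  have \<tau>: "0 < \<tau>" "\<tau> < 1" "\<tau> \<le> l0 * t0 / 2" using l0 t0(1) by (auto simp: \<tau>_def)
  \<comment> \<open>Bounds the ratio b/a when the difference is negative and l (y \<bullet> e) \<ge>
    \<tau>.\<close>
  define \<theta> where "\<theta> = ((1 - \<tau>) / (1 + \<tau>)) powr \<alpha>"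
  have \<theta>: "0 < \<theta>" "\<theta> < 1"
  proof -
    have "0 < (1 - \<tau>) / (1 + \<tau>)" "(1 - \<tau>) / (1 + \<tau>) < 1" using \<tau> by auto
    then show "0 < \<theta>" "\<theta> < 1" unfolding \<theta>_def using \<alpha> powr_less_mono2[of \<alpha> "(1 - \<tau>) / (1 + \<tau>)" 1] by auto
  qed
  have mM: "m \<le> M" using um[OF e] uM[OF e] by linarith
  have "(\<lambda>a. \<theta> * a) ` {m..M} \<subseteq> {0<..}"
  proof (rule image_subsetI)
    fix a assume "a \<in> {m..M}"
    then have "0 < a" using m by simp
    then show "\<theta> * a \<in> {0<..}" using \<theta> by simp
  qed
  then have "continuous_on {m..M} (\<lambda>a. h (\<theta> * a))"
    by (intro continuous_on_compose2[OF hc, where f="\<lambda>a. \<theta> * a"] continuous_intros)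
  moreover have "continuous_on {m..M} h" by (rule continuous_on_subset[OF hc]) (use m in auto)
  ultimately have "continuous_on {m..M} (\<lambda>a. h (\<theta> * a) - h a)" by (rule continuous_on_diff)
  then have "\<exists>a0\<in>{m..M}. \<forall>a\<in>{m..M}. h (\<theta> * a0) - h a0 \<le> h (\<theta> * a) - h a"
    using mM by (intro continuous_attains_inf) auto
  then obtain a0 where a0: "a0 \<in> {m..M}" "\<And>a. a \<in> {m..M} \<Longrightarrow> h (\<theta> * a0) - h a0 \<le> h (\<theta> * a) - h a" by blast
  \<comment> \<open>The smallest gain of h over the compact range [m, M]; it is attained and hence
    positive by strict decrease.\<close>
  define \<delta> where "\<delta> = h (\<theta> * a0) - h a0"
  have \<delta>: "\<delta> > 0"
  proof -
    have "0 < a0" using a0(1) m by auto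
    then have "h a0 < h (\<theta> * a0)" using \<theta> by (intro hdec) auto
    then show ?thesis by (simp add: \<delta>_def)
  qed
  \<comment> \<open>A lower bound for the pulled-back value at the mirror image that holds for all l
    \<le> l0: there the conformal factor is at least sqrt(1 - l^2).\<close>
  define B0 where "B0 = sqrt (1 - l0\<^sup>2) powr \<alpha> * m"
  have l0': "\<bar>l0\<bar> < 1" using l0 by simp
  have B0: "B0 > 0" using boost_sqrt_pos(1)[OF e l0'] m by (simp add: B0_def)
  define \<epsilon> where "\<epsilon> = \<delta> * B0 powr q / (mv_C + 1)"
  have \<epsilon>: "\<epsilon> > 0" using \<delta> B0 mv_C_nonneg by (simp add: \<epsilon>_def)
  have C\<epsilon>: "mv_C * \<epsilon> \<le> \<delta> * B0 powr q"
  proof -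
    have "mv_C * \<epsilon> \<le> (mv_C + 1) * \<epsilon>" using \<epsilon> by (intro mult_right_mono) auto
    also have "\<dots> = \<delta> * B0 powr q" using mv_C_nonneg by (simp add: \<epsilon>_def)
    finally show ?thesis .
  qed
  let ?T = "{0..l0} \<times> sphere (0::'a) 1"
  have "uniformly_continuous_on ?T (\<lambda>p. mv_diff u \<alpha> e (fst p) (snd p))"
    by (intro compact_uniformly_continuous continuous_on_subset[OF continuous_on_mv_diff_joint] compact_Times)
       (use l0 in auto)
  then obtain \<eta>1 where \<eta>1: "\<eta>1 > 0" "\<And>p p'. p \<in> ?T \<Longrightarrow> p' \<in> ?T \<Longrightarrow> dist p' p < \<eta>1 \<Longrightarrow>
      dist (mv_diff u \<alpha> e (fst p') (snd p')) (mv_diff u \<alpha> e (fst p) (snd p)) < \<epsilon>"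
    using \<epsilon> unfolding uniformly_continuous_on_def by blast
  \<comment> \<open>The bound l0/2 keeps l \<ge> l0/2, on which the choice of \<tau> relies.\<close>
  define \<eta> where "\<eta> = min \<eta>1 (l0 / 2)"
  have \<eta>: "\<eta> > 0" using \<eta>1(1) l0 by (simp add: \<eta>_def)
  have "mv_diff u \<alpha> e l x \<ge> 0" if l: "0 \<le> l" "l0 - \<eta> < l" "l \<le> l0" and x: "x \<in> sphere 0 1" "x \<bullet> e \<ge> 0" for l x
  proof (rule ccontr)
    assume "\<not> mv_diff u \<alpha> e l x \<ge> 0"
    then have neg: "mv_diff u \<alpha> e l x < 0" by simp
    have l1: "l < 1" using l l0 by linarith
    have l': "\<bar>l\<bar> < 1" using l l1 by simp
    have lh: "l \<ge> l0 / 2" using l(2) by (simp add: \<eta>_def)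
    have close: "mv_diff u \<alpha> e l y > - \<epsilon>" if y: "y \<in> sphere 0 1" "y \<bullet> e \<ge> 0" for y
    proof -
      have "dist (mv_diff u \<alpha> e (fst (l, y)) (snd (l, y))) (mv_diff u \<alpha> e (fst (l0, y)) (snd (l0, y))) < \<epsilon>"
        by (rule \<eta>1(2)) (use l l0 y in \<open>auto simp: dist_Pair_Pair dist_real_def \<eta>_def\<close>)
      then show ?thesis using nn[OF y] by (simp add: dist_real_def)
    qed
    obtain x1 where x1: "x1 \<in> sphere 0 1" "x1 \<bullet> e \<ge> 0" "mv_diff u \<alpha> e l x1 < 0"
      and min: "\<forall>y\<in>sphere 0 1. y \<bullet> e \<ge> 0 \<longrightarrow> mv_diff u \<alpha> e l x1 \<le> mv_diff u \<alpha> e l y"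
      and le: "- mv_diff u \<alpha> e l x1 \<le> \<kappa> * rpot (- \<alpha>)
        (\<lambda>y. if y \<bullet> e > 0 \<and> mv_diff u \<alpha> e l y < 0 then max 0 (- mv_F l y) else 0) x1" by (rule mv_minimum[OF l(1) l1 x neg], rule that, assumption+)
    define \<nu> where "\<nu> = - mv_diff u \<alpha> e l x1"
    have \<nu>: "\<nu> > 0" using x1(3) by (simp add: \<nu>_def)
    have S1: "sqrt (1 - l\<^sup>2) powr (n - 2 * \<alpha>) \<le> 1"
    proof -
      have "sqrt (1 - l\<^sup>2) powr (n - 2 * \<alpha>) \<le> 1 powr (n - 2 * \<alpha>)"
        using boost_sqrt_pos(1)[OF e l'] \<alpha> by (intro powr_mono2) auto
      then show ?thesis by simp
    qed
    have far: "mv_F l y \<ge> 0" if y: "y \<in> sphere 0 1" and t: "y \<bullet> e \<ge> t0" and wneg: "mv_diff u \<alpha> e l y < 0" for y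
    proof -
      let ?R = "sph_refl e" and ?\<rho> = "boost_factor l e" and ?\<psi> = "boost l e"
      have tp: "y \<bullet> e > 0" using t t0(1) by linarith
      note bf = boost_factor_refl_bounds[OF l(1) l1 y tp]
      have Ry: "?R y \<in> sphere 0 1" by (rule sph_refl_sphere[OF e y])
      have r: "0 < ?\<rho> y" "0 < ?\<rho> (?R y)" by (rule boost_factor_pos[OF e l'], rule y Ry)+
      define a where "a = u (?\<psi> y)"
      define b where "b = u (?\<psi> (?R y))"
      have a: "m \<le> a" "a \<le> M" unfolding a_def by (rule um[OF boost_sphere[OF e l' y]], rule uM[OF boost_sphere[OF e l' y]])
      have b: "m \<le> b" unfolding b_def by (rule um[OF boost_sphere[OF e l' Ry]])
      have ab0: "0 < a" "0 < b" using a b m by linarith+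
      define A where "A = ?\<rho> y powr \<alpha> * a"
      define B where "B = ?\<rho> (?R y) powr \<alpha> * b"
      have AB: "mv_u u \<alpha> e l y = A" "mv_u u \<alpha> e l (?R y) = B" by (simp_all add: mv_u_def A_def B_def a_def b_def)
      have BA: "B < A" using wneg by (simp add: mv_diff_def AB)
      have Bpos: "0 < B" using r ab0 by (simp add: B_def)
      define s where "s = l * (y \<bullet> e)"
      have s: "\<tau> \<le> s" "s < 1"
      proof -
        have "l0 / 2 * t0 \<le> l * (y \<bullet> e)" using lh t l0 t0(1) by (intro mult_mono) auto
        then show "\<tau> \<le> s" using \<tau>(3) by (simp add: s_def)
        show "s < 1" using bf(4) by (simp add: s_def)
      qed
      \<comment> \<open>With k the ratio of the conformal factors at the mirror image and at y,
        negativity of the difference says k^\<alpha> b < a, and k grows with s = l (y \<bullet> e)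
        \<ge> \<tau>.\<close>
      have "b \<le> \<theta> * a"
      proof -
        define k where "k = (1 + s) / (1 - s)"
        have k: "k > 0" using s \<tau> by (simp add: k_def)
        have "?\<rho> (?R y) powr \<alpha> = ?\<rho> y powr \<alpha> * k powr \<alpha>"
          unfolding bf(3) s_def[symmetric] k_def[symmetric] using r k by (simp add: powr_mult)
        then have "?\<rho> y powr \<alpha> * (k powr \<alpha> * b) < ?\<rho> y powr \<alpha> * a" using BA by (simp add: A_def B_def mult.assoc)
        then have kb: "k powr \<alpha> * b < a" using r by simp
        have "(1 - s) / (1 + s) \<le> (1 - \<tau>) / (1 + \<tau>)"
          using s \<tau> by (intro frac_le) auto
        then have "inverse k \<le> (1 - \<tau>) / (1 + \<tau>)" by (simp add: k_def)
        then have ik: "inverse k powr \<alpha> \<le> \<theta>" unfolding \<theta>_def using k \<alpha> by (intro powr_mono2) auto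
        have "b = inverse k powr \<alpha> * (k powr \<alpha> * b)"
          using k by (simp add: powr_mult[symmetric] mult.assoc[symmetric])
        also have "\<dots> \<le> \<theta> * a" using ik kb ab0 less_imp_le[OF \<theta>(1)] by (intro mult_mono) auto
        finally show ?thesis .
      qed
      then have "h (\<theta> * a) \<le> h b" using ab0 by (intro hdec_le)
      moreover have "\<delta> \<le> h (\<theta> * a) - h a" unfolding \<delta>_def by (rule a0(2)) (use a in auto)
      ultimately have hb: "h a + \<delta> \<le> h b" by linarith
      have "B0 \<le> B"
      proof -
        have "l\<^sup>2 \<le> l0\<^sup>2" using l by (intro power_mono) auto
        then have "sqrt (1 - l0\<^sup>2) \<le> sqrt (1 - l\<^sup>2)" by simp
        then have "sqrt (1 - l0\<^sup>2) \<le> ?\<rho> (?R y)" using bf(2) by linarith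
        then show ?thesis
          unfolding B0_def B_def using boost_sqrt_pos(1)[OF e l0'] b m \<alpha> by (intro mult_mono powr_mono2) auto
      qed
      from mv_num_gain[OF a ab0(2) r(1) A_def Bpos BA hb less_imp_le[OF \<delta>] B0 this]
      have "- mv_F l y \<le> mv_C * ?\<rho> y powr (n - 2 * \<alpha>) * (A - B) - \<delta> * B0 powr q"
        by (simp add: mv_F_def mv_K_def AB a_def b_def)
      also have "mv_C * ?\<rho> y powr (n - 2 * \<alpha>) * (A - B) \<le> mv_C * 1 * \<epsilon>"
      proof (intro mult_mono)
        have "?\<rho> y powr (n - 2 * \<alpha>) \<le> sqrt (1 - l\<^sup>2) powr (n - 2 * \<alpha>)" using bf(1) r \<alpha> by (intro powr_mono2) auto
        then show "?\<rho> y powr (n - 2 * \<alpha>) \<le> 1" using S1 by linarith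
        show "A - B \<le> \<epsilon>" using close[OF y less_imp_le[OF tp]] by (simp add: mv_diff_def AB)
      qed (use mv_C_nonneg BA in auto)
      finally show ?thesis using C\<epsilon> by simp
    qed
    have "rpot (- \<alpha>) (\<lambda>y. if y \<bullet> e > 0 \<and> mv_diff u \<alpha> e l y < 0 then max 0 (- mv_F l y) else 0) x1
        \<le> rpot (- \<alpha>) (\<lambda>y. mv_C * \<nu> * indicator {y. 0 < y \<bullet> e \<and> y \<bullet> e < t0} y) x1"
    proof (rule rpot_le[OF dim x1(1) mv_beta(1)])
      show "(\<lambda>y. mv_C * \<nu> * indicator {y. 0 < y \<bullet> e \<and> y \<bullet> e < t0} y) \<in> borel_measurable sph_measure"
        unfolding indicator_def by measurable
      fix y :: 'a assume y: "y \<in> sphere 0 1"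
      show "0 \<le> mv_C * \<nu> * indicator {y. 0 < y \<bullet> e \<and> y \<bullet> e < t0} y"
        "\<bar>mv_C * \<nu> * indicator {y. 0 < y \<bullet> e \<and> y \<bullet> e < t0} y\<bar> \<le> mv_C * \<nu>"
        using mv_C_nonneg \<nu> by (auto simp: indicator_def)
      show "(if y \<bullet> e > 0 \<and> mv_diff u \<alpha> e l y < 0 then max 0 (- mv_F l y) else 0)
          \<le> mv_C * \<nu> * indicator {y. 0 < y \<bullet> e \<and> y \<bullet> e < t0} y"
      proof (cases "y \<bullet> e > 0 \<and> mv_diff u \<alpha> e l y < 0")
        case True
        show ?thesis
        proof (cases "y \<bullet> e < t0")
          case near: True
          have "- mv_F l y \<le> mv_C * sqrt (1 - l\<^sup>2) powr (n - 2 * \<alpha>) * - mv_diff u \<alpha> e l y"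
            by (rule mv_F_neg_bound[OF l(1) l1 y]) (use True in auto)
          also have "\<dots> \<le> mv_C * 1 * \<nu>"
            using mv_C_nonneg S1 True min[rule_format, OF y] by (intro mult_mono) (auto simp: \<nu>_def)
          finally show ?thesis using True near mv_C_nonneg \<nu> by simp
        next
          case False
          then have "mv_F l y \<ge> 0" using far[OF y] True by simp
          then show ?thesis using True False by simp
        qed
      next
        case False
        have "0 \<le> mv_C * \<nu> * indicator {y. 0 < y \<bullet> e \<and> y \<bullet> e < t0} y"
          using mv_C_nonneg \<nu> by (simp add: indicator_def)
        then show ?thesis using False by (simp only: if_False)
      qed
    qed
    also have "\<dots> = mv_C * \<nu> * rpot (- \<alpha>) (indicator {y. 0 < y \<bullet> e \<and> y \<bullet> e < t0}) x1"
      unfolding rpot_def integral_mult_right_zero[symmetric] by (simp only: mult.left_commute)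
    also have "\<dots> \<le> mv_C * \<nu> * (1 / (2 * (\<kappa> * mv_C + 1)))"
      using t0(2)[OF x1(1)] mv_C_nonneg \<nu> by (intro mult_left_mono) auto
    finally have "\<kappa> * rpot (- \<alpha>) (\<lambda>y. if y \<bullet> e > 0 \<and> mv_diff u \<alpha> e l y < 0 then max 0 (- mv_F l y) else 0) x1
        \<le> \<kappa> * (mv_C * \<nu> * (1 / (2 * (\<kappa> * mv_C + 1))))" using \<kappa> by (intro mult_left_mono) auto
    then have "\<nu> \<le> \<kappa> * (mv_C * \<nu> * (1 / (2 * (\<kappa> * mv_C + 1))))" using le unfolding \<nu>_def by linarith
    also have "\<dots> = \<nu> * (\<kappa> * mv_C * (1 / (2 * (\<kappa> * mv_C + 1))))" by (simp only: mult_ac)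
    also have "\<dots> < \<nu> * 1"
    proof (rule mult_strict_left_mono[OF _ \<nu>])
      have "0 \<le> \<kappa> * mv_C" using \<kappa> mv_C_nonneg by simp
      then show "\<kappa> * mv_C * (1 / (2 * (\<kappa> * mv_C + 1))) < 1" by (simp add: divide_less_eq)
    qed
    finally show False by simp
  qed
  then show ?thesis using \<eta> by (intro exI[of _ \<eta>]) blast
qed

text \<open>A continuity argument in l: the set of good parameters contains a value near 1 and is
  closed, and its infimum can be lowered unless it is 0, where the boost is the identity.\<close>

lemma mv_reflection_le:
  assumes x: "x \<in> sphere 0 1" "x \<bullet> e \<ge> 0"
  shows "u x \<le> u (sph_refl e x)"
proof -
  define K where "K = \<kappa> * mv_C * rpot (- \<alpha>) (\<lambda>_. 1) e"
  have E0: "rpot (- \<alpha>) (\<lambda>_. 1) e > 0" by (rule rpot_mass_pos[OF dim e mv_beta(1)])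
  have K: "K \<ge> 0" using \<kappa> mv_C_nonneg E0 by (simp add: K_def)
  define \<sigma> where "\<sigma> = n - 2 * \<alpha>"
  have \<sigma>: "\<sigma> > 0" using \<alpha> by (simp add: \<sigma>_def)
  \<comment> \<open>The value of sqrt(1 - l1^2), small enough that K \<theta>^\<sigma> < 1, as the
    start requires.\<close>
  define \<theta> where "\<theta> = min (1 / 2) ((1 / (2 * (K + 1))) powr (1 / \<sigma>))"
  have \<theta>: "0 < \<theta>" "\<theta> \<le> 1 / 2" "\<theta> \<le> (1 / (2 * (K + 1))) powr (1 / \<sigma>)" using K by (auto simp: \<theta>_def)
  define l1 where "l1 = sqrt (1 - \<theta>\<^sup>2)"
  have \<theta>2: "0 < \<theta>\<^sup>2" "\<theta>\<^sup>2 < 1" using \<theta> by (auto simp: abs_square_less_1)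
  have l1: "0 \<le> l1" "l1 < 1" using \<theta>2 by (auto simp: l1_def)
  have "l1\<^sup>2 = 1 - \<theta>\<^sup>2" using \<theta>2 by (simp add: l1_def)
  then have S: "sqrt (1 - l1\<^sup>2) = \<theta>" using \<theta>(1) by simp
  have "\<theta> powr \<sigma> \<le> ((1 / (2 * (K + 1))) powr (1 / \<sigma>)) powr \<sigma>" using \<theta> \<sigma> by (intro powr_mono2) auto
  also have "\<dots> = 1 / (2 * (K + 1))" using \<sigma> K by (simp add: powr_powr)
  finally have "K * \<theta> powr \<sigma> \<le> K * (1 / (2 * (K + 1)))" using K by (intro mult_left_mono) auto
  also have "\<dots> < 1" using K by (simp add: divide_less_eq)
  finally have small: "\<kappa> * (mv_C * sqrt (1 - l1\<^sup>2) powr (n - 2 * \<alpha>)) * rpot (- \<alpha>) (\<lambda>_. 1) e < 1"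
    unfolding S \<sigma>_def[symmetric] K_def by (simp only: mult_ac)
  define \<Omega> where "\<Omega> = sphere 0 1 \<inter> {y. y \<bullet> e \<ge> 0}"
  \<comment> \<open>It is enough that the infimum belongs to this set; the set need not be known to
    be an interval.\<close>
  define \<Lambda> where "\<Lambda> = {l \<in> {0..l1}. \<forall>x\<in>\<Omega>. 0 \<le> mv_diff u \<alpha> e l x}"
  have l1\<Lambda>: "l1 \<in> \<Lambda>" unfolding \<Lambda>_def \<Omega>_def using l1 mv_start[OF l1 small] by auto
  have closed: "closed \<Lambda>"
  proof -
    have "\<Lambda> = {0..l1} \<inter> (\<Inter>x\<in>\<Omega>. {l \<in> {0..l1}. 0 \<le> mv_diff u \<alpha> e l x})" unfolding \<Lambda>_def by auto
    moreover have "closed {l \<in> {0..l1}. 0 \<le> mv_diff u \<alpha> e l x}" if "x \<in> \<Omega>" for x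
    proof -
      have "continuous_on {0..l1} (\<lambda>l. mv_diff u \<alpha> e (fst (l, x)) (snd (l, x)))"
        by (rule continuous_on_compose2[OF continuous_on_mv_diff_joint])
           (use that l1 in \<open>auto simp: \<Omega>_def intro!: continuous_intros\<close>)
      then have c: "continuous_on {0..l1} (\<lambda>l. mv_diff u \<alpha> e l x)" by simp
      have "{l \<in> {0..l1}. 0 \<le> mv_diff u \<alpha> e l x} = {0..l1} \<inter> (\<lambda>l. mv_diff u \<alpha> e l x) -` {0..}" by auto
      also have "closed \<dots>" by (rule continuous_closed_preimage[OF c]) auto
      finally show ?thesis .
    qed
    ultimately show ?thesis by (simp only:) (intro closed_Int closed_INT closed_atLeastAtMost ballI)
  qed
  have bdd: "bdd_below \<Lambda>" unfolding \<Lambda>_def by (intro bdd_belowI[of _ 0]) auto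
  define l0 where "l0 = Inf \<Lambda>"
  have l0: "l0 \<in> \<Lambda>" unfolding l0_def by (rule closed_contains_Inf[OF _ bdd closed]) (use l1\<Lambda> in auto)
  have "l0 = 0"
  proof (rule ccontr)
    assume "l0 \<noteq> 0"
    then have l0p: "0 < l0" "l0 < 1" using l0 l1 by (auto simp: \<Lambda>_def)
    have "\<exists>\<eta>>0. \<forall>l. 0 \<le> l \<longrightarrow> l0 - \<eta> < l \<longrightarrow> l \<le> l0 \<longrightarrow>
        (\<forall>x\<in>sphere 0 1. x \<bullet> e \<ge> 0 \<longrightarrow> mv_diff u \<alpha> e l x \<ge> 0)"
      by (rule mv_step[OF l0p]) (use l0 in \<open>auto simp: \<Lambda>_def \<Omega>_def\<close>)
    then obtain \<eta> where \<eta>: "\<eta> > 0" "\<And>l x. 0 \<le> l \<Longrightarrow> l0 - \<eta> < l \<Longrightarrow> l \<le> l0 \<Longrightarrow> x \<in> sphere 0 1 \<Longrightarrow>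
        x \<bullet> e \<ge> 0 \<Longrightarrow> mv_diff u \<alpha> e l x \<ge> 0" by blast
    define l where "l = max 0 (l0 - \<eta> / 2)"
    have l: "0 \<le> l" "l0 - \<eta> < l" "l < l0" using \<eta>(1) l0p by (auto simp: l_def)
    have "l \<in> \<Lambda>" unfolding \<Lambda>_def \<Omega>_def using l \<eta>(2)[OF l(1,2)] l0 by (auto simp: \<Lambda>_def)
    then have "l0 \<le> l" unfolding l0_def by (rule cInf_lower[OF _ bdd])
    then show False using l by simp
  qed
  then have "0 \<le> mv_diff u \<alpha> e 0 x" using l0 x by (auto simp: \<Lambda>_def \<Omega>_def)
  then show ?thesis by (simp add: mv_diff_def mv_u_def)
qed

end

lemma mv_constant:
  assumes x: "x \<in> sphere 0 1" and y: "y \<in> sphere 0 1"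
  shows "u x = u y"
proof -
  have le: "u x \<le> u y" if x: "x \<in> sphere 0 1" and y: "y \<in> sphere 0 1" for x y
  proof (cases "x = y")
    case False
    note r = sph_refl_swap[OF x y False]
    show ?thesis using mv_reflection_le[OF r(1) x less_imp_le[OF r(3)]] unfolding r(2) .
  qed simp
  show ?thesis using le[OF x y] le[OF y x] by simp
qed

end

section \<open>Constant solutions, the rigidity statement and the power case\<close>

lemma weak_sol_const_iff:
  fixes u :: "'a::euclidean_space \<Rightarrow> real"
  assumes dim: "DIM('a) \<ge> 4" and s: "0 < s" "s < (real DIM('a) - 1) / 2"
    and u: "\<And>x. x \<in> sphere 0 1 \<Longrightarrow> u x = c"
  shows "weak_sol s f u \<longleftrightarrow> f c = 0"
proof -
  define n where "n = real DIM('a) - 1"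
  have n1: "n \<ge> 1" using dim by (simp add: n_def)
  define d where "d = d_ns n s"
  have P0: "Ps_mult n s 0 = d"
    using Ps_mult_sph_eig[OF n1, of s 0] by (simp add: sph_eig_def d_def d_ns_def)
  have ints: "sph_int (\<lambda>x. u x * \<phi> x) = real DIM('a) * (c * integral\<^sup>L sph_measure \<phi>)"
    "sph_int (\<lambda>x. (f (u x) + d * u x) * \<phi> x) = real DIM('a) * ((f c + d * c) * integral\<^sup>L sph_measure \<phi>)"
    if \<phi>: "continuous_on (sphere 0 1) \<phi>" for \<phi>
  proof -
    have gen: "sph_int (\<lambda>x. k x * \<phi> x) = real DIM('a) * (b * integral\<^sup>L sph_measure \<phi>)"
      if k: "\<And>x. x \<in> sphere 0 1 \<Longrightarrow> k x = b" for k b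
    proof -
      have "continuous_on (sphere 0 1) (\<lambda>x. b * \<phi> x)" by (intro continuous_intros \<phi>)
      then have "continuous_on (sphere 0 1) (\<lambda>x. k x * \<phi> x)" by (rule continuous_on_eq) (simp add: k)
      then have "sph_int (\<lambda>x. k x * \<phi> x) = real DIM('a) * (LINT x|sph_measure. k x * \<phi> x)" by (rule sph_int_eq_integral)
      also have "(LINT x|sph_measure. k x * \<phi> x) = (LINT x|sph_measure. b * \<phi> x)"
        by (rule Bochner_Integration.integral_cong) (simp_all add: k)
      finally show ?thesis by simp
    qed
    show "sph_int (\<lambda>x. u x * \<phi> x) = real DIM('a) * (c * integral\<^sup>L sph_measure \<phi>)" by (rule gen[OF u])
    show "sph_int (\<lambda>x. (f (u x) + d * u x) * \<phi> x) = real DIM('a) * ((f c + d * c) * integral\<^sup>L sph_measure \<phi>)"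
      by (rule gen) (simp add: u)
  qed
  show ?thesis
  proof
    assume sol: "weak_sol s f u"
    have one: "continuous_on (sphere 0 1) (\<lambda>_::'a. 1::real)" by simp
    have "Ps_mult n s 0 * sph_int (\<lambda>x. u x * 1) = sph_int (\<lambda>x. (f (u x) + d * u x) * 1)"
      using sol[unfolded weak_sol_def, rule_format, OF sph_eigenfn_const[of 1]] by (simp add: n_def d_def)
    then have "d * c * sph_total TYPE('a) = (f c + d * c) * sph_total TYPE('a)"
      unfolding P0 ints[OF one] by simp
    then show "f c = 0" using sph_total_pos[where 'a='a] by simp
  next
    assume fc: "f c = 0"
    show "weak_sol s f u"
      unfolding weak_sol_def
    proof (intro allI impI)
      fix \<mu> and \<phi> :: "'a \<Rightarrow> real" assume eig: "sph_eigenfn \<mu> \<phi>"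
      then have C2: "C2_on (hom_ext \<phi>) (- {0})" by (simp add: sph_eigenfn_def)
      have \<phi>: "continuous_on (sphere 0 1) \<phi>" by (rule C2_hom_ext_continuous(1)[OF C2])
      have "0 = integral\<^sup>L sph_measure (sph_lap \<phi>)" by (rule integral_sph_lap_eq_0[OF C2, symmetric])
      also have "\<dots> = (LINT x|sph_measure. - \<mu> * \<phi> x)"
      proof (rule Bochner_Integration.integral_cong[OF refl])
        fix x :: 'a assume "x \<in> space sph_measure"
        then have "- sph_lap \<phi> x = \<mu> * \<phi> x" using eig by (simp add: sph_eigenfn_def)
        then show "sph_lap \<phi> x = - \<mu> * \<phi> x" by simp
      qed
      \<comment> \<open>An eigenfunction with nonzero eigenvalue has integral zero, so for constant
        u only the eigenvalue 0 gives a condition, and its multiplier is \<open>d\<close>.\<close>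
      finally have z: "\<mu> = 0 \<or> integral\<^sup>L sph_measure \<phi> = 0" by simp
      show "Ps_mult (real DIM('a) - 1) s \<mu> * sph_int (\<lambda>x. u x * \<phi> x)
          = sph_int (\<lambda>x. (f (u x) + d_ns (real DIM('a) - 1) s * u x) * \<phi> x)"
        unfolding n_def[symmetric] d_def[symmetric] ints[OF \<phi>] using z P0 fc by auto
    qed
  qed
qed

text \<open>Compactness of the sphere gives the positive lower bound m for u. With \<alpha> = n/2 -
  s and the critical exponent q one has \<alpha> q = n - \<alpha>, and h(t) t^q = f(t) + d t turns
  the integral equation into the form needed for moving spheres.\<close>

theorem rigidity:
  fixes u :: "'a::euclidean_space \<Rightarrow> real" and f :: "real \<Rightarrow> real"
  assumes dim: "DIM('a) \<ge> 4"
  defines "n \<equiv> real DIM('a) - 1"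
  assumes s: "0 < s" "s < n / 2" and fc: "continuous_on {0<..} f"
    and dec: "\<And>a b. 0 < a \<Longrightarrow> a < b \<Longrightarrow> b powr (- crit_exp n s) * (f b + d_ns n s * b)
      < a powr (- crit_exp n s) * (f a + d_ns n s * a)"
    and mono: "\<And>a b. s > 1 \<Longrightarrow> 0 < a \<Longrightarrow> a \<le> b \<Longrightarrow> f a + d_ns n s * a \<le> f b + d_ns n s * b"
    and uc: "continuous_on (sphere 0 1) u" and upos: "\<And>x. x \<in> sphere 0 1 \<Longrightarrow> u x > 0"
    and sol: "weak_sol s f u" and x: "x \<in> sphere 0 1" and y: "y \<in> sphere 0 1"
  shows "u x = u y"
proof -
  define d where "d = d_ns n s"
  define q where "q = crit_exp n s"
  define \<alpha> where "\<alpha> = n / 2 - s"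
  define h where "h t = t powr (- q) * (f t + d * t)" for t
  have n3: "n \<ge> 1" using dim by (simp add: n_def)
  have d: "d > 0" unfolding d_def by (rule d_ns_pos[OF n3 s])
  have \<alpha>: "0 < \<alpha>" "\<alpha> < n / 2" using s by (simp_all add: \<alpha>_def)
  have ns: "n - 2 * s > 0" using s by simp
  have nD: "real DIM('a) - 1 = n" by (simp add: n_def)
  have sn: "s - n / 2 > - (real DIM('a) - 1) / 2" unfolding nD using s(1) by linarith
  have q: "q \<ge> 1" "\<alpha> * q = n - \<alpha>"
    using ns s by (simp_all add: q_def crit_exp_def \<alpha>_def field_simps)
  have hq: "h t * t powr q = f t + d * t" if "t > 0" for t
  proof -
    have "t powr (- q) * t powr q = 1" using that by (simp flip: powr_add)
    then show ?thesis by (simp add: h_def mult_ac)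
  qed
  have "\<exists>x0\<in>sphere 0 1. \<forall>y\<in>sphere 0 1. u x0 \<le> u y"
    using x by (intro continuous_attains_inf uc) auto
  then obtain x0 where x0: "x0 \<in> sphere 0 1" "\<And>y. y \<in> sphere 0 1 \<Longrightarrow> u x0 \<le> u y" by blast
  obtain M where M: "M > 0" "\<And>y. y \<in> sphere 0 1 \<Longrightarrow> \<bar>u y\<bar> \<le> M" using bounded_on_sphere[OF uc] by blast
  have hc: "continuous_on {0<..} h"
    unfolding h_def by (intro continuous_intros fc) auto
  define E where "E = rpot (s - n / 2) (\<lambda>_. 1) x"
  have E: "E > 0" unfolding E_def by (rule rpot_mass_pos[OF dim x sn])
  have gc: "continuous_on (sphere 0 1) (\<lambda>w. f (u w) + d * u w)"
    by (intro continuous_intros uc continuous_on_compose2[OF fc uc]) (use upos in auto)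
  have rep: "u w = 1 / (E * d) * rpot (- \<alpha>) (\<lambda>v. h (u v) * u v powr q) w" if w: "w \<in> sphere 0 1" for w
  proof -
    have "u w = 1 / (E * d) * rpot (s - n / 2) (\<lambda>w. f (u w) + d * u w) w"
      unfolding E_def d_def n_def
      by (rule weak_sol_integral_equation[OF dim _ _ uc _ _ sol x w]) (use s gc in \<open>auto simp: n_def d_def\<close>)
    also have "rpot (s - n / 2) (\<lambda>w. f (u w) + d * u w) w = rpot (- \<alpha>) (\<lambda>v. h (u v) * u v powr q) w"
      unfolding \<alpha>_def minus_diff_eq by (rule rpot_cong) (simp add: hq upos)
    finally show ?thesis .
  qed
  show ?thesis
  proof (rule mv_constant[where u=u and x=x and y=y and h=h and \<alpha>=\<alpha> and q=q and \<kappa>="1 / (E * d)" and m="u x0" and M=M and n=n])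
    show "n = real DIM('a) - 1" by (simp add: n_def)
    show "0 < u x0" by (rule upos[OF x0(1)])
    show "u w \<le> M" if "w \<in> sphere 0 1" for w using M(2)[OF that] by linarith
    show "h b < h a" if "0 < a" "a < b" for a b
      unfolding h_def q_def d_def by (rule dec[OF that])
    show "0 < 1 / (E * d)" using E d by simp
    show "- \<alpha> \<le> 1 - n / 2 \<or> (\<forall>a b. 0 < a \<longrightarrow> a \<le> b \<longrightarrow> h a * a powr q \<le> h b * b powr q)"
    \<comment> \<open>For s \<le> 1 the first alternative reads s - n/2 \<le> 1 - n/2.\<close>
    proof (cases "s > 1")
      case True
      have "h a * a powr q \<le> h b * b powr q" if "0 < a" "a \<le> b" for a b
        using hq[of a] hq[of b] mono[OF True that] that by (simp add: d_def)
      then show ?thesis by blast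
    next
      case False
      then show ?thesis by (simp add: \<alpha>_def)
    qed
  qed (use dim \<alpha> q uc x0 hc rep x y in auto)
qed

text \<open>After division by t^q the expression is t^(p - q) + (d - lam) t^(1 - q). Both terms are
  nonincreasing since 1 < p \<le> q and lam \<le> d, and whichever inequality is strict makes one of
  them strictly decreasing.\<close>

lemma power_nonlinearity:
  fixes p q lam d :: real
  assumes p: "p > 1" "p \<le> q" and lam: "lam \<le> d" and strict: "p < q \<or> lam < d"
  shows "0 < a \<Longrightarrow> a < b \<Longrightarrow>
      b powr (- q) * (b powr p - lam * b + d * b) < a powr (- q) * (a powr p - lam * a + d * a)"
    and "0 < a \<Longrightarrow> a \<le> b \<Longrightarrow> a powr p - lam * a + d * a \<le> b powr p - lam * b + d * b"
proof -
  have split: "t powr (- q) * (t powr p - lam * t + d * t) = t powr (p - q) + (d - lam) * t powr (1 - q)"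
    if "t > 0" for t :: real
  proof -
    have "t powr (p - q) = t powr (- q) * t powr p" "t powr (1 - q) = t powr (- q) * t"
      using that powr_add[of t "- q" p] powr_add[of t "- q" 1] by simp_all
    then show ?thesis by (simp add: algebra_simps)
  qed
  show "b powr (- q) * (b powr p - lam * b + d * b) < a powr (- q) * (a powr p - lam * a + d * a)"
    if ab: "0 < a" "a < b"
  proof -
    have b: "0 < b" using ab by simp
    have le: "b powr (p - q) \<le> a powr (p - q)" using ab p by (intro powr_mono2') auto
    have lt1: "b powr (1 - q) < a powr (1 - q)" using ab p by (intro powr_less_mono2_neg) auto
    have "b powr (p - q) + (d - lam) * b powr (1 - q) < a powr (p - q) + (d - lam) * a powr (1 - q)"
      using strict
    proof
      assume "p < q"
      then have "b powr (p - q) < a powr (p - q)" using ab by (intro powr_less_mono2_neg) auto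
      moreover have "(d - lam) * b powr (1 - q) \<le> (d - lam) * a powr (1 - q)"
        using lt1 lam by (intro mult_left_mono) auto
      ultimately show ?thesis by linarith
    next
      assume "lam < d"
      then have "(d - lam) * b powr (1 - q) < (d - lam) * a powr (1 - q)"
        using lt1 by (intro mult_strict_left_mono) auto
      then show ?thesis using le by linarith
    qed
    then show ?thesis unfolding split[OF ab(1)] split[OF b] .
  qed
  show "a powr p - lam * a + d * a \<le> b powr p - lam * b + d * b" if ab: "0 < a" "a \<le> b"
  proof -
    have "a powr p \<le> b powr p" using ab p by (intro powr_mono2) auto
    moreover have "(d - lam) * a \<le> (d - lam) * b" using ab lam by (intro mult_left_mono) auto
    ultimately show ?thesis by (simp add: algebra_simps)
  qed
qed

lemma powr_eq_linear_iff:
  fixes c p lam :: real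
  assumes "c > 0" "p > 1" "lam > 0"
  shows "c powr p - lam * c = 0 \<longleftrightarrow> c = lam powr (1 / (p - 1))"
proof -
  have "c powr p = c powr (p - 1) * c" using assms powr_add[of c "p - 1" 1] by simp
  then have "c powr p - lam * c = 0 \<longleftrightarrow> c powr (p - 1) = lam" using assms by (simp flip: left_diff_distrib)
  also have "\<dots> \<longleftrightarrow> c = lam powr (1 / (p - 1))"
  proof
    assume "c powr (p - 1) = lam"
    then have "lam powr (1 / (p - 1)) = (c powr (p - 1)) powr (1 / (p - 1))" by simp
    then show "c = lam powr (1 / (p - 1))" using assms by (simp add: powr_powr)
  next
    assume "c = lam powr (1 / (p - 1))"
    then show "c powr (p - 1) = lam" using assms by (simp add: powr_powr)
  qed
  finally show ?thesis .
qed

text \<open>The power case combines rigidity with the test against constants, which leaves c^p = lam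
  c for the constant value c > 0. The equivalence also records that this constant is a
  solution.\<close>

theorem theorem1p5:
  fixes s :: real
  assumes dim: "DIM('a::euclidean_space) \<ge> 4"
    and s_pos: "0 < s" and s_lt: "s < (real DIM('a) - 1) / 2"
  shows
   "(\<forall>f :: real \<Rightarrow> real.
       continuous_on {0<..} f \<longrightarrow>
       (\<forall>a b. 0 < a \<longrightarrow> a < b \<longrightarrow>
          b powr (- crit_exp (real DIM('a) - 1) s)
            * (f b + d_ns (real DIM('a) - 1) s * b)
          < a powr (- crit_exp (real DIM('a) - 1) s)
            * (f a + d_ns (real DIM('a) - 1) s * a)) \<longrightarrow>
       (s > 1 \<longrightarrow> (\<forall>a b. 0 < a \<longrightarrow> a \<le> b \<longrightarrow>
          f a + d_ns (real DIM('a) - 1) s * a \<le> f b + d_ns (real DIM('a) - 1) s * b)) \<longrightarrow>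
       (\<forall>u :: 'a \<Rightarrow> real. continuous_on (sphere 0 1) u \<longrightarrow>
          (\<forall>x\<in>sphere 0 1. u x > 0) \<longrightarrow> weak_sol s f u \<longrightarrow>
          (\<exists>c. \<forall>x\<in>sphere 0 1. u x = c)))
    \<and>
    (\<forall>p lam :: real. p > 1 \<longrightarrow> lam > 0 \<longrightarrow>
       p \<le> crit_exp (real DIM('a) - 1) s \<longrightarrow>
       lam \<le> d_ns (real DIM('a) - 1) s \<longrightarrow>
       (p < crit_exp (real DIM('a) - 1) s \<or> lam < d_ns (real DIM('a) - 1) s) \<longrightarrow>
       (\<forall>u :: 'a \<Rightarrow> real. continuous_on (sphere 0 1) u \<longrightarrow>
          (\<forall>x\<in>sphere 0 1. u x > 0) \<longrightarrow>
          (weak_sol s (\<lambda>t. t powr p - lam * t) u \<longleftrightarrow>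
           (\<forall>x\<in>sphere 0 1. u x = lam powr (1 / (p - 1))))))"
proof -
  obtain b :: 'a where "b \<in> Basis" using nonempty_Basis by blast
  then have b: "b \<in> sphere 0 1" by simp
  note rigid = rigidity[OF dim s_pos s_lt]
  have part1: "\<exists>c. \<forall>x\<in>sphere 0 1. u x = c"
    if "continuous_on {0<..} f"
      and "\<forall>a b. 0 < a \<longrightarrow> a < b \<longrightarrow>
          b powr (- crit_exp (real DIM('a) - 1) s) * (f b + d_ns (real DIM('a) - 1) s * b)
          < a powr (- crit_exp (real DIM('a) - 1) s) * (f a + d_ns (real DIM('a) - 1) s * a)"
      and "s > 1 \<longrightarrow> (\<forall>a b. 0 < a \<longrightarrow> a \<le> b \<longrightarrow>
          f a + d_ns (real DIM('a) - 1) s * a \<le> f b + d_ns (real DIM('a) - 1) s * b)"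
      and "continuous_on (sphere 0 1) u" "\<forall>x\<in>sphere 0 1. u x > 0" "weak_sol s f u"
    for f :: "real \<Rightarrow> real" and u :: "'a \<Rightarrow> real"
    by (intro exI[of _ "u b"] ballI rigid[where f=f]) (use that b in auto)
  have part2: "weak_sol s (\<lambda>t. t powr p - lam * t) u \<longleftrightarrow> (\<forall>x\<in>sphere 0 1. u x = lam powr (1 / (p - 1)))"
    if p: "p > 1" "p \<le> crit_exp (real DIM('a) - 1) s" and lam: "lam > 0" "lam \<le> d_ns (real DIM('a) - 1) s"
      and strict: "p < crit_exp (real DIM('a) - 1) s \<or> lam < d_ns (real DIM('a) - 1) s"
      and u: "continuous_on (sphere 0 1) u" "\<forall>x\<in>sphere 0 1. u x > 0"
    for p lam and u :: "'a \<Rightarrow> real"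
  proof
    assume sol: "weak_sol s (\<lambda>t. t powr p - lam * t) u"
    have "\<exists>c. \<forall>x\<in>sphere 0 1. u x = c"
    proof (rule part1[OF _ _ _ u sol])
      show "continuous_on {0<..} (\<lambda>t. t powr p - lam * t)" by (intro continuous_intros) auto
    qed (intro allI impI power_nonlinearity[OF p lam(2) strict], assumption+)+
    then obtain c where c: "\<And>x. x \<in> sphere 0 1 \<Longrightarrow> u x = c" by blast
    have "c > 0" using u(2) b c[OF b] by auto
    moreover have "c powr p - lam * c = 0" using sol weak_sol_const_iff[OF dim s_pos s_lt c] by simp
    ultimately have "c = lam powr (1 / (p - 1))" using powr_eq_linear_iff[OF _ p(1) lam(1)] by simp
    then show "\<forall>x\<in>sphere 0 1. u x = lam powr (1 / (p - 1))" using c by blast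
  next
    assume c: "\<forall>x\<in>sphere 0 1. u x = lam powr (1 / (p - 1))"
    have "(lam powr (1 / (p - 1))) powr p - lam * lam powr (1 / (p - 1)) = 0"
      using p(1) lam(1) by (subst powr_eq_linear_iff) auto
    then show "weak_sol s (\<lambda>t. t powr p - lam * t) u"
      using weak_sol_const_iff[OF dim s_pos s_lt, of u] c by blast
  qed
  show ?thesis
    by (intro conjI allI impI; (rule part1 part2; assumption))
qed


end
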